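(* Let $(\eta,\omega_1,\omega_2,\omega_3)$ be a Sasaki-Einstein $SU(2)$-structure on a $5$-manifold $N^5$, i.e. an $SU(2)$-structure satisfying $$d\eta=-2\omega_3,\qquad d\omega_1=3\eta\wedge\omega_2,\qquad d\omega_2=-3\eta\wedge\omega_1,$$ and let $g_5$ be its metric. Then the $SU(3)$-structure $(F,\Psi_+,\Psi_-)$ on $N^5\times(0,\pi)$, with $t$ the coordinate on the interval, defined by $$\begin{aligned}F&=\sin^2t\,(\sin t\,\omega_1+\cos t\,\omega_3)+\sin t\,\eta\wedge dt,\\ \Psi_+&=\sin^3t\,\eta\wedge\omega_2-\sin^2t\,(-\cos t\,\omega_1+\sin t\,\omega_3)\wedge dt,\\ \Psi_-&=\sin^3t\,(-\cos t\,\omega_1+\sin t\,\omega_3)\wedge\eta+\sin^2t\,\omega_2\wedge dt\end{aligned}$$ is a nearly Kähler structure, and its metric is the Einstein metric $g_6=dt^2+\sin^2t\,g_5$. If moreover $N^5$ is compact, then $(N^5\times[0,\pi],F,\Psi_+,\Psi_-)$ is a compact nearly Kähler $6$-manifold with two conical singularities, at $t=0$ and $t=\pi$.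
   Context: An $SU(2)$-structure on a $5$-manifold is a quadruplet $(\eta,\omega_1,\omega_2,\omega_3)$ of a $1$-form $\eta$ and $2$-forms $\omega_i$ with $\omega_i\wedge\omega_j=\delta_{ij}v$ for some $4$-form $v$ with $v\wedge\eta$ nowhere zero, and such that $X\lrcorner\omega_1=Y\lrcorner\omega_2$ implies $\omega_3(X,Y)\ge 0$. Equivalently, locally there is a coframe $e^1,\dots,e^5$ with $\eta=e^5$, $\omega_1=e^{12}+e^{34}$, $\omega_2=e^{13}+e^{42}$, $\omega_3=e^{14}+e^{23}$; the metric of the structure is the one making such a coframe orthonormal. An $SU(3)$-structure on a $6$-manifold is a triple $(F,\Psi_+,\Psi_-)$ such that locally there is a coframe $e^1,\dots,e^6$ with $F=e^{12}+e^{34}+e^{56}$, $\Psi_++i\Psi_-=(e^1+ie^2)\wedge(e^3+ie^4)\wedge(e^5+ie^6)$; its metric makes this coframe orthonormal. It is nearly Kähler if $dF=3\Psi_+$ and $d\Psi_-=-2F\wedge F$. "Compact nearly Kähler manifold with conical singularities at $t=0,\pi$" means: the compact space $N^5\times[0,\pi]$ with each end $N^5\times\{0\}$, $N^5\times\{\pi\}$ collapsed to a point, the nearly Kähler structure being smooth on $N^5\times(0,\pi)$ and its metric behaving near the ends to leading order like the cone metric $ds^2+s^2g_5$ with $s=t$, resp. $s=\pi-t$. *)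

theory Defs
  imports "HOL-Analysis.Analysis" "HOL-Combinatorics.Permutations"
begin

section \<open>Smooth maps and alternating forms on a Euclidean space\<close>

text \<open>Intended for open \<open>S\<close>. On a finite-dimensional space continuity of all iterated directional
  derivatives is the usual notion of \<open>C\<^sup>k\<close>.\<close>

primrec Ck_on :: "nat \<Rightarrow> 'a::real_normed_vector set \<Rightarrow> ('a \<Rightarrow> 'b::real_normed_vector) \<Rightarrow> bool" where
  "Ck_on 0 S f \<longleftrightarrow> continuous_on S f"
| "Ck_on (Suc k) S f \<longleftrightarrow>
     (\<forall>x\<in>S. f differentiable (at x)) \<and> (\<forall>v. Ck_on k S (\<lambda>x. frechet_derivative f (at x) v))"

definition smooth_on :: "'a::real_normed_vector set \<Rightarrow> ('a \<Rightarrow> 'b::real_normed_vector) \<Rightarrow> bool" where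
  "smooth_on S f \<longleftrightarrow> (\<forall>k. Ck_on k S f)"

text \<open>A \<open>k\<close>-covector takes its arguments as a sequence of vectors, of which only the entries
  \<open>0, \<dots>, k - 1\<close> matter. The values lie in \<open>\<real>\<close> or \<open>\<complex>\<close>.\<close>

type_synonym ('e, 'b) covector = "(nat \<Rightarrow> 'e) \<Rightarrow> 'b"

definition alternating :: "nat \<Rightarrow> ('e::real_vector, 'b::real_vector) covector \<Rightarrow> bool" where
  "alternating k a \<longleftrightarrow>
     (\<forall>v w. (\<forall>i<k. v i = w i) \<longrightarrow> a v = a w) \<and>
     (\<forall>v. \<forall>i<k. linear (\<lambda>u. a (v(i := u)))) \<and>
     (\<forall>v. \<forall>i<k. \<forall>j<k. i \<noteq> j \<and> v i = v j \<longrightarrow> a v = 0)"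

text \<open>Wedge product of a \<open>p\<close>-covector and a \<open>q\<close>-covector, normalised so that
  \<open>(a \<and> b)(X, Y) = a(X) b(Y) - a(Y) b(X)\<close> for \<open>p = q = 1\<close>.\<close>

definition wedge :: "nat \<Rightarrow> nat \<Rightarrow> ('e, 'b::real_normed_field) covector \<Rightarrow> ('e, 'b) covector \<Rightarrow>
    ('e, 'b) covector" where
  "wedge p q a b = (\<lambda>v.
     (\<Sum>\<sigma> | \<sigma> permutes {..<p + q}.
        of_int (sign \<sigma>) * a (\<lambda>i. v (\<sigma> i)) * b (\<lambda>i. v (\<sigma> (p + i)))) / (fact p * fact q))"

definition interior_prod :: "'e \<Rightarrow> ('e, 'b) covector \<Rightarrow> ('e, 'b) covector" where
  "interior_prod X a = (\<lambda>v. a (case_nat X v))"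

text \<open>Exterior derivative of a \<open>k\<close>-form, in the normalisation
  \<open>d\<alpha>(X, Y) = X \<alpha>(Y) - Y \<alpha>(X)\<close> for constant vector fields and \<open>k = 1\<close>.\<close>

definition ext_deriv :: "nat \<Rightarrow> ('e::real_normed_vector \<Rightarrow> ('e, real) covector) \<Rightarrow>
    'e \<Rightarrow> ('e, real) covector" where
  "ext_deriv k \<alpha> x = (\<lambda>v. \<Sum>i\<le>k. (-1) ^ i *
     frechet_derivative (\<lambda>y. \<alpha> y (\<lambda>j. if j < i then v j else v (Suc j))) (at x) (v i))"

definition pullback :: "('d::real_normed_vector \<Rightarrow> 'e::real_normed_vector) \<Rightarrow>
    ('e \<Rightarrow> ('e, 'b) covector) \<Rightarrow> 'd \<Rightarrow> ('d, 'b) covector" where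
  "pullback f \<alpha> x = (\<lambda>v. \<alpha> (f x) (\<lambda>j. frechet_derivative f (at x) (v j)))"


section \<open>Smooth manifolds, differential forms and Riemannian metrics\<close>

text \<open>An \<open>n\<close>-manifold is a topological space with an atlas indexed by a set \<open>I\<close>, with charts into a
  Euclidean space of dimension \<open>n\<close>. A tensor field is given by its local expressions in the charts
  of the atlas, which have to transform correctly under the transition maps; values outside the
  image of the chart are irrelevant.\<close>

type_synonym ('m, 'e) chart = "'m set \<times> ('m \<Rightarrow> 'e)"

definition chart_image :: "('m, 'e) chart \<Rightarrow> 'e set" where
  "chart_image c = snd c ` fst c"

definition transition :: "('m, 'e) chart \<Rightarrow> ('m, 'e) chart \<Rightarrow> 'e \<Rightarrow> 'e" where
  "transition c d = snd d \<circ> inv_into (fst c) (snd c)"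

definition smooth_manifold :: "'m topology \<Rightarrow> 'i set \<Rightarrow> ('i \<Rightarrow> ('m, 'e::euclidean_space) chart) \<Rightarrow> bool" where
  "smooth_manifold X I ch \<longleftrightarrow>
     Hausdorff_space X \<and> second_countable X \<and>
     (\<Union>i\<in>I. fst (ch i)) = topspace X \<and>
     (\<forall>i\<in>I. openin X (fst (ch i)) \<and> open (chart_image (ch i)) \<and>
        homeomorphic_map (subtopology X (fst (ch i))) (top_of_set (chart_image (ch i))) (snd (ch i))) \<and>
     (\<forall>i\<in>I. \<forall>j\<in>I. smooth_on (snd (ch i) ` (fst (ch i) \<inter> fst (ch j))) (transition (ch i) (ch j)))"

definition diff_form :: "'i set \<Rightarrow> ('i \<Rightarrow> ('m, 'e::euclidean_space) chart) \<Rightarrow> nat \<Rightarrow>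
    ('i \<Rightarrow> 'e \<Rightarrow> ('e, real) covector) \<Rightarrow> bool" where
  "diff_form I ch k \<alpha> \<longleftrightarrow>
     (\<forall>i\<in>I. \<forall>x\<in>chart_image (ch i). alternating k (\<alpha> i x)) \<and>
     (\<forall>i\<in>I. \<forall>v. smooth_on (chart_image (ch i)) (\<lambda>x. \<alpha> i x v)) \<and>
     (\<forall>i\<in>I. \<forall>j\<in>I. \<forall>x\<in>snd (ch i) ` (fst (ch i) \<inter> fst (ch j)).
        \<alpha> i x = pullback (transition (ch i) (ch j)) (\<alpha> j) x)"

type_synonym 'e metric_tensor = "'e \<Rightarrow> 'e \<Rightarrow> 'e \<Rightarrow> real"

definition riemannian_metric :: "'i set \<Rightarrow> ('i \<Rightarrow> ('m, 'e::euclidean_space) chart) \<Rightarrow>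
    ('i \<Rightarrow> 'e metric_tensor) \<Rightarrow> bool" where
  "riemannian_metric I ch g \<longleftrightarrow>
     (\<forall>i\<in>I. \<forall>x\<in>chart_image (ch i).
        bilinear (g i x) \<and> (\<forall>u v. g i x u v = g i x v u) \<and> (\<forall>u. u \<noteq> 0 \<longrightarrow> g i x u u > 0)) \<and>
     (\<forall>i\<in>I. \<forall>u v. smooth_on (chart_image (ch i)) (\<lambda>x. g i x u v)) \<and>
     (\<forall>i\<in>I. \<forall>j\<in>I. \<forall>x\<in>snd (ch i) ` (fst (ch i) \<inter> fst (ch j)). \<forall>u v.
        let \<tau> = transition (ch i) (ch j); D = frechet_derivative \<tau> (at x)
        in g i x u v = g j (\<tau> x) (D u) (D v))"

text \<open>Curvature of a metric on an open subset of \<open>'e\<close>: \<open>christoffel g x u v\<close> is the value at \<open>x\<close> of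
  the Levi-Civita derivative \<open>\<nabla>\<^sub>u v\<close> of the constant vector field \<open>v\<close>, characterised by the
  Koszul formula.\<close>

definition christoffel :: "'e::euclidean_space metric_tensor \<Rightarrow> 'e \<Rightarrow> 'e \<Rightarrow> 'e \<Rightarrow> 'e" where
  "christoffel g x u v = (THE z. \<forall>w. g x z w =
     (frechet_derivative (\<lambda>y. g y v w) (at x) u + frechet_derivative (\<lambda>y. g y u w) (at x) v
        - frechet_derivative (\<lambda>y. g y u v) (at x) w) / 2)"

definition curvature :: "'e::euclidean_space metric_tensor \<Rightarrow> 'e \<Rightarrow> 'e \<Rightarrow> 'e \<Rightarrow> 'e \<Rightarrow> 'e" where
  "curvature g x u v w =
     frechet_derivative (\<lambda>y. christoffel g y v w) (at x) u
     - frechet_derivative (\<lambda>y. christoffel g y u w) (at x) v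
     + christoffel g x u (christoffel g x v w) - christoffel g x v (christoffel g x u w)"

definition ricci :: "'e::euclidean_space metric_tensor \<Rightarrow> 'e metric_tensor" where
  "ricci g x v w = (\<Sum>b\<in>Basis. curvature g x b v w \<bullet> b)"

definition einstein_metric :: "'i set \<Rightarrow> ('i \<Rightarrow> ('m, 'e::euclidean_space) chart) \<Rightarrow>
    ('i \<Rightarrow> 'e metric_tensor) \<Rightarrow> bool" where
  "einstein_metric I ch g \<longleftrightarrow> riemannian_metric I ch g \<and>
     (\<exists>c. \<forall>i\<in>I. \<forall>x\<in>chart_image (ch i). \<forall>u v. ricci (g i) x u v = c * g i x u v)"


section \<open>\<open>SU(2)\<close>- and \<open>SU(3)\<close>-structures\<close>

definition coframe :: "nat \<Rightarrow> (nat \<Rightarrow> ('e::euclidean_space, real) covector) \<Rightarrow> bool" where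
  "coframe n e \<longleftrightarrow> DIM('e) = n \<and> (\<forall>a\<in>{1..n}. alternating 1 (e a)) \<and>
     (\<forall>c. (\<forall>v. (\<Sum>a=1..n. c a * e a v) = 0) \<longrightarrow> (\<forall>a\<in>{1..n}. c a = 0))"

text \<open>The inner product that makes the coframe orthonormal.\<close>

definition coframe_metric :: "nat \<Rightarrow> (nat \<Rightarrow> ('e, real) covector) \<Rightarrow> 'e \<Rightarrow> 'e \<Rightarrow> real" where
  "coframe_metric n e u v = (\<Sum>a=1..n. e a (\<lambda>_. u) * e a (\<lambda>_. v))"

definition su2_structure :: "'m topology \<Rightarrow> 'i set \<Rightarrow> ('i \<Rightarrow> ('m, 'e::euclidean_space) chart) \<Rightarrow>
    ('i \<Rightarrow> 'e \<Rightarrow> ('e, real) covector) \<Rightarrow> (nat \<Rightarrow> 'i \<Rightarrow> 'e \<Rightarrow> ('e, real) covector) \<Rightarrow> bool" where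
  "su2_structure X I ch \<eta> \<omega> \<longleftrightarrow>
     smooth_manifold X I ch \<and> DIM('e) = 5 \<and>
     diff_form I ch 1 \<eta> \<and> (\<forall>a\<in>{1,2,3}. diff_form I ch 2 (\<omega> a)) \<and>
     (\<exists>\<nu>. diff_form I ch 4 \<nu> \<and>
        (\<forall>i\<in>I. \<forall>x\<in>chart_image (ch i).
           (\<forall>a\<in>{1,2,3}. \<forall>b\<in>{1,2,3}.
              wedge 2 2 (\<omega> a i x) (\<omega> b i x) = (if a = b then \<nu> i x else (\<lambda>_. 0))) \<and>
           wedge 4 1 (\<nu> i x) (\<eta> i x) \<noteq> (\<lambda>_. 0))) \<and>
     (\<forall>i\<in>I. \<forall>x\<in>chart_image (ch i). \<forall>A B.
        interior_prod A (\<omega> 1 i x) = interior_prod B (\<omega> 2 i x) \<longrightarrow>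
        \<omega> 3 i x (case_nat A (\<lambda>_. B)) \<ge> 0)"

definition su2_adapted :: "(nat \<Rightarrow> ('e::euclidean_space, real) covector) \<Rightarrow>
    ('e, real) covector \<Rightarrow> (nat \<Rightarrow> ('e, real) covector) \<Rightarrow> bool" where
  "su2_adapted e \<eta> \<omega> \<longleftrightarrow> coframe 5 e \<and>
     \<eta> = e 5 \<and>
     \<omega> 1 = (\<lambda>v. wedge 1 1 (e 1) (e 2) v + wedge 1 1 (e 3) (e 4) v) \<and>
     \<omega> 2 = (\<lambda>v. wedge 1 1 (e 1) (e 3) v + wedge 1 1 (e 4) (e 2) v) \<and>
     \<omega> 3 = (\<lambda>v. wedge 1 1 (e 1) (e 4) v + wedge 1 1 (e 2) (e 3) v)"

definition su2_metric :: "('i \<Rightarrow> 'e::euclidean_space \<Rightarrow> ('e, real) covector) \<Rightarrow>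
    (nat \<Rightarrow> 'i \<Rightarrow> 'e \<Rightarrow> ('e, real) covector) \<Rightarrow> 'i \<Rightarrow> 'e metric_tensor" where
  "su2_metric \<eta> \<omega> i x =
     (THE h. \<exists>e. su2_adapted e (\<eta> i x) (\<lambda>a. \<omega> a i x) \<and> h = coframe_metric 5 e)"

definition sasaki_einstein :: "'m topology \<Rightarrow> 'i set \<Rightarrow> ('i \<Rightarrow> ('m, 'e::euclidean_space) chart) \<Rightarrow>
    ('i \<Rightarrow> 'e \<Rightarrow> ('e, real) covector) \<Rightarrow> (nat \<Rightarrow> 'i \<Rightarrow> 'e \<Rightarrow> ('e, real) covector) \<Rightarrow> bool" where
  "sasaki_einstein X I ch \<eta> \<omega> \<longleftrightarrow> su2_structure X I ch \<eta> \<omega> \<and>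
     (\<forall>i\<in>I. \<forall>x\<in>chart_image (ch i).
        ext_deriv 1 (\<eta> i) x = (\<lambda>v. -2 * \<omega> 3 i x v) \<and>
        ext_deriv 2 (\<omega> 1 i) x = (\<lambda>v. 3 * wedge 1 2 (\<eta> i x) (\<omega> 2 i x) v) \<and>
        ext_deriv 2 (\<omega> 2 i) x = (\<lambda>v. -3 * wedge 1 2 (\<eta> i x) (\<omega> 1 i x) v))"

definition su3_adapted :: "(nat \<Rightarrow> ('e::euclidean_space, real) covector) \<Rightarrow>
    ('e, real) covector \<Rightarrow> ('e, real) covector \<Rightarrow> ('e, real) covector \<Rightarrow> bool" where
  "su3_adapted e F \<Psi>p \<Psi>m \<longleftrightarrow> coframe 6 e \<and>
     F = (\<lambda>v. wedge 1 1 (e 1) (e 2) v + wedge 1 1 (e 3) (e 4) v + wedge 1 1 (e 5) (e 6) v) \<and>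
     (let \<theta> = (\<lambda>a b v. complex_of_real (e a v) + \<i> * complex_of_real (e b v))
      in (\<lambda>v. complex_of_real (\<Psi>p v) + \<i> * complex_of_real (\<Psi>m v)) =
           wedge 2 1 (wedge 1 1 (\<theta> 1 2) (\<theta> 3 4)) (\<theta> 5 6))"

definition su3_structure :: "'m topology \<Rightarrow> 'i set \<Rightarrow> ('i \<Rightarrow> ('m, 'e::euclidean_space) chart) \<Rightarrow>
    ('i \<Rightarrow> 'e \<Rightarrow> ('e, real) covector) \<Rightarrow> ('i \<Rightarrow> 'e \<Rightarrow> ('e, real) covector) \<Rightarrow>
    ('i \<Rightarrow> 'e \<Rightarrow> ('e, real) covector) \<Rightarrow> bool" where
  "su3_structure X I ch F \<Psi>p \<Psi>m \<longleftrightarrow>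
     smooth_manifold X I ch \<and> DIM('e) = 6 \<and>
     diff_form I ch 2 F \<and> diff_form I ch 3 \<Psi>p \<and> diff_form I ch 3 \<Psi>m \<and>
     (\<forall>i\<in>I. \<forall>x\<in>chart_image (ch i). \<exists>V e. open V \<and> x \<in> V \<and> V \<subseteq> chart_image (ch i) \<and>
        (\<forall>a\<in>{1..6}. \<forall>v. smooth_on V (\<lambda>y. e a y v)) \<and>
        (\<forall>y\<in>V. su3_adapted (\<lambda>a. e a y) (F i y) (\<Psi>p i y) (\<Psi>m i y)))"

definition su3_metric :: "('i \<Rightarrow> 'e::euclidean_space \<Rightarrow> ('e, real) covector) \<Rightarrow>
    ('i \<Rightarrow> 'e \<Rightarrow> ('e, real) covector) \<Rightarrow> ('i \<Rightarrow> 'e \<Rightarrow> ('e, real) covector) \<Rightarrow>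
    'i \<Rightarrow> 'e metric_tensor" where
  "su3_metric F \<Psi>p \<Psi>m i x =
     (THE h. \<exists>e. su3_adapted e (F i x) (\<Psi>p i x) (\<Psi>m i x) \<and> h = coframe_metric 6 e)"

definition nearly_kaehler :: "'m topology \<Rightarrow> 'i set \<Rightarrow> ('i \<Rightarrow> ('m, 'e::euclidean_space) chart) \<Rightarrow>
    ('i \<Rightarrow> 'e \<Rightarrow> ('e, real) covector) \<Rightarrow> ('i \<Rightarrow> 'e \<Rightarrow> ('e, real) covector) \<Rightarrow>
    ('i \<Rightarrow> 'e \<Rightarrow> ('e, real) covector) \<Rightarrow> bool" where
  "nearly_kaehler X I ch F \<Psi>p \<Psi>m \<longleftrightarrow> su3_structure X I ch F \<Psi>p \<Psi>m \<and>
     (\<forall>i\<in>I. \<forall>x\<in>chart_image (ch i).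
        ext_deriv 2 (F i) x = (\<lambda>v. 3 * \<Psi>p i x v) \<and>
        ext_deriv 3 (\<Psi>m i) x = (\<lambda>v. -2 * wedge 2 2 (F i x) (F i x) v))"


section \<open>The open cylinder over a manifold and its completion by two points\<close>

definition cyl_top :: "'m topology \<Rightarrow> ('m \<times> real) topology" where
  "cyl_top X = prod_topology X (top_of_set {0<..<pi})"

definition cyl_chart :: "('m, 'e) chart \<Rightarrow> ('m \<times> real, 'e \<times> real) chart" where
  "cyl_chart c = (fst c \<times> {0<..<pi}, \<lambda>z. (snd c (fst z), snd z))"

text \<open>In the product charts the projection to the manifold is \<open>fst\<close> and the coordinate on the
  interval is \<open>snd\<close>.\<close>

definition lift_form :: "('e::euclidean_space \<Rightarrow> ('e, real) covector) \<Rightarrow>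
    'e \<times> real \<Rightarrow> ('e \<times> real, real) covector" where
  "lift_form \<alpha> = pullback fst \<alpha>"

definition dt :: "'e::euclidean_space \<times> real \<Rightarrow> ('e \<times> real, real) covector" where
  "dt = ext_deriv 0 (\<lambda>z _. snd z)"

text \<open>\<open>ds\<^sup>2 + r(t)\<^sup>2 h\<close>, where \<open>s\<close> and \<open>r\<close> are functions of the coordinate \<open>t\<close>.\<close>

definition warped_metric :: "(real \<Rightarrow> real) \<Rightarrow> (real \<Rightarrow> real) \<Rightarrow> ('i \<Rightarrow> 'e metric_tensor) \<Rightarrow>
    'i \<Rightarrow> ('e \<times> real) metric_tensor" where
  "warped_metric s r h i z u v =
     (deriv s (snd z) * snd u) * (deriv s (snd z) * snd v)
     + (r (snd z))\<^sup>2 * h i (fst z) (fst u) (fst v)"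

definition collapse_ends :: "'m set \<Rightarrow> 'm \<times> real \<Rightarrow> ('m \<times> real) set" where
  "collapse_ends N z = (if snd z = 0 \<or> snd z = pi then N \<times> {snd z} else {z})"

text \<open>\<open>X \<times> [0, \<pi>]\<close> with each of \<open>X \<times> {0}\<close> and \<open>X \<times> {\<pi>}\<close> collapsed to a point, with the
  quotient topology.\<close>

definition collapsed_cyl :: "'m topology \<Rightarrow> ('m \<times> real) set topology" where
  "collapsed_cyl X =
     (let Z = prod_topology X (top_of_set {0..pi}); q = collapse_ends (topspace X)
      in topology (\<lambda>U. U \<subseteq> q ` topspace Z \<and> openin Z {z \<in> topspace Z. q z \<in> U}))"

lemma quotient_map_collapsed_cyl:
  "quotient_map (prod_topology X (top_of_set {0..pi})) (collapsed_cyl X) (collapse_ends (topspace X))"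
proof -
  define Z where "Z = prod_topology X (top_of_set {0..pi})"
  define q where "q = collapse_ends (topspace X)"
  define P where "P = (\<lambda>U. U \<subseteq> q ` topspace Z \<and> openin Z {z \<in> topspace Z. q z \<in> U})"
  have "P (S \<inter> T)" if "P S" "P T" for S T
  proof -
    have "{z \<in> topspace Z. q z \<in> S \<inter> T} =
        {z \<in> topspace Z. q z \<in> S} \<inter> {z \<in> topspace Z. q z \<in> T}"
      by auto
    then show ?thesis
      using that unfolding P_def by auto
  qed
  moreover have "P (\<Union>\<K>)" if "\<forall>K\<in>\<K>. P K" for \<K>
  proof -
    have "{z \<in> topspace Z. q z \<in> \<Union>\<K>} = (\<Union>K\<in>\<K>. {z \<in> topspace Z. q z \<in> K})"
      by auto
    then show ?thesis
      using that unfolding P_def by auto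
  qed
  ultimately have "istopology P"
    unfolding istopology_def by blast
  then have op: "openin (topology P) = P"
    by (rule topology_inverse')
  have Q: "collapsed_cyl X = topology P"
    unfolding collapsed_cyl_def P_def Z_def q_def Let_def ..
  have "P (q ` topspace Z)"
  proof -
    have "{z \<in> topspace Z. q z \<in> q ` topspace Z} = topspace Z"
      by auto
    then show ?thesis
      unfolding P_def by simp
  qed
  then have "q ` topspace Z \<subseteq> topspace (topology P)"
    by (intro openin_subset) (simp add: op)
  moreover have "topspace (topology P) \<subseteq> q ` topspace Z"
    using openin_topspace[of "topology P"] unfolding op by (simp add: P_def)
  ultimately have top: "topspace (topology P) = q ` topspace Z"
    by (rule subset_antisym[rotated])
  have "quotient_map Z (topology P) q"
    unfolding quotient_map_def top op by (auto simp: P_def)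
  then show ?thesis
    unfolding Q Z_def q_def .
qed

text \<open>The metric \<open>g\<close> agrees to leading order with the cone metric \<open>ds\<^sup>2 + s\<^sup>2 h\<close> as \<open>s \<rightarrow> 0\<close>: the
  difference, measured by the cone metric, tends to \<open>0\<close>, uniformly over the link.\<close>

definition conical_end :: "'i set \<Rightarrow> ('i \<Rightarrow> ('m, 'e::euclidean_space) chart) \<Rightarrow>
    ('i \<Rightarrow> 'e metric_tensor) \<Rightarrow> (real \<Rightarrow> real) \<Rightarrow> ('i \<Rightarrow> ('e \<times> real) metric_tensor) \<Rightarrow> bool" where
  "conical_end I ch h s g \<longleftrightarrow>
     (\<forall>\<epsilon>>0. \<exists>\<delta>>0. \<forall>i\<in>I. \<forall>z\<in>chart_image (cyl_chart (ch i)). s (snd z) < \<delta> \<longrightarrow>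
        (\<forall>u. \<bar>g i z u u - warped_metric s s h i z u u\<bar> \<le> \<epsilon> * warped_metric s s h i z u u))"

text \<open>The singular points are the two collapsed ends; the open cylinder is their complement.\<close>

definition compact_nk_two_conical :: "'m topology \<Rightarrow> 'i set \<Rightarrow> ('i \<Rightarrow> ('m, 'e::euclidean_space) chart) \<Rightarrow>
    ('i \<Rightarrow> 'e metric_tensor) \<Rightarrow>
    ('i \<Rightarrow> 'e \<times> real \<Rightarrow> ('e \<times> real, real) covector) \<Rightarrow>
    ('i \<Rightarrow> 'e \<times> real \<Rightarrow> ('e \<times> real, real) covector) \<Rightarrow>
    ('i \<Rightarrow> 'e \<times> real \<Rightarrow> ('e \<times> real, real) covector) \<Rightarrow> bool" where
  "compact_nk_two_conical X I ch h F \<Psi>p \<Psi>m \<longleftrightarrow>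
     compact_space (collapsed_cyl X) \<and>
     homeomorphic_map (cyl_top X)
       (subtopology (collapsed_cyl X)
          (topspace (collapsed_cyl X) - collapse_ends (topspace X) ` (topspace X \<times> {0, pi})))
       (collapse_ends (topspace X)) \<and>
     nearly_kaehler (cyl_top X) I (cyl_chart \<circ> ch) F \<Psi>p \<Psi>m \<and>
     riemannian_metric I ch h \<and>
     conical_end I ch h (\<lambda>t. t) (su3_metric F \<Psi>p \<Psi>m) \<and>
     conical_end I ch h (\<lambda>t. pi - t) (su3_metric F \<Psi>p \<Psi>m)"


section \<open>The sine-cone structure\<close>

definition sine_cone_F :: "('i \<Rightarrow> 'e::euclidean_space \<Rightarrow> ('e, real) covector) \<Rightarrow>
    (nat \<Rightarrow> 'i \<Rightarrow> 'e \<Rightarrow> ('e, real) covector) \<Rightarrow> 'i \<Rightarrow> 'e \<times> real \<Rightarrow> ('e \<times> real, real) covector" where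
  "sine_cone_F \<eta> \<omega> i z = (let t = snd z; \<eta>' = lift_form (\<eta> i) z; \<omega>' = (\<lambda>a. lift_form (\<omega> a i) z) in
     (\<lambda>v. sin t ^ 2 * (sin t * \<omega>' 1 v + cos t * \<omega>' 3 v) + sin t * wedge 1 1 \<eta>' (dt z) v))"

definition sine_cone_Psi_plus :: "('i \<Rightarrow> 'e::euclidean_space \<Rightarrow> ('e, real) covector) \<Rightarrow>
    (nat \<Rightarrow> 'i \<Rightarrow> 'e \<Rightarrow> ('e, real) covector) \<Rightarrow> 'i \<Rightarrow> 'e \<times> real \<Rightarrow> ('e \<times> real, real) covector" where
  "sine_cone_Psi_plus \<eta> \<omega> i z = (let t = snd z; \<eta>' = lift_form (\<eta> i) z; \<omega>' = (\<lambda>a. lift_form (\<omega> a i) z) in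
     (\<lambda>v. sin t ^ 3 * wedge 1 2 \<eta>' (\<omega>' 2) v
        - sin t ^ 2 * wedge 2 1 (\<lambda>w. - cos t * \<omega>' 1 w + sin t * \<omega>' 3 w) (dt z) v))"

definition sine_cone_Psi_minus :: "('i \<Rightarrow> 'e::euclidean_space \<Rightarrow> ('e, real) covector) \<Rightarrow>
    (nat \<Rightarrow> 'i \<Rightarrow> 'e \<Rightarrow> ('e, real) covector) \<Rightarrow> 'i \<Rightarrow> 'e \<times> real \<Rightarrow> ('e \<times> real, real) covector" where
  "sine_cone_Psi_minus \<eta> \<omega> i z = (let t = snd z; \<eta>' = lift_form (\<eta> i) z; \<omega>' = (\<lambda>a. lift_form (\<omega> a i) z) in
     (\<lambda>v. sin t ^ 3 * wedge 2 1 (\<lambda>w. - cos t * \<omega>' 1 w + sin t * \<omega>' 3 w) \<eta>' v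
        + sin t ^ 2 * wedge 2 1 (\<omega>' 2) (dt z) v))"

end

(*
The structure is adapted to a local smooth coframe e of N, and a Sasaki-Einstein structure lifts to
the coframe sin t e^1, sin t (sin t e^2 + cos t e^4), sin t e^3, sin t (sin t e^4 - cos t e^2),
sin t e^5, dt of the cylinder, which is adapted to (F, Psi_+, Psi_-); hence the metric of the latter
is g_6, and the nearly Kaehler equations follow from the structure equations and d omega_3 = 0.

The structure equations do not determine the connection forms of e, but they do so up to a part that
is anti-self-dual in the indices 1, ..., 4. The curvature of g_5 therefore differs from that of the
round sphere by an anti-self-dual term, which is Ricci-flat by the Bianchi identity. So
Ric g_5 = 4 g_5, and the warped product formula gives Ric g_6 = 5 g_6.
*)

theory Submission
  imports Defs
begin

section \<open>Calculus of smooth maps\<close>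

text \<open>Both metrics are definite descriptions over adapted coframes, so uniqueness needs a
  formula in the forms alone. If Y satisfies
  \<open>\<omega>\<^sub>2(Y, -) = \<omega>\<^sub>1(u, -)\<close>, it is J u up to a Reeb component,
  and g_5(u, w) is \<eta>(u) \<eta>(w) plus \<open>\<omega>\<^sub>3(w, Y)\<close>. Similarly g_6(w,
  u) = F(w, J u), with J read off from Psi_+ and Psi_-.

  Existence is the main obstacle: an SU(2)-structure is given by wedge relations and a sign
  condition, and a smooth adapted coframe has to be built. It consists of \<eta> and of contractions
  of the 2-forms with a fixed vector X and its partner Y, divided by the root of
  \<open>\<omega>\<^sub>3(X, Y)\<close>. The relations make this number nonzero, the sign condition
  makes it positive, and Cramer's rule makes Y smooth.

  Curvature is defined through Christoffel symbols of constant fields; Cartan's equations, a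
  consequence of the symmetry of second derivatives, carry it over to coframes. The constants 4 and
  5 are those of the unit spheres of dimension 5 and 6.\<close>

lemma has_frechet_derivative:
  "f differentiable (at x) \<Longrightarrow> (f has_derivative frechet_derivative f (at x)) (at x)"
  by (simp add: frechet_derivative_works)

lemma frechet_derivative_eqI:
  "(f has_derivative f') (at x) \<Longrightarrow> frechet_derivative f (at x) = f'"
  using frechet_derivative_at by metis

lemma differentiable_transform_open:
  assumes "f differentiable (at x)" "open S" "x \<in> S" "\<And>y. y \<in> S \<Longrightarrow> f y = g y"
  shows "g differentiable (at x)"
  using assms has_derivative_transform_within_open unfolding differentiable_def by blast

text \<open>On an open set, equality of functions is equality of germs at each point, so the
  derivatives agree on the set as well and the induction goes through.\<close>

lemma Ck_on_cong:
  assumes "open S" "\<And>x. x \<in> S \<Longrightarrow> f x = g x" "Ck_on k S f"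
  shows "Ck_on k S g"
  using assms(2,3)
proof (induction k arbitrary: f g)
  case 0
  then show ?case using continuous_on_cong by (metis Ck_on.simps(1))
next
  case (Suc k)
  have d: "f differentiable (at x)" if "x \<in> S" for x
    using Suc.prems that by simp
  have "g differentiable (at x)" if "x \<in> S" for x
    using differentiable_transform_open[OF d[OF that] assms(1) that Suc.prems(1)] .
  moreover have "Ck_on k S (\<lambda>x. frechet_derivative g (at x) v)" for v
  proof (rule Suc.IH)
    show "Ck_on k S (\<lambda>x. frechet_derivative f (at x) v)" using Suc.prems by simp
    show "frechet_derivative f (at x) v = frechet_derivative g (at x) v" if "x \<in> S" for x
      using frechet_derivative_transform_within_open[OF d[OF that] assms(1) that Suc.prems(1)] by simp
  qed
  ultimately show ?case by simp
qed

lemma Ck_on_subset: "Ck_on k S f \<Longrightarrow> T \<subseteq> S \<Longrightarrow> Ck_on k T f"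
  by (induction k arbitrary: f) (auto intro: continuous_on_subset)

text \<open>Serves to recognise the metric as smooth on a whole chart: it is smooth near each point,
  where it is a sum of squares of a smooth coframe.\<close>

lemma Ck_on_local:
  assumes "\<And>x. x \<in> S \<Longrightarrow> \<exists>V. open V \<and> x \<in> V \<and> Ck_on k V f"
  shows "Ck_on k S f"
  using assms
proof (induction k arbitrary: f)
  case 0
  have "isCont f x" if "x \<in> S" for x
    using 0[OF that] by (auto simp: continuous_on_eq_continuous_at)
  then show ?case by (simp add: continuous_at_imp_continuous_on)
next
  case (Suc k)
  have "f differentiable (at x)" if "x \<in> S" for x
    using Suc.prems[OF that] by auto
  moreover have "Ck_on k S (\<lambda>x. frechet_derivative f (at x) v)" for v
    by (rule Suc.IH) (use Suc.prems in fastforce)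
  ultimately show ?case by simp
qed

lemma Ck_on_SucD: "Ck_on (Suc k) S f \<Longrightarrow> Ck_on k S f"
proof (induction k arbitrary: f)
  case 0
  then show ?case
    by (auto intro!: continuous_at_imp_continuous_on differentiable_imp_continuous_within)
next
  case (Suc k)
  then show ?case by (metis Ck_on.simps(2))
qed

lemma Ck_on_const: "Ck_on k S (\<lambda>x. c)"
  by (induction k arbitrary: c) auto

lemma Ck_on_bounded_linear:
  assumes "bounded_linear f" shows "Ck_on k S f"
proof (cases k)
  case 0
  then show ?thesis using assms linear_continuous_on by auto
next
  case (Suc m)
  have "(f has_derivative f) (at x)" for x
    using assms by (rule bounded_linear_imp_has_derivative)
  then have "frechet_derivative f (at x) = f" "f differentiable (at x)" for x
    using frechet_derivative_eqI differentiable_def by blast+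
  then show ?thesis using Suc by (simp add: Ck_on_const)
qed

lemma Ck_on_add:
  assumes S: "open S" and "Ck_on k S a" "Ck_on k S b"
  shows "Ck_on k S (\<lambda>x. a x + b x)"
  using assms(2,3)
proof (induction k arbitrary: a b)
  case 0
  then show ?case by (auto intro: continuous_intros)
next
  case (Suc k)
  have hd: "((\<lambda>x. a x + b x) has_derivative
      (\<lambda>v. frechet_derivative a (at x) v + frechet_derivative b (at x) v)) (at x)"
    if "x \<in> S" for x
    using Suc.prems that by (intro has_derivative_add has_frechet_derivative) auto
  have "(\<lambda>x. a x + b x) differentiable (at x)" if "x \<in> S" for x
    using hd[OF that] differentiable_def by blast
  moreover have "Ck_on k S (\<lambda>x. frechet_derivative (\<lambda>x. a x + b x) (at x) v)" for v
  proof (rule Ck_on_cong[OF S])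
    show "frechet_derivative a (at x) v + frechet_derivative b (at x) v =
        frechet_derivative (\<lambda>x. a x + b x) (at x) v" if "x \<in> S" for x
      using frechet_derivative_eqI[OF hd[OF that]] by simp
    show "Ck_on k S (\<lambda>x. frechet_derivative a (at x) v + frechet_derivative b (at x) v)"
      using Suc by auto
  qed
  ultimately show ?case by simp
qed

text \<open>One Leibniz rule for multiplication and for scalar multiplication.\<close>

lemma Ck_on_bilinear:
  assumes p: "bounded_bilinear p" and S: "open S"
    and "Ck_on k S f" "Ck_on k S g"
  shows "Ck_on k S (\<lambda>x. p (f x) (g x))"
  using assms(3,4)
proof (induction k arbitrary: f g)
  case 0
  then show ?case using bounded_bilinear.continuous_on[OF p] by simp
next
  case (Suc k)
  have hd: "((\<lambda>x. p (f x) (g x)) has_derivative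
      (\<lambda>v. p (f x) (frechet_derivative g (at x) v) + p (frechet_derivative f (at x) v) (g x))) (at x)"
    if "x \<in> S" for x
    using Suc.prems that
    by (intro bounded_bilinear.FDERIV[OF p] has_frechet_derivative) auto
  have "(\<lambda>x. p (f x) (g x)) differentiable (at x)" if "x \<in> S" for x
    using hd[OF that] differentiable_def by blast
  moreover have "Ck_on k S (\<lambda>x. frechet_derivative (\<lambda>x. p (f x) (g x)) (at x) v)" for v
  proof (rule Ck_on_cong[OF S])
    show "p (f x) (frechet_derivative g (at x) v) + p (frechet_derivative f (at x) v) (g x) =
        frechet_derivative (\<lambda>x. p (f x) (g x)) (at x) v" if "x \<in> S" for x
      using frechet_derivative_eqI[OF hd[OF that]] by simp
    \<comment> \<open>In each term one factor is undifferentiated, hence of class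
      \<open>Suc k\<close>; it is weakened to class \<open>k\<close> so that the induction
      hypothesis applies to both factors.\<close>
    have *: "Ck_on k S (\<lambda>x. p (f x) (frechet_derivative g (at x) v))"
      "Ck_on k S (\<lambda>x. p (frechet_derivative f (at x) v) (g x))"
      using Suc Ck_on_SucD by (metis Ck_on.simps(2))+
    show "Ck_on k S (\<lambda>x. p (f x) (frechet_derivative g (at x) v)
        + p (frechet_derivative f (at x) v) (g x))"
      using * by (intro Ck_on_add S)
  qed
  ultimately show ?case by simp
qed

lemma Ck_on_compose_linear:
  assumes L: "bounded_linear L" and T: "open T" and LT: "\<And>x. x \<in> T \<Longrightarrow> L x \<in> S"
    and "Ck_on k S f"
  shows "Ck_on k T (\<lambda>x. f (L x))"
  using assms(4)
proof (induction k arbitrary: f)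
  case 0
  then show ?case
    using continuous_on_compose2[OF _ linear_continuous_on[OF L]] LT by (auto simp: image_subset_iff)
next
  case (Suc k)
  have hd: "((\<lambda>x. f (L x)) has_derivative (\<lambda>v. frechet_derivative f (at (L x)) (L v))) (at x)"
    if "x \<in> T" for x
    by (rule has_derivative_compose[OF bounded_linear_imp_has_derivative[OF L] has_frechet_derivative])
      (use Suc.prems LT that in simp)
  have "(\<lambda>x. f (L x)) differentiable (at x)" if "x \<in> T" for x
    using hd[OF that] differentiable_def by blast
  moreover have "Ck_on k T (\<lambda>x. frechet_derivative (\<lambda>x. f (L x)) (at x) v)" for v
  proof (rule Ck_on_cong[OF T])
    show "frechet_derivative f (at (L x)) (L v) = frechet_derivative (\<lambda>x. f (L x)) (at x) v"
      if "x \<in> T" for x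
      using frechet_derivative_eqI[OF hd[OF that]] by simp
    show "Ck_on k T (\<lambda>x. frechet_derivative f (at (L x)) (L v))"
      using Suc by auto
  qed
  ultimately show ?case by simp
qed

lemma Ck_on_linear_comp:
  assumes L: "bounded_linear L" and S: "open S" and "Ck_on k S f"
  shows "Ck_on k S (\<lambda>x. L (f x))"
  using assms(3)
proof (induction k arbitrary: f)
  case 0
  then show ?case by (simp add: L bounded_linear.continuous_on)
next
  case (Suc k)
  have hd: "((\<lambda>x. L (f x)) has_derivative (\<lambda>v. L (frechet_derivative f (at x) v))) (at x)"
    if "x \<in> S" for x
    using Suc.prems that by (intro bounded_linear.has_derivative[OF L] has_frechet_derivative) auto
  have "(\<lambda>x. L (f x)) differentiable (at x)" if "x \<in> S" for x
    using hd[OF that] differentiable_def by blast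
  moreover have "Ck_on k S (\<lambda>x. frechet_derivative (\<lambda>x. L (f x)) (at x) v)" for v
  proof (rule Ck_on_cong[OF S])
    show "L (frechet_derivative f (at x) v) = frechet_derivative (\<lambda>x. L (f x)) (at x) v"
      if "x \<in> S" for x
      using frechet_derivative_eqI[OF hd[OF that]] by simp
    show "Ck_on k S (\<lambda>x. L (frechet_derivative f (at x) v))"
      using Suc by auto
  qed
  ultimately show ?case by simp
qed

text \<open>The hypothesis says that \<open>h' \<circ> f\<close> is again a composition of the same kind or built from such
  compositions, which is how the chain rule is iterated for \<open>inverse\<close>, \<open>sqrt\<close>, \<open>sin\<close> and \<open>cos\<close>.\<close>

lemma Ck_on_chain:
  fixes f :: "'a::real_normed_vector \<Rightarrow> real" and h :: "real \<Rightarrow> real"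
  assumes S: "open S" and f: "Ck_on (Suc k) S f"
    and h: "\<And>x. x \<in> S \<Longrightarrow> (h has_real_derivative h' (f x)) (at (f x))"
    and h': "Ck_on k S (\<lambda>x. h' (f x))"
  shows "Ck_on (Suc k) S (\<lambda>x. h (f x))"
proof -
  have hd: "((\<lambda>x. h (f x)) has_derivative (\<lambda>v. h' (f x) * frechet_derivative f (at x) v)) (at x)"
    if "x \<in> S" for x
  proof -
    have "(f has_derivative frechet_derivative f (at x)) (at x)"
      using f that by (intro has_frechet_derivative) auto
    then show ?thesis
      using has_derivative_compose[of f _ x UNIV h] h[OF that]
      by (simp add: has_field_derivative_def)
  qed
  have "(\<lambda>x. h (f x)) differentiable (at x)" if "x \<in> S" for x
    using hd[OF that] differentiable_def by blast
  moreover have "Ck_on k S (\<lambda>x. frechet_derivative (\<lambda>x. h (f x)) (at x) v)" for v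
  proof (rule Ck_on_cong[OF S])
    show "h' (f x) * frechet_derivative f (at x) v = frechet_derivative (\<lambda>x. h (f x)) (at x) v"
      if "x \<in> S" for x
      using frechet_derivative_eqI[OF hd[OF that]] by simp
    show "Ck_on k S (\<lambda>x. h' (f x) * frechet_derivative f (at x) v)"
      using f by (intro Ck_on_bilinear[OF bounded_bilinear_mult S h']) auto
  qed
  ultimately show ?thesis by simp
qed

text \<open>The derivative of the reciprocal is minus the square of the reciprocal, so the induction
  hypothesis already covers it.\<close>

lemma Ck_on_inverse:
  fixes f :: "'a::real_normed_vector \<Rightarrow> real"
  assumes S: "open S" and nz: "\<And>x. x \<in> S \<Longrightarrow> f x \<noteq> 0" and "Ck_on k S f"
  shows "Ck_on k S (\<lambda>x. inverse (f x))"
  using assms(3)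
proof (induction k)
  case 0
  then show ?case using nz by (auto intro!: continuous_intros)
next
  case (Suc k)
  then have i: "Ck_on k S (\<lambda>x. inverse (f x))"
    using Ck_on_SucD by blast
  have "Ck_on k S (\<lambda>x. (-1) * (inverse (f x) * inverse (f x)))"
    by (intro Ck_on_bilinear[OF bounded_bilinear_mult S] Ck_on_const i)
  then show ?case
    by (intro Ck_on_chain[OF S Suc.prems, where h' = "\<lambda>y. - 1 * (inverse y * inverse y)"])
      (use nz in \<open>auto intro!: derivative_eq_intros simp: power2_eq_square\<close>)
qed

text \<open>The derivative of the root is half the reciprocal of the root, which the induction
  hypothesis and the previous lemma cover.\<close>

lemma Ck_on_sqrt:
  fixes f :: "'a::real_normed_vector \<Rightarrow> real"
  assumes S: "open S" and nz: "\<And>x. x \<in> S \<Longrightarrow> f x > 0" and "Ck_on k S f"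
  shows "Ck_on k S (\<lambda>x. sqrt (f x))"
  using assms(3)
proof (induction k)
  case 0
  then show ?case by (auto intro!: continuous_intros)
next
  case (Suc k)
  then have i: "Ck_on k S (\<lambda>x. inverse (sqrt (f x)))"
    using Ck_on_SucD nz by (intro Ck_on_inverse[OF S]) force+
  have "Ck_on k S (\<lambda>x. (1/2) * inverse (sqrt (f x)))"
    by (intro Ck_on_bilinear[OF bounded_bilinear_mult S] Ck_on_const i)
  then show ?case
    by (intro Ck_on_chain[OF S Suc.prems, where h' = "\<lambda>y. (1/2) * inverse (sqrt y)"])
      (use nz in \<open>force intro!: derivative_eq_intros simp: divide_simps dest: less_imp_neq\<close>)+
qed

text \<open>Sine and cosine are treated together because each is, up to sign, the derivative of the
  other.\<close>

lemma Ck_on_sin_cos: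
  fixes f :: "'a::real_normed_vector \<Rightarrow> real"
  assumes S: "open S" and "Ck_on k S f"
  shows "Ck_on k S (\<lambda>x. sin (f x)) \<and> Ck_on k S (\<lambda>x. cos (f x))"
  using assms(2)
proof (induction k)
  case 0
  then show ?case by (auto intro!: continuous_intros)
next
  case (Suc k)
  then have i: "Ck_on k S (\<lambda>x. sin (f x))" "Ck_on k S (\<lambda>x. cos (f x))"
    using Ck_on_SucD by blast+
  have "Ck_on k S (\<lambda>x. (-1) * sin (f x))"
    by (intro Ck_on_bilinear[OF bounded_bilinear_mult S] Ck_on_const i)
  then have "Ck_on (Suc k) S (\<lambda>x. cos (f x))"
    by (intro Ck_on_chain[OF S Suc.prems, where h' = "\<lambda>y. (-1) * sin y"])
      (auto intro!: derivative_eq_intros)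
  moreover have "Ck_on (Suc k) S (\<lambda>x. sin (f x))"
    by (intro Ck_on_chain[OF S Suc.prems, where h' = cos] i)
      (auto intro!: derivative_eq_intros)
  ultimately show ?case by blast
qed

section \<open>Closure properties of smooth maps\<close>

lemma smooth_on_cong:
  "open S \<Longrightarrow> smooth_on S f \<Longrightarrow> (\<And>x. x \<in> S \<Longrightarrow> f x = g x) \<Longrightarrow> smooth_on S g"
  unfolding smooth_on_def using Ck_on_cong by blast

lemma smooth_on_subset: "smooth_on S f \<Longrightarrow> T \<subseteq> S \<Longrightarrow> smooth_on T f"
  unfolding smooth_on_def using Ck_on_subset by blast

lemma smooth_on_local:
  "(\<And>x. x \<in> S \<Longrightarrow> \<exists>V. open V \<and> x \<in> V \<and> smooth_on V f) \<Longrightarrow> smooth_on S f"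
  unfolding smooth_on_def by (meson Ck_on_local)

lemma smooth_on_differentiable: "smooth_on S f \<Longrightarrow> x \<in> S \<Longrightarrow> f differentiable (at x)"
  unfolding smooth_on_def by (metis Ck_on.simps(2))

lemma smooth_on_has_derivative:
  "smooth_on S f \<Longrightarrow> x \<in> S \<Longrightarrow> (f has_derivative frechet_derivative f (at x)) (at x)"
  by (intro has_frechet_derivative smooth_on_differentiable)

lemma smooth_on_frechet_derivative: "smooth_on S f \<Longrightarrow> smooth_on S (\<lambda>x. frechet_derivative f (at x) v)"
  unfolding smooth_on_def by (metis Ck_on.simps(2))

lemma smooth_on_continuous_on: "smooth_on S f \<Longrightarrow> continuous_on S f"
  unfolding smooth_on_def by (metis Ck_on.simps(1))

lemma smooth_on_const: "smooth_on S (\<lambda>x. c)"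
  by (simp add: smooth_on_def Ck_on_const)

lemma smooth_on_bounded_linear: "bounded_linear f \<Longrightarrow> smooth_on S f"
  by (simp add: smooth_on_def Ck_on_bounded_linear)

lemma smooth_on_bilinear:
  "bounded_bilinear p \<Longrightarrow> open S \<Longrightarrow> smooth_on S f \<Longrightarrow> smooth_on S g \<Longrightarrow> smooth_on S (\<lambda>x. p (f x) (g x))"
  by (simp add: smooth_on_def Ck_on_bilinear)

lemmas smooth_on_mult = smooth_on_bilinear[OF bounded_bilinear_mult]
  and smooth_on_scaleR = smooth_on_bilinear[OF bounded_bilinear_scaleR]

lemma smooth_on_add: "open S \<Longrightarrow> smooth_on S f \<Longrightarrow> smooth_on S g \<Longrightarrow> smooth_on S (\<lambda>x. f x + g x)"
  by (simp add: smooth_on_def Ck_on_add)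

lemma smooth_on_linear_comp:
  "bounded_linear L \<Longrightarrow> open S \<Longrightarrow> smooth_on S f \<Longrightarrow> smooth_on S (\<lambda>x. L (f x))"
  by (simp add: smooth_on_def Ck_on_linear_comp)

lemma smooth_on_compose_linear:
  assumes "bounded_linear L" "open T" "smooth_on S f" "\<And>x. x \<in> T \<Longrightarrow> L x \<in> S"
  shows "smooth_on T (\<lambda>x. f (L x))"
  using assms(3) Ck_on_compose_linear[OF assms(1,2,4)] unfolding smooth_on_def by blast

lemma smooth_on_minus: "open S \<Longrightarrow> smooth_on S f \<Longrightarrow> smooth_on S (\<lambda>x. - f x)"
  by (rule smooth_on_linear_comp[OF bounded_linear_minus[OF bounded_linear_ident]])

lemma smooth_on_diff:
  "open S \<Longrightarrow> smooth_on S f \<Longrightarrow> smooth_on S g \<Longrightarrow> smooth_on S (\<lambda>x. f x - g x)"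
  using smooth_on_add[of S f "\<lambda>x. - g x"] smooth_on_minus[of S g] by simp

lemma smooth_on_sum:
  "open S \<Longrightarrow> (\<And>i. i \<in> A \<Longrightarrow> smooth_on S (f i)) \<Longrightarrow> smooth_on S (\<lambda>x. \<Sum>i\<in>A. f i x)"
  by (induction A rule: infinite_finite_induct) (auto intro: smooth_on_add smooth_on_const)

lemma smooth_on_prod:
  fixes f :: "'i \<Rightarrow> 'a::real_normed_vector \<Rightarrow> 'b::{real_normed_algebra, comm_ring_1}"
  shows "open S \<Longrightarrow> (\<And>i. i \<in> A \<Longrightarrow> smooth_on S (f i)) \<Longrightarrow> smooth_on S (\<lambda>x. \<Prod>i\<in>A. f i x)"
  by (induction A rule: infinite_finite_induct) (auto intro: smooth_on_mult smooth_on_const)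

lemma smooth_on_power:
  fixes f :: "'a::real_normed_vector \<Rightarrow> real"
  shows "open S \<Longrightarrow> smooth_on S f \<Longrightarrow> smooth_on S (\<lambda>x. f x ^ n)"
  by (induction n) (auto intro: smooth_on_mult smooth_on_const)

lemma smooth_on_inverse:
  fixes f :: "'a::real_normed_vector \<Rightarrow> real"
  shows "open S \<Longrightarrow> smooth_on S f \<Longrightarrow> (\<And>x. x \<in> S \<Longrightarrow> f x \<noteq> 0) \<Longrightarrow> smooth_on S (\<lambda>x. inverse (f x))"
  by (simp add: smooth_on_def Ck_on_inverse)

lemma smooth_on_divide:
  fixes f :: "'a::real_normed_vector \<Rightarrow> real"
  assumes "open S" "smooth_on S f" "smooth_on S g" "\<And>x. x \<in> S \<Longrightarrow> g x \<noteq> 0"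
  shows "smooth_on S (\<lambda>x. f x / g x)"
  unfolding divide_inverse by (intro smooth_on_mult smooth_on_inverse assms)

lemma smooth_on_sqrt:
  fixes f :: "'a::real_normed_vector \<Rightarrow> real"
  shows "open S \<Longrightarrow> smooth_on S f \<Longrightarrow> (\<And>x. x \<in> S \<Longrightarrow> f x > 0) \<Longrightarrow> smooth_on S (\<lambda>x. sqrt (f x))"
  by (simp add: smooth_on_def Ck_on_sqrt)

lemma smooth_on_sin: "open S \<Longrightarrow> smooth_on S f \<Longrightarrow> smooth_on S (\<lambda>x. sin (f x))"
  and smooth_on_cos: "open S \<Longrightarrow> smooth_on S f \<Longrightarrow> smooth_on S (\<lambda>x. cos (f x))"
  for f :: "'a::real_normed_vector \<Rightarrow> real"
  by (simp_all add: smooth_on_def Ck_on_sin_cos)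

lemma smooth_on_if: "(P \<Longrightarrow> smooth_on S f) \<Longrightarrow> (\<not> P \<Longrightarrow> smooth_on S g) \<Longrightarrow> smooth_on S (\<lambda>x. if P then f x else g x)"
  by (cases P) simp_all

lemma smooth_on_componentwise:
  fixes f :: "'a::real_normed_vector \<Rightarrow> 'b::euclidean_space"
  assumes "open S" "\<And>b. b \<in> Basis \<Longrightarrow> smooth_on S (\<lambda>x. f x \<bullet> b)"
  shows "smooth_on S f"
proof -
  have "smooth_on S (\<lambda>x. \<Sum>b\<in>Basis. (f x \<bullet> b) *\<^sub>R b)"
    using assms by (intro smooth_on_sum smooth_on_scaleR smooth_on_const)
  then show ?thesis by (simp add: euclidean_representation)
qed

lemma smooth_on_det:
  fixes A :: "'a::real_normed_vector \<Rightarrow> real ^ 'n ^ 'n"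
  assumes "open S" "\<And>i j. smooth_on S (\<lambda>x. A x $ i $ j)"
  shows "smooth_on S (\<lambda>x. det (A x))"
  unfolding det_def using assms by (intro smooth_on_sum smooth_on_mult smooth_on_prod smooth_on_const)

text \<open>By Cramer's rule.\<close>

lemma smooth_on_linear_solve:
  fixes A :: "'a::real_normed_vector \<Rightarrow> real ^ 'n ^ 'n"
  assumes S: "open S" and A: "\<And>i j. smooth_on S (\<lambda>x. A x $ i $ j)" and b: "\<And>i. smooth_on S (\<lambda>x. b x $ i)"
    and d: "\<And>x. x \<in> S \<Longrightarrow> det (A x) \<noteq> 0" and y: "\<And>x. x \<in> S \<Longrightarrow> A x *v y x = b x"
  shows "smooth_on S y"
proof (rule smooth_on_componentwise[OF S])
  fix c :: "real ^ 'n" assume "c \<in> Basis"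
  then obtain k where c: "c = axis k 1" unfolding Basis_vec_def by auto
  have "smooth_on S (\<lambda>x. det (\<chi> i j. if j = k then b x $ i else A x $ i $ j) / det (A x))"
    by (intro smooth_on_divide smooth_on_det S d) (simp_all add: A b smooth_on_if)
  moreover have "det (\<chi> i j. if j = k then b x $ i else A x $ i $ j) / det (A x) = y x \<bullet> c" if "x \<in> S" for x
  proof -
    have "y x $ k = det (\<chi> i j. if j = k then b x $ i else A x $ i $ j) / det (A x)"
      using arg_cong[OF iffD1[OF cramer[OF d[OF that]] y[OF that]], of "\<lambda>z. z $ k"] by simp
    then show ?thesis using c by (simp add: inner_axis)
  qed
  ultimately show "smooth_on S (\<lambda>x. y x \<bullet> c)"
    by (rule smooth_on_cong[OF S])
qed

section \<open>Symmetry of mixed second derivatives\<close>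

lemma directional_derivative_along_line:
  fixes f :: "'a::real_normed_vector \<Rightarrow> real"
  assumes "f differentiable (at (p + s *\<^sub>R u))"
  shows "((\<lambda>r. f (p + r *\<^sub>R u)) has_real_derivative frechet_derivative f (at (p + s *\<^sub>R u)) u) (at s)"
proof -
  have "((\<lambda>r. p + r *\<^sub>R u) has_derivative (\<lambda>r. r *\<^sub>R u)) (at s)"
    by (auto intro!: derivative_eq_intros)
  then have "((\<lambda>r. f (p + r *\<^sub>R u)) has_derivative
      (\<lambda>r. frechet_derivative f (at (p + s *\<^sub>R u)) (r *\<^sub>R u))) (at s)"
    using has_derivative_compose has_frechet_derivative[OF assms] by blast
  moreover have "frechet_derivative f (at (p + s *\<^sub>R u)) (r *\<^sub>R u)
      = frechet_derivative f (at (p + s *\<^sub>R u)) u * r" for r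
    using linear_frechet_derivative[OF assms] by (simp add: linear_scale)
  ultimately show ?thesis by (simp add: has_field_derivative_def)
qed

text \<open>Two applications of the mean value theorem: along u to the difference
  \<open>\<phi>\<close> of the values of f on opposite edges of the parallelogram, then along v to
  the derivative of f in direction u.\<close>

lemma second_difference_mvt:
  fixes f :: "'a::real_normed_vector \<Rightarrow> real"
  assumes sm: "smooth_on S f" and h: "0 < h"
    and seg: "\<And>s t. 0 \<le> s \<Longrightarrow> s \<le> h \<Longrightarrow> 0 \<le> t \<Longrightarrow> t \<le> h \<Longrightarrow> x + s *\<^sub>R u + t *\<^sub>R v \<in> S"
  obtains s t where "0 < s" "s < h" "0 < t" "t < h"
    "f (x + h *\<^sub>R u + h *\<^sub>R v) - f (x + h *\<^sub>R u) - f (x + h *\<^sub>R v) + f x =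
       h * (h * frechet_derivative (\<lambda>y. frechet_derivative f (at y) u) (at (x + s *\<^sub>R u + t *\<^sub>R v)) v)"
proof -
  define D where "D = (\<lambda>y. frechet_derivative f (at y) u)"
  have sD: "smooth_on S D" unfolding D_def by (rule smooth_on_frechet_derivative[OF sm])
  define \<phi> where "\<phi> s = f (x + h *\<^sub>R v + s *\<^sub>R u) - f (x + s *\<^sub>R u)" for s
  have "\<exists>s>0. s < h \<and> \<phi> h - \<phi> 0 = (h - 0) * (D (x + h *\<^sub>R v + s *\<^sub>R u) - D (x + s *\<^sub>R u))"
    unfolding \<phi>_def D_def
  proof (intro MVT2[OF h] DERIV_diff directional_derivative_along_line smooth_on_differentiable[OF sm])
    fix s assume "0 \<le> s" "s \<le> h"
    then show "x + h *\<^sub>R v + s *\<^sub>R u \<in> S" "x + s *\<^sub>R u \<in> S"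
      using seg[of s h] seg[of s 0] h by (simp_all add: algebra_simps)
  qed
  then obtain s where s: "0 < s" "s < h" "\<phi> h - \<phi> 0 = h * (D (x + h *\<^sub>R v + s *\<^sub>R u) - D (x + s *\<^sub>R u))"
    by auto
  have "\<exists>t>0. t < h \<and> D (x + s *\<^sub>R u + h *\<^sub>R v) - D (x + s *\<^sub>R u + 0 *\<^sub>R v) =
      (h - 0) * frechet_derivative D (at (x + s *\<^sub>R u + t *\<^sub>R v)) v"
  proof (intro MVT2[OF h] directional_derivative_along_line smooth_on_differentiable[OF sD])
    fix t assume "0 \<le> t" "t \<le> h"
    then show "x + s *\<^sub>R u + t *\<^sub>R v \<in> S" using seg s by simp
  qed
  then obtain t where t: "0 < t" "t < h" "D (x + s *\<^sub>R u + h *\<^sub>R v) - D (x + s *\<^sub>R u) =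
      h * frechet_derivative D (at (x + s *\<^sub>R u + t *\<^sub>R v)) v"
    by auto
  have "f (x + h *\<^sub>R u + h *\<^sub>R v) - f (x + h *\<^sub>R u) - f (x + h *\<^sub>R v) + f x = \<phi> h - \<phi> 0"
    unfolding \<phi>_def by (simp add: algebra_simps)
  also have "\<dots> = h * (h * frechet_derivative D (at (x + s *\<^sub>R u + t *\<^sub>R v)) v)"
    using s(3) t(3) by (simp add: algebra_simps)
  finally show thesis using that s t unfolding D_def by blast
qed

text \<open>Both mixed derivatives represent the same second difference, each at some point close to
  x, and both are continuous at x. This symmetry is behind the closedness of the exact form
  \<open>\<omega>\<^sub>3\<close> and behind Cartan's structure equation.\<close>

lemma frechet_derivative_commute:
  fixes f :: "'a::real_normed_vector \<Rightarrow> real"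
  assumes sm: "smooth_on S f" and S: "open S" "x \<in> S"
  shows "frechet_derivative (\<lambda>y. frechet_derivative f (at y) u) (at x) v =
    frechet_derivative (\<lambda>y. frechet_derivative f (at y) v) (at x) u"
proof (rule ccontr)
  define A where "A = (\<lambda>y. frechet_derivative (\<lambda>y. frechet_derivative f (at y) u) (at y) v)"
  define B where "B = (\<lambda>y. frechet_derivative (\<lambda>y. frechet_derivative f (at y) v) (at y) u)"
  assume "\<not> ?thesis"
  then have ne: "\<bar>A x - B x\<bar> > 0" unfolding A_def B_def by simp
  \<comment> \<open>Half the supposed gap: two values within this distance of \<open>A x\<close> and
    \<open>B x\<close> cannot coincide.\<close>
  define \<epsilon> where "\<epsilon> = \<bar>A x - B x\<bar> / 2"
  have \<epsilon>: "\<epsilon> > 0" using ne by (simp add: \<epsilon>_def)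
  have "continuous_on S A" "continuous_on S B"
    unfolding A_def B_def by (intro smooth_on_continuous_on smooth_on_frechet_derivative sm)+
  then have "isCont A x" "isCont B x"
    using S continuous_on_eq_continuous_at by blast+
  then obtain d1 d2 where d1: "d1 > 0" "\<And>y. dist y x < d1 \<Longrightarrow> dist (A y) (A x) < \<epsilon>"
    and d2: "d2 > 0" "\<And>y. dist y x < d2 \<Longrightarrow> dist (B y) (B x) < \<epsilon>"
    using \<epsilon> unfolding continuous_at_eps_delta by metis
  obtain d3 where d3: "d3 > 0" "ball x d3 \<subseteq> S"
    using S open_contains_ball by blast
  define d where "d = min d1 (min d2 d3)"
  \<comment> \<open>The summand 1 keeps the denominator positive if both directions vanish; the
    factor 2 keeps the parallelogram strictly inside the ball of radius d.\<close>
  define h where "h = d / (2 * (norm u + norm v + 1))"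
  have dpos: "d > 0" unfolding d_def using d1 d2 d3 by simp
  have hpos: "h > 0" unfolding h_def using dpos by (simp add: add_nonneg_pos)
  have near: "dist (x + s *\<^sub>R u + t *\<^sub>R v) x < d" if "0 \<le> s" "s \<le> h" "0 \<le> t" "t \<le> h" for s t
  proof -
    have "dist (x + s *\<^sub>R u + t *\<^sub>R v) x = norm (s *\<^sub>R u + t *\<^sub>R v)"
      by (simp add: dist_norm algebra_simps)
    also have "\<dots> \<le> s * norm u + t * norm v"
      using norm_triangle_ineq[of "s *\<^sub>R u" "t *\<^sub>R v"] that by simp
    also have "\<dots> \<le> h * norm u + h * norm v"
      using that by (intro add_mono mult_right_mono) auto
    also have "\<dots> = h * (norm u + norm v)"
      by (simp add: algebra_simps)
    also have "\<dots> \<le> h * (norm u + norm v + 1)"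
      using hpos by (intro mult_left_mono) auto
    also have "\<dots> = d / 2"
    proof -
      have "norm u + norm v + 1 \<noteq> 0"
        using norm_ge_zero[of u] norm_ge_zero[of v] by linarith
      moreover have "d / (2 * c) * c = d / 2" if "c \<noteq> 0" for c :: real
        using that by simp
      ultimately show ?thesis unfolding h_def by blast
    qed
    finally show ?thesis using dpos by simp
  qed
  have inS: "x + s *\<^sub>R u + t *\<^sub>R v \<in> S" if "0 \<le> s" "s \<le> h" "0 \<le> t" "t \<le> h" for s t
  proof -
    have "x + s *\<^sub>R u + t *\<^sub>R v \<in> ball x d3"
      using near[OF that] by (simp add: d_def dist_commute)
    then show ?thesis using d3 by blast
  qed
  obtain s t where st: "0 < s" "s < h" "0 < t" "t < h"
    "f (x + h *\<^sub>R u + h *\<^sub>R v) - f (x + h *\<^sub>R u) - f (x + h *\<^sub>R v) + f x = h * (h * A (x + s *\<^sub>R u + t *\<^sub>R v))"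
    using second_difference_mvt[OF sm hpos, of x u v] inS unfolding A_def by blast
  obtain s' t' where st': "0 < s'" "s' < h" "0 < t'" "t' < h"
    "f (x + h *\<^sub>R v + h *\<^sub>R u) - f (x + h *\<^sub>R v) - f (x + h *\<^sub>R u) + f x = h * (h * B (x + s' *\<^sub>R v + t' *\<^sub>R u))"
  proof (rule second_difference_mvt[OF sm hpos, of x v u, folded B_def])
    show "x + s *\<^sub>R v + t *\<^sub>R u \<in> S" if "0 \<le> s" "s \<le> h" "0 \<le> t" "t \<le> h" for s t
      using inS[of t s] that by (simp add: algebra_simps)
  qed (use that in \<open>auto simp: B_def\<close>)
  have "h * (h * A (x + s *\<^sub>R u + t *\<^sub>R v)) = h * (h * B (x + s' *\<^sub>R v + t' *\<^sub>R u))"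
    using st(5) st'(5) by (simp add: algebra_simps)
  then have eq: "A (x + s *\<^sub>R u + t *\<^sub>R v) = B (x + t' *\<^sub>R u + s' *\<^sub>R v)"
    using hpos by (simp add: algebra_simps)
  have "dist (A (x + s *\<^sub>R u + t *\<^sub>R v)) (A x) < \<epsilon>"
    using near[of s t] st by (intro d1) (auto simp: d_def)
  moreover have "dist (B (x + t' *\<^sub>R u + s' *\<^sub>R v)) (B x) < \<epsilon>"
    using near[of t' s'] st' by (intro d2) (auto simp: d_def)
  ultimately have "\<bar>A x - B x\<bar> < 2 * \<epsilon>"
    using eq by (simp add: dist_real_def)
  then show False by (simp add: \<epsilon>_def)
qed

section \<open>Alternating forms\<close>

text \<open>Curried versions of covectors of degree 1 and 2. The entries of the argument sequence
  beyond the degree are filled with the last vector; an alternating covector does not see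
  them.\<close>

definition form1 :: "('e, 'b) covector \<Rightarrow> 'e \<Rightarrow> 'b" where
  "form1 a u = a (\<lambda>_. u)"

definition form2 :: "('e, 'b) covector \<Rightarrow> 'e \<Rightarrow> 'e \<Rightarrow> 'b" where
  "form2 a u w = a (case_nat u (\<lambda>_. w))"

lemma alternating_cong: "alternating k a \<Longrightarrow> (\<And>i. i < k \<Longrightarrow> v i = w i) \<Longrightarrow> a v = a w"
  unfolding alternating_def by blast

lemma alternating_linear: "alternating k a \<Longrightarrow> i < k \<Longrightarrow> linear (\<lambda>u. a (v(i := u)))"
  unfolding alternating_def by blast

lemma alternating_repeat: "alternating k a \<Longrightarrow> i < k \<Longrightarrow> j < k \<Longrightarrow> i \<noteq> j \<Longrightarrow> v i = v j \<Longrightarrow> a v = 0"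
  unfolding alternating_def by blast

lemma alternatingI:
  assumes "\<And>v w. (\<And>i. i < k \<Longrightarrow> v i = w i) \<Longrightarrow> a v = a w"
    and "\<And>v i. i < k \<Longrightarrow> linear (\<lambda>u. a (v(i := u)))"
    and "\<And>v i j. i < k \<Longrightarrow> j < k \<Longrightarrow> i \<noteq> j \<Longrightarrow> v i = v j \<Longrightarrow> a v = 0"
  shows "alternating k a"
  using assms unfolding alternating_def by blast

lemma alternating_add:
  assumes "alternating k a" "alternating k b"
  shows "alternating k (\<lambda>v. a v + b v)"
  using alternating_cong[OF assms(1)] alternating_cong[OF assms(2)]
    alternating_repeat[OF assms(1)] alternating_repeat[OF assms(2)]
  by (intro alternatingI linear_compose_add alternating_linear[OF assms(1)] alternating_linear[OF assms(2)])
    (metis, assumption, assumption, metis add_0)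

lemma alternating_scaleR:
  assumes "alternating k a"
  shows "alternating k (\<lambda>v. c *\<^sub>R a v)"
  using alternating_cong[OF assms] alternating_repeat[OF assms]
  by (intro alternatingI linear_compose_scale_right alternating_linear[OF assms])
    (metis, assumption, metis scaleR_zero_right)

lemma alternating_mult:
  fixes c :: "'b::real_algebra"
  assumes "alternating k a"
  shows "alternating k (\<lambda>v. c * a v)"
proof (rule alternatingI)
  show "linear (\<lambda>u. c * a (v(i := u)))" if "i < k" for v i
  proof -
    interpret linear "\<lambda>u. a (v(i := u))" by (rule alternating_linear[OF assms that])
    show ?thesis by (rule linearI) (simp_all add: add scale algebra_simps)
  qed
qed (use alternating_cong[OF assms] alternating_repeat[OF assms] in \<open>metis+\<close>, use alternating_repeat[OF assms] in force)

lemma alternating_diff: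
  fixes a b :: "('e::real_vector, 'b::real_vector) covector"
  shows "alternating k a \<Longrightarrow> alternating k b \<Longrightarrow> alternating k (\<lambda>v. a v - b v)"
  using alternating_add[of k a "\<lambda>v. (-1) *\<^sub>R b v"] alternating_scaleR[of k b "-1"] by simp

lemma alternating_of_real:
  fixes a :: "('e::real_vector, real) covector"
  assumes "alternating k a"
  shows "alternating k (\<lambda>v. of_real (a v) :: 'b::real_algebra_1)"
proof (rule alternatingI)
  show "linear (\<lambda>u. of_real (a (v(i := u))) :: 'b)" if "i < k" for v i
  proof -
    interpret linear "\<lambda>u. a (v(i := u))" by (rule alternating_linear[OF assms that])
    show ?thesis by (rule linearI) (simp_all add: add scale scaleR_conv_of_real)
  qed
qed (use alternating_cong[OF assms] alternating_repeat[OF assms] in \<open>metis+\<close>, use alternating_repeat[OF assms] in force)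

lemma alternating_1:
  assumes "alternating 1 a"
  shows alternating_1_apply: "a v = form1 a (v 0)" and linear_form1: "linear (form1 a)"
proof -
  show "a v = form1 a (v 0)"
    unfolding form1_def by (rule alternating_cong[OF assms]) simp
  have "linear (\<lambda>u. a ((\<lambda>_. undefined)(0 := u)))"
    by (rule alternating_linear[OF assms]) simp
  moreover have "a ((\<lambda>_. undefined)(0 := u)) = form1 a u" for u
    unfolding form1_def by (rule alternating_cong[OF assms]) simp
  ultimately show "linear (form1 a)" by simp
qed

lemma alternating_2:
  assumes "alternating 2 a"
  shows alternating_2_apply: "a v = form2 a (v 0) (v 1)"
    and linear_form2_left: "linear (\<lambda>u. form2 a u w)"
    and linear_form2_right: "linear (form2 a w)"
    and form2_self: "form2 a u u = 0"
    and form2_swap: "form2 a u w = - form2 a w u"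
proof -
  show ap: "a v = form2 a (v 0) (v 1)" for v
    unfolding form2_def by (rule alternating_cong[OF assms]) (auto simp: less_2_cases_iff)
  show L: "linear (\<lambda>u. form2 a u w)" for w
    using alternating_linear[OF assms, of 0 "\<lambda>_. w"] by (simp add: ap)
  show R: "linear (form2 a w)" for w
    using alternating_linear[OF assms, of 1 "\<lambda>_. w"] by (simp add: ap)
  show z: "form2 a u u = 0" for u
    using alternating_repeat[OF assms, of 0 1 "\<lambda>_. u"] by (simp add: ap)
  have "form2 a (u + w) (u + w) = 0" by (rule z)
  then have "form2 a u w + form2 a w u = 0"
    unfolding linear_add[OF L] linear_add[OF R] z[of u] z[of w] by (simp add: add.commute)
  then show "form2 a u w = - form2 a w u" by (simp add: eq_neg_iff_add_eq_0)
qed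

lemma alternating_1I:
  assumes "linear f" shows "alternating 1 (\<lambda>v. f (v 0))"
  using assms by (intro alternatingI) auto

lemma linear_mult_left': "linear f \<Longrightarrow> linear (\<lambda>u. f u * c)"
  and linear_mult_right': "linear f \<Longrightarrow> linear (\<lambda>u. c * f u)" for c :: "'b::real_algebra"
  by (auto intro!: linearI simp: linear_add linear_scale algebra_simps)

section \<open>The wedge product: alternation and explicit formulas\<close>

lemma wedge_summand_perm:
  assumes "\<tau> permutes {..<p + q}"
  shows "(\<Sum>\<sigma> | \<sigma> permutes {..<p + q}. f \<sigma>) = (\<Sum>\<sigma> | \<sigma> permutes {..<p + q}. f (\<tau> \<circ> \<sigma>))"
  by (rule sum.reindex_bij_witness[of _ "\<lambda>\<sigma>. \<tau> \<circ> \<sigma>" "\<lambda>\<sigma>. inv \<tau> \<circ> \<sigma>"])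
    (use assms in \<open>auto intro: permutes_compose permutes_inv
      simp: o_assoc permutes_inv_o[OF assms]\<close>)

text \<open>In the summand of \<sigma> the argument with number i occurs exactly once, at position
  \<open>inv \<sigma> i\<close>, in one of the two factors; this gives linearity. If two arguments
  coincide, composing \<sigma> with their transposition changes only the sign, so the sum equals its
  own negative.\<close>

lemma alternating_wedge:
  assumes a: "alternating p a" and b: "alternating q (b :: ('e::real_vector, 'b::real_normed_field) covector)"
  shows "alternating (p + q) (wedge p q a b)"
proof -
  define T where "T v \<sigma> = of_int (sign \<sigma>) * a (\<lambda>i. v (\<sigma> i)) * b (\<lambda>i. v (\<sigma> (p + i)))"
    for v :: "nat \<Rightarrow> 'e" and \<sigma> :: "nat \<Rightarrow> nat"
  have W: "wedge p q a b v = (\<Sum>\<sigma> | \<sigma> permutes {..<p + q}. T v \<sigma>) / (fact p * fact q)" for v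
    unfolding wedge_def T_def ..
  have cong: "T v \<sigma> = T w \<sigma>" if "\<sigma> permutes {..<p + q}" "\<And>i. i < p + q \<Longrightarrow> v i = w i" for v w \<sigma>
  proof -
    have "\<sigma> i < p + q" if "i < p + q" for i
      using permutes_in_image[OF \<open>\<sigma> permutes _\<close>, of i] that by simp
    then have "a (\<lambda>i. v (\<sigma> i)) = a (\<lambda>i. w (\<sigma> i))" "b (\<lambda>i. v (\<sigma> (p + i))) = b (\<lambda>i. w (\<sigma> (p + i)))"
      using that(2) by (auto intro!: alternating_cong[OF a] alternating_cong[OF b])
    then show ?thesis by (simp add: T_def)
  qed
  show ?thesis
  proof (rule alternatingI)
    show "wedge p q a b v = wedge p q a b w" if "\<And>i. i < p + q \<Longrightarrow> v i = w i" for v w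
      unfolding W using cong that by (metis (no_types, lifting) mem_Collect_eq sum.cong)
  next
    fix v :: "nat \<Rightarrow> 'e" and i assume i: "i < p + q"
    have "linear (\<lambda>u. T (v(i := u)) \<sigma>)" if \<sigma>: "\<sigma> permutes {..<p + q}" for \<sigma>
    proof -
      define j where "j = inv \<sigma> i"
      have j: "\<sigma> j = i" and jl: "j < p + q"
        using permutes_inverses(1)[OF \<sigma>] permutes_in_image[OF permutes_inv[OF \<sigma>]] i
        by (auto simp: j_def)
      have inj: "\<sigma> k = i \<longleftrightarrow> k = j" for k
        using j permutes_inj[OF \<sigma>] by (metis injD)
      show ?thesis
      proof (cases "j < p")
        case True
        have "(\<lambda>k. (v(i := u)) (\<sigma> k)) = (\<lambda>k. v (\<sigma> k))(j := u)" for u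
          using inj by auto
        moreover have "(\<lambda>k. (v(i := u)) (\<sigma> (p + k))) = (\<lambda>k. v (\<sigma> (p + k)))" for u
          using inj True by auto
        ultimately have "T (v(i := u)) \<sigma> = of_int (sign \<sigma>) * a ((\<lambda>k. v (\<sigma> k))(j := u)) * b (\<lambda>k. v (\<sigma> (p + k)))" for u
          by (simp add: T_def)
        then show ?thesis
          using alternating_linear[OF a True] by (auto intro!: linear_mult_left' linear_mult_right')
      next
        case False
        then have jp: "j - p < q" using jl by simp
        have "a (\<lambda>k. (v(i := u)) (\<sigma> k)) = a (\<lambda>k. v (\<sigma> k))" for u
          using inj False by (intro alternating_cong[OF a]) auto
        moreover have "(\<lambda>k. (v(i := u)) (\<sigma> (p + k))) = (\<lambda>k. v (\<sigma> (p + k)))(j - p := u)" for u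
          using inj False by (auto simp: fun_eq_iff)
        ultimately have "T (v(i := u)) \<sigma> = of_int (sign \<sigma>) * a (\<lambda>k. v (\<sigma> k)) * b ((\<lambda>k. v (\<sigma> (p + k)))(j - p := u))" for u
          by (simp add: T_def)
        then show ?thesis
          using alternating_linear[OF b jp] by (auto intro!: linear_mult_right')
      qed
    qed
    then show "linear (\<lambda>u. wedge p q a b (v(i := u)))"
      unfolding W divide_inverse by (intro linear_mult_left' linear_compose_sum) auto
  next
    fix v :: "nat \<Rightarrow> 'e" and i j assume ij: "i < p + q" "j < p + q" "i \<noteq> j" and eq: "v i = v j"
    define \<tau> where "\<tau> = Transposition.transpose i j"
    have \<tau>: "\<tau> permutes {..<p + q}"
      unfolding \<tau>_def using ij by (intro permutes_swap_id) auto
    have v\<tau>: "v (\<tau> k) = v k" for k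
      using eq by (auto simp: \<tau>_def Transposition.transpose_def)
    have "T v (\<tau> \<circ> \<sigma>) = - T v \<sigma>" if "\<sigma> permutes {..<p + q}" for \<sigma>
    proof -
      have "sign (\<tau> \<circ> \<sigma>) = - sign \<sigma>"
        using \<tau> that ij by (subst sign_compose)
          (auto simp: \<tau>_def sign_swap_id permutation_swap_id intro: permutation_permutes[THEN iffD2])
      then show ?thesis by (simp add: T_def v\<tau>)
    qed
    then have "(\<Sum>\<sigma> | \<sigma> permutes {..<p + q}. T v \<sigma>) = - (\<Sum>\<sigma> | \<sigma> permutes {..<p + q}. T v \<sigma>)"
      by (subst wedge_summand_perm[OF \<tau>]) (simp add: sum_negf[symmetric])
    then have "(\<Sum>\<sigma> | \<sigma> permutes {..<p + q}. T v \<sigma>) = 0"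
      by (metis (no_types, lifting) add.inverse_unique add_cancel_right_right eq_neg_iff_add_eq_0 mult_2 mult_eq_0_iff zero_neq_numeral)
    then show "wedge p q a b v = 0" by (simp add: W)
  qed
qed

text \<open>A permutation of \<open>{..<Suc n}\<close> is, in a unique way, a permutation fixing n
  followed by an exchange of n with some b. Iteration lists the permutations of two, three and four
  points.\<close>

lemma sum_permutes_lessThan_Suc:
  "(\<Sum>\<sigma> | \<sigma> permutes {..<Suc n}. f \<sigma>) = (\<Sum>b\<le>n. \<Sum>\<sigma> | \<sigma> permutes {..<n}. f (Transposition.transpose n b \<circ> \<sigma>))"
  unfolding lessThan_Suc by (subst sum_over_permutations_insert) (auto simp: lessThan_Suc[symmetric] lessThan_Suc_atMost)

lemma sum_permutes_1: "(\<Sum>\<sigma> | \<sigma> permutes {..<1::nat}. f \<sigma>) = f id"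
  using sum_permutes_lessThan_Suc[of f 0] by simp

lemma sum_permutes_2: "(\<Sum>\<sigma> | \<sigma> permutes {..<2::nat}. f \<sigma>) = f id + f (Transposition.transpose 1 0)"
  using sum_permutes_lessThan_Suc[of f 1] unfolding sum_permutes_1 by (simp add: numeral_2_eq_2 ac_simps)

lemma sum_permutes_3:
  "(\<Sum>\<sigma> | \<sigma> permutes {..<3::nat}. f \<sigma>) =
    (let s = (\<lambda>f. f id + f (Transposition.transpose 1 0)) in
      s f + s (\<lambda>\<sigma>. f (Transposition.transpose 2 0 \<circ> \<sigma>)) + s (\<lambda>\<sigma>. f (Transposition.transpose 2 1 \<circ> \<sigma>)))"
  using sum_permutes_lessThan_Suc[of f 2] unfolding sum_permutes_2 Let_def
  by (simp add: numeral_2_eq_2 numeral_3_eq_3 ac_simps)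

lemma sum_permutes_4:
  "(\<Sum>\<sigma> | \<sigma> permutes {..<4::nat}. f \<sigma>) =
    (let s = (\<lambda>f. f id + f (Transposition.transpose 1 0));
         t = (\<lambda>f. s f + s (\<lambda>\<sigma>. f (Transposition.transpose 2 0 \<circ> \<sigma>)) + s (\<lambda>\<sigma>. f (Transposition.transpose 2 1 \<circ> \<sigma>)))
     in t f + t (\<lambda>\<sigma>. f (Transposition.transpose 3 0 \<circ> \<sigma>)) + t (\<lambda>\<sigma>. f (Transposition.transpose 3 1 \<circ> \<sigma>))
       + t (\<lambda>\<sigma>. f (Transposition.transpose 3 2 \<circ> \<sigma>)))"
proof -
  have "{..<4} = {..<Suc 3::nat}" "{..3} = {0, 1, 2, 3::nat}" by auto
  then show ?thesis
    by (simp only: sum_permutes_lessThan_Suc sum_permutes_3 Let_def) (simp add: ac_simps)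
qed

lemma sign_transpose_compose:
  "permutation p \<Longrightarrow> sign (Transposition.transpose a b \<circ> p) = (if a = b then 1 else - 1) * sign p"
  by (simp add: sign_compose permutation_swap_id sign_swap_id)

lemmas sign_expand = sign_transpose_compose permutation_compose permutation_swap_id permutation_id sign_id

lemma wedge_1_1:
  fixes a b :: "('e::real_vector, 'b::real_normed_field) covector"
  assumes "alternating 1 a" "alternating 1 b"
  shows "wedge 1 1 a b v = form1 a (v 0) * form1 b (v 1) - form1 a (v 1) * form1 b (v 0)"
proof -
  have W: "wedge 1 1 a b v = (\<Sum>\<sigma> | \<sigma> permutes {..<2}.
      of_int (sign \<sigma>) * form1 a (v (\<sigma> 0)) * form1 b (v (\<sigma> 1))) / (fact 1 * fact 1)"
    unfolding wedge_def by (simp add: numeral_2_eq_2 numeral_3_eq_3 alternating_1_apply[OF assms(1)] alternating_1_apply[OF assms(2)])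
  show ?thesis
    unfolding W sum_permutes_2 Let_def
    by (simp only: sign_expand) (simp add: sign_swap_id Transposition.transpose_def field_simps)
qed

lemma wedge_2_1:
  fixes a b :: "('e::real_vector, 'b::real_normed_field) covector"
  assumes "alternating 2 a" "alternating 1 b"
  shows "wedge 2 1 a b v = form2 a (v 0) (v 1) * form1 b (v 2)
    - form2 a (v 0) (v 2) * form1 b (v 1) + form2 a (v 1) (v 2) * form1 b (v 0)"
proof -
  have w: "form2 a (v 1) (v 0) = - form2 a (v 0) (v 1)" "form2 a (v 2) (v 0) = - form2 a (v 0) (v 2)"
    "form2 a (v 2) (v 1) = - form2 a (v 1) (v 2)"
    by (rule form2_swap[OF assms(1)])+
  have W: "wedge 2 1 a b v = (\<Sum>\<sigma> | \<sigma> permutes {..<3}.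
      of_int (sign \<sigma>) * form2 a (v (\<sigma> 0)) (v (\<sigma> 1)) * form1 b (v (\<sigma> 2))) / (fact 2 * fact 1)"
    unfolding wedge_def by (simp add: numeral_2_eq_2 numeral_3_eq_3 alternating_2_apply[OF assms(1)] alternating_1_apply[OF assms(2)])
  show ?thesis
    unfolding W sum_permutes_3 Let_def
    by (simp only: sign_expand) (simp add: sign_swap_id Transposition.transpose_def w[simplified] field_simps)
qed

lemma wedge_1_2:
  fixes a b :: "('e::real_vector, 'b::real_normed_field) covector"
  assumes "alternating 1 a" "alternating 2 b"
  shows "wedge 1 2 a b v = form1 a (v 0) * form2 b (v 1) (v 2)
    - form1 a (v 1) * form2 b (v 0) (v 2) + form1 a (v 2) * form2 b (v 0) (v 1)"
proof -
  have w: "form2 b (v 1) (v 0) = - form2 b (v 0) (v 1)" "form2 b (v 2) (v 0) = - form2 b (v 0) (v 2)"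
    "form2 b (v 2) (v 1) = - form2 b (v 1) (v 2)"
    by (rule form2_swap[OF assms(2)])+
  have W: "wedge 1 2 a b v = (\<Sum>\<sigma> | \<sigma> permutes {..<3}.
      of_int (sign \<sigma>) * form1 a (v (\<sigma> 0)) * form2 b (v (\<sigma> 1)) (v (\<sigma> 2))) / (fact 1 * fact 2)"
    unfolding wedge_def by (simp add: numeral_2_eq_2 numeral_3_eq_3 alternating_1_apply[OF assms(1)] alternating_2_apply[OF assms(2)])
  show ?thesis
    unfolding W sum_permutes_3 Let_def
    by (simp only: sign_expand) (simp add: sign_swap_id Transposition.transpose_def w[simplified] field_simps)
qed

text \<open>By skew symmetry of both factors the 24 permutations form six groups of four equal
  terms, which cancels the normalising factor 2! 2!.\<close>

lemma wedge_2_2: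
  fixes a b :: "('e::real_vector, 'b::real_normed_field) covector"
  assumes "alternating 2 a" "alternating 2 b"
  shows "wedge 2 2 a b v =
      form2 a (v 0) (v 1) * form2 b (v 2) (v 3) - form2 a (v 0) (v 2) * form2 b (v 1) (v 3)
    + form2 a (v 0) (v 3) * form2 b (v 1) (v 2) + form2 a (v 1) (v 2) * form2 b (v 0) (v 3)
    - form2 a (v 1) (v 3) * form2 b (v 0) (v 2) + form2 a (v 2) (v 3) * form2 b (v 0) (v 1)"
proof -
  have w: "form2 c (v 1) (v 0) = - form2 c (v 0) (v 1)" "form2 c (v 2) (v 0) = - form2 c (v 0) (v 2)"
    "form2 c (v 2) (v 1) = - form2 c (v 1) (v 2)" "form2 c (v 3) (v 0) = - form2 c (v 0) (v 3)"
    "form2 c (v 3) (v 1) = - form2 c (v 1) (v 3)" "form2 c (v 3) (v 2) = - form2 c (v 2) (v 3)"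
    if "c = a \<or> c = b" for c
    using form2_swap[OF assms(1)] form2_swap[OF assms(2)] that by fast+
  have W: "wedge 2 2 a b v = (\<Sum>\<sigma> | \<sigma> permutes {..<4}.
      of_int (sign \<sigma>) * form2 a (v (\<sigma> 0)) (v (\<sigma> 1)) * form2 b (v (\<sigma> 2)) (v (\<sigma> 3))) / (fact 2 * fact 2)"
    unfolding wedge_def by (simp add: eval_nat_numeral numeral_2_eq_2 numeral_3_eq_3 alternating_2_apply[OF assms(1)] alternating_2_apply[OF assms(2)])
  show ?thesis
    unfolding W sum_permutes_4 Let_def
    by (simp only: sign_expand) (simp add: sign_swap_id Transposition.transpose_def w[simplified] field_simps)
qed

lemma alternating_wedge_1_1:
  "alternating 1 a \<Longrightarrow> alternating 1 b \<Longrightarrow> alternating 2 (wedge 1 1 a b)"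
  for a :: "('e::real_vector, 'b::real_normed_field) covector"
  using alternating_wedge[of 1 a 1 b] by (simp add: numeral_2_eq_2)

lemma alternating_wedge_2_1:
  "alternating 2 a \<Longrightarrow> alternating 1 b \<Longrightarrow> alternating 3 (wedge 2 1 a b)"
  for a :: "('e::real_vector, 'b::real_normed_field) covector"
  using alternating_wedge[of 2 a 1 b] by (simp add: numeral_3_eq_3)

lemma alternating_wedge_1_2:
  "alternating 1 a \<Longrightarrow> alternating 2 b \<Longrightarrow> alternating 3 (wedge 1 2 a b)"
  for a :: "('e::real_vector, 'b::real_normed_field) covector"
  using alternating_wedge[of 1 a 2 b] by (simp add: numeral_3_eq_3)

lemma form2_wedge_1_1:
  fixes a b :: "('e::real_vector, 'b::real_normed_field) covector"
  assumes "alternating 1 a" "alternating 1 b"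
  shows "form2 (wedge 1 1 a b) u w = form1 a u * form1 b w - form1 a w * form1 b u"
  unfolding form2_def wedge_1_1[OF assms] by simp

section \<open>Coframes\<close>

lemma coframe_alternating: "coframe n e \<Longrightarrow> a \<in> {1..n} \<Longrightarrow> alternating 1 (e a)"
  unfolding coframe_def by blast

lemma coframe_DIM: "coframe n (e :: nat \<Rightarrow> ('e::euclidean_space, real) covector) \<Longrightarrow> DIM('e) = n"
  unfolding coframe_def by blast

lemma coframe_linear: "coframe n e \<Longrightarrow> a \<in> {1..n} \<Longrightarrow> linear (form1 (e a))"
  using coframe_alternating linear_form1 by blast

lemma coframe_independent:
  assumes "coframe n e" "\<And>u. (\<Sum>a=1..n. c a * form1 (e a) u) = 0" "a \<in> {1..n}"
  shows "c a = 0"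
proof -
  have "(\<Sum>a=1..n. c a * e a v) = 0" for v
    using assms(2)[of "v 0"] alternating_1_apply[OF coframe_alternating[OF assms(1)]] by simp
  then show ?thesis using assms unfolding coframe_def by blast
qed

lemma coframeI:
  fixes e :: "nat \<Rightarrow> ('e::euclidean_space, real) covector"
  assumes "DIM('e) = n" "\<And>a. a \<in> {1..n} \<Longrightarrow> alternating 1 (e a)"
    and "\<And>c. (\<And>u. (\<Sum>a=1..n. c a * form1 (e a) u) = 0) \<Longrightarrow> \<forall>a\<in>{1..n}. c a = 0"
  shows "coframe n e"
  unfolding coframe_def
proof (intro conjI allI impI)
  fix c assume *: "\<forall>v. (\<Sum>a=1..n. c a * e a v) = 0"
  have "(\<Sum>a=1..n. c a * form1 (e a) u) = 0" for u
    unfolding form1_def using * by blast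
  then show "\<forall>a\<in>{1..n}. c a = 0" by (rule assms(3))
qed (use assms in auto)

lemma linear_inner_representation:
  fixes f :: "'e::euclidean_space \<Rightarrow> real"
  assumes "linear f"
  shows "f u = u \<bullet> (\<Sum>b\<in>Basis. f b *\<^sub>R b)"
proof -
  have "f u = f (\<Sum>b\<in>Basis. (u \<bullet> b) *\<^sub>R b)" by (simp add: euclidean_representation)
  also have "\<dots> = (\<Sum>b\<in>Basis. (u \<bullet> b) * f b)"
    by (simp add: linear_sum[OF assms] linear_scale[OF assms])
  finally show ?thesis by (simp add: inner_sum_right mult.commute)
qed

text \<open>Independent forms separate vectors: their representing vectors \<open>r a\<close> are
  independent and as many as the dimension, hence they span. So u is a combination of vectors
  orthogonal to it.\<close>

lemma coframe_total:
  fixes e :: "nat \<Rightarrow> ('e::euclidean_space, real) covector"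
  assumes e: "coframe n e" and u: "\<And>a. a \<in> {1..n} \<Longrightarrow> form1 (e a) u = 0"
  shows "u = 0"
proof -
  obtain \<beta> where \<beta>: "bij_betw \<beta> {1..n} (Basis :: 'e set)"
    using ex_bij_betw_nat_finite_1[OF finite_Basis] coframe_DIM[OF e] by blast
  define r where "r a = (\<Sum>b\<in>Basis. form1 (e a) b *\<^sub>R b)" for a
  have er: "form1 (e a) w = w \<bullet> r a" if "a \<in> {1..n}" for a w
    unfolding r_def by (rule linear_inner_representation[OF coframe_linear[OF e that]])
  define \<Phi> where "\<Phi> z = (\<Sum>a=1..n. (z \<bullet> \<beta> a) *\<^sub>R r a)" for z
  have lin: "linear \<Phi>"
    unfolding \<Phi>_def by (intro linear_compose_sum) (auto intro!: linearI simp: inner_simps algebra_simps)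
  have "z = 0" if z: "\<Phi> z = 0" for z
  proof -
    have "(\<Sum>a=1..n. (z \<bullet> \<beta> a) * form1 (e a) w) = w \<bullet> \<Phi> z" for w
      unfolding \<Phi>_def by (simp add: inner_sum_right er)
    then have "(\<Sum>a=1..n. (z \<bullet> \<beta> a) * form1 (e a) w) = 0" for w
      using z by simp
    then have "z \<bullet> \<beta> a = 0" if "a \<in> {1..n}" for a
      using coframe_independent[OF e, of "\<lambda>a. z \<bullet> \<beta> a"] that by blast
    then have "\<forall>b\<in>\<beta> ` {1..n}. z \<bullet> b = 0" by blast
    then show "z = 0"
      unfolding bij_betw_imp_surj_on[OF \<beta>] by (simp only: euclidean_all_zero_iff)
  qed
  then have "surj \<Phi>"
    using linear_injective_imp_surjective[OF lin] linear_injective_0[OF lin] by blast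
  then obtain z where "\<Phi> z = u" by (metis surjD)
  then have "u \<bullet> u = u \<bullet> \<Phi> z" by simp
  also have "\<dots> = (\<Sum>a=1..n. (z \<bullet> \<beta> a) * form1 (e a) u)"
    unfolding \<Phi>_def by (simp add: inner_sum_right er)
  also have "\<dots> = 0" by (simp add: u)
  finally show "u = 0" by simp
qed

text \<open>The coordinate map T of the coframe is injective, hence bijective; the dual vectors are
  the preimages of an orthonormal basis.\<close>

lemma coframe_dual_basis:
  fixes e :: "nat \<Rightarrow> ('e::euclidean_space, real) covector"
  assumes e: "coframe n e"
  obtains E where "\<And>a b. a \<in> {1..n} \<Longrightarrow> b \<in> {1..n} \<Longrightarrow> form1 (e a) (E b) = (if a = b then 1 else 0)"
    and "\<And>u. u = (\<Sum>a=1..n. form1 (e a) u *\<^sub>R E a)"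
proof -
  obtain \<beta> where \<beta>: "bij_betw \<beta> {1..n} (Basis :: 'e set)"
    using ex_bij_betw_nat_finite_1[OF finite_Basis] coframe_DIM[OF e] by blast
  have inner: "\<beta> a \<bullet> \<beta> b = (if a = b then 1 else 0)" if "a \<in> {1..n}" "b \<in> {1..n}" for a b
  proof -
    have "\<beta> a \<in> Basis" "\<beta> b \<in> Basis" using \<beta> that by (auto simp: bij_betw_def)
    moreover have "\<beta> a = \<beta> b \<longleftrightarrow> a = b" using \<beta> that by (meson bij_betw_def inj_on_eq_iff)
    ultimately show ?thesis by (simp add: inner_Basis)
  qed
  define T where "T u = (\<Sum>a=1..n. form1 (e a) u *\<^sub>R \<beta> a)" for u
  have lin: "linear T"
    unfolding T_def
    by (intro linear_compose_sum) (auto intro!: linearI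
        simp: linear_add[OF coframe_linear[OF e]] linear_scale[OF coframe_linear[OF e]] algebra_simps)
  have T\<beta>: "T u \<bullet> \<beta> b = form1 (e b) u" if "b \<in> {1..n}" for u b
  proof -
    have "T u \<bullet> \<beta> b = (\<Sum>a=1..n. form1 (e a) u * (if a = b then 1 else 0))"
      unfolding T_def inner_sum_left inner_scaleR_left
      using inner[OF _ that] by (intro sum.cong) auto
    then show ?thesis using that by (simp add: if_distrib[of "(*) _"] cong: if_cong)
  qed
  have "u = 0" if "T u = 0" for u
    using T\<beta> that by (intro coframe_total[OF e]) (metis inner_zero_left)
  then have inj: "inj T" using linear_injective_0[OF lin] by blast
  have "surj T" by (rule linear_injective_imp_surjective[OF lin inj]) simp
  define E where "E b = inv T (\<beta> b)" for b
  have E: "T (E b) = \<beta> b" for b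
    unfolding E_def by (rule surj_f_inv_f[OF \<open>surj T\<close>])
  have "form1 (e a) (E b) = (if a = b then 1 else 0)" if "a \<in> {1..n}" "b \<in> {1..n}" for a b
    using T\<beta>[OF that(1), of "E b"] inner[OF that(2,1)] unfolding E by auto
  moreover have "u = (\<Sum>a=1..n. form1 (e a) u *\<^sub>R E a)" for u
  proof (rule injD[OF inj])
    show "T u = T (\<Sum>a=1..n. form1 (e a) u *\<^sub>R E a)"
      by (simp add: linear_sum[OF lin] linear_scale[OF lin] E) (simp add: T_def)
  qed
  ultimately show thesis by (rule that)
qed

lemma coframe_metric_form1: "coframe_metric n e u v = (\<Sum>a=1..n. form1 (e a) u * form1 (e a) v)"
  by (simp add: coframe_metric_def form1_def)

lemma bilinear_coframe_metric:
  assumes "coframe n e" shows "bilinear (coframe_metric n e)"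
  unfolding bilinear_def coframe_metric_form1
  by (intro conjI allI linear_compose_sum linear_mult_left' linear_mult_right' coframe_linear[OF assms] ballI) auto

lemma coframe_metric_commute: "coframe_metric n e u v = coframe_metric n e v u"
  by (simp add: coframe_metric_def mult.commute)

lemma coframe_metric_pos:
  assumes "coframe n e" "u \<noteq> 0" shows "coframe_metric n e u u > 0"
proof -
  obtain a where a: "a \<in> {1..n}" "form1 (e a) u \<noteq> 0"
    using coframe_total[OF assms(1)] assms(2) by blast
  then show ?thesis
    unfolding coframe_metric_form1 by (intro sum_pos2[of _ a]) (auto simp: less_le)
qed

lemma sum_1_5: "(\<Sum>a=1..5. f a) = f 1 + f 2 + f 3 + f 4 + f (5::nat)"
  by (simp add: eval_nat_numeral)

lemma sum_1_6: "(\<Sum>a=1..6. f a) = f 1 + f 2 + f 3 + f 4 + f 5 + f (6::nat)"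
  by (simp add: eval_nat_numeral)

lemma ball_1_5: "(\<forall>a\<in>{1..5}. P a) \<longleftrightarrow> P 1 \<and> P 2 \<and> P 3 \<and> P 4 \<and> P (5::nat)"
  by (auto simp: eval_nat_numeral le_Suc_eq)

lemma ball_1_6: "(\<forall>a\<in>{1..6}. P a) \<longleftrightarrow> P 1 \<and> P 2 \<and> P 3 \<and> P 4 \<and> P 5 \<and> P (6::nat)"
  by (auto simp: eval_nat_numeral le_Suc_eq)

section \<open>Pointwise linear algebra of \<open>SU(2)\<close>-structures\<close>

text \<open>The value of a \<and> b on (p, q, r, s) for 2-forms in curried notation, free of
  permutations and hence open to polynomial arithmetic.\<close>

definition quad :: "('e \<Rightarrow> 'e \<Rightarrow> real) \<Rightarrow> ('e \<Rightarrow> 'e \<Rightarrow> real) \<Rightarrow> 'e \<Rightarrow> 'e \<Rightarrow> 'e \<Rightarrow> 'e \<Rightarrow> real" where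
  "quad a b p q r s = a p q * b r s - a p r * b q s + a p s * b q r
     + a q r * b p s - a q s * b p r + a r s * b p q"

text \<open>The hypothesis says \<beta> \<and> w = 0. Where \<beta> does not vanish this makes w a
  product \<beta> \<and> \<gamma>, whose square is zero.\<close>

lemma quad_eq_0_if_divisible:
  assumes d: "\<And>a b c. \<beta> a * w b c - \<beta> b * w a c + \<beta> c * w a b = 0" and a: "\<beta> a \<noteq> 0"
  shows "quad w w p q r s = (0::real)"
proof -
  define \<gamma> where "\<gamma> b = w a b / \<beta> a" for b
  have w: "w b c = \<beta> b * \<gamma> c - \<beta> c * \<gamma> b" for b c
    using d[of a b c] a unfolding \<gamma>_def by (simp add: field_simps)
  show ?thesis unfolding quad_def w by (simp add: algebra_simps)
qed

text \<open>Whether the n arguments span the space or are dependent, some combination of them with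
  nonzero coefficient vector z equals Y or 0. Put into a slot whose coefficient is not zero, it
  multiplies the value by that coefficient; but the result is 0.\<close>

lemma alternating_kernel:
  fixes a :: "('e::euclidean_space, real) covector"
  assumes a: "alternating n a" and n: "DIM('e) = n" and Y: "Y \<noteq> 0"
    and k: "\<And>v i. i < n \<Longrightarrow> a (v(i := Y)) = 0"
  shows "a v = 0"
proof -
  obtain \<beta> where \<beta>: "bij_betw \<beta> {..<n} (Basis :: 'e set)"
    using ex_bij_betw_nat_finite[OF finite_Basis] n by (metis lessThan_atLeast0)
  define \<Phi> where "\<Phi> z = (\<Sum>i<n. (z \<bullet> \<beta> i) *\<^sub>R v i)" for z
  have lin: "linear \<Phi>"
    unfolding \<Phi>_def by (intro linear_compose_sum) (auto intro!: linearI simp: inner_simps algebra_simps)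
  have "\<exists>z. z \<noteq> 0 \<and> (\<Phi> z = 0 \<or> \<Phi> z = Y)"
  proof (cases "inj \<Phi>")
    case True
    have "surj \<Phi>" by (rule linear_injective_imp_surjective[OF lin True]) simp
    then have "\<Phi> (inv \<Phi> Y) = Y" by (rule surj_f_inv_f)
    moreover from this have "inv \<Phi> Y \<noteq> 0" using Y linear_0[OF lin] by metis
    ultimately show ?thesis by blast
  next
    case False
    then show ?thesis using linear_injective_0[OF lin] by blast
  qed
  then obtain z where z: "z \<noteq> 0" "\<Phi> z = 0 \<or> \<Phi> z = Y" by blast
  have "\<not> (\<forall>b\<in>\<beta> ` {..<n}. z \<bullet> b = 0)"
    unfolding bij_betw_imp_surj_on[OF \<beta>] euclidean_all_zero_iff using z(1) .
  then obtain i where i: "i < n" "z \<bullet> \<beta> i \<noteq> 0" by blast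
  define L where "L u = a (v(i := u))" for u
  have L: "linear L" unfolding L_def by (rule alternating_linear[OF a i(1)])
  have "L (v j) = (if i = j then a v else 0)" if "j < n" for j
  proof (cases "i = j")
    case False
    then show ?thesis
      unfolding L_def using alternating_repeat[OF a i(1) that] by simp
  qed (simp add: L_def)
  then have "L (\<Phi> z) = (\<Sum>j<n. (z \<bullet> \<beta> j) * (if i = j then a v else 0))"
    unfolding \<Phi>_def by (simp add: linear_sum[OF L] linear_scale[OF L])
  also have "\<dots> = (z \<bullet> \<beta> i) * a v"
    using i(1) by (simp add: if_distrib[of "(*) _"] cong: if_cong)
  finally have *: "L (\<Phi> z) = (z \<bullet> \<beta> i) * a v" .
  have "L (\<Phi> z) = 0"
    using z(2) linear_0[OF L] k[OF i(1)] by (auto simp: L_def)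
  then show ?thesis using * i(2) by simp
qed

text \<open>Each summand has Y as an argument of one of its two factors.\<close>

lemma wedge_kernel:
  fixes a b :: "('e::real_vector, real) covector"
  assumes a: "\<And>v i. i < p \<Longrightarrow> a (v(i := Y)) = 0" and b: "\<And>v i. i < q \<Longrightarrow> b (v(i := Y)) = 0"
    and i: "i < p + q"
  shows "wedge p q a b (v(i := Y)) = 0"
proof -
  have "of_int (sign \<sigma>) * a (\<lambda>k. (v(i := Y)) (\<sigma> k)) * b (\<lambda>k. (v(i := Y)) (\<sigma> (p + k))) = 0"
    if \<sigma>: "\<sigma> permutes {..<p + q}" for \<sigma>
  proof -
    define j where "j = inv \<sigma> i"
    have j: "\<sigma> j = i" and jl: "j < p + q"
      using permutes_inverses(1)[OF \<sigma>] permutes_in_image[OF permutes_inv[OF \<sigma>]] i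
      by (auto simp: j_def)
    have inj: "\<sigma> k = i \<longleftrightarrow> k = j" for k
      using j permutes_inj[OF \<sigma>] by (metis injD)
    show ?thesis
    proof (cases "j < p")
      case True
      have "(\<lambda>k. (v(i := Y)) (\<sigma> k)) = (\<lambda>k. v (\<sigma> k))(j := Y)"
        using inj by auto
      then show ?thesis using a[OF True] by simp
    next
      case False
      then have jp: "j - p < q" using jl by simp
      have "(\<lambda>k. (v(i := Y)) (\<sigma> (p + k))) = (\<lambda>k. v (\<sigma> (p + k)))(j - p := Y)"
        using inj False by (auto simp: fun_eq_iff)
      then show ?thesis using b[OF jp] by simp
    qed
  qed
  then have "(\<Sum>\<sigma> | \<sigma> permutes {..<p + q}. of_int (sign \<sigma>) * a (\<lambda>k. (v(i := Y)) (\<sigma> k)) *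
      b (\<lambda>k. (v(i := Y)) (\<sigma> (p + k)))) = 0"
    by (intro sum.neutral) blast
  then show ?thesis unfolding wedge_def by (simp only: div_0)
qed

text \<open>The algebra of an SU(2)-structure at one point, with \<open>quad\<close> in place of the
  wedge product. The assumption \<open>ker\<close> is the form in which the nonvanishing of \<nu>
  \<and> \<eta> enters.\<close>

locale su2_forms =
  fixes w1 w2 w3 :: "real ^ 5 \<Rightarrow> real ^ 5 \<Rightarrow> real" and \<eta> :: "real ^ 5 \<Rightarrow> real"
  assumes lin1: "linear (w1 u)" and lin2: "linear (w2 u)" and lin3: "linear (w3 u)"
    and swap1: "w1 u v = - w1 v u" and swap2: "w2 u v = - w2 v u" and swap3: "w3 u v = - w3 v u"
    and lin\<eta>: "linear \<eta>"
    and q22: "quad w2 w2 p q r s = quad w1 w1 p q r s"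
    and q33: "quad w3 w3 p q r s = quad w1 w1 p q r s"
    and q12: "quad w1 w2 p q r s = 0" and q13: "quad w1 w3 p q r s = 0" and q23: "quad w2 w3 p q r s = 0"
    and nz: "\<exists>p q r s. quad w1 w1 p q r s \<noteq> 0"
    and ker: "(\<And>u. w1 Y u = 0) \<Longrightarrow> (\<And>u. w2 Y u = 0) \<Longrightarrow> (\<And>u. w3 Y u = 0) \<Longrightarrow> \<eta> Y = 0 \<Longrightarrow> Y = 0"
    and pos: "(\<And>u. w1 A u = w2 B u) \<Longrightarrow> w3 A B \<ge> 0"
begin

lemma self1: "w1 u u = 0" using swap1[of u u] by simp
lemma self2: "w2 u u = 0" using swap2[of u u] by simp
lemma self3: "w3 u u = 0" using swap3[of u u] by simp

text \<open>Contracting w \<and> w with Y gives twice w(Y, -) \<and> w. If this is zero and w(Y, -)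
  is not, then w is divisible by w(Y, -) and w \<and> w = 0, against \<open>nz\<close>. The argument
  applies to all three forms because they have the same square; therefore they have the same
  kernel.\<close>

lemma kernel_of_quad:
  assumes "\<And>q r s. quad w1 w1 Y q r s = 0"
  shows "w1 Y u = 0" "w2 Y u = 0" "w3 Y u = 0"
proof -
  have *: "w Y u = 0" if q: "\<And>p q r s. quad w w p q r s = quad w1 w1 p q r s"
    and s: "\<And>u v. w u v = - w v u" for w :: "real ^ 5 \<Rightarrow> real ^ 5 \<Rightarrow> real"
  proof (rule ccontr)
    assume "w Y u \<noteq> 0"
    moreover have "w Y a * w b c - w Y b * w a c + w Y c * w a b = 0" for a b c
      using assms[of a b c] q[of Y a b c] by (simp add: quad_def algebra_simps)
    ultimately have "quad w w p q r s = 0" for p q r s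
      using quad_eq_0_if_divisible[of "w Y" w] by blast
    then show False using nz q by simp
  qed
  show "w1 Y u = 0" "w2 Y u = 0" "w3 Y u = 0"
    using *[of w1] *[of w2] *[of w3] swap1 swap2 swap3 q22 q33 by blast+
qed

lemma kernel_1: "(\<And>u. w1 Y u = 0) \<Longrightarrow> w2 Y u = 0 \<and> w3 Y u = 0"
proof -
  assume "\<And>u. w1 Y u = 0"
  then have "quad w1 w1 Y q r s = 0" for q r s
    by (simp add: quad_def)
  then show ?thesis using kernel_of_quad by blast
qed

lemma kernel_2: "(\<And>u. w2 Y u = 0) \<Longrightarrow> w1 Y u = 0 \<and> w3 Y u = 0"
proof -
  assume "\<And>u. w2 Y u = 0"
  then have "quad w1 w1 Y q r s = 0" for q r s
    using q22[of Y q r s] by (simp add: quad_def)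
  then show ?thesis using kernel_of_quad by blast
qed

lemma trivial_kernel: "(\<And>u. w2 Y u = 0) \<Longrightarrow> \<eta> Y = 0 \<Longrightarrow> Y = 0"
  using ker kernel_2 by blast

text \<open>The matrix of \<open>w1\<close> is skew of odd order 5, so its determinant equals its
  own negative and there is a kernel vector. It is annihilated by the other two forms as well, so
  \<eta> cannot vanish on it.\<close>

lemma ex_reeb: "\<exists>\<xi>. \<eta> \<xi> \<noteq> 0 \<and> (\<forall>u. w1 \<xi> u = 0 \<and> w2 \<xi> u = 0 \<and> w3 \<xi> u = 0)"
proof -
  define M :: "real ^ 5 ^ 5" where "M = (\<chi> i j. w1 (axis j 1) (axis i 1))"
  have "transpose M = (\<chi> i. (-1) *s M $ i)"
    by (simp add: vec_eq_iff M_def transpose_def) (metis swap1)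
  then have "det M = (-1) ^ CARD(5) * det M"
    using det_transpose[of M] det_rows_mul[of "\<lambda>_. -1" "\<lambda>i. M $ i"] by (simp add: vec_lambda_eta)
  then have "det M = 0" by simp
  then have "\<not> invertible M" by (simp add: invertible_det_nz)
  then obtain \<xi> where \<xi>: "M *v \<xi> = 0" "\<xi> \<noteq> 0"
    using matrix_left_invertible_ker[of M] invertible_left_inverse[of M] by blast
  have lin1': "linear (\<lambda>v. w1 v u)" for u
    using linear_compose_neg[OF lin1[of u]] by (simp add: swap1[of _ u])
  have "w1 \<xi> (axis i 1) = 0" for i
  proof -
    have "w1 \<xi> (axis i 1) = w1 (\<Sum>j\<in>UNIV. \<xi> $ j *\<^sub>R axis j 1) (axis i 1)"
      using basis_expansion[of \<xi>] by (simp add: scalar_mult_eq_scaleR)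
    also have "\<dots> = (\<Sum>j\<in>UNIV. \<xi> $ j * w1 (axis j 1) (axis i 1))"
      by (simp add: linear_sum[OF lin1'] linear_scale[OF lin1'])
    also have "\<dots> = (M *v \<xi>) $ i"
      by (simp add: M_def matrix_vector_mult_def mult.commute)
    finally show ?thesis using \<xi> by simp
  qed
  then have z: "w1 \<xi> u = 0" for u
    by (subst basis_expansion[of u, symmetric])
      (simp add: scalar_mult_eq_scaleR linear_sum[OF lin1] linear_scale[OF lin1])
  then have "\<eta> \<xi> \<noteq> 0"
    using ker[of \<xi>] kernel_1[of \<xi>] \<xi>(2) by blast
  then show ?thesis using z kernel_1[of \<xi>] by blast
qed

text \<open>Matrix of the map sending Y to w2(Y, -) + \<eta>(Y) \<eta>. The form \<open>w2\<close>
  alone is degenerate along the Reeb direction; the term of rank one repairs this, so that partners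
  can be computed by Cramer's rule.\<close>

definition solve_matrix :: "real ^ 5 ^ 5" where
  "solve_matrix = (\<chi> i j. w2 (axis j 1) (axis i 1) + \<eta> (axis j 1) * \<eta> (axis i 1))"

lemma lin2': "linear (\<lambda>v. w2 v u)"
  using linear_compose_neg[OF lin2[of u]] by (simp add: swap2[of _ u])

lemma solve_matrix_apply: "(solve_matrix *v Y) $ i = w2 Y (axis i 1) + \<eta> Y * \<eta> (axis i 1)"
proof -
  have l: "linear (\<lambda>Y. w2 Y (axis i 1) + \<eta> Y * \<eta> (axis i 1))"
    by (intro linear_compose_add lin2' linear_mult_left' lin\<eta>)
  have "w2 Y (axis i 1) + \<eta> Y * \<eta> (axis i 1) =
      (\<lambda>Y. w2 Y (axis i 1) + \<eta> Y * \<eta> (axis i 1)) (\<Sum>j\<in>UNIV. Y $ j *\<^sub>R axis j 1)"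
    using basis_expansion[of Y] by (simp add: scalar_mult_eq_scaleR)
  also have "\<dots> = (\<Sum>j\<in>UNIV. Y $ j *\<^sub>R (w2 (axis j 1) (axis i 1) + \<eta> (axis j 1) * \<eta> (axis i 1)))"
    unfolding linear_sum[OF l] linear_scale[OF l] ..
  finally show ?thesis
    by (simp add: solve_matrix_def matrix_vector_mult_def mult.commute)
qed

lemma solve_matrix_iff:
  assumes "linear \<phi>"
  shows "solve_matrix *v Y = (\<chi> i. \<phi> (axis i 1)) \<longleftrightarrow> (\<forall>u. w2 Y u + \<eta> Y * \<eta> u = \<phi> u)"
proof
  assume *: "solve_matrix *v Y = (\<chi> i. \<phi> (axis i 1))"
  have l: "linear (\<lambda>u. w2 Y u + \<eta> Y * \<eta> u)"
    by (intro linear_compose_add lin2 linear_mult_right' lin\<eta>)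
  have a: "w2 Y (axis i 1) + \<eta> Y * \<eta> (axis i 1) = \<phi> (axis i 1)" for i
    using * unfolding vec_eq_iff solve_matrix_apply by simp
  show "\<forall>u. w2 Y u + \<eta> Y * \<eta> u = \<phi> u"
  proof
    fix u
    have "(\<lambda>u. w2 Y u + \<eta> Y * \<eta> u) u = \<phi> u"
    proof (rule linear_eq_on[OF l assms, where B = Basis])
      fix b :: "real ^ 5" assume "b \<in> Basis"
      then obtain i where "b = axis i 1" unfolding Basis_vec_def by auto
      then show "w2 Y b + \<eta> Y * \<eta> b = \<phi> b" using a by simp
    qed simp
    then show "w2 Y u + \<eta> Y * \<eta> u = \<phi> u" .
  qed
qed (simp add: vec_eq_iff solve_matrix_apply)

lemma det_solve_matrix: "det solve_matrix \<noteq> 0"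
proof -
  obtain \<xi> where \<xi>: "\<eta> \<xi> \<noteq> 0" "\<And>u. w2 \<xi> u = 0" using ex_reeb by blast
  have "Y = 0" if "solve_matrix *v Y = 0" for Y
  proof -
    have "solve_matrix *v Y = (\<chi> i. (\<lambda>_. 0) (axis i 1))" using that by (simp add: vec_eq_iff)
    then have *: "w2 Y u + \<eta> Y * \<eta> u = 0" for u
      using solve_matrix_iff[of "\<lambda>_. 0" Y] by (simp add: linear_zero)
    \<comment> \<open>Evaluation at the Reeb vector removes the \<open>w2\<close> term and leaves
      \<open>\<eta> Y * \<eta> \<xi> = 0\<close>.\<close>
    then have "\<eta> Y = 0" using \<xi> swap2[of Y \<xi>] by (metis add_0 mult_eq_0_iff neg_0_equal_iff_equal)
    then show "Y = 0" using trivial_kernel * by simp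
  qed
  then show ?thesis
    using matrix_left_invertible_ker[of solve_matrix] invertible_left_inverse[of solve_matrix]
      invertible_det_nz[of solve_matrix] by blast
qed

text \<open>Both 2-forms vanish on the Reeb vector while \<eta> does not, so the added term of rank
  one is zero for a solution.\<close>

lemma solve_matrix_partner:
  assumes "solve_matrix *v Y = (\<chi> i. w1 X (axis i 1))"
  shows "w2 Y u = w1 X u"
proof -
  have *: "w2 Y u + \<eta> Y * \<eta> u = w1 X u" for u
    using assms solve_matrix_iff[OF lin1] by blast
  obtain \<xi> where \<xi>: "\<eta> \<xi> \<noteq> 0" "\<And>u. w2 \<xi> u = 0" "\<And>u. w1 \<xi> u = 0" using ex_reeb by blast
  have "\<eta> Y = 0" using *[of \<xi>] \<xi> swap2[of Y \<xi>] swap1[of X \<xi>] by simp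
  then show ?thesis using *[of u] by simp
qed

lemma ex_partner: "\<exists>Y. solve_matrix *v Y = (\<chi> i. w1 X (axis i 1))"
  using cramer[OF det_solve_matrix] by blast

text \<open>The partner Y of X is J X up to a Reeb component, where J is the almost complex
  structure for which \<open>w3 X (J X)\<close> is the squared length of the horizontal part of X.
  What follows derives the properties of J from the wedge relations alone.\<close>

context
  fixes X Y
  assumes XY: "\<And>u. w2 Y u = w1 X u"
begin

text \<open>Let \<beta> be the sum of the two sides that should cancel. Contracting w1 \<and> w2 = 0
  with X and w2 \<and> w2 = w1 \<and> w1 with Y and inserting \<open>XY\<close> gives \<beta> \<and>
  w1 = 0, so \<beta> must vanish since otherwise w1 \<and> w1 would.\<close>

lemma partner_1: "w1 Y u = - w2 X u"
proof (rule ccontr)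
  define \<beta> where "\<beta> u = w1 Y u + w2 X u" for u
  assume "w1 Y u \<noteq> - w2 X u"
  then have "\<beta> u \<noteq> 0" by (simp add: \<beta>_def add_eq_0_iff)
  moreover have "\<beta> a * w1 b c - \<beta> b * w1 a c + \<beta> c * w1 a b = 0" for a b c
    using q12[of X a b c] q22[of Y a b c]
    unfolding quad_def XY \<beta>_def by (simp add: algebra_simps)
  ultimately have "quad w1 w1 p q r s = 0" for p q r s
    using quad_eq_0_if_divisible[of \<beta> w1] by blast
  then show False using nz by blast
qed

lemma partner_0: "w1 X Y = 0" "w2 X Y = 0" "w1 Y X = 0" "w2 Y X = 0"
  using XY[of Y] XY[of X] self1 self2 swap1[of X Y] swap2[of X Y] by simp_all

text \<open>Contracting w1 \<and> w3 = 0 with X and Y leaves w3(X, Y) w1 and products of contracted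
  1-forms. In the same way the next two lemmas come from w2 \<and> w3 = 0 and from w3 \<and> w3 = w2
  \<and> w2. Divided by w3(X, Y), the three identities are the model formulas in the coframe
  \<open>su2_frame\<close>.\<close>

lemma w1_decompose:
  "w3 X Y * w1 r s = - w3 Y r * w1 X s + w3 Y s * w1 X r + w2 X r * w3 X s - w2 X s * w3 X r"
  using q13[of X Y r s] unfolding quad_def partner_1 partner_0 by (simp add: algebra_simps)

lemma w2_decompose:
  "w3 X Y * w2 r s = - w3 Y r * w2 X s + w3 Y s * w2 X r + w3 X r * w1 X s - w3 X s * w1 X r"
  using q23[of X Y r s] unfolding quad_def XY partner_0 by (simp add: algebra_simps)

lemma w3_decompose:
  "w3 X Y * w3 r s = w3 X r * w3 Y s - w3 X s * w3 Y r + w1 X r * w2 X s - w1 X s * w2 X r"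
  using q33[of X Y r s] q22[of X Y r s] unfolding quad_def XY partner_0 partner_1 swap3[of Y X]
  by (simp add: algebra_simps)

text \<open>If w2(X, -) were k times w1(X, -), the form w = w2 - k w1 would annihilate X. Since w
  \<and> w = (1 + k^2) w1 \<and> w1, the contraction of w1 \<and> w1 with X would vanish, and with
  it w1(X, -).\<close>

lemma independent_12:
  assumes X: "w1 X u \<noteq> 0"
  obtains a b where "w1 X a * w2 X b - w1 X b * w2 X a \<noteq> 0"
proof (rule ccontr)
  assume "\<not> thesis"
  then have z: "w1 X a * w2 X b - w1 X b * w2 X a = 0" for a b using that by blast
  define k where "k = w2 X u / w1 X u"
  have k: "w2 X b = k * w1 X b" for b
    using z[of u b] X by (simp add: k_def field_simps)
  define w where "w a b = w2 a b - k * w1 a b" for a b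
  have "quad w w X q r s = (1 + k\<^sup>2) * quad w1 w1 X q r s" for q r s
    using q12[of X q r s] q22[of X q r s]
    unfolding quad_def w_def power2_eq_square by algebra
  moreover have "quad w w X q r s = 0" for q r s
    unfolding quad_def w_def k by simp
  moreover have "1 + k\<^sup>2 \<noteq> 0" by (smt (verit) zero_le_power2)
  ultimately have "quad w1 w1 X q r s = 0" for q r s by simp
  then show False using kernel_of_quad(1)[of X u] X by blast
qed

text \<open>If \<open>\<omega>\<^sub>3(X, Y)\<close> vanished, the three decompositions would give \<open>P\<^sup>2 + R\<^sup>2 = - D\<^sup>2\<close> with \<open>D \<noteq> 0\<close>.\<close>

lemma norm_pos:
  assumes X: "w1 X u \<noteq> 0"
  shows "w3 X Y > 0"
proof -
  have "w3 X Y \<noteq> 0"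
  proof
    assume N: "w3 X Y = 0"
    obtain r s where D: "w1 X r * w2 X s - w1 X s * w2 X r \<noteq> 0"
      using independent_12[OF X] by blast
    define D' P R where "D' = w1 X r * w2 X s - w1 X s * w2 X r"
      and "P = w1 X r * w3 X s - w1 X s * w3 X r" and "R = w2 X r * w3 X s - w2 X s * w3 X r"
    have e1: "w3 Y r * w1 X s - w3 Y s * w1 X r = R"
      using w1_decompose[of r s] N unfolding R_def by (simp add: algebra_simps)
    have e2: "w3 Y r * w2 X s - w3 Y s * w2 X r = - P"
      using w2_decompose[of r s] N unfolding P_def by (simp add: algebra_simps)
    have e3: "w3 X r * w3 Y s - w3 X s * w3 Y r = - D'"
      using w3_decompose[of r s] N unfolding D'_def by (simp add: algebra_simps)
    have "P\<^sup>2 + R\<^sup>2 = - D' * D'"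
      using e1 e2 e3 unfolding D'_def P_def R_def power2_eq_square by algebra
    then have "P\<^sup>2 + R\<^sup>2 + D' * D' = 0" by simp
    then have "D' = 0" by (smt (verit) zero_le_power2 zero_le_square mult_eq_0_iff)
    then show False using D by (simp add: D'_def)
  qed
  moreover have "w3 X Y \<ge> 0" using pos[of X Y] XY by simp
  ultimately show ?thesis by simp
qed

end

end

text \<open>Coframes and forms are indexed from the literal \<open>1\<close>, which the simplifier
  would otherwise turn into \<open>Suc 0\<close>.\<close>

declare One_nat_def [simp del]

lemma case_nat_1 [simp]: "case_nat x f 1 = f 0"
  by (simp add: One_nat_def)

section \<open>From SU(2)-structures in charts to the pointwise algebra\<close>

lemma wedge_2_2_quad:
  assumes "alternating 2 a" "alternating 2 (b :: ('e::real_vector, real) covector)"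
  shows "wedge 2 2 a b v = quad (form2 a) (form2 b) (v 0) (v 1) (v 2) (v 3)"
  unfolding quad_def wedge_2_2[OF assms] ..

lemma quad_wedge_2_2:
  assumes "alternating 2 a" "alternating 2 (b :: ('e::real_vector, real) covector)"
  shows "quad (form2 a) (form2 b) p q r s = wedge 2 2 a b (case_nat p (case_nat q (case_nat r (\<lambda>_. s))))"
  unfolding wedge_2_2_quad[OF assms] by (simp add: One_nat_def numeral_2_eq_2 numeral_3_eq_3)

lemma diff_form_alternating:
  "diff_form I ch k \<alpha> \<Longrightarrow> i \<in> I \<Longrightarrow> x \<in> chart_image (ch i) \<Longrightarrow> alternating k (\<alpha> i x)"
  unfolding diff_form_def by blast

lemma su2_structure_alternating:
  assumes "su2_structure X I ch \<eta> \<omega>" "i \<in> I" "x \<in> chart_image (ch i)"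
  shows "alternating 1 (\<eta> i x)" "alternating 2 (\<omega> 1 i x)" "alternating 2 (\<omega> 2 i x)" "alternating 2 (\<omega> 3 i x)"
  using assms by (auto simp: su2_structure_def intro: diff_form_alternating)

text \<open>The point is the kernel condition: a nonzero vector annihilated by
  \<open>\<omega>\<^sub>1\<close> and \<eta> is annihilated by the square \<nu> of
  \<open>\<omega>\<^sub>1\<close>, hence by the top-degree form \<nu> \<and> \<eta>, which would
  then vanish.\<close>

lemma su2_structure_forms:
  fixes ch :: "'i \<Rightarrow> ('m, real ^ 5) chart"
  assumes su2: "su2_structure X I ch \<eta> \<omega>" and i: "i \<in> I" and x: "x \<in> chart_image (ch i)"
  shows "su2_forms (form2 (\<omega> 1 i x)) (form2 (\<omega> 2 i x)) (form2 (\<omega> 3 i x)) (form1 (\<eta> i x))"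
proof -
  note alt = su2_structure_alternating[OF assms]
  obtain \<nu> where \<nu>: "diff_form I ch 4 \<nu>" and rel: "\<forall>i\<in>I. \<forall>x\<in>chart_image (ch i).
           (\<forall>a\<in>{1,2,3}. \<forall>b\<in>{1,2,3}.
              wedge 2 2 (\<omega> a i x) (\<omega> b i x) = (if a = b then \<nu> i x else (\<lambda>_. 0))) \<and>
           wedge 4 1 (\<nu> i x) (\<eta> i x) \<noteq> (\<lambda>_. 0)"
    using su2 unfolding su2_structure_def by blast
  have W: "wedge 2 2 (\<omega> a i x) (\<omega> b i x) = (if a = b then \<nu> i x else (\<lambda>_. 0))"
    if "a \<in> {1,2,3}" "b \<in> {1,2,3}" for a b
    using rel i x that by blast
  have ne: "wedge 4 1 (\<nu> i x) (\<eta> i x) \<noteq> (\<lambda>_. 0)" using rel i x by blast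
  have alt\<nu>: "alternating 4 (\<nu> i x)" using \<nu> i x unfolding diff_form_def by blast
  have \<nu>11: "\<nu> i x = wedge 2 2 (\<omega> 1 i x) (\<omega> 1 i x)" using W[of 1 1] by simp
  have \<nu>v: "\<nu> i x v = quad (form2 (\<omega> 1 i x)) (form2 (\<omega> 1 i x)) (v 0) (v 1) (v 2) (v 3)" for v
    unfolding \<nu>11 by (rule wedge_2_2_quad[OF alt(2) alt(2)])
  show ?thesis
  proof (rule su2_forms.intro)
    show "quad (form2 (\<omega> 2 i x)) (form2 (\<omega> 2 i x)) p q r s = quad (form2 (\<omega> 1 i x)) (form2 (\<omega> 1 i x)) p q r s"
      for p q r s
      unfolding quad_wedge_2_2[OF alt(2) alt(2)] quad_wedge_2_2[OF alt(3) alt(3)]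
      using W[of 1 1] W[of 2 2] by simp
    show "quad (form2 (\<omega> 3 i x)) (form2 (\<omega> 3 i x)) p q r s = quad (form2 (\<omega> 1 i x)) (form2 (\<omega> 1 i x)) p q r s"
      for p q r s
      unfolding quad_wedge_2_2[OF alt(2) alt(2)] quad_wedge_2_2[OF alt(4) alt(4)]
      using W[of 1 1] W[of 3 3] by simp
    show "quad (form2 (\<omega> 1 i x)) (form2 (\<omega> 2 i x)) p q r s = 0" for p q r s
      unfolding quad_wedge_2_2[OF alt(2) alt(3)] using W[of 1 2] by simp
    show "quad (form2 (\<omega> 1 i x)) (form2 (\<omega> 3 i x)) p q r s = 0" for p q r s
      unfolding quad_wedge_2_2[OF alt(2) alt(4)] using W[of 1 3] by simp
    show "quad (form2 (\<omega> 2 i x)) (form2 (\<omega> 3 i x)) p q r s = 0" for p q r s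
      unfolding quad_wedge_2_2[OF alt(3) alt(4)] using W[of 2 3] by simp
    show "\<exists>p q r s. quad (form2 (\<omega> 1 i x)) (form2 (\<omega> 1 i x)) p q r s \<noteq> 0"
    proof (rule ccontr)
      assume "\<not> ?thesis"
      then have "\<nu> i x = (\<lambda>_. 0)" using \<nu>v by auto
      then show False using ne by (simp add: wedge_def)
    qed
    show "Y = 0" if z: "\<And>u. form2 (\<omega> 1 i x) Y u = 0" and z\<eta>: "form1 (\<eta> i x) Y = 0" for Y
    proof (rule ccontr)
      assume Y: "Y \<noteq> 0"
      have z': "form2 (\<omega> 1 i x) u Y = 0" for u
        using form2_swap[OF alt(2), of u Y] z by simp
      have k\<nu>: "\<nu> i x (v(k := Y)) = 0" if "k < 4" for v k
      proof -
        have "k = 0 \<or> k = 1 \<or> k = 2 \<or> k = 3" using that by auto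
        then show ?thesis unfolding \<nu>v by (elim disjE) (simp_all add: quad_def z z')
      qed
      have k\<eta>: "\<eta> i x (v(k := Y)) = 0" if "k < 1" for v k
        using that z\<eta> by (simp add: alternating_1_apply[OF alt(1)])
      have alt5: "alternating 5 (wedge 4 1 (\<nu> i x) (\<eta> i x))"
        using alternating_wedge[OF alt\<nu> alt(1)] by simp
      have "wedge 4 1 (\<nu> i x) (\<eta> i x) v = 0" for v
      proof (rule alternating_kernel[OF alt5 _ Y])
        show "wedge 4 1 (\<nu> i x) (\<eta> i x) (v(k := Y)) = 0" if "k < 5" for v k
          by (rule wedge_kernel) (use k\<nu> k\<eta> that in auto)
      qed simp
      then show False using ne by blast
    qed
    show "0 \<le> form2 (\<omega> 3 i x) A B" if "\<And>u. form2 (\<omega> 1 i x) A u = form2 (\<omega> 2 i x) B u" for A B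
    proof -
      have "interior_prod A (\<omega> 1 i x) = interior_prod B (\<omega> 2 i x)"
        unfolding interior_prod_def
        using that by (simp add: alternating_2_apply[OF alt(2)] alternating_2_apply[OF alt(3)])
      then show ?thesis
        using su2 i x unfolding su2_structure_def form2_def by blast
    qed
  qed (use linear_form2_right[OF alt(2)] linear_form2_right[OF alt(3)] linear_form2_right[OF alt(4)]
        linear_form1[OF alt(1)] form2_swap[OF alt(2)] form2_swap[OF alt(3)] form2_swap[OF alt(4)] in blast)+
qed

text \<open>In the model, contracting the three 2-forms with the first dual vector gives e^2, e^3,
  e^4, and contracting the third with the fourth dual vector gives - e^1. Here X and Y are, up to
  Reeb components, these two vectors scaled by the square root of
  \<open>form2 (\<omega> 3) X Y\<close>.\<close>

definition su2_frame :: "'e \<Rightarrow> 'e \<Rightarrow> ('e, real) covector \<Rightarrow> (nat \<Rightarrow> ('e, real) covector) \<Rightarrow> nat \<Rightarrow> ('e, real) covector" where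
  "su2_frame X Y \<eta> \<omega> a =
     (if a = 1 then (\<lambda>v. - form2 (\<omega> 3) Y (v 0) / sqrt (form2 (\<omega> 3) X Y))
      else if a = 5 then \<eta> else (\<lambda>v. form2 (\<omega> (a - 1)) X (v 0) / sqrt (form2 (\<omega> 3) X Y)))"

lemma su2_frame_adapted:
  fixes \<eta> :: "(real ^ 5, real) covector"
  assumes alt: "alternating 1 \<eta>" "alternating 2 (\<omega> 1)" "alternating 2 (\<omega> 2)" "alternating 2 (\<omega> 3)"
    and forms: "su2_forms (form2 (\<omega> 1)) (form2 (\<omega> 2)) (form2 (\<omega> 3)) (form1 \<eta>)"
    and XY: "\<And>u. form2 (\<omega> 2) Y u = form2 (\<omega> 1) X u" and X: "form2 (\<omega> 1) X u\<^sub>0 \<noteq> 0"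
  shows "su2_adapted (su2_frame X Y \<eta> \<omega>) \<eta> \<omega>"
proof -
  interpret su2_forms "form2 (\<omega> 1)" "form2 (\<omega> 2)" "form2 (\<omega> 3)" "form1 \<eta>" by (rule forms)
  define N where "N = form2 (\<omega> 3) X Y"
  have N: "N > 0" unfolding N_def by (rule norm_pos[OF XY X])
  define e where "e = su2_frame X Y \<eta> \<omega>"
  have e1: "e 1 = (\<lambda>v. - form2 (\<omega> 3) Y (v 0) / sqrt N)"
    and e2: "e 2 = (\<lambda>v. form2 (\<omega> 1) X (v 0) / sqrt N)"
    and e3: "e 3 = (\<lambda>v. form2 (\<omega> 2) X (v 0) / sqrt N)"
    and e4: "e 4 = (\<lambda>v. form2 (\<omega> 3) X (v 0) / sqrt N)"
    and e5: "e 5 = \<eta>"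
    by (simp_all add: e_def su2_frame_def N_def One_nat_def[symmetric])
  have f: "form1 (e 1) u = - form2 (\<omega> 3) Y u / sqrt N" "form1 (e 2) u = form2 (\<omega> 1) X u / sqrt N"
    "form1 (e 3) u = form2 (\<omega> 2) X u / sqrt N" "form1 (e 4) u = form2 (\<omega> 3) X u / sqrt N"
    "form1 (e 5) u = form1 \<eta> u" for u
    by (simp_all add: e1 e2 e3 e4 e5 form1_def)
  have lin: "linear (\<lambda>u. form2 w Z u / sqrt N)" "linear (\<lambda>u. - form2 w Z u / sqrt N)"
    if "alternating 2 w" for w Z
    using linear_mult_left'[OF linear_form2_right[OF that, of Z], of "1 / sqrt N"]
      linear_mult_left'[OF linear_form2_right[OF that, of Z], of "- 1 / sqrt N"] by simp_all
  have alte: "alternating 1 (e 1)" "alternating 1 (e 2)" "alternating 1 (e 3)" "alternating 1 (e 4)" "alternating 1 (e 5)"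
    unfolding e1 e2 e3 e4 e5
    by (rule alternating_1I[OF lin(2)[OF alt(4)]] alternating_1I[OF lin(1)[OF alt(2)]]
        alternating_1I[OF lin(1)[OF alt(3)]] alternating_1I[OF lin(1)[OF alt(4)]] alt(1))+
  obtain \<xi> where \<xi>: "form1 \<eta> \<xi> \<noteq> 0" "\<And>u. form2 (\<omega> 1) \<xi> u = 0" "\<And>u. form2 (\<omega> 2) \<xi> u = 0" "\<And>u. form2 (\<omega> 3) \<xi> u = 0"
    using ex_reeb by blast
  have \<xi>': "form2 (\<omega> 1) u \<xi> = 0" "form2 (\<omega> 2) u \<xi> = 0" "form2 (\<omega> 3) u \<xi> = 0" for u
    using \<xi> swap1[of u \<xi>] swap2[of u \<xi>] swap3[of u \<xi>] by simp_all
  have cof: "coframe 5 e"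
  proof (rule coframeI)
    show "\<And>a. a \<in> {1..5} \<Longrightarrow> alternating 1 (e a)" using alte ball_1_5[of "\<lambda>a. alternating 1 (e a)"] by blast
    fix c assume c: "\<And>u. (\<Sum>a=1..5. c a * form1 (e a) u) = 0"
    \<comment> \<open>Evaluation separates the coefficients: \<xi> is seen only by e^5; apart from
      e^5, X is seen only by e^1 and Y only by e^4. The remaining two forms are independent by
      \<open>independent_12\<close>.\<close>
    have c5: "c 5 = 0" using c[of \<xi>] \<xi> \<xi>' by (simp only: sum_1_5 f) simp
    have c1: "c 1 = 0" using c[of X] c5 N swap3[of Y X]
      by (simp only: sum_1_5 f self1 self2 self3) (simp add: N_def)
    have c4: "c 4 = 0" using c[of Y] c5 c1 N
      by (simp only: sum_1_5 f self1 self2 self3 partner_0[OF XY]) (simp add: N_def)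
    have c23: "c 2 * form2 (\<omega> 1) X u + c 3 * form2 (\<omega> 2) X u = 0" for u
      using c[of u] c5 c1 c4 N by (simp only: sum_1_5 f) (simp add: field_simps)
    obtain a b where D: "form2 (\<omega> 1) X a * form2 (\<omega> 2) X b - form2 (\<omega> 1) X b * form2 (\<omega> 2) X a \<noteq> 0"
      using independent_12[OF XY X] by blast
    have "c 2 * (form2 (\<omega> 1) X a * form2 (\<omega> 2) X b - form2 (\<omega> 1) X b * form2 (\<omega> 2) X a) = 0"
      "c 3 * (form2 (\<omega> 1) X a * form2 (\<omega> 2) X b - form2 (\<omega> 1) X b * form2 (\<omega> 2) X a) = 0"
      using c23[of a] c23[of b] by algebra+
    then have "c 2 = 0" "c 3 = 0" using D by simp_all
    then show "\<forall>a\<in>{1..5}. c a = 0" using c1 c4 c5 by (simp add: ball_1_5)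
  qed simp
  have NN: "sqrt N * sqrt N = N" using N by simp
  have div: "p / sqrt N * (q / sqrt N) = p * q / N" for p q
    using NN by (simp add: times_divide_times_eq)
  have r1: "\<omega> 1 v = wedge 1 1 (e 1) (e 2) v + wedge 1 1 (e 3) (e 4) v" for v
    unfolding wedge_1_1[OF alte(1) alte(2)] wedge_1_1[OF alte(3) alte(4)] f div alternating_2_apply[OF alt(2), of v]
    using arg_cong[OF w1_decompose[OF XY, of "v 0" "v 1", folded N_def], of "\<lambda>z. z / N"] N
    by (simp add: add_divide_distrib diff_divide_distrib)
  have r2: "\<omega> 2 v = wedge 1 1 (e 1) (e 3) v + wedge 1 1 (e 4) (e 2) v" for v
    unfolding wedge_1_1[OF alte(1) alte(3)] wedge_1_1[OF alte(4) alte(2)] f div alternating_2_apply[OF alt(3), of v]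
    using arg_cong[OF w2_decompose[OF XY, of "v 0" "v 1", folded N_def], of "\<lambda>z. z / N"] N
    by (simp add: add_divide_distrib diff_divide_distrib)
  have r3: "\<omega> 3 v = wedge 1 1 (e 1) (e 4) v + wedge 1 1 (e 2) (e 3) v" for v
    unfolding wedge_1_1[OF alte(1) alte(4)] wedge_1_1[OF alte(2) alte(3)] f div alternating_2_apply[OF alt(4), of v]
    using arg_cong[OF w3_decompose[OF XY, of "v 0" "v 1", folded N_def], of "\<lambda>z. z / N"] N
    by (simp add: add_divide_distrib diff_divide_distrib mult.commute)
  show ?thesis
    unfolding su2_adapted_def e_def[symmetric]
    using cof e5 r1 r2 r3 by blast
qed

section \<open>The metric of an SU(2)-structure\<close>

lemma su2_adapted_alternating:
  assumes "su2_adapted e \<eta> \<omega>"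
  shows "alternating 1 (e 1)" "alternating 1 (e 2)" "alternating 1 (e 3)" "alternating 1 (e 4)" "alternating 1 (e 5)"
  using assms coframe_alternating[of 5 e] unfolding su2_adapted_def by auto

lemma su2_adapted_form2:
  assumes "su2_adapted e \<eta> \<omega>"
  shows "form2 (\<omega> 1) u w = form1 (e 1) u * form1 (e 2) w - form1 (e 1) w * form1 (e 2) u
      + form1 (e 3) u * form1 (e 4) w - form1 (e 3) w * form1 (e 4) u"
    and "form2 (\<omega> 2) u w = form1 (e 1) u * form1 (e 3) w - form1 (e 1) w * form1 (e 3) u
      + form1 (e 4) u * form1 (e 2) w - form1 (e 4) w * form1 (e 2) u"
    and "form2 (\<omega> 3) u w = form1 (e 1) u * form1 (e 4) w - form1 (e 1) w * form1 (e 4) u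
      + form1 (e 2) u * form1 (e 3) w - form1 (e 2) w * form1 (e 3) u"
proof -
  note alt = su2_adapted_alternating[OF assms]
  have w: "\<omega> 1 = (\<lambda>v. wedge 1 1 (e 1) (e 2) v + wedge 1 1 (e 3) (e 4) v)"
    "\<omega> 2 = (\<lambda>v. wedge 1 1 (e 1) (e 3) v + wedge 1 1 (e 4) (e 2) v)"
    "\<omega> 3 = (\<lambda>v. wedge 1 1 (e 1) (e 4) v + wedge 1 1 (e 2) (e 3) v)"
    using assms unfolding su2_adapted_def by blast+
  show "form2 (\<omega> 1) u w = form1 (e 1) u * form1 (e 2) w - form1 (e 1) w * form1 (e 2) u
      + form1 (e 3) u * form1 (e 4) w - form1 (e 3) w * form1 (e 4) u"
    "form2 (\<omega> 2) u w = form1 (e 1) u * form1 (e 3) w - form1 (e 1) w * form1 (e 3) u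
      + form1 (e 4) u * form1 (e 2) w - form1 (e 4) w * form1 (e 2) u"
    "form2 (\<omega> 3) u w = form1 (e 1) u * form1 (e 4) w - form1 (e 1) w * form1 (e 4) u
      + form1 (e 2) u * form1 (e 3) w - form1 (e 2) w * form1 (e 3) u"
    unfolding w form2_def
    using alt by (simp_all add: wedge_1_1 One_nat_def[symmetric])
qed

text \<open>The horizontal part of the metric is \<open>\<omega>\<^sub>3(w, J u)\<close>, and Y
  differs from J u by a Reeb component, which \<open>\<omega>\<^sub>3\<close> does not see. The
  right-hand side mentions only the forms; hence all adapted coframes define the same metric, and
  the metric transforms like the forms under a change of chart.\<close>

lemma su2_adapted_metric:
  fixes e :: "nat \<Rightarrow> ('e::euclidean_space, real) covector"
  assumes ad: "su2_adapted e \<eta> \<omega>" and Y: "\<And>w. form2 (\<omega> 2) Y w = form2 (\<omega> 1) u w"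
  shows "coframe_metric 5 e u w = form1 \<eta> u * form1 \<eta> w + form2 (\<omega> 3) w Y"
proof -
  have cof: "coframe 5 e" and \<eta>: "\<eta> = e 5" using ad unfolding su2_adapted_def by blast+
  obtain E where E: "\<And>a b. a \<in> {1..5} \<Longrightarrow> b \<in> {1..5} \<Longrightarrow> form1 (e a) (E b) = (if a = b then 1 else 0)"
    and "\<And>u. u = (\<Sum>a=1..5. form1 (e a) u *\<^sub>R E a)"
    by (rule coframe_dual_basis[OF cof]) (use that in blast)
  note Y' = Y[unfolded su2_adapted_form2[OF ad]]
  have "form1 (e 3) Y = form1 (e 2) u" "form1 (e 1) Y = - form1 (e 4) u"
    "form1 (e 4) Y = form1 (e 1) u" "form1 (e 2) Y = - form1 (e 3) u"
    \<comment> \<open>Testing the partner relation on the dual vectors isolates one component of Y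
      at a time.\<close>
    using Y'[of "E 1"] Y'[of "E 2"] Y'[of "E 3"] Y'[of "E 4"] by (simp_all add: E)
  then show ?thesis
    unfolding coframe_metric_form1 sum_1_5 su2_adapted_form2[OF ad] \<eta> by (simp add: algebra_simps)
qed

lemma su2_adapted_ex_partner:
  fixes e :: "nat \<Rightarrow> ('e::euclidean_space, real) covector"
  assumes ad: "su2_adapted e \<eta> \<omega>"
  shows "\<exists>Y. \<forall>w. form2 (\<omega> 2) Y w = form2 (\<omega> 1) u w"
proof -
  have cof: "coframe 5 e" using ad unfolding su2_adapted_def by blast
  obtain E where E: "\<And>a b. a \<in> {1..5} \<Longrightarrow> b \<in> {1..5} \<Longrightarrow> form1 (e a) (E b) = (if a = b then 1 else 0)"
    and "\<And>u. u = (\<Sum>a=1..5. form1 (e a) u *\<^sub>R E a)"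
    by (rule coframe_dual_basis[OF cof]) (use that in blast)
  \<comment> \<open>These are the components that the previous lemma forces; the Reeb component is
    free and set to 0.\<close>
  define Y where "Y = form1 (e 1) u *\<^sub>R E 4 + (- form1 (e 4) u) *\<^sub>R E 1 + form1 (e 2) u *\<^sub>R E 3 + (- form1 (e 3) u) *\<^sub>R E 2"
  have l: "linear (form1 (e a))" if "a \<in> {1..5}" for a using coframe_linear[OF cof that] .
  have Ye: "form1 (e a) Y = form1 (e 1) u * form1 (e a) (E 4) + (- form1 (e 4) u) * form1 (e a) (E 1)
      + form1 (e 2) u * form1 (e a) (E 3) + (- form1 (e 3) u) * form1 (e a) (E 2)" if "a \<in> {1..5}" for a
    unfolding Y_def linear_add[OF l[OF that]] linear_scale[OF l[OF that]] by simp
  have "form1 (e 3) Y = form1 (e 2) u" "form1 (e 1) Y = - form1 (e 4) u"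
    "form1 (e 4) Y = form1 (e 1) u" "form1 (e 2) Y = - form1 (e 3) u"
    by (simp_all add: Ye E)
  then have "form2 (\<omega> 2) Y w = form2 (\<omega> 1) u w" for w
    unfolding su2_adapted_form2[OF ad] by (simp add: algebra_simps)
  then show ?thesis by blast
qed

lemma su2_metric_eq:
  assumes "su2_adapted e (\<eta> i x) (\<lambda>a. \<omega> a i x)"
  shows "su2_metric \<eta> \<omega> i x = coframe_metric 5 e"
  unfolding su2_metric_def
proof (rule the_equality)
  show "\<exists>e'. su2_adapted e' (\<eta> i x) (\<lambda>a. \<omega> a i x) \<and> coframe_metric 5 e = coframe_metric 5 e'"
    using assms by blast
  fix h assume "\<exists>e. su2_adapted e (\<eta> i x) (\<lambda>a. \<omega> a i x) \<and> h = coframe_metric 5 e"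
  then obtain e' where e': "su2_adapted e' (\<eta> i x) (\<lambda>a. \<omega> a i x)" "h = coframe_metric 5 e'" by blast
  show "h = coframe_metric 5 e"
  proof (intro ext)
    fix u w
    obtain Y where Y: "\<And>w. form2 (\<omega> 2 i x) Y w = form2 (\<omega> 1 i x) u w"
      using su2_adapted_ex_partner[OF assms, of u] by blast
    show "h u w = coframe_metric 5 e u w"
      unfolding e'(2) su2_adapted_metric[OF assms Y] su2_adapted_metric[OF e'(1) Y] ..
  qed
qed

section \<open>Smooth local adapted coframes\<close>

lemma smooth_on_form1:
  assumes "diff_form I ch 1 \<alpha>" "i \<in> I" shows "smooth_on (chart_image (ch i)) (\<lambda>y. form1 (\<alpha> i y) u)"
  using assms unfolding diff_form_def form1_def by blast

lemma smooth_on_form2: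
  assumes "diff_form I ch 2 \<alpha>" "i \<in> I" shows "smooth_on (chart_image (ch i)) (\<lambda>y. form2 (\<alpha> i y) u w)"
  using assms unfolding diff_form_def form2_def by blast

text \<open>A constant vector Z outside the kernel of \<open>\<omega>\<^sub>1\<close> at x stays
  outside it nearby. There its partner is the solution of a linear system with smooth coefficients
  and nonzero determinant, and the normalising factor is the root of a positive smooth
  function.\<close>

lemma su2_structure_local_coframe:
  fixes ch :: "'i \<Rightarrow> ('m, real ^ 5) chart"
  assumes su2: "su2_structure X I ch \<eta> \<omega>" and i: "i \<in> I" and x: "x \<in> chart_image (ch i)"
  obtains V e where "open V" "x \<in> V" "V \<subseteq> chart_image (ch i)"
    "\<And>a v. a \<in> {1..5} \<Longrightarrow> smooth_on V (\<lambda>y. e a y v)"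
    "\<And>y. y \<in> V \<Longrightarrow> su2_adapted (\<lambda>a. e a y) (\<eta> i y) (\<lambda>a. \<omega> a i y)"
proof -
  define U where "U = chart_image (ch i)"
  have U: "open U" using su2 i unfolding su2_structure_def smooth_manifold_def U_def by blast
  have d: "diff_form I ch 1 \<eta>" "diff_form I ch 2 (\<omega> 1)" "diff_form I ch 2 (\<omega> 2)" "diff_form I ch 2 (\<omega> 3)"
    using su2 unfolding su2_structure_def by blast+
  note forms = su2_structure_forms[OF su2 i] and alt = su2_structure_alternating[OF su2 i]
  note sm = smooth_on_form1[OF d(1) i, folded U_def] smooth_on_form2[OF d(2) i, folded U_def]
    smooth_on_form2[OF d(3) i, folded U_def] smooth_on_form2[OF d(4) i, folded U_def]
  have "\<exists>Z u. form2 (\<omega> 1 i x) Z u \<noteq> 0"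
  proof (rule ccontr)
    assume "\<not> ?thesis"
    then have "form2 (\<omega> 1 i x) = (\<lambda>_ _. 0)" by (intro ext) blast
    then show False using su2_forms.nz[OF forms[OF x]] by (simp add: quad_def)
  qed
  then obtain Z u\<^sub>0 where Z: "form2 (\<omega> 1 i x) Z u\<^sub>0 \<noteq> 0" by blast
  define V where "V = {y \<in> U. form2 (\<omega> 1 i y) Z u\<^sub>0 \<noteq> 0}"
  have V: "open V"
  proof -
    have "V = U \<inter> (\<lambda>y. form2 (\<omega> 1 i y) Z u\<^sub>0) -` (- {0})" unfolding V_def by auto
    then show ?thesis
      using continuous_open_preimage[OF smooth_on_continuous_on[OF sm(2)[of Z u\<^sub>0]] U
        open_Compl[OF closed_singleton, of 0]] by simp
  qed
  have VU: "V \<subseteq> U" unfolding V_def by blast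
  have xV: "x \<in> V" using x Z unfolding V_def U_def by blast
  define A where "A y = su2_forms.solve_matrix (form2 (\<omega> 2 i y)) (form1 (\<eta> i y))" for y
  define b :: "real ^ 5 \<Rightarrow> real ^ 5" where "b y = (\<chi> k. form2 (\<omega> 1 i y) Z (axis k 1))" for y
  \<comment> \<open>On V the matrix is invertible, so the chosen solution is the only one and
    Cramer's rule shows that it depends smoothly on the point.\<close>
  define Y where "Y y = (SOME Y. A y *v Y = b y)" for y
  have Y: "A y *v Y y = b y" if "y \<in> V" for y
  proof -
    have "\<exists>Y. A y *v Y = b y"
      unfolding A_def b_def by (rule su2_forms.ex_partner[OF forms]) (use that VU U_def in blast)
    then show ?thesis unfolding Y_def by (rule someI_ex)
  qed
  have YX: "form2 (\<omega> 2 i y) (Y y) u = form2 (\<omega> 1 i y) Z u" if "y \<in> V" for y u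
    by (rule su2_forms.solve_matrix_partner[OF forms]) (use that VU U_def Y[OF that] A_def b_def in auto)
  note smV = sm[THEN smooth_on_subset, OF VU]
  have smA: "smooth_on V (\<lambda>y. A y $ k $ l)" for k l
  proof (rule smooth_on_cong[OF V])
    show "smooth_on V (\<lambda>y. form2 (\<omega> 2 i y) (axis l 1) (axis k 1) + form1 (\<eta> i y) (axis l 1) * form1 (\<eta> i y) (axis k 1))"
      by (intro smooth_on_add smooth_on_mult V smV)
    show "form2 (\<omega> 2 i y) (axis l 1) (axis k 1) + form1 (\<eta> i y) (axis l 1) * form1 (\<eta> i y) (axis k 1) = A y $ k $ l"
      if "y \<in> V" for y
      using su2_forms.solve_matrix_def[OF forms[of y]] that VU U_def by (auto simp: A_def)
  qed
  have smY: "smooth_on V Y"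
  proof (rule smooth_on_linear_solve[OF V smA _ _ Y])
    show "smooth_on V (\<lambda>y. b y $ k)" for k unfolding b_def using smV(2) by simp
    show "det (A y) \<noteq> 0" if "y \<in> V" for y
      unfolding A_def by (rule su2_forms.det_solve_matrix[OF forms]) (use that VU U_def in blast)
  qed
  have sm3: "smooth_on V (\<lambda>y. form2 (\<omega> 3 i y) (Y y) u)" for u
  proof (rule smooth_on_cong[OF V])
    \<comment> \<open>Smoothness of the form is known for constant arguments only, so the varying
      vector is expanded in the standard basis.\<close>
    show "smooth_on V (\<lambda>y. \<Sum>b\<in>Basis. (Y y \<bullet> b) * form2 (\<omega> 3 i y) b u)"
      by (intro smooth_on_sum smooth_on_mult V smV smooth_on_linear_comp[OF bounded_linear_inner_left] smY)
    show "(\<Sum>b\<in>Basis. (Y y \<bullet> b) * form2 (\<omega> 3 i y) b u) = form2 (\<omega> 3 i y) (Y y) u" if "y \<in> V" for y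
    proof -
      have l: "linear (\<lambda>Z. form2 (\<omega> 3 i y) Z u)"
        using linear_form2_left alt(4) that VU U_def by blast
      have "form2 (\<omega> 3 i y) (Y y) u = (\<lambda>Z. form2 (\<omega> 3 i y) Z u) (\<Sum>b\<in>Basis. (Y y \<bullet> b) *\<^sub>R b)"
        by (simp add: euclidean_representation)
      also have "\<dots> = (\<Sum>b\<in>Basis. (Y y \<bullet> b) * form2 (\<omega> 3 i y) b u)"
        unfolding linear_sum[OF l] linear_scale[OF l] by simp
      finally show ?thesis by simp
    qed
  qed
  have N: "form2 (\<omega> 3 i y) Z (Y y) > 0" if "y \<in> V" for y
    by (rule su2_forms.norm_pos[OF forms YX]) (use that VU U_def V_def in blast)+
  have smN: "smooth_on V (\<lambda>y. sqrt (form2 (\<omega> 3 i y) Z (Y y)))"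
  proof (intro smooth_on_sqrt V N)
    have "smooth_on V (\<lambda>y. - form2 (\<omega> 3 i y) (Y y) Z)" by (intro smooth_on_minus V sm3)
    then show "smooth_on V (\<lambda>y. form2 (\<omega> 3 i y) Z (Y y))"
      by (rule smooth_on_cong[OF V]) (use form2_swap[OF alt(4)] VU U_def in \<open>metis subsetD\<close>)
  qed
  define e where "e a y = su2_frame Z (Y y) (\<eta> i y) (\<lambda>a. \<omega> a i y) a" for a y
  have sN: "sqrt (form2 (\<omega> 3 i y) Z (Y y)) \<noteq> 0" if "y \<in> V" for y using N[OF that] by simp
  show thesis
  proof (rule that[of V e])
    show "smooth_on V (\<lambda>y. e a y v)" if "a \<in> {1..5}" for a v
    proof -
      have "a = 1 \<or> a = 2 \<or> a = 3 \<or> a = 4 \<or> a = 5" using that by auto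
      moreover have "smooth_on V (\<lambda>y. \<eta> i y v)"
        using d(1) i VU unfolding diff_form_def U_def by (blast intro: smooth_on_subset)
      ultimately show ?thesis
        unfolding e_def su2_frame_def
        by (elim disjE)
          (auto simp: One_nat_def[symmetric] intro!: smooth_on_divide smooth_on_minus V sm3 smV smN sN)
    qed
    show "su2_adapted (\<lambda>a. e a y) (\<eta> i y) (\<lambda>a. \<omega> a i y)" if "y \<in> V" for y
    proof -
      have y: "y \<in> chart_image (ch i)" using that VU U_def by blast
      show ?thesis
        unfolding e_def
        by (rule su2_frame_adapted[OF alt[OF y] forms[OF y] YX[OF that], of u\<^sub>0]) (use that V_def in blast)
    qed
  qed (use V xV VU U_def in auto)
qed

section \<open>Pointwise linear algebra of \<open>SU(3)\<close>-structures\<close>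

text \<open>The value of f \<and> g \<and> h on (p, q, r), that is, a determinant of order 3
  expanded along h.\<close>

definition cdet3 :: "('e \<Rightarrow> complex) \<Rightarrow> ('e \<Rightarrow> complex) \<Rightarrow> ('e \<Rightarrow> complex) \<Rightarrow> 'e \<Rightarrow> 'e \<Rightarrow> 'e \<Rightarrow> complex" where
  "cdet3 f g h p q r = (f p * g q - f q * g p) * h r - (f p * g r - f r * g p) * h q
     + (f q * g r - f r * g q) * h p"

definition cpair :: "(nat \<Rightarrow> ('e, real) covector) \<Rightarrow> nat \<Rightarrow> nat \<Rightarrow> 'e \<Rightarrow> complex" where
  "cpair e a b u = Complex (form1 (e a) u) (form1 (e b) u)"

lemma su3_adapted_iff:
  fixes e :: "nat \<Rightarrow> ('e::euclidean_space, real) covector"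
  shows "su3_adapted e F \<Psi>p \<Psi>m \<longleftrightarrow> coframe 6 e \<and>
    (\<forall>v. F v = form1 (e 1) (v 0) * form1 (e 2) (v 1) - form1 (e 1) (v 1) * form1 (e 2) (v 0)
        + form1 (e 3) (v 0) * form1 (e 4) (v 1) - form1 (e 3) (v 1) * form1 (e 4) (v 0)
        + form1 (e 5) (v 0) * form1 (e 6) (v 1) - form1 (e 5) (v 1) * form1 (e 6) (v 0)) \<and>
    (\<forall>v. Complex (\<Psi>p v) (\<Psi>m v) = cdet3 (cpair e 1 2) (cpair e 3 4) (cpair e 5 6) (v 0) (v 1) (v 2))"
proof (cases "coframe 6 e")
  case True
  then have alt: "alternating 1 (e 1)" "alternating 1 (e 2)" "alternating 1 (e 3)" "alternating 1 (e 4)"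
    "alternating 1 (e 5)" "alternating 1 (e 6)"
    by (auto intro: coframe_alternating)
  define \<theta> where "\<theta> a b v = complex_of_real (e a v) + \<i> * complex_of_real (e b v)" for a b v
  have f\<theta>: "form1 (\<theta> a b) = cpair e a b" for a b
    by (rule ext) (simp add: form1_def \<theta>_def cpair_def Complex_eq)
  have alt\<theta>: "alternating 1 (\<theta> a b)" if "alternating 1 (e a)" "alternating 1 (e b)" for a b
    unfolding \<theta>_def using that by (intro alternating_add alternating_mult alternating_of_real)
  note t = alt\<theta>[OF alt(1,2)] alt\<theta>[OF alt(3,4)] alt\<theta>[OF alt(5,6)]
  have W: "wedge 2 1 (wedge 1 1 (\<theta> 1 2) (\<theta> 3 4)) (\<theta> 5 6) v =
      cdet3 (cpair e 1 2) (cpair e 3 4) (cpair e 5 6) (v 0) (v 1) (v 2)" for v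
    unfolding wedge_2_1[OF alternating_wedge_1_1[OF t(1,2)] t(3)] form2_wedge_1_1[OF t(1,2)] f\<theta> cdet3_def
    by simp
  have "su3_adapted e F \<Psi>p \<Psi>m \<longleftrightarrow>
    F = (\<lambda>v. wedge 1 1 (e 1) (e 2) v + wedge 1 1 (e 3) (e 4) v + wedge 1 1 (e 5) (e 6) v) \<and>
    (\<lambda>v. Complex (\<Psi>p v) (\<Psi>m v)) = wedge 2 1 (wedge 1 1 (\<theta> 1 2) (\<theta> 3 4)) (\<theta> 5 6)"
    using True unfolding su3_adapted_def Let_def \<theta>_def Complex_eq by blast
  then show ?thesis
    using True unfolding fun_eq_iff W wedge_1_1[OF alt(1,2)] wedge_1_1[OF alt(3,4)] wedge_1_1[OF alt(5,6)]
    by (simp add: algebra_simps)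
next
  case False
  then show ?thesis unfolding su3_adapted_def by blast
qed

text \<open>The 3-form Psi_+ + i Psi_- is complex linear in each argument with respect to J, so the
  condition on Y says Y = J u, and the metric is F(w, J u). Again the coframe has disappeared from
  the right-hand side, which gives uniqueness of the metric.\<close>

lemma su3_adapted_metric:
  fixes e :: "nat \<Rightarrow> ('e::euclidean_space, real) covector"
  assumes ad: "su3_adapted e F \<Psi>p \<Psi>m"
    and Y: "\<And>p q. \<Psi>m (case_nat Y (case_nat p (\<lambda>_. q))) = \<Psi>p (case_nat u (case_nat p (\<lambda>_. q)))"
  shows "coframe_metric 6 e w u = F (case_nat w (\<lambda>_. Y))"
proof -
  have cof: "coframe 6 e" using ad unfolding su3_adapted_def by blast
  obtain E where E: "\<And>a b. a \<in> {1..6} \<Longrightarrow> b \<in> {1..6} \<Longrightarrow> form1 (e a) (E b) = (if a = b then 1 else 0)"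
    and "\<And>u. u = (\<Sum>a=1..6. form1 (e a) u *\<^sub>R E a)"
    by (rule coframe_dual_basis[OF cof]) (use that in blast)
  have F: "F v = form1 (e 1) (v 0) * form1 (e 2) (v 1) - form1 (e 1) (v 1) * form1 (e 2) (v 0)
        + form1 (e 3) (v 0) * form1 (e 4) (v 1) - form1 (e 3) (v 1) * form1 (e 4) (v 0)
        + form1 (e 5) (v 0) * form1 (e 6) (v 1) - form1 (e 5) (v 1) * form1 (e 6) (v 0)" for v
    using ad unfolding su3_adapted_iff by blast
  define D where "D = cdet3 (cpair e 1 2) (cpair e 3 4) (cpair e 5 6)"
  have C: "Complex (\<Psi>p v) (\<Psi>m v) = D (v 0) (v 1) (v 2)" for v
    using ad unfolding su3_adapted_iff D_def by blast
  have Yc: "Im (D Y p q) = Re (D u p q)" for p q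
    using Y[of p q] arg_cong[OF C[of "case_nat Y (case_nat p (\<lambda>_. q))"], of Im]
      arg_cong[OF C[of "case_nat u (case_nat p (\<lambda>_. q))"], of Re]
    by (simp add: numeral_2_eq_2)
  note d = D_def cdet3_def cpair_def
  \<comment> \<open>Inserting dual vectors of two of the complex coordinates reduces the determinant
    to the third coordinate, times 1 or i; its imaginary part then isolates a component of
    Y.\<close>
  have "form1 (e 2) Y = form1 (e 1) u" "form1 (e 1) Y = - form1 (e 2) u"
    using Yc[of "E 3" "E 5"] Yc[of "E 4" "E 5"] by (simp_all add: d E)
  moreover have "form1 (e 4) Y = form1 (e 3) u" "form1 (e 3) Y = - form1 (e 4) u"
    using Yc[of "E 5" "E 1"] Yc[of "E 5" "E 2"] by (simp_all add: d E)
  moreover have "form1 (e 6) Y = form1 (e 5) u" "form1 (e 5) Y = - form1 (e 6) u"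
    using Yc[of "E 1" "E 3"] Yc[of "E 2" "E 3"] by (simp_all add: d E)
  ultimately show ?thesis
    unfolding coframe_metric_form1 sum_1_6 F by (simp add: algebra_simps)
qed

lemma su3_adapted_ex_partner:
  fixes e :: "nat \<Rightarrow> ('e::euclidean_space, real) covector"
  assumes ad: "su3_adapted e F \<Psi>p \<Psi>m"
  shows "\<exists>Y. \<forall>p q. \<Psi>m (case_nat Y (case_nat p (\<lambda>_. q))) = \<Psi>p (case_nat u (case_nat p (\<lambda>_. q)))"
proof -
  have cof: "coframe 6 e" using ad unfolding su3_adapted_def by blast
  obtain E where E: "\<And>a b. a \<in> {1..6} \<Longrightarrow> b \<in> {1..6} \<Longrightarrow> form1 (e a) (E b) = (if a = b then 1 else 0)"
    and "\<And>u. u = (\<Sum>a=1..6. form1 (e a) u *\<^sub>R E a)"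
    by (rule coframe_dual_basis[OF cof]) (use that in blast)
  \<comment> \<open>This is J u: each of the three complex coordinates is multiplied by i.\<close>
  define Y where "Y = (- form1 (e 2) u) *\<^sub>R E 1 + form1 (e 1) u *\<^sub>R E 2 + (- form1 (e 4) u) *\<^sub>R E 3
    + form1 (e 3) u *\<^sub>R E 4 + (- form1 (e 6) u) *\<^sub>R E 5 + form1 (e 5) u *\<^sub>R E 6"
  have l: "linear (form1 (e a))" if "a \<in> {1..6}" for a using coframe_linear[OF cof that] .
  have Ye: "form1 (e a) Y = (- form1 (e 2) u) * form1 (e a) (E 1) + form1 (e 1) u * form1 (e a) (E 2)
      + (- form1 (e 4) u) * form1 (e a) (E 3) + form1 (e 3) u * form1 (e a) (E 4)
      + (- form1 (e 6) u) * form1 (e a) (E 5) + form1 (e 5) u * form1 (e a) (E 6)" if "a \<in> {1..6}" for a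
    unfolding Y_def linear_add[OF l[OF that]] linear_scale[OF l[OF that]] by simp
  have c: "cpair e 1 2 Y = \<i> * cpair e 1 2 u" "cpair e 3 4 Y = \<i> * cpair e 3 4 u" "cpair e 5 6 Y = \<i> * cpair e 5 6 u"
    by (simp_all add: cpair_def Ye E complex_eq_iff)
  define D where "D = cdet3 (cpair e 1 2) (cpair e 3 4) (cpair e 5 6)"
  have C: "Complex (\<Psi>p v) (\<Psi>m v) = D (v 0) (v 1) (v 2)" for v
    using ad unfolding su3_adapted_iff D_def by blast
  have "D Y p q = \<i> * D u p q" for p q
    unfolding D_def cdet3_def c by (simp add: algebra_simps)
  then have "\<Psi>m (case_nat Y (case_nat p (\<lambda>_. q))) = \<Psi>p (case_nat u (case_nat p (\<lambda>_. q)))" for p q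
    using arg_cong[OF C[of "case_nat Y (case_nat p (\<lambda>_. q))"], of Im]
      arg_cong[OF C[of "case_nat u (case_nat p (\<lambda>_. q))"], of Re]
    by (simp add: numeral_2_eq_2)
  then show ?thesis by blast
qed

lemma su3_metric_eq:
  assumes "su3_adapted e (F i x) (\<Psi>p i x) (\<Psi>m i x)"
  shows "su3_metric F \<Psi>p \<Psi>m i x = coframe_metric 6 e"
  unfolding su3_metric_def
proof (rule the_equality)
  show "\<exists>e'. su3_adapted e' (F i x) (\<Psi>p i x) (\<Psi>m i x) \<and> coframe_metric 6 e = coframe_metric 6 e'"
    using assms by blast
  fix h assume "\<exists>e. su3_adapted e (F i x) (\<Psi>p i x) (\<Psi>m i x) \<and> h = coframe_metric 6 e"
  then obtain e' where e': "su3_adapted e' (F i x) (\<Psi>p i x) (\<Psi>m i x)" "h = coframe_metric 6 e'" by blast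
  show "h = coframe_metric 6 e"
  proof (intro ext)
    fix w u
    obtain Y where Y: "\<And>p q. \<Psi>m i x (case_nat Y (case_nat p (\<lambda>_. q))) = \<Psi>p i x (case_nat u (case_nat p (\<lambda>_. q)))"
      using su3_adapted_ex_partner[OF assms, of u] by blast
    show "h w u = coframe_metric 6 e w u"
      unfolding e'(2) su3_adapted_metric[OF assms Y] su3_adapted_metric[OF e'(1) Y] ..
  qed
qed

section \<open>The forms of the sine cone\<close>

lemma dt_apply: "dt z v = snd (v 0)"
proof -
  have "((\<lambda>y. snd y) has_derivative snd) (at z)"
    by (auto intro!: derivative_eq_intros)
  then have "frechet_derivative (\<lambda>y. snd y) (at z) = snd"
    by (rule frechet_derivative_eqI)
  then show ?thesis by (simp add: dt_def ext_deriv_def)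
qed

lemma lift_form_apply: "lift_form \<alpha> z v = \<alpha> (fst z) (\<lambda>j. fst (v j))"
proof -
  have "((\<lambda>y. fst y) has_derivative fst) (at z)"
    by (auto intro!: derivative_eq_intros)
  then have "frechet_derivative fst (at z) = fst"
    by (rule frechet_derivative_eqI)
  then show ?thesis by (simp add: lift_form_def pullback_def)
qed

lemma alternating_dt: "alternating 1 (dt (z :: 'e::euclidean_space \<times> real))"
proof -
  have "dt z = (\<lambda>v. snd (v 0))" by (rule ext) (rule dt_apply)
  then show ?thesis using alternating_1I[of snd] by (simp add: linear_snd)
qed

lemma alternating_lift_form:
  fixes \<alpha> :: "'e::euclidean_space \<Rightarrow> ('e, real) covector"
  assumes "alternating k (\<alpha> (fst z))"
  shows "alternating k (lift_form \<alpha> z)"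
proof (rule alternatingI)
  show "lift_form \<alpha> z v = lift_form \<alpha> z w" if "\<And>i. i < k \<Longrightarrow> v i = w i" for v w
    unfolding lift_form_apply by (rule alternating_cong[OF assms]) (simp add: that)
  show "lift_form \<alpha> z v = 0" if "i < k" "j < k" "i \<noteq> j" "v i = v j" for v i j
    unfolding lift_form_apply by (rule alternating_repeat[OF assms that(1-3)]) (simp add: that)
  show "linear (\<lambda>u. lift_form \<alpha> z (v(i := u)))" if "i < k" for v i
  proof -
    have "(\<lambda>j. fst ((v(i := u)) j)) = (\<lambda>j. fst (v j))(i := fst u)" for u by auto
    then show ?thesis
      unfolding lift_form_apply
      using linear_compose[OF linear_fst alternating_linear[OF assms that, of "\<lambda>j. fst (v j)"]]
      by (simp add: o_def)
  qed
qed

lemma form1_lift_form: "form1 (lift_form \<alpha> z) u = form1 (\<alpha> (fst z)) (fst u)"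
  by (simp add: form1_def lift_form_apply)

lemma form2_lift_form: "form2 (lift_form \<alpha> z) u w = form2 (\<alpha> (fst z)) (fst u) (fst w)"
proof -
  have "(\<lambda>j. fst (case_nat u (\<lambda>_. w) j)) = case_nat (fst u) (\<lambda>_. fst w)"
    by (rule ext) (simp split: nat.split)
  then show ?thesis by (simp add: form2_def lift_form_apply)
qed

lemma form1_dt: "form1 (dt z) u = snd u"
  by (simp add: form1_def dt_apply)

definition su2_alternating :: "('i \<Rightarrow> 'e::euclidean_space \<Rightarrow> ('e, real) covector) \<Rightarrow>
    (nat \<Rightarrow> 'i \<Rightarrow> 'e \<Rightarrow> ('e, real) covector) \<Rightarrow> 'i \<Rightarrow> 'e \<Rightarrow> bool" where
  "su2_alternating \<eta> \<omega> i x \<longleftrightarrow> alternating 1 (\<eta> i x) \<and> (\<forall>a\<in>{1, 2, 3}. alternating 2 (\<omega> a i x))"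

text \<open>Replaces pullbacks and wedge products by explicit expressions in values on the base and
  in t; the verification of the SU(3)-structure, of smoothness, of the transformation law and of the
  differential equations starts from these.\<close>

lemma sine_cone_forms:
  fixes z :: "'e::euclidean_space \<times> real"
  assumes "su2_alternating \<eta> \<omega> i (fst z)"
  defines "\<eta>' \<equiv> form1 (\<eta> i (fst z))" and "w \<equiv> \<lambda>a. form2 (\<omega> a i (fst z))"
    and "s \<equiv> sin (snd z)" and "c \<equiv> cos (snd z)"
  shows sine_cone_F_apply: "sine_cone_F \<eta> \<omega> i z v =
      s\<^sup>2 * (s * w 1 (fst (v 0)) (fst (v 1)) + c * w 3 (fst (v 0)) (fst (v 1)))
      + s * (\<eta>' (fst (v 0)) * snd (v 1) - \<eta>' (fst (v 1)) * snd (v 0))"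
    and sine_cone_Psi_plus_apply: "sine_cone_Psi_plus \<eta> \<omega> i z v =
      s ^ 3 * (\<eta>' (fst (v 0)) * w 2 (fst (v 1)) (fst (v 2)) - \<eta>' (fst (v 1)) * w 2 (fst (v 0)) (fst (v 2))
        + \<eta>' (fst (v 2)) * w 2 (fst (v 0)) (fst (v 1)))
      - s\<^sup>2 * ((s * w 3 (fst (v 0)) (fst (v 1)) - c * w 1 (fst (v 0)) (fst (v 1))) * snd (v 2)
        - (s * w 3 (fst (v 0)) (fst (v 2)) - c * w 1 (fst (v 0)) (fst (v 2))) * snd (v 1)
        + (s * w 3 (fst (v 1)) (fst (v 2)) - c * w 1 (fst (v 1)) (fst (v 2))) * snd (v 0))"
    and sine_cone_Psi_minus_apply: "sine_cone_Psi_minus \<eta> \<omega> i z v =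
      s ^ 3 * ((s * w 3 (fst (v 0)) (fst (v 1)) - c * w 1 (fst (v 0)) (fst (v 1))) * \<eta>' (fst (v 2))
        - (s * w 3 (fst (v 0)) (fst (v 2)) - c * w 1 (fst (v 0)) (fst (v 2))) * \<eta>' (fst (v 1))
        + (s * w 3 (fst (v 1)) (fst (v 2)) - c * w 1 (fst (v 1)) (fst (v 2))) * \<eta>' (fst (v 0)))
      + s\<^sup>2 * (w 2 (fst (v 0)) (fst (v 1)) * snd (v 2) - w 2 (fst (v 0)) (fst (v 2)) * snd (v 1)
        + w 2 (fst (v 1)) (fst (v 2)) * snd (v 0))"
    and alternating_sine_cone_F: "alternating 2 (sine_cone_F \<eta> \<omega> i z)"
    and alternating_sine_cone_Psi_plus: "alternating 3 (sine_cone_Psi_plus \<eta> \<omega> i z)"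
    and alternating_sine_cone_Psi_minus: "alternating 3 (sine_cone_Psi_minus \<eta> \<omega> i z)"
proof -
  have l\<eta>: "alternating 1 (lift_form (\<eta> i) z)" and l: "alternating 2 (lift_form (\<omega> 1 i) z)"
    "alternating 2 (lift_form (\<omega> 2 i) z)" "alternating 2 (lift_form (\<omega> 3 i) z)"
    using assms(1) unfolding su2_alternating_def by (auto intro: alternating_lift_form)
  define \<Omega> where "\<Omega> = (\<lambda>w. - c * lift_form (\<omega> 1 i) z w + s * lift_form (\<omega> 3 i) z w)"
  have \<Omega>: "alternating 2 \<Omega>" unfolding \<Omega>_def by (intro alternating_add alternating_mult l)
  have f\<Omega>: "form2 \<Omega> u v = s * form2 (\<omega> 3 i (fst z)) (fst u) (fst v) - c * form2 (\<omega> 1 i (fst z)) (fst u) (fst v)" for u v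
    unfolding form2_lift_form[symmetric] by (simp add: \<Omega>_def form2_def)
  note F = sine_cone_F_def[of \<eta> \<omega> i z, unfolded Let_def, folded s_def c_def]
    and Pp = sine_cone_Psi_plus_def[of \<eta> \<omega> i z, unfolded Let_def, folded s_def c_def, folded \<Omega>_def]
    and Pm = sine_cone_Psi_minus_def[of \<eta> \<omega> i z, unfolded Let_def, folded s_def c_def, folded \<Omega>_def]
  show "alternating 2 (sine_cone_F \<eta> \<omega> i z)"
    unfolding F by (intro alternating_add alternating_mult alternating_wedge_1_1 l l\<eta> alternating_dt)
  show "alternating 3 (sine_cone_Psi_plus \<eta> \<omega> i z)"
    unfolding Pp by (intro alternating_diff alternating_mult alternating_wedge_1_2 alternating_wedge_2_1 l l\<eta> \<Omega> alternating_dt)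
  show "alternating 3 (sine_cone_Psi_minus \<eta> \<omega> i z)"
    unfolding Pm by (intro alternating_add alternating_mult alternating_wedge_2_1 l l\<eta> \<Omega> alternating_dt)
  show "sine_cone_F \<eta> \<omega> i z v =
      s\<^sup>2 * (s * w 1 (fst (v 0)) (fst (v 1)) + c * w 3 (fst (v 0)) (fst (v 1)))
      + s * (\<eta>' (fst (v 0)) * snd (v 1) - \<eta>' (fst (v 1)) * snd (v 0))"
    unfolding F wedge_1_1[OF l\<eta> alternating_dt] form1_lift_form form1_dt w_def \<eta>'_def
    by (simp only: alternating_2_apply[OF l(1), of v] alternating_2_apply[OF l(3), of v] form2_lift_form)
  show "sine_cone_Psi_plus \<eta> \<omega> i z v =
      s ^ 3 * (\<eta>' (fst (v 0)) * w 2 (fst (v 1)) (fst (v 2)) - \<eta>' (fst (v 1)) * w 2 (fst (v 0)) (fst (v 2))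
        + \<eta>' (fst (v 2)) * w 2 (fst (v 0)) (fst (v 1)))
      - s\<^sup>2 * ((s * w 3 (fst (v 0)) (fst (v 1)) - c * w 1 (fst (v 0)) (fst (v 1))) * snd (v 2)
        - (s * w 3 (fst (v 0)) (fst (v 2)) - c * w 1 (fst (v 0)) (fst (v 2))) * snd (v 1)
        + (s * w 3 (fst (v 1)) (fst (v 2)) - c * w 1 (fst (v 1)) (fst (v 2))) * snd (v 0))"
    unfolding Pp wedge_1_2[OF l\<eta> l(2)] wedge_2_1[OF \<Omega> alternating_dt] f\<Omega> form1_lift_form form2_lift_form
      form1_dt w_def \<eta>'_def ..
  show "sine_cone_Psi_minus \<eta> \<omega> i z v =
      s ^ 3 * ((s * w 3 (fst (v 0)) (fst (v 1)) - c * w 1 (fst (v 0)) (fst (v 1))) * \<eta>' (fst (v 2))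
        - (s * w 3 (fst (v 0)) (fst (v 2)) - c * w 1 (fst (v 0)) (fst (v 2))) * \<eta>' (fst (v 1))
        + (s * w 3 (fst (v 1)) (fst (v 2)) - c * w 1 (fst (v 1)) (fst (v 2))) * \<eta>' (fst (v 0)))
      + s\<^sup>2 * (w 2 (fst (v 0)) (fst (v 1)) * snd (v 2) - w 2 (fst (v 0)) (fst (v 2)) * snd (v 1)
        + w 2 (fst (v 1)) (fst (v 2)) * snd (v 0))"
    unfolding Pm wedge_2_1[OF \<Omega> l\<eta>] wedge_2_1[OF l(2) alternating_dt] f\<Omega> form1_lift_form form2_lift_form
      form1_dt w_def \<eta>'_def ..
qed

text \<open>\<open>(\<omega>\<^sub>1, \<omega>\<^sub>2, \<omega>\<^sub>3)\<close> is rotated into \<open>(sin t \<omega>\<^sub>1 + cos t \<omega>\<^sub>3, \<omega>\<^sub>2, - cos t \<omega>\<^sub>1 + sin t \<omega>\<^sub>3)\<close>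
  by rotating \<open>(e\<^sub>2, e\<^sub>4)\<close>.\<close>

definition sine_cone_frame :: "(nat \<Rightarrow> ('e::euclidean_space, real) covector) \<Rightarrow> real \<Rightarrow> nat \<Rightarrow> ('e \<times> real, real) covector" where
  "sine_cone_frame e t a = (\<lambda>v.
     if a = 6 then snd (v 0)
     else if a = 2 then sin t * (sin t * form1 (e 2) (fst (v 0)) + cos t * form1 (e 4) (fst (v 0)))
     else if a = 4 then sin t * (sin t * form1 (e 4) (fst (v 0)) - cos t * form1 (e 2) (fst (v 0)))
     else sin t * form1 (e a) (fst (v 0)))"

lemma form1_sine_cone_frame:
  "form1 (sine_cone_frame e t 1) u = sin t * form1 (e 1) (fst u)"
  "form1 (sine_cone_frame e t 2) u = sin t * (sin t * form1 (e 2) (fst u) + cos t * form1 (e 4) (fst u))"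
  "form1 (sine_cone_frame e t 3) u = sin t * form1 (e 3) (fst u)"
  "form1 (sine_cone_frame e t 4) u = sin t * (sin t * form1 (e 4) (fst u) - cos t * form1 (e 2) (fst u))"
  "form1 (sine_cone_frame e t 5) u = sin t * form1 (e 5) (fst u)"
  "form1 (sine_cone_frame e t 6) u = snd u"
  by (simp_all add: form1_def sine_cone_frame_def)

lemma sine_cone_frame_coframe:
  fixes e :: "nat \<Rightarrow> ('e::euclidean_space, real) covector"
  assumes e: "coframe 5 e" and t: "sin t \<noteq> 0"
  shows "coframe 6 (sine_cone_frame e t)"
proof (rule coframeI)
  show "DIM('e \<times> real) = 6" using coframe_DIM[OF e] by simp
  have l: "linear (form1 (e a))" if "a \<in> {1..5}" for a using coframe_linear[OF e that] .
  have l': "linear (\<lambda>u. form1 (e a) (fst u))" if "a \<in> {1..5}" for a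
    using linear_compose[OF linear_fst l[OF that]] by (simp add: o_def)
  fix a :: nat assume a: "a \<in> {1..6}"
  show "alternating 1 (sine_cone_frame e t a)"
  proof -
    have "linear (\<lambda>u. if a = 6 then snd u
     else if a = 2 then sin t * (sin t * form1 (e 2) (fst u) + cos t * form1 (e 4) (fst u))
     else if a = 4 then sin t * (sin t * form1 (e 4) (fst u) - cos t * form1 (e 2) (fst u))
     else sin t * form1 (e a) (fst u))"
    proof -
      have "a = 1 \<or> a = 2 \<or> a = 3 \<or> a = 4 \<or> a = 5 \<or> a = 6" using a by auto
      then show ?thesis
        by (elim disjE)
          (simp_all add: l' linear_mult_right' linear_compose_add linear_compose_sub linear_snd)
    qed
    then show ?thesis unfolding sine_cone_frame_def by (rule alternating_1I)
  qed
next
  fix c assume c: "\<And>u. (\<Sum>a=1..6. c a * form1 (sine_cone_frame e t a) u) = 0"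
  have l0: "form1 (e a) 0 = 0" if "a \<in> {1..5}" for a using linear_0[OF coframe_linear[OF e that]] .
  have c6: "c 6 = 0" using c[of "(0, 1)"] by (simp add: sum_1_6 form1_sine_cone_frame l0)
  \<comment> \<open>On vectors (u, 0) the relation with coefficients c is sin t times a relation
    among the e^a; d are its coefficients, rotated in the plane of the indices 2 and 4. The rotation
    is undone at the end.\<close>
  define d where "d a = (if a = 2 then c 2 * sin t - c 4 * cos t else if a = 4 then c 2 * cos t + c 4 * sin t else c a)" for a
  have "(\<Sum>a=1..5. d a * form1 (e a) u) = 0" for u
  proof -
    have "sin t * (\<Sum>a=1..5. d a * form1 (e a) u) = 0"
      using c[of "(u, 0)"] unfolding sum_1_5 sum_1_6 form1_sine_cone_frame d_def
      by (simp add: algebra_simps)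
    then show ?thesis using t by simp
  qed
  then have "d a = 0" if "a \<in> {1..5}" for a using coframe_independent[OF e _ that] by blast
  then have "d 1 = 0" "d 2 = 0" "d 3 = 0" "d 4 = 0" "d 5 = 0" by simp_all
  then have d: "c 1 = 0" "c 3 = 0" "c 5 = 0" "c 2 * sin t - c 4 * cos t = 0" "c 2 * cos t + c 4 * sin t = 0"
    by (simp_all add: d_def)
  have "c 2 = sin t * (c 2 * sin t - c 4 * cos t) + cos t * (c 2 * cos t + c 4 * sin t)"
    "c 4 = sin t * (c 2 * cos t + c 4 * sin t) - cos t * (c 2 * sin t - c 4 * cos t)"
    using sin_cos_squared_add[of t] unfolding power2_eq_square by algebra+
  then have "c 2 = 0" "c 4 = 0" unfolding d(4,5) by simp_all
  then show "\<forall>a\<in>{1..6}. c a = 0" using c6 d by (simp add: ball_1_6)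
qed

text \<open>The rotation of (e^2, e^4) is orthogonal, so only the common factor sin t is
  left.\<close>

lemma coframe_metric_sine_cone_frame:
  "coframe_metric 6 (sine_cone_frame e t) u v = snd u * snd v + (sin t)\<^sup>2 * coframe_metric 5 e (fst u) (fst v)"
proof -
  have "(sin t * (sin t * a + cos t * b)) * (sin t * (sin t * a' + cos t * b'))
      + (sin t * (sin t * b - cos t * a)) * (sin t * (sin t * b' - cos t * a')) = (sin t)\<^sup>2 * (a * a' + b * b')" for a b a' b'
    using sin_cos_squared_add[of t] unfolding power2_eq_square by algebra
  from this[of "form1 (e 2) (fst u)" "form1 (e 4) (fst u)" "form1 (e 2) (fst v)" "form1 (e 4) (fst v)"]
  show ?thesis
    unfolding coframe_metric_form1 sum_1_5 sum_1_6 form1_sine_cone_frame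
    by (simp add: algebra_simps power2_eq_square)
qed

text \<open>With the model formulas of both structures inserted, these are polynomial identities in
  the values of the coframe. That the rotation leaves \<open>\<omega>\<^sub>2\<close> unchanged is
  where \<open>s * s + c * c = 1\<close> enters.\<close>

lemma sine_cone_adapted:
  fixes z :: "'e::euclidean_space \<times> real"
  assumes ad: "su2_adapted e (\<eta> i (fst z)) (\<lambda>a. \<omega> a i (fst z))" and t: "sin (snd z) \<noteq> 0"
    and alt: "su2_alternating \<eta> \<omega> i (fst z)"
  shows "su3_adapted (sine_cone_frame e (snd z)) (sine_cone_F \<eta> \<omega> i z)
    (sine_cone_Psi_plus \<eta> \<omega> i z) (sine_cone_Psi_minus \<eta> \<omega> i z)"
proof -
  have cof: "coframe 5 e" and \<eta>: "\<eta> i (fst z) = e 5" using ad unfolding su2_adapted_def by blast+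
  show ?thesis
    unfolding su3_adapted_iff
  proof (intro conjI allI)
    show "coframe 6 (sine_cone_frame e (snd z))" by (rule sine_cone_frame_coframe[OF cof t])
    note u = form1_sine_cone_frame sine_cone_forms(1-3)[OF alt] su2_adapted_form2[OF ad] \<eta>
    define s c where "s = sin (snd z)" and "c = cos (snd z)"
    have sc: "s * s + c * c = 1" unfolding s_def c_def using sin_cos_squared_add[of "snd z"] by (simp add: power2_eq_square)
    fix v :: "nat \<Rightarrow> 'e \<times> real"
    show "sine_cone_F \<eta> \<omega> i z v =
      form1 (sine_cone_frame e (snd z) 1) (v 0) * form1 (sine_cone_frame e (snd z) 2) (v 1)
        - form1 (sine_cone_frame e (snd z) 1) (v 1) * form1 (sine_cone_frame e (snd z) 2) (v 0)
        + form1 (sine_cone_frame e (snd z) 3) (v 0) * form1 (sine_cone_frame e (snd z) 4) (v 1)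
        - form1 (sine_cone_frame e (snd z) 3) (v 1) * form1 (sine_cone_frame e (snd z) 4) (v 0)
        + form1 (sine_cone_frame e (snd z) 5) (v 0) * form1 (sine_cone_frame e (snd z) 6) (v 1)
        - form1 (sine_cone_frame e (snd z) 5) (v 1) * form1 (sine_cone_frame e (snd z) 6) (v 0)"
      unfolding u s_def[symmetric] c_def[symmetric] by (simp add: algebra_simps power2_eq_square)
    show "Complex (sine_cone_Psi_plus \<eta> \<omega> i z v) (sine_cone_Psi_minus \<eta> \<omega> i z v) =
      cdet3 (cpair (sine_cone_frame e (snd z)) 1 2) (cpair (sine_cone_frame e (snd z)) 3 4)
        (cpair (sine_cone_frame e (snd z)) 5 6) (v 0) (v 1) (v 2)"
      unfolding complex_eq_iff cdet3_def cpair_def complex.sel minus_complex.sel plus_complex.sel times_complex.sel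
        u s_def[symmetric] c_def[symmetric] power2_eq_square power3_eq_cube
      using sc by (intro conjI; algebra)
  qed
qed

section \<open>The nearly Kaehler equations\<close>

text \<open>Both sides choose from the same predicate, so they agree even at points where there is
  no derivative.\<close>

lemma frechet_derivative_cong_open:
  assumes "open S" "x \<in> S" "\<And>y. y \<in> S \<Longrightarrow> f y = g y"
  shows "frechet_derivative f (at x) = frechet_derivative g (at x)"
proof -
  have "(f has_derivative D) (at x) \<longleftrightarrow> (g has_derivative D) (at x)" for D
    using has_derivative_transform_within_open[of f D x UNIV S g] has_derivative_transform_within_open[of g D x UNIV S f] assms
    by auto
  then show ?thesis unfolding frechet_derivative_def by simp
qed

lemma ext_deriv_1:
  assumes "open S" "x \<in> S" "\<And>y. y \<in> S \<Longrightarrow> alternating 1 (\<alpha> y)"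
  shows "ext_deriv 1 \<alpha> x v = frechet_derivative (\<lambda>y. form1 (\<alpha> y) (v 1)) (at x) (v 0)
    - frechet_derivative (\<lambda>y. form1 (\<alpha> y) (v 0)) (at x) (v 1)"
proof -
  have *: "frechet_derivative (\<lambda>y. \<alpha> y w) (at x) = frechet_derivative (\<lambda>y. form1 (\<alpha> y) (w 0)) (at x)" for w
    by (rule frechet_derivative_cong_open[OF assms(1,2)]) (rule alternating_1_apply[OF assms(3)])
  have "{..1::nat} = {0, 1}" by auto
  then show ?thesis unfolding ext_deriv_def * by (simp add: One_nat_def[symmetric])
qed

lemma ext_deriv_2:
  assumes "open S" "x \<in> S" "\<And>y. y \<in> S \<Longrightarrow> alternating 2 (\<alpha> y)"
  shows "ext_deriv 2 \<alpha> x v = frechet_derivative (\<lambda>y. form2 (\<alpha> y) (v 1) (v 2)) (at x) (v 0)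
    - frechet_derivative (\<lambda>y. form2 (\<alpha> y) (v 0) (v 2)) (at x) (v 1)
    + frechet_derivative (\<lambda>y. form2 (\<alpha> y) (v 0) (v 1)) (at x) (v 2)"
proof -
  have *: "frechet_derivative (\<lambda>y. \<alpha> y w) (at x) = frechet_derivative (\<lambda>y. form2 (\<alpha> y) (w 0) (w 1)) (at x)" for w
    by (rule frechet_derivative_cong_open[OF assms(1,2)]) (rule alternating_2_apply[OF assms(3)])
  have "{..2::nat} = {0, 1, 2}" by auto
  then show ?thesis unfolding ext_deriv_def * by (simp add: One_nat_def[symmetric])
qed

lemma ext_deriv_3:
  "ext_deriv 3 \<alpha> x v = frechet_derivative (\<lambda>y. \<alpha> y (\<lambda>j. v (Suc j))) (at x) (v 0)
    - frechet_derivative (\<lambda>y. \<alpha> y (\<lambda>j. if j < 1 then v j else v (Suc j))) (at x) (v 1)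
    + frechet_derivative (\<lambda>y. \<alpha> y (\<lambda>j. if j < 2 then v j else v (Suc j))) (at x) (v 2)
    - frechet_derivative (\<lambda>y. \<alpha> y (\<lambda>j. if j < 3 then v j else v (Suc j))) (at x) (v 3)"
proof -
  have "{..3::nat} = {0, 1, 2, 3}" by auto
  then show ?thesis unfolding ext_deriv_def by simp
qed

lemma ext_deriv_2_args:
  "ext_deriv 2 \<alpha> x v = frechet_derivative (\<lambda>y. \<alpha> y (\<lambda>j. v (Suc j))) (at x) (v 0)
    - frechet_derivative (\<lambda>y. \<alpha> y (\<lambda>j. if j < 1 then v j else v (Suc j))) (at x) (v 1)
    + frechet_derivative (\<lambda>y. \<alpha> y (\<lambda>j. if j < 2 then v j else v (Suc j))) (at x) (v 2)"
proof -
  have "{..2::nat} = {0, 1, 2}" by auto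
  then show ?thesis unfolding ext_deriv_def by simp
qed

lemma ext_deriv_cong_open:
  assumes "open S" "x \<in> S" "\<And>y. y \<in> S \<Longrightarrow> \<alpha> y = \<beta> y"
  shows "ext_deriv k \<alpha> x = ext_deriv k \<beta> x"
proof -
  have "frechet_derivative (\<lambda>y. \<alpha> y w) (at x) = frechet_derivative (\<lambda>y. \<beta> y w) (at x)" for w
    by (rule frechet_derivative_cong_open[OF assms(1,2)]) (simp add: assms(3))
  then show ?thesis unfolding ext_deriv_def by simp
qed

text \<open>The coefficients of the forms and of the metric on the cylinder are sums of such
  products, a function of t times a function on the base.\<close>

lemma has_derivative_separated:
  fixes z :: "'e::euclidean_space \<times> real"
  assumes "(\<phi> has_real_derivative \<phi>') (at (snd z))" "(g has_derivative g') (at (fst z))"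
  shows "((\<lambda>y. \<phi> (snd y) * g (fst y)) has_derivative
    (\<lambda>u. \<phi>' * snd u * g (fst z) + \<phi> (snd z) * g' (fst u))) (at z)"
proof -
  have 1: "((\<lambda>y. \<phi> (snd y)) has_derivative (\<lambda>u. \<phi>' * snd u)) (at z)"
    using has_derivative_compose[of snd snd z UNIV \<phi> "(*) \<phi>'"] assms(1)
      bounded_linear_imp_has_derivative[OF bounded_linear_snd]
    by (auto simp: has_field_derivative_def)
  have 2: "((\<lambda>y. g (fst y)) has_derivative (\<lambda>u. g' (fst u))) (at z)"
    using has_derivative_compose[of fst fst z UNIV g g'] assms(2)
      bounded_linear_imp_has_derivative[OF bounded_linear_fst] by auto
  show ?thesis
    using has_derivative_mult[OF 1 2] by (simp add: algebra_simps)
qed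

text \<open>The Sasaki-Einstein equations on the image U of one chart, evaluated on constant vector
  fields, so that exterior derivatives contain no bracket terms.\<close>

locale sasaki_point =
  fixes U :: "(real ^ 5) set" and \<eta> :: "real ^ 5 \<Rightarrow> real ^ 5 \<Rightarrow> real"
    and w :: "nat \<Rightarrow> real ^ 5 \<Rightarrow> real ^ 5 \<Rightarrow> real ^ 5 \<Rightarrow> real"
  assumes U: "open U"
    and smooth_eta: "smooth_on U (\<lambda>y. \<eta> y p)"
    and smooth_w: "a \<in> {1, 2, 3} \<Longrightarrow> smooth_on U (\<lambda>y. w a y p q)"
    and d_eta: "x \<in> U \<Longrightarrow> frechet_derivative (\<lambda>y. \<eta> y q) (at x) p - frechet_derivative (\<lambda>y. \<eta> y p) (at x) q
        = - 2 * w 3 x p q"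
    and d_w1: "x \<in> U \<Longrightarrow> frechet_derivative (\<lambda>y. w 1 y q r) (at x) p - frechet_derivative (\<lambda>y. w 1 y p r) (at x) q
        + frechet_derivative (\<lambda>y. w 1 y p q) (at x) r
        = 3 * (\<eta> x p * w 2 x q r - \<eta> x q * w 2 x p r + \<eta> x r * w 2 x p q)"
    and d_w2: "x \<in> U \<Longrightarrow> frechet_derivative (\<lambda>y. w 2 y q r) (at x) p - frechet_derivative (\<lambda>y. w 2 y p r) (at x) q
        + frechet_derivative (\<lambda>y. w 2 y p q) (at x) r
        = - 3 * (\<eta> x p * w 1 x q r - \<eta> x q * w 1 x p r + \<eta> x r * w 1 x p q)"
begin

text \<open>\<open>d\<omega>\<^sub>3 = 0\<close> because \<open>\<omega>\<^sub>3\<close> is exact.\<close>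

lemma d_w3:
  assumes x: "x \<in> U"
  shows "frechet_derivative (\<lambda>y. w 3 y q r) (at x) p - frechet_derivative (\<lambda>y. w 3 y p r) (at x) q
        + frechet_derivative (\<lambda>y. w 3 y p q) (at x) r = 0"
proof -
  define dd where "dd a b c = frechet_derivative (\<lambda>y. frechet_derivative (\<lambda>y. \<eta> y a) (at y) b) (at x) c" for a b c
  have comm: "dd a b c = dd a c b" for a b c
    unfolding dd_def by (rule frechet_derivative_commute[OF smooth_eta U x])
  have D: "frechet_derivative (\<lambda>y. w 3 y q r) (at x) p = (-1/2) * (dd r q p - dd q r p)" for p q r
  proof -
    have "((\<lambda>y. (-1/2) * (frechet_derivative (\<lambda>y. \<eta> y r) (at y) q - frechet_derivative (\<lambda>y. \<eta> y q) (at y) r))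
        has_derivative (\<lambda>p. (-1/2) * (dd r q p - dd q r p))) (at x)"
      unfolding dd_def
      by (intro has_derivative_mult_right has_derivative_diff
          smooth_on_has_derivative[OF smooth_on_frechet_derivative[OF smooth_eta] x])
    then have "((\<lambda>y. w 3 y q r) has_derivative (\<lambda>p. (-1/2) * (dd r q p - dd q r p))) (at x)"
      by (rule has_derivative_transform_within_open[OF _ U x]) (use d_eta[of _ r q] in fastforce)
    then show ?thesis by (simp only: frechet_derivative_eqI)
  qed
  show ?thesis unfolding D comm[of r q p] comm[of q r p] comm[of p r q] by (simp add: algebra_simps)
qed

text \<open>The explicit formulas of the sine cone forms as functions on the whole space. They agree
  with the forms over an open chart, so derivatives there may be computed from them.\<close>

definition F where
  "F z v = (sin (snd z))\<^sup>2 * (sin (snd z) * w 1 (fst z) (fst (v 0)) (fst (v 1)) + cos (snd z) * w 3 (fst z) (fst (v 0)) (fst (v 1)))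
      + sin (snd z) * (\<eta> (fst z) (fst (v 0)) * snd (v 1) - \<eta> (fst z) (fst (v 1)) * snd (v (0::nat)))"

definition \<Psi>m where
  "\<Psi>m z v =
      sin (snd z) ^ 3 * ((sin (snd z) * w 3 (fst z) (fst (v 0)) (fst (v 1)) - cos (snd z) * w 1 (fst z) (fst (v 0)) (fst (v 1))) * \<eta> (fst z) (fst (v 2))
        - (sin (snd z) * w 3 (fst z) (fst (v 0)) (fst (v 2)) - cos (snd z) * w 1 (fst z) (fst (v 0)) (fst (v 2))) * \<eta> (fst z) (fst (v 1))
        + (sin (snd z) * w 3 (fst z) (fst (v 1)) (fst (v 2)) - cos (snd z) * w 1 (fst z) (fst (v 1)) (fst (v 2))) * \<eta> (fst z) (fst (v 0)))
      + (sin (snd z))\<^sup>2 * (w 2 (fst z) (fst (v 0)) (fst (v 1)) * snd (v 2) - w 2 (fst z) (fst (v 0)) (fst (v 2)) * snd (v 1)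
        + w 2 (fst z) (fst (v 1)) (fst (v 2)) * snd (v (0::nat)))"

abbreviation D\<eta> where "D\<eta> x q p \<equiv> frechet_derivative (\<lambda>y. \<eta> y q) (at x) p"
abbreviation Dw where "Dw a x q r p \<equiv> frechet_derivative (\<lambda>y. w a y q r) (at x) p"

lemma hd_eta: "x \<in> U \<Longrightarrow> ((\<lambda>y. \<eta> y q) has_derivative D\<eta> x q) (at x)"
  by (rule smooth_on_has_derivative[OF smooth_eta])

lemma hd_w: "a \<in> {1, 2, 3} \<Longrightarrow> x \<in> U \<Longrightarrow> ((\<lambda>y. w a y q r) has_derivative Dw a x q r) (at x)"
  by (rule smooth_on_has_derivative[OF smooth_w])

text \<open>The functions of t in F and Psi_-. In the second and fifth item cos^2 has been
  eliminated, which makes the expansions of dF and d Psi_- independent of this relation.\<close>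

lemma D_sin_cos:
  "((\<lambda>t. sin t ^ 3) has_real_derivative 3 * (sin t)\<^sup>2 * cos t) (at t)"
  "((\<lambda>t. (sin t)\<^sup>2 * cos t) has_real_derivative 2 * sin t - 3 * sin t ^ 3) (at t)"
  "(sin has_real_derivative cos t) (at t)"
  "((\<lambda>t. sin t ^ 4) has_real_derivative 4 * sin t ^ 3 * cos t) (at t)"
  "((\<lambda>t. - (sin t ^ 3 * cos t)) has_real_derivative - (3 * (sin t)\<^sup>2 - 4 * sin t ^ 4)) (at t)"
  "((\<lambda>t. (sin t)\<^sup>2) has_real_derivative 2 * sin t * cos t) (at t)"
proof -
  have "((\<lambda>t. (sin t)\<^sup>2 * cos t) has_real_derivative 2 * sin t * cos t * cos t - sin t ^ 3) (at t)"
    by (auto intro!: derivative_eq_intros simp: power2_eq_square power3_eq_cube algebra_simps)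
  moreover have "2 * sin t * cos t * cos t - sin t ^ 3 = 2 * sin t - 3 * sin t ^ 3"
    using sin_cos_squared_add[of t] by algebra
  ultimately show "((\<lambda>t. (sin t)\<^sup>2 * cos t) has_real_derivative 2 * sin t - 3 * sin t ^ 3) (at t)"
    by simp
  have "((\<lambda>t. - (sin t ^ 3 * cos t)) has_real_derivative - (3 * (sin t)\<^sup>2 * cos t * cos t - sin t ^ 4)) (at t)"
    by (auto intro!: derivative_eq_intros simp: power2_eq_square power3_eq_cube power4_eq_xxxx algebra_simps)
  moreover have "- (3 * (sin t)\<^sup>2 * cos t * cos t - sin t ^ 4) = - (3 * (sin t)\<^sup>2 - 4 * sin t ^ 4)"
    using sin_cos_squared_add[of t] by algebra
  ultimately show "((\<lambda>t. - (sin t ^ 3 * cos t)) has_real_derivative - (3 * (sin t)\<^sup>2 - 4 * sin t ^ 4)) (at t)"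
    by (simp only:)
qed (auto intro!: derivative_eq_intros simp: algebra_simps power2_eq_square power3_eq_cube)

lemma frechet_derivative_F:
  assumes x: "fst z \<in> U"
  shows "frechet_derivative (\<lambda>y. F y v) (at z) u =
      snd u * (3 * (sin (snd z))\<^sup>2 * cos (snd z) * w 1 (fst z) (fst (v 0)) (fst (v 1))
        + (2 * sin (snd z) - 3 * sin (snd z) ^ 3) * w 3 (fst z) (fst (v 0)) (fst (v 1))
        + cos (snd z) * (\<eta> (fst z) (fst (v 0)) * snd (v 1) - \<eta> (fst z) (fst (v 1)) * snd (v 0)))
      + sin (snd z) ^ 3 * Dw 1 (fst z) (fst (v 0)) (fst (v 1)) (fst u)
      + (sin (snd z))\<^sup>2 * cos (snd z) * Dw 3 (fst z) (fst (v 0)) (fst (v 1)) (fst u)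
      + sin (snd z) * (D\<eta> (fst z) (fst (v 0)) (fst u) * snd (v 1) - D\<eta> (fst z) (fst (v 1)) (fst u) * snd (v 0))"
proof -
  have e: "F y v = sin (snd y) ^ 3 * w 1 (fst y) (fst (v 0)) (fst (v 1))
      + (sin (snd y))\<^sup>2 * cos (snd y) * w 3 (fst y) (fst (v 0)) (fst (v 1))
      + sin (snd y) * (\<eta> (fst y) (fst (v 0)) * snd (v 1) - \<eta> (fst y) (fst (v 1)) * snd (v 0))" for y
    unfolding F_def by (simp add: algebra_simps power2_eq_square power3_eq_cube)
  have g: "((\<lambda>y. \<eta> y (fst (v 0)) * snd (v 1) - \<eta> y (fst (v 1)) * snd (v 0)) has_derivative
      (\<lambda>p. D\<eta> (fst z) (fst (v 0)) p * snd (v 1) - D\<eta> (fst z) (fst (v 1)) p * snd (v 0))) (at (fst z))"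
    by (intro has_derivative_diff has_derivative_mult_left hd_eta x)
  show ?thesis
    unfolding e
    by (subst frechet_derivative_eqI[OF has_derivative_add[OF has_derivative_add[OF
      has_derivative_separated[OF D_sin_cos(1) hd_w[OF _ x]]
      has_derivative_separated[OF D_sin_cos(2) hd_w[OF _ x]]]
      has_derivative_separated[OF D_sin_cos(3) g]]]) (simp_all add: algebra_simps)
qed

text \<open>Without dt, only \<open>sin^3 t d\<omega>\<^sub>1\<close> contributes, since
  \<open>\<omega>\<^sub>3\<close> is closed. In the dt part, \<open>sin t d\<eta> \<and> dt = - 2
  sin t \<omega>\<^sub>3 \<and> dt\<close> cancels the term 2 sin t in the derivative of sin^2 t cos
  t; what remains has the common factor 3.\<close>

lemma d_F:
  assumes x: "fst z \<in> U"
  shows "ext_deriv 2 F z v =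
   3 * (sin (snd z) ^ 3 * (\<eta> (fst z) (fst (v 0)) * w 2 (fst z) (fst (v 1)) (fst (v 2))
        - \<eta> (fst z) (fst (v 1)) * w 2 (fst z) (fst (v 0)) (fst (v 2))
        + \<eta> (fst z) (fst (v 2)) * w 2 (fst z) (fst (v 0)) (fst (v 1)))
      - (sin (snd z))\<^sup>2 * ((sin (snd z) * w 3 (fst z) (fst (v 0)) (fst (v 1)) - cos (snd z) * w 1 (fst z) (fst (v 0)) (fst (v 1))) * snd (v 2)
        - (sin (snd z) * w 3 (fst z) (fst (v 0)) (fst (v 2)) - cos (snd z) * w 1 (fst z) (fst (v 0)) (fst (v 2))) * snd (v 1)
        + (sin (snd z) * w 3 (fst z) (fst (v 1)) (fst (v 2)) - cos (snd z) * w 1 (fst z) (fst (v 1)) (fst (v 2))) * snd (v 0)))"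
proof -
  define p where "p i = fst (v i)" for i
  define b where "b i = snd (v i)" for i
  define a1 a2 a3 where "a1 = (\<lambda>j. v (Suc j))" and "a2 = (\<lambda>j. if j < 1 then v j else v (Suc j))"
    and "a3 = (\<lambda>j. if j < 2 then v j else v (Suc j))"
  have args: "a1 0 = v 1" "a1 1 = v 2" "a2 0 = v 0" "a2 1 = v 2" "a3 0 = v 0" "a3 1 = v 1"
    by (simp_all add: a1_def a2_def a3_def One_nat_def[symmetric])
  \<comment> \<open>The structure equations are turned into rewrite rules, each eliminating one of
    the permuted derivatives; the others cancel in the alternating sum.\<close>
  have eta: "D\<eta> (fst z) q r = D\<eta> (fst z) r q - 2 * w 3 (fst z) r q" for q r
    using d_eta[OF x, of q r] by simp
  have w1: "Dw 1 (fst z) (p 1) (p 2) (p 0) = Dw 1 (fst z) (p 0) (p 2) (p 1) - Dw 1 (fst z) (p 0) (p 1) (p 2)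
      + 3 * (\<eta> (fst z) (p 0) * w 2 (fst z) (p 1) (p 2) - \<eta> (fst z) (p 1) * w 2 (fst z) (p 0) (p 2) + \<eta> (fst z) (p 2) * w 2 (fst z) (p 0) (p 1))"
    using d_w1[OF x, of "p 1" "p 2" "p 0"] by simp
  have w3: "Dw 3 (fst z) (p 1) (p 2) (p 0) = Dw 3 (fst z) (p 0) (p 2) (p 1) - Dw 3 (fst z) (p 0) (p 1) (p 2)"
    using d_w3[OF x, of "p 1" "p 2" "p 0"] by simp
  show ?thesis
    unfolding ext_deriv_2_args a1_def[symmetric] a2_def[symmetric] a3_def[symmetric] frechet_derivative_F[OF x] args p_def[symmetric] b_def[symmetric]
      w1 w3 eta[of "p 1" "p 0"] eta[of "p 2" "p 0"] eta[of "p 2" "p 1"]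
    by (simp add: algebra_simps power2_eq_square power3_eq_cube)
qed

lemma frechet_derivative_Psi_minus:
  assumes x: "fst z \<in> U"
  shows "frechet_derivative (\<lambda>y. \<Psi>m y v) (at z) u =
      snd u * (4 * sin (snd z) ^ 3 * cos (snd z) * (w 3 (fst z) (fst (v 0)) (fst (v 1)) * \<eta> (fst z) (fst (v 2))
          - w 3 (fst z) (fst (v 0)) (fst (v 2)) * \<eta> (fst z) (fst (v 1)) + w 3 (fst z) (fst (v 1)) (fst (v 2)) * \<eta> (fst z) (fst (v 0)))
        - (3 * (sin (snd z))\<^sup>2 - 4 * sin (snd z) ^ 4) * (w 1 (fst z) (fst (v 0)) (fst (v 1)) * \<eta> (fst z) (fst (v 2))
          - w 1 (fst z) (fst (v 0)) (fst (v 2)) * \<eta> (fst z) (fst (v 1)) + w 1 (fst z) (fst (v 1)) (fst (v 2)) * \<eta> (fst z) (fst (v 0)))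
        + 2 * sin (snd z) * cos (snd z) * (w 2 (fst z) (fst (v 0)) (fst (v 1)) * snd (v 2) - w 2 (fst z) (fst (v 0)) (fst (v 2)) * snd (v 1)
          + w 2 (fst z) (fst (v 1)) (fst (v 2)) * snd (v 0)))
      + sin (snd z) ^ 4 * ((w 3 (fst z) (fst (v 0)) (fst (v 1)) * D\<eta> (fst z) (fst (v 2)) (fst u) + Dw 3 (fst z) (fst (v 0)) (fst (v 1)) (fst u) * \<eta> (fst z) (fst (v 2)))
        - (w 3 (fst z) (fst (v 0)) (fst (v 2)) * D\<eta> (fst z) (fst (v 1)) (fst u) + Dw 3 (fst z) (fst (v 0)) (fst (v 2)) (fst u) * \<eta> (fst z) (fst (v 1)))
        + (w 3 (fst z) (fst (v 1)) (fst (v 2)) * D\<eta> (fst z) (fst (v 0)) (fst u) + Dw 3 (fst z) (fst (v 1)) (fst (v 2)) (fst u) * \<eta> (fst z) (fst (v 0))))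
      - sin (snd z) ^ 3 * cos (snd z) * ((w 1 (fst z) (fst (v 0)) (fst (v 1)) * D\<eta> (fst z) (fst (v 2)) (fst u) + Dw 1 (fst z) (fst (v 0)) (fst (v 1)) (fst u) * \<eta> (fst z) (fst (v 2)))
        - (w 1 (fst z) (fst (v 0)) (fst (v 2)) * D\<eta> (fst z) (fst (v 1)) (fst u) + Dw 1 (fst z) (fst (v 0)) (fst (v 2)) (fst u) * \<eta> (fst z) (fst (v 1)))
        + (w 1 (fst z) (fst (v 1)) (fst (v 2)) * D\<eta> (fst z) (fst (v 0)) (fst u) + Dw 1 (fst z) (fst (v 1)) (fst (v 2)) (fst u) * \<eta> (fst z) (fst (v 0))))
      + (sin (snd z))\<^sup>2 * (Dw 2 (fst z) (fst (v 0)) (fst (v 1)) (fst u) * snd (v 2) - Dw 2 (fst z) (fst (v 0)) (fst (v 2)) (fst u) * snd (v 1)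
        + Dw 2 (fst z) (fst (v 1)) (fst (v 2)) (fst u) * snd (v 0))"
proof -
  define G where "G a y = w a y (fst (v 0)) (fst (v 1)) * \<eta> y (fst (v 2)) - w a y (fst (v 0)) (fst (v 2)) * \<eta> y (fst (v 1))
      + w a y (fst (v 1)) (fst (v 2)) * \<eta> y (fst (v 0))" for a y
  define H where "H y = w 2 y (fst (v 0)) (fst (v 1)) * snd (v 2) - w 2 y (fst (v 0)) (fst (v 2)) * snd (v 1)
      + w 2 y (fst (v 1)) (fst (v 2)) * snd (v 0)" for y
  have e: "\<Psi>m y v = sin (snd y) ^ 4 * G 3 (fst y) + (- (sin (snd y) ^ 3 * cos (snd y))) * G 1 (fst y)
      + (sin (snd y))\<^sup>2 * H (fst y)" for y
    unfolding \<Psi>m_def G_def H_def by (simp add: algebra_simps power2_eq_square power3_eq_cube power4_eq_xxxx)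
  have g: "(G a has_derivative (\<lambda>p.
      (w a (fst z) (fst (v 0)) (fst (v 1)) * D\<eta> (fst z) (fst (v 2)) p + Dw a (fst z) (fst (v 0)) (fst (v 1)) p * \<eta> (fst z) (fst (v 2)))
        - (w a (fst z) (fst (v 0)) (fst (v 2)) * D\<eta> (fst z) (fst (v 1)) p + Dw a (fst z) (fst (v 0)) (fst (v 2)) p * \<eta> (fst z) (fst (v 1)))
        + (w a (fst z) (fst (v 1)) (fst (v 2)) * D\<eta> (fst z) (fst (v 0)) p + Dw a (fst z) (fst (v 1)) (fst (v 2)) p * \<eta> (fst z) (fst (v 0))))) (at (fst z))"
    if "a \<in> {1, 2, 3}" for a
    unfolding G_def by (intro has_derivative_diff has_derivative_add has_derivative_mult hd_w[OF that] hd_eta x)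
  have h: "(H has_derivative (\<lambda>p. Dw 2 (fst z) (fst (v 0)) (fst (v 1)) p * snd (v 2) - Dw 2 (fst z) (fst (v 0)) (fst (v 2)) p * snd (v 1)
        + Dw 2 (fst z) (fst (v 1)) (fst (v 2)) p * snd (v 0))) (at (fst z))"
    unfolding H_def by (intro has_derivative_diff has_derivative_add has_derivative_mult_left hd_w x) simp_all
  show ?thesis
    unfolding e
    by (subst frechet_derivative_eqI[OF has_derivative_add[OF has_derivative_add[OF
      has_derivative_separated[OF D_sin_cos(4) g]
      has_derivative_separated[OF D_sin_cos(5) g]]
      has_derivative_separated[OF D_sin_cos(6) h]]]) (simp_all add: algebra_simps G_def H_def)
qed

definition F2 where "F2 z u u' = F z (case_nat u (\<lambda>_. u'))"

text \<open>The 2-form \<eta> \<and> dt. Together with the lifts \<open>W2\<close> of the three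
  2-forms it makes up \<open>F2\<close>.\<close>

definition E2 where "E2 z u u' = \<eta> (fst z) (fst u) * snd u' - \<eta> (fst z) (fst u') * snd (u :: (real ^ 5) \<times> real)"

definition W2 where "W2 a z u u' = w a (fst z) (fst u) (fst (u' :: (real ^ 5) \<times> real))"

text \<open>Write F = sin^2 t A + sin t B with
  \<open>A = sin t \<omega>\<^sub>1 + cos t \<omega>\<^sub>3\<close> and B = \<eta> \<and> dt. Then
  B \<and> B = 0, and A has the same square as \<open>\<omega>\<^sub>3\<close> because
  \<open>\<omega>\<^sub>1 \<and> \<omega>\<^sub>3 = 0\<close> and the two forms have equal squares.
  The cross terms are the other two summands.\<close>

lemma quad_F2:
  assumes q11: "\<And>p q r s. quad (w 1 (fst z)) (w 1 (fst z)) p q r s = quad (w 3 (fst z)) (w 3 (fst z)) p q r s"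
    and q13: "\<And>p q r s. quad (w 1 (fst z)) (w 3 (fst z)) p q r s = 0"
  shows "quad (F2 z) (F2 z) p q r s = (sin (snd z)) ^ 4 * quad (W2 3 z) (W2 3 z) p q r s
    + 2 * sin (snd z) ^ 4 * quad (W2 1 z) (E2 z) p q r s
    + 2 * sin (snd z) ^ 3 * cos (snd z) * quad (W2 3 z) (E2 z) p q r s"
proof -
  define S C where "S = sin (snd z)" and "C = cos (snd z)"
  have F2: "F2 z u u' = S\<^sup>2 * (S * W2 1 z u u' + C * W2 3 z u u') + S * E2 z u u'" for u u'
    by (simp add: F2_def F_def W2_def E2_def S_def C_def)
  have E: "quad (E2 z) (E2 z) p q r s = 0"
    unfolding quad_def E2_def by (simp add: algebra_simps)
  have Q: "quad (W2 1 z) (W2 1 z) p q r s = quad (W2 3 z) (W2 3 z) p q r s" "quad (W2 1 z) (W2 3 z) p q r s = 0"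
    using q11[of "fst p" "fst q" "fst r" "fst s"] q13[of "fst p" "fst q" "fst r" "fst s"]
    unfolding quad_def W2_def by simp_all
  have "quad (F2 z) (F2 z) p q r s = S ^ 4 * S\<^sup>2 * quad (W2 1 z) (W2 1 z) p q r s + S ^ 4 * C\<^sup>2 * quad (W2 3 z) (W2 3 z) p q r s
    + 2 * S ^ 4 * S * C * quad (W2 1 z) (W2 3 z) p q r s + S\<^sup>2 * quad (E2 z) (E2 z) p q r s
    + 2 * S ^ 4 * quad (W2 1 z) (E2 z) p q r s + 2 * S ^ 3 * C * quad (W2 3 z) (E2 z) p q r s"
    unfolding quad_def F2 by (simp add: algebra_simps power2_eq_square power3_eq_cube power4_eq_xxxx)
  also have "\<dots> = S ^ 4 * (S\<^sup>2 + C\<^sup>2) * quad (W2 3 z) (W2 3 z) p q r s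
    + 2 * S ^ 4 * quad (W2 1 z) (E2 z) p q r s + 2 * S ^ 3 * C * quad (W2 3 z) (E2 z) p q r s"
    unfolding Q E by (simp add: algebra_simps power2_eq_square power3_eq_cube power4_eq_xxxx)
  finally show ?thesis by (simp add: S_def C_def)
qed

text \<open>The part without dt is \<open>sin^4 t \<omega>\<^sub>3 \<and> d\<eta>\<close>, which
  gives - 2 times the square of \<open>\<omega>\<^sub>3\<close>; the product
  \<open>d\<omega>\<^sub>1 \<and> \<eta>\<close> vanishes. In the dt part,
  \<open>sin^2 t d\<omega>\<^sub>2 \<and> dt\<close> cancels the term 3 sin^2 t from the derivative
  of sin^3 t cos t, leaving the cross terms of F \<and> F.\<close>

lemma d_Psi_minus:
  assumes x: "fst z \<in> U"
    and q11: "\<And>p q r s. quad (w 1 (fst z)) (w 1 (fst z)) p q r s = quad (w 3 (fst z)) (w 3 (fst z)) p q r s"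
    and q13: "\<And>p q r s. quad (w 1 (fst z)) (w 3 (fst z)) p q r s = 0"
  shows "ext_deriv 3 \<Psi>m z v = - 2 * quad (F2 z) (F2 z) (v 0) (v 1) (v 2) (v 3)"
proof -
  define p where "p i = fst (v i)" for i
  define b where "b i = snd (v i)" for i
  define S C where "S = sin (snd z)" and "C = cos (snd z)"
  define a1 a2 a3 a4 where "a1 = (\<lambda>j. v (Suc j))" and "a2 = (\<lambda>j. if j < 1 then v j else v (Suc j))"
    and "a3 = (\<lambda>j. if j < 2 then v j else v (Suc j))" and "a4 = (\<lambda>j. if j < 3 then v j else v (Suc j))"
  have args: "a1 0 = v 1" "a1 1 = v 2" "a1 2 = v 3" "a2 0 = v 0" "a2 1 = v 2" "a2 2 = v 3"
    "a3 0 = v 0" "a3 1 = v 1" "a3 2 = v 3" "a4 0 = v 0" "a4 1 = v 1" "a4 2 = v 2"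
    by (simp_all add: a1_def a2_def a3_def a4_def One_nat_def[symmetric])
  have eta: "D\<eta> (fst z) q r = D\<eta> (fst z) r q - 2 * w 3 (fst z) r q" for q r
    using d_eta[OF x, of q r] by simp
  have w1: "Dw 1 (fst z) q r p = Dw 1 (fst z) p r q - Dw 1 (fst z) p q r
      + 3 * (\<eta> (fst z) p * w 2 (fst z) q r - \<eta> (fst z) q * w 2 (fst z) p r + \<eta> (fst z) r * w 2 (fst z) p q)" for p q r
    using d_w1[OF x, of q r p] by simp
  have w2: "Dw 2 (fst z) q r p = Dw 2 (fst z) p r q - Dw 2 (fst z) p q r
      - 3 * (\<eta> (fst z) p * w 1 (fst z) q r - \<eta> (fst z) q * w 1 (fst z) p r + \<eta> (fst z) r * w 1 (fst z) p q)" for p q r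
    using d_w2[OF x, of q r p] by simp
  have w3: "Dw 3 (fst z) q r p = Dw 3 (fst z) p r q - Dw 3 (fst z) p q r" for p q r
    using d_w3[OF x, of q r p] by simp
  note t = w1[of "p 1" "p 2" "p 0"] w1[of "p 1" "p 3" "p 0"] w1[of "p 2" "p 3" "p 0"] w1[of "p 2" "p 3" "p 1"]
    w2[of "p 1" "p 2" "p 0"] w2[of "p 1" "p 3" "p 0"] w2[of "p 2" "p 3" "p 0"] w2[of "p 2" "p 3" "p 1"]
    w3[of "p 1" "p 2" "p 0"] w3[of "p 1" "p 3" "p 0"] w3[of "p 2" "p 3" "p 0"] w3[of "p 2" "p 3" "p 1"]
    eta[of "p 1" "p 0"] eta[of "p 2" "p 0"] eta[of "p 3" "p 0"] eta[of "p 2" "p 1"] eta[of "p 3" "p 1"] eta[of "p 3" "p 2"]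
  \<comment> \<open>The last summand comes from \<open>\<omega>\<^sub>1 \<and> d\<eta>\<close>. It
    is zero by \<open>q13\<close>, but with it the equation holds by polynomial arithmetic
    alone.\<close>
  have "ext_deriv 3 \<Psi>m z v = - 2 * (S ^ 4 * quad (W2 3 z) (W2 3 z) (v 0) (v 1) (v 2) (v 3)
    + 2 * S ^ 4 * quad (W2 1 z) (E2 z) (v 0) (v 1) (v 2) (v 3)
    + 2 * S ^ 3 * C * quad (W2 3 z) (E2 z) (v 0) (v 1) (v 2) (v 3))
    + 2 * S ^ 3 * C * quad (w 1 (fst z)) (w 3 (fst z)) (p 0) (p 1) (p 2) (p 3)"
    unfolding ext_deriv_3 a1_def[symmetric] a2_def[symmetric] a3_def[symmetric] a4_def[symmetric]
      frechet_derivative_Psi_minus[OF x] args p_def[symmetric] b_def[symmetric]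
      S_def[symmetric] C_def[symmetric] t quad_def W2_def E2_def
    by (simp add: algebra_simps power2_eq_square power3_eq_cube power4_eq_xxxx)
  then show ?thesis unfolding q13 quad_F2[OF q11 q13] S_def C_def by simp
qed

end

section \<open>Levi-Civita connection and curvature in an orthonormal coframe\<close>

lemma frechet_derivative_add:
  assumes "f differentiable (at x)" "g differentiable (at x)"
  shows "frechet_derivative (\<lambda>y. f y + g y) (at x) u = frechet_derivative f (at x) u + frechet_derivative g (at x) u"
  by (simp add: frechet_derivative_eqI[OF has_derivative_add[OF assms[THEN has_frechet_derivative]]])

lemma frechet_derivative_sum:
  assumes "\<And>i. i \<in> A \<Longrightarrow> f i differentiable (at x)"
  shows "frechet_derivative (\<lambda>y. \<Sum>i\<in>A. f i y) (at x) u = (\<Sum>i\<in>A. frechet_derivative (f i) (at x) u)"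
  by (simp add: frechet_derivative_eqI[OF has_derivative_sum[OF assms[THEN has_frechet_derivative]]])

lemma frechet_derivative_diff:
  assumes "f differentiable (at x)" "g differentiable (at x)"
  shows "frechet_derivative (\<lambda>y. f y - g y) (at x) u = frechet_derivative f (at x) u - frechet_derivative g (at x) u"
  by (simp add: frechet_derivative_eqI[OF has_derivative_diff[OF assms[THEN has_frechet_derivative]]])

lemma frechet_derivative_mult:
  fixes f g :: "'a::real_normed_vector \<Rightarrow> real"
  assumes "f differentiable (at x)" "g differentiable (at x)"
  shows "frechet_derivative (\<lambda>y. f y * g y) (at x) u = f x * frechet_derivative g (at x) u + frechet_derivative f (at x) u * g x"
  by (simp add: frechet_derivative_eqI[OF has_derivative_mult[OF assms[THEN has_frechet_derivative]]])

lemma frechet_derivative_cmult: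
  fixes f :: "'a::real_normed_vector \<Rightarrow> real"
  assumes "f differentiable (at x)"
  shows "frechet_derivative (\<lambda>y. c * f y) (at x) u = c * frechet_derivative f (at x) u"
  by (simp add: frechet_derivative_eqI[OF has_derivative_mult_right[OF assms[THEN has_frechet_derivative]]])

lemma linear_basis_sum: "linear f \<Longrightarrow> f u = (\<Sum>b\<in>Basis. (u \<bullet> b) *\<^sub>R f b)" for u :: "'e::euclidean_space"
proof -
  assume f: "linear f"
  have "f u = f (\<Sum>b\<in>Basis. (u \<bullet> b) *\<^sub>R b)" by (simp add: euclidean_representation)
  also have "\<dots> = (\<Sum>b\<in>Basis. (u \<bullet> b) *\<^sub>R f b)" unfolding linear_sum[OF f] linear_scale[OF f] ..
  finally show ?thesis .
qed

lemma linear_frechet_family: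
  fixes \<alpha> :: "'e::euclidean_space \<Rightarrow> 'd::euclidean_space \<Rightarrow> real"
  assumes S: "open S" "x \<in> S" and l: "\<And>y. y \<in> S \<Longrightarrow> linear (\<alpha> y)" and d: "\<And>w. (\<lambda>y. \<alpha> y w) differentiable (at x)"
  shows "linear (\<lambda>w. frechet_derivative (\<lambda>y. \<alpha> y w) (at x) u)"
proof (rule linearI)
  fix w w' c
  have "frechet_derivative (\<lambda>y. \<alpha> y (w + w')) (at x) = frechet_derivative (\<lambda>y. \<alpha> y w + \<alpha> y w') (at x)"
    by (rule frechet_derivative_cong_open[OF S]) (simp add: linear_add[OF l])
  then show "frechet_derivative (\<lambda>y. \<alpha> y (w + w')) (at x) u
      = frechet_derivative (\<lambda>y. \<alpha> y w) (at x) u + frechet_derivative (\<lambda>y. \<alpha> y w') (at x) u"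
    by (simp add: frechet_derivative_add d)
  have "frechet_derivative (\<lambda>y. \<alpha> y (c *\<^sub>R w)) (at x) = frechet_derivative (\<lambda>y. c * \<alpha> y w) (at x)"
    by (rule frechet_derivative_cong_open[OF S]) (simp add: linear_scale[OF l])
  then show "frechet_derivative (\<lambda>y. \<alpha> y (c *\<^sub>R w)) (at x) u = c *\<^sub>R frechet_derivative (\<lambda>y. \<alpha> y w) (at x) u"
    by (simp add: frechet_derivative_cmult d)
qed

lemma smooth_on_apply:
  fixes \<alpha> :: "'e::euclidean_space \<Rightarrow> 'd::euclidean_space \<Rightarrow> real"
  assumes S: "open S" and l: "\<And>y. y \<in> S \<Longrightarrow> linear (\<alpha> y)" and s: "\<And>w. smooth_on S (\<lambda>y. \<alpha> y w)" and Z: "smooth_on S Z"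
  shows "smooth_on S (\<lambda>y. \<alpha> y (Z y))"
proof (rule smooth_on_cong[OF S])
  show "smooth_on S (\<lambda>y. \<Sum>b\<in>Basis. (Z y \<bullet> b) * \<alpha> y b)"
    by (intro smooth_on_sum smooth_on_mult S s smooth_on_linear_comp[OF bounded_linear_inner_left] Z)
  show "(\<Sum>b\<in>Basis. (Z y \<bullet> b) * \<alpha> y b) = \<alpha> y (Z y)" if "y \<in> S" for y
    using linear_basis_sum[OF l[OF that], of "Z y"] by simp
qed

text \<open>Leibniz rule for a varying linear form applied to a varying vector. Derivatives are
  available for constant arguments, so both terms are obtained from the expansion of
  \<open>Z y\<close> in the standard basis.\<close>

lemma frechet_derivative_apply:
  fixes \<alpha> :: "'e::euclidean_space \<Rightarrow> 'd::euclidean_space \<Rightarrow> real"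
  assumes S: "open S" "x \<in> S" and l: "\<And>y. y \<in> S \<Longrightarrow> linear (\<alpha> y)" and d: "\<And>w. (\<lambda>y. \<alpha> y w) differentiable (at x)"
    and Z: "Z differentiable (at x)"
  shows "frechet_derivative (\<lambda>y. \<alpha> y (Z y)) (at x) u =
    \<alpha> x (frechet_derivative Z (at x) u) + frechet_derivative (\<lambda>y. \<alpha> y (Z x)) (at x) u"
proof -
  have hZ: "((\<lambda>y. Z y \<bullet> b) has_derivative (\<lambda>u. frechet_derivative Z (at x) u \<bullet> b)) (at x)" for b
    by (intro has_derivative_inner_left has_frechet_derivative Z)
  have "frechet_derivative (\<lambda>y. \<alpha> y (Z y)) (at x) u = frechet_derivative (\<lambda>y. \<Sum>b\<in>Basis. (Z y \<bullet> b) * \<alpha> y b) (at x) u"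
    by (rule fun_cong[OF frechet_derivative_cong_open[OF S]]) (use linear_basis_sum[OF l] in simp)
  also have "\<dots> = (\<Sum>b\<in>Basis. (Z x \<bullet> b) * frechet_derivative (\<lambda>y. \<alpha> y b) (at x) u
      + (frechet_derivative Z (at x) u \<bullet> b) * \<alpha> x b)"
    by (subst frechet_derivative_eqI[OF has_derivative_sum[OF has_derivative_mult[OF hZ has_frechet_derivative[OF d]]]]) simp
  also have "\<dots> = frechet_derivative (\<lambda>y. \<alpha> y (Z x)) (at x) u + \<alpha> x (frechet_derivative Z (at x) u)"
    using linear_basis_sum[OF linear_frechet_family[OF S l d], of "Z x" u]
      linear_basis_sum[OF l[OF S(2)], of "frechet_derivative Z (at x) u"]
    by (simp add: sum.distrib)
  finally show ?thesis by simp
qed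

text \<open>The dimension is a parameter because the locale is used twice: for the base, and with
  \<open>Suc n\<close> for the cylinder over it.\<close>

locale orthonormal_coframe =
  fixes n :: nat and V :: "'e::euclidean_space set" and e :: "nat \<Rightarrow> 'e \<Rightarrow> 'e \<Rightarrow> real" and E :: "nat \<Rightarrow> 'e \<Rightarrow> 'e"
    and g :: "'e metric_tensor"
  assumes V: "open V"
    and lin_e: "a \<in> {1..n} \<Longrightarrow> y \<in> V \<Longrightarrow> linear (e a y)"
    and smooth_e: "a \<in> {1..n} \<Longrightarrow> smooth_on V (\<lambda>y. e a y u)"
    and smooth_E: "a \<in> {1..n} \<Longrightarrow> smooth_on V (E a)"
    and dual: "a \<in> {1..n} \<Longrightarrow> b \<in> {1..n} \<Longrightarrow> y \<in> V \<Longrightarrow> e a y (E b y) = (if a = b then 1 else 0)"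
    and expand: "y \<in> V \<Longrightarrow> u = (\<Sum>a=1..n. e a y u *\<^sub>R E a y)"
    and metric: "y \<in> V \<Longrightarrow> g y u v = (\<Sum>a=1..n. e a y u * e a y v)"
begin

lemma diff_e: "a \<in> {1..n} \<Longrightarrow> x \<in> V \<Longrightarrow> (\<lambda>y. e a y u) differentiable (at x)"
  by (rule smooth_on_differentiable[OF smooth_e])

lemma smooth_g: "smooth_on V (\<lambda>y. g y u v)"
  by (rule smooth_on_cong[OF V, of "\<lambda>y. \<Sum>a=1..n. e a y u * e a y v"])
    (auto intro!: smooth_on_sum smooth_on_mult V smooth_e simp: metric)

lemma diff_g: "x \<in> V \<Longrightarrow> (\<lambda>y. g y u v) differentiable (at x)"
  by (rule smooth_on_differentiable[OF smooth_g])

lemma g_commute: "y \<in> V \<Longrightarrow> g y u v = g y v u"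
  by (simp add: metric mult.commute)

lemma linear_g: "y \<in> V \<Longrightarrow> linear (g y u)"
proof -
  assume y: "y \<in> V"
  have "linear (\<lambda>v. \<Sum>a=1..n. e a y u * e a y v)"
    by (intro linear_compose_sum ballI linear_mult_right' lin_e y)
  moreover have "g y u = (\<lambda>v. \<Sum>a=1..n. e a y u * e a y v)" using metric[OF y] by blast
  ultimately show ?thesis by simp
qed

lemma linear_g': "y \<in> V \<Longrightarrow> linear (\<lambda>u. g y u v)"
proof -
  assume y: "y \<in> V"
  have "(\<lambda>u. g y u v) = g y v" using g_commute[OF y] by blast
  then show ?thesis using linear_g[OF y] by simp
qed

lemma g_E: "y \<in> V \<Longrightarrow> a \<in> {1..n} \<Longrightarrow> g y u (E a y) = e a y u"
  by (simp add: metric dual if_distrib cong: if_cong)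

lemma e_eqI: "y \<in> V \<Longrightarrow> (\<And>a. a \<in> {1..n} \<Longrightarrow> e a y u = e a y v) \<Longrightarrow> u = v"
proof -
  assume y: "y \<in> V" and eq: "\<And>a. a \<in> {1..n} \<Longrightarrow> e a y u = e a y v"
  have "u = (\<Sum>a=1..n. e a y u *\<^sub>R E a y)" by (rule expand[OF y])
  also have "\<dots> = (\<Sum>a=1..n. e a y v *\<^sub>R E a y)" by (rule sum.cong) (simp_all add: eq)
  also have "\<dots> = v" by (rule expand[OF y, symmetric])
  finally show ?thesis .
qed

section \<open>The Levi-Civita connection in an orthonormal coframe\<close>

definition koszul where
  "koszul x u v w = (frechet_derivative (\<lambda>y. g y v w) (at x) u + frechet_derivative (\<lambda>y. g y u w) (at x) v
        - frechet_derivative (\<lambda>y. g y u v) (at x) w) / 2"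

lemma linear_Dg: "x \<in> V \<Longrightarrow> linear (\<lambda>w. frechet_derivative (\<lambda>y. g y v w) (at x) u)"
  by (rule linear_frechet_family[OF V]) (auto intro: linear_g diff_g)

lemma linear_Dg': "x \<in> V \<Longrightarrow> linear (\<lambda>v. frechet_derivative (\<lambda>y. g y v w) (at x) u)"
  by (rule linear_frechet_family[OF V]) (auto intro: linear_g' diff_g)

lemma linear_D: "x \<in> V \<Longrightarrow> linear (\<lambda>u. frechet_derivative (\<lambda>y. g y v w) (at x) u)"
  by (rule linear_frechet_derivative) (rule diff_g)

lemma linear_koszul: "x \<in> V \<Longrightarrow> linear (koszul x u v)"
  and linear_koszul_2: "x \<in> V \<Longrightarrow> linear (\<lambda>v. koszul x u v w)"
  unfolding koszul_def divide_inverse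
  by (intro linear_mult_left' linear_compose_add linear_compose_sub linear_Dg linear_Dg' linear_D; assumption)+

lemma koszul_commute: "x \<in> V \<Longrightarrow> koszul x u v w = koszul x v u w"
proof -
  assume x: "x \<in> V"
  have "frechet_derivative (\<lambda>y. g y u v) (at x) = frechet_derivative (\<lambda>y. g y v u) (at x)"
    by (rule frechet_derivative_cong_open[OF V x]) (rule g_commute)
  then show ?thesis unfolding koszul_def by simp
qed

text \<open>The frame solves the Koszul formula explicitly. So the definite description in
  \<open>christoffel\<close> denotes, and its smoothness can be read off from that of the
  frame.\<close>

lemma christoffel_expand:
  assumes x: "x \<in> V"
  shows "christoffel g x u v = (\<Sum>a=1..n. koszul x u v (E a x) *\<^sub>R E a x)"
proof -
  define z where "z = (\<Sum>a=1..n. koszul x u v (E a x) *\<^sub>R E a x)"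
  have ez: "e a x z = koszul x u v (E a x)" if "a \<in> {1..n}" for a
    unfolding z_def linear_sum[OF lin_e[OF that x]] linear_scale[OF lin_e[OF that x]]
    using that x by (simp add: dual if_distrib cong: if_cong)
  have gz: "g x z w = koszul x u v w" for w
  proof -
    have "koszul x u v w = koszul x u v (\<Sum>a=1..n. e a x w *\<^sub>R E a x)" using expand[OF x, of w] by simp
    also have "\<dots> = (\<Sum>a=1..n. e a x w * koszul x u v (E a x))"
      by (simp add: linear_sum[OF linear_koszul[OF x]] linear_scale[OF linear_koszul[OF x]])
    also have "\<dots> = g x z w" unfolding metric[OF x] by (rule sum.cong) (simp_all add: ez)
    finally show ?thesis by simp
  qed
  have "christoffel g x u v = z"
    unfolding christoffel_def koszul_def[symmetric]
  proof (rule the_equality)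
    show "\<forall>w. g x z w = koszul x u v w" using gz by blast
    fix z' assume z': "\<forall>w. g x z' w = koszul x u v w"
    show "z' = z"
    proof (rule e_eqI[OF x])
      fix a assume "a \<in> {1..n}"
      then show "e a x z' = e a x z" using z' ez by (simp add: g_E[OF x, symmetric] flip: gz)
    qed
  qed
  then show ?thesis by (simp add: z_def)
qed

lemma g_christoffel:
  assumes x: "x \<in> V"
  shows "g x (christoffel g x u v) w = koszul x u v w"
proof -
  have "g x (christoffel g x u v) w = (\<Sum>a=1..n. koszul x u v (E a x) * e a x w)"
    unfolding christoffel_expand[OF x] linear_sum[OF linear_g'[OF x]] linear_scale[OF linear_g'[OF x]]
    by (rule sum.cong) (simp_all add: g_commute[OF x, of "E _ x"] g_E[OF x])
  also have "\<dots> = koszul x u v (\<Sum>a=1..n. e a x w *\<^sub>R E a x)"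
    by (simp add: linear_sum[OF linear_koszul[OF x]] linear_scale[OF linear_koszul[OF x]] mult.commute)
  finally show ?thesis using expand[OF x, of w] by simp
qed

lemma christoffel_eqI:
  assumes x: "x \<in> V" and "\<And>w. g x z w = koszul x u v w"
  shows "christoffel g x u v = z"
  by (rule e_eqI[OF x]) (simp add: g_E[OF x, symmetric] g_christoffel[OF x] assms(2))

lemma christoffel_commute: "x \<in> V \<Longrightarrow> christoffel g x u v = christoffel g x v u"
  by (simp add: christoffel_expand koszul_commute)

lemma linear_christoffel: "x \<in> V \<Longrightarrow> linear (christoffel g x u)"
proof -
  assume x: "x \<in> V"
  have "linear (\<lambda>v. \<Sum>a=1..n. koszul x u v (E a x) *\<^sub>R E a x)"
    by (intro linear_compose_sum ballI linearI)
      (simp_all add: linear_add[OF linear_koszul_2[OF x]] linear_scale[OF linear_koszul_2[OF x]] algebra_simps)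
  moreover have "christoffel g x u = (\<lambda>v. \<Sum>a=1..n. koszul x u v (E a x) *\<^sub>R E a x)"
    using christoffel_expand[OF x] by blast
  ultimately show ?thesis by simp
qed

lemma linear_christoffel': "x \<in> V \<Longrightarrow> linear (\<lambda>u. christoffel g x u v)"
proof -
  assume x: "x \<in> V"
  have "(\<lambda>u. christoffel g x u v) = christoffel g x v" using christoffel_commute[OF x] by blast
  then show ?thesis using linear_christoffel[OF x] by simp
qed

lemma smooth_christoffel: "smooth_on V (\<lambda>y. christoffel g y u v)"
proof (rule smooth_on_cong[OF V])
  have k: "smooth_on V (\<lambda>y. koszul y u v w)" for w
    unfolding koszul_def
    by (intro smooth_on_divide smooth_on_add smooth_on_diff smooth_on_frechet_derivative smooth_g V smooth_on_const) simp
  show "smooth_on V (\<lambda>y. \<Sum>a=1..n. koszul y u v (E a y) *\<^sub>R E a y)"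
    by (intro smooth_on_sum smooth_on_scaleR V smooth_E smooth_on_apply[OF V linear_koszul k])
qed (simp add: christoffel_expand)

lemma diff_christoffel: "x \<in> V \<Longrightarrow> (\<lambda>y. christoffel g y u v) differentiable (at x)"
  by (rule smooth_on_differentiable[OF smooth_christoffel])

lemma metric_compatible:
  assumes x: "x \<in> V"
  shows "frechet_derivative (\<lambda>y. g y v w) (at x) u = g x (christoffel g x u v) w + g x v (christoffel g x u w)"
proof -
  have c: "frechet_derivative (\<lambda>y. g y a b) (at x) = frechet_derivative (\<lambda>y. g y b a) (at x)" for a b
    by (rule frechet_derivative_cong_open[OF V x]) (rule g_commute)
  show ?thesis
    unfolding g_commute[OF x, of v "christoffel g x u w"] g_christoffel[OF x] koszul_def c[of w v]
    by (simp add: field_simps)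
qed

text \<open>\<open>cov a x u v\<close> is \<open>(\<nabla>\<^sub>u e\<^sup>a)(v)\<close> and \<open>\<psi>\<close> is the matrix of connection forms, \<open>\<nabla>e\<^sup>a = - \<Sum>\<^sub>b \<psi>\<^sub>a\<^sub>b \<otimes> e\<^sup>b\<close>.\<close>

definition cov where
  "cov a x u v = frechet_derivative (\<lambda>y. e a y v) (at x) u - e a x (christoffel g x u v)"

definition \<psi> where "\<psi> a b x u = - cov a x u (E b x)"

lemma linear_cov: "a \<in> {1..n} \<Longrightarrow> x \<in> V \<Longrightarrow> linear (cov a x u)"
proof -
  assume a: "a \<in> {1..n}" and x: "x \<in> V"
  have "linear (\<lambda>v. frechet_derivative (\<lambda>y. e a y v) (at x) u - e a x (christoffel g x u v))"
    by (intro linear_compose_sub linear_frechet_family[OF V x] lin_e diff_e a x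
        linear_compose[OF linear_christoffel[OF x] lin_e[OF a x], unfolded o_def])
  then show ?thesis unfolding cov_def .
qed

lemma linear_cov': "a \<in> {1..n} \<Longrightarrow> x \<in> V \<Longrightarrow> linear (\<lambda>u. cov a x u v)"
  unfolding cov_def
  by (intro linear_compose_sub linear_frechet_derivative diff_e
      linear_compose[OF linear_christoffel' lin_e, unfolded o_def])

lemma linear_\<psi>: "a \<in> {1..n} \<Longrightarrow> x \<in> V \<Longrightarrow> linear (\<psi> a b x)"
proof -
  assume a: "a \<in> {1..n}" and x: "x \<in> V"
  have "\<psi> a b x = (\<lambda>u. - cov a x u (E b x))" by (rule ext) (simp add: \<psi>_def)
  then show ?thesis using linear_compose_neg[OF linear_cov'[OF a x]] by simp
qed

lemma smooth_\<psi>: "a \<in> {1..n} \<Longrightarrow> b \<in> {1..n} \<Longrightarrow> smooth_on V (\<lambda>y. \<psi> a b y u)"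
proof -
  assume a: "a \<in> {1..n}" and b: "b \<in> {1..n}"
  have s: "smooth_on V (\<lambda>y. cov a y u v)" for v
    unfolding cov_def
    by (intro smooth_on_diff smooth_on_frechet_derivative smooth_e a V smooth_on_apply[OF V lin_e[OF a]] smooth_christoffel)
  show ?thesis
    unfolding \<psi>_def
    by (rule smooth_on_minus[OF V smooth_on_apply[where \<alpha> = "\<lambda>y. cov a y u", OF V linear_cov[OF a] s smooth_E[OF b]]])
qed

lemma diff_\<psi>: "a \<in> {1..n} \<Longrightarrow> b \<in> {1..n} \<Longrightarrow> x \<in> V \<Longrightarrow> (\<lambda>y. \<psi> a b y u) differentiable (at x)"
  by (rule smooth_on_differentiable[OF smooth_\<psi>])

lemma cov_eq: "a \<in> {1..n} \<Longrightarrow> x \<in> V \<Longrightarrow> cov a x u v = - (\<Sum>b=1..n. \<psi> a b x u * e b x v)"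
proof -
  assume a: "a \<in> {1..n}" and x: "x \<in> V"
  have "cov a x u v = cov a x u (\<Sum>b=1..n. e b x v *\<^sub>R E b x)" using expand[OF x, of v] by simp
  also have "\<dots> = (\<Sum>b=1..n. e b x v * cov a x u (E b x))"
    unfolding linear_sum[OF linear_cov[OF a x]] linear_scale[OF linear_cov[OF a x]] by simp
  finally show ?thesis by (simp add: \<psi>_def sum_negf mult.commute)
qed

lemma D_e: "a \<in> {1..n} \<Longrightarrow> x \<in> V \<Longrightarrow> frechet_derivative (\<lambda>y. e a y v) (at x) u
    = e a x (christoffel g x u v) - (\<Sum>b=1..n. \<psi> a b x u * e b x v)"
  using cov_eq[of a x u v] by (simp add: cov_def)

text \<open>The metric is parallel and is the sum of the squares of the e^c, so the symmetrised
  products of e^c with its covariant derivative sum to zero; evaluate this on \<open>E a\<close> and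
  \<open>E b\<close>.\<close>

lemma \<psi>_skew:
  assumes a: "a \<in> {1..n}" and b: "b \<in> {1..n}" and x: "x \<in> V"
  shows "\<psi> a b x u = - \<psi> b a x u"
proof -
  have *: "(\<Sum>c=1..n. cov c x u v * e c x w + e c x v * cov c x u w) = 0" for v w
  proof -
    have "frechet_derivative (\<lambda>y. g y v w) (at x) u = frechet_derivative (\<lambda>y. \<Sum>c=1..n. e c y v * e c y w) (at x) u"
      by (rule fun_cong[OF frechet_derivative_cong_open[OF V x]]) (rule metric)
    also have "\<dots> = (\<Sum>c=1..n. e c x v * frechet_derivative (\<lambda>y. e c y w) (at x) u
        + frechet_derivative (\<lambda>y. e c y v) (at x) u * e c x w)"
      by (subst frechet_derivative_sum) (auto intro!: differentiable_mult diff_e x sum.cong frechet_derivative_mult)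
    finally have "(\<Sum>c=1..n. e c x v * frechet_derivative (\<lambda>y. e c y w) (at x) u
        + frechet_derivative (\<lambda>y. e c y v) (at x) u * e c x w)
      = (\<Sum>c=1..n. e c x (christoffel g x u v) * e c x w) + (\<Sum>c=1..n. e c x v * e c x (christoffel g x u w))"
      using metric_compatible[OF x, of v w u] by (simp add: metric[OF x])
    then show ?thesis
      by (simp add: cov_def sum.distrib sum_subtractf algebra_simps)
  qed
  have "cov b x u (E a x) + cov a x u (E b x) = 0"
    using *[of "E a x" "E b x"] a b x
    by (simp add: sum.distrib dual if_distrib if_distribR cong: if_cong)
  then show ?thesis by (simp add: \<psi>_def)
qed

section \<open>Curvature forms and Ricci curvature\<close>

definition d\<psi> where
  "d\<psi> a b x u v = frechet_derivative (\<lambda>y. \<psi> a b y v) (at x) u - frechet_derivative (\<lambda>y. \<psi> a b y u) (at x) v"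

text \<open>The matrix d\<psi> + \<psi> \<and> \<psi> of Cartan's second structure equation.\<close>

definition \<Omega> where
  "\<Omega> a c x u v = d\<psi> a c x u v + (\<Sum>b=1..n. \<psi> a b x u * \<psi> b c x v - \<psi> a b x v * \<psi> b c x u)"

text \<open>Differentiates \<open>D_e\<close> once more and uses it again for the first derivatives
  that arise. Antisymmetrised in u and v, this becomes the structure equation.\<close>

lemma DD_e:
  assumes a: "a \<in> {1..n}" and x: "x \<in> V"
  shows "frechet_derivative (\<lambda>y. frechet_derivative (\<lambda>y. e a y w) (at y) v) (at x) u =
    e a x (frechet_derivative (\<lambda>y. christoffel g y v w) (at x) u)
    + (e a x (christoffel g x u (christoffel g x v w)) - (\<Sum>b=1..n. \<psi> a b x u * e b x (christoffel g x v w)))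
    - (\<Sum>b=1..n. \<psi> a b x v * (e b x (christoffel g x u w) - (\<Sum>c=1..n. \<psi> b c x u * e c x w))
        + frechet_derivative (\<lambda>y. \<psi> a b y v) (at x) u * e b x w)"
proof -
  have d1: "(\<lambda>y. e a y (christoffel g y v w)) differentiable (at x)"
    by (rule smooth_on_differentiable[OF smooth_on_apply[OF V lin_e[OF a] smooth_e[OF a] smooth_christoffel] x])
  have d2: "(\<lambda>y. \<Sum>b=1..n. \<psi> a b y v * e b y w) differentiable (at x)"
    by (rule smooth_on_differentiable[OF _ x]) (intro smooth_on_sum smooth_on_mult V smooth_\<psi> smooth_e a)
  have "frechet_derivative (\<lambda>y. frechet_derivative (\<lambda>y. e a y w) (at y) v) (at x) u
      = frechet_derivative (\<lambda>y. e a y (christoffel g y v w) - (\<Sum>b=1..n. \<psi> a b y v * e b y w)) (at x) u"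
    by (rule fun_cong[OF frechet_derivative_cong_open[OF V x]]) (rule D_e[OF a])
  also have "\<dots> = (e a x (frechet_derivative (\<lambda>y. christoffel g y v w) (at x) u)
      + frechet_derivative (\<lambda>y. e a y (christoffel g x v w)) (at x) u)
    - (\<Sum>b=1..n. \<psi> a b x v * frechet_derivative (\<lambda>y. e b y w) (at x) u
        + frechet_derivative (\<lambda>y. \<psi> a b y v) (at x) u * e b x w)"
  proof -
    have "frechet_derivative (\<lambda>y. \<Sum>b=1..n. \<psi> a b y v * e b y w) (at x) u =
      (\<Sum>b=1..n. \<psi> a b x v * frechet_derivative (\<lambda>y. e b y w) (at x) u
        + frechet_derivative (\<lambda>y. \<psi> a b y v) (at x) u * e b x w)"
      by (subst frechet_derivative_sum)
        (auto intro!: differentiable_mult diff_e diff_\<psi> a x sum.cong frechet_derivative_mult)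
    then show ?thesis
      using frechet_derivative_diff[OF d1 d2]
        frechet_derivative_apply[OF V x lin_e[OF a] diff_e[OF a x] diff_christoffel[OF x, of v w]] by simp
  qed
  also have "\<dots> = e a x (frechet_derivative (\<lambda>y. christoffel g y v w) (at x) u)
    + (e a x (christoffel g x u (christoffel g x v w)) - (\<Sum>b=1..n. \<psi> a b x u * e b x (christoffel g x v w)))
    - (\<Sum>b=1..n. \<psi> a b x v * (e b x (christoffel g x u w) - (\<Sum>c=1..n. \<psi> b c x u * e c x w))
        + frechet_derivative (\<lambda>y. \<psi> a b y v) (at x) u * e b x w)"
  proof -
    have "(\<Sum>b=1..n. \<psi> a b x v * frechet_derivative (\<lambda>y. e b y w) (at x) u
        + frechet_derivative (\<lambda>y. \<psi> a b y v) (at x) u * e b x w) =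
      (\<Sum>b=1..n. \<psi> a b x v * (e b x (christoffel g x u w) - (\<Sum>c=1..n. \<psi> b c x u * e c x w))
        + frechet_derivative (\<lambda>y. \<psi> a b y v) (at x) u * e b x w)"
      by (rule sum.cong[OF refl]) (simp only: D_e[OF _ x])
    then show ?thesis by (simp only: D_e[OF a x])
  qed
  finally show ?thesis .
qed

text \<open>Second derivatives commute, so the two sides of \<open>DD_e\<close> with u and v
  exchanged agree. The Christoffel terms assemble to the curvature, the terms free of Christoffel
  symbols to \<Omega>, and the mixed ones are symmetric in u and v and drop out.\<close>

lemma cartan:
  assumes a: "a \<in> {1..n}" and x: "x \<in> V"
  shows "e a x (curvature g x u v w) = (\<Sum>c=1..n. \<Omega> a c x u v * e c x w)"
proof -
  have l: "linear (e a x)" by (rule lin_e[OF a x])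
  have R: "e a x (curvature g x u v w) =
      e a x (frechet_derivative (\<lambda>y. christoffel g y v w) (at x) u) - e a x (frechet_derivative (\<lambda>y. christoffel g y u w) (at x) v)
      + e a x (christoffel g x u (christoffel g x v w)) - e a x (christoffel g x v (christoffel g x u w))"
    unfolding curvature_def by (simp add: linear_add[OF l] linear_diff[OF l])
  have sw: "(\<Sum>b=1..n. \<psi> a b x p * (\<Sum>c=1..n. \<psi> b c x q * e c x w)) = (\<Sum>c=1..n. (\<Sum>b=1..n. \<psi> a b x p * \<psi> b c x q) * e c x w)" for p q
    unfolding sum_distrib_left sum_distrib_right by (subst sum.swap) (simp add: mult.assoc)
  have "frechet_derivative (\<lambda>y. frechet_derivative (\<lambda>y. e a y w) (at y) v) (at x) u
      = frechet_derivative (\<lambda>y. frechet_derivative (\<lambda>y. e a y w) (at y) u) (at x) v"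
    by (rule frechet_derivative_commute[OF smooth_e[OF a] V x])
  then show ?thesis
    unfolding DD_e[OF a x] R \<Omega>_def d\<psi>_def
    by (simp add: sum.distrib sum_subtractf right_diff_distrib left_diff_distrib distrib_right sw)
qed

text \<open>The connection has no torsion: the Christoffel symbols and their derivatives are
  symmetric, so the terms of the cyclic sum cancel in pairs.\<close>

lemma bianchi:
  assumes x: "x \<in> V"
  shows "curvature g x u v w + curvature g x v w u + curvature g x w u v = 0"
proof -
  have c: "frechet_derivative (\<lambda>y. christoffel g y p q) (at x) = frechet_derivative (\<lambda>y. christoffel g y q p) (at x)" for p q
    by (rule frechet_derivative_cong_open[OF V x]) (rule christoffel_commute)
  show ?thesis
    unfolding curvature_def c[of w u] c[of w v] c[of v u]
      christoffel_commute[OF x, of w u] christoffel_commute[OF x, of w v] christoffel_commute[OF x, of v u]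
    by (simp add: algebra_simps)
qed

lemma linear_\<Omega>: "a \<in> {1..n} \<Longrightarrow> c \<in> {1..n} \<Longrightarrow> x \<in> V \<Longrightarrow> linear (\<lambda>u. \<Omega> a c x u v)"
  unfolding \<Omega>_def d\<psi>_def
  by (intro linear_compose_add linear_compose_sub linear_compose_sum ballI linear_mult_left' linear_mult_right' linear_\<psi>
      linear_frechet_derivative diff_\<psi> linear_frechet_family[OF V])

lemma \<Omega>_swap: "\<Omega> a c x v u = - \<Omega> a c x u v"
  unfolding \<Omega>_def d\<psi>_def by (simp add: sum_subtractf)

lemma \<Omega>_skew:
  assumes a: "a \<in> {1..n}" and c: "c \<in> {1..n}" and x: "x \<in> V"
  shows "\<Omega> c a x u v = - \<Omega> a c x u v"
proof -
  have D: "frechet_derivative (\<lambda>y. \<psi> c a y v) (at x) u = - frechet_derivative (\<lambda>y. \<psi> a c y v) (at x) u" for u v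
  proof -
    have "frechet_derivative (\<lambda>y. \<psi> c a y v) (at x) u = frechet_derivative (\<lambda>y. (-1) * \<psi> a c y v) (at x) u"
      by (rule fun_cong[OF frechet_derivative_cong_open[OF V x]]) (use \<psi>_skew[OF c a] in simp)
    also have "\<dots> = (-1) * frechet_derivative (\<lambda>y. \<psi> a c y v) (at x) u"
      by (rule frechet_derivative_cmult[OF diff_\<psi>[OF a c x]])
    finally show ?thesis by simp
  qed
  have "d\<psi> c a x u v = - d\<psi> a c x u v"
    unfolding d\<psi>_def D by simp
  moreover have "(\<Sum>b=1..n. \<psi> c b x u * \<psi> b a x v - \<psi> c b x v * \<psi> b a x u) =
      - (\<Sum>b=1..n. \<psi> a b x u * \<psi> b c x v - \<psi> a b x v * \<psi> b c x u)"
    unfolding sum_negf[symmetric]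
  proof (rule sum.cong)
    fix b assume b: "b \<in> {1..n}"
    show "\<psi> c b x u * \<psi> b a x v - \<psi> c b x v * \<psi> b a x u = - (\<psi> a b x u * \<psi> b c x v - \<psi> a b x v * \<psi> b c x u)"
      unfolding \<psi>_skew[OF c b x] \<psi>_skew[OF b a x] by (simp add: algebra_simps)
  qed simp
  ultimately show ?thesis unfolding \<Omega>_def by simp
qed

text \<open>A trace may be taken in any basis; here it passes from the standard basis of the chart
  to the frame E, where Cartan's equation applies.\<close>

lemma ricci_\<Omega>:
  assumes x: "x \<in> V"
  shows "ricci g x v w = (\<Sum>c=1..n. (\<Sum>a=1..n. \<Omega> a c x (E a x) v) * e c x w)"
proof -
  have "ricci g x v w = (\<Sum>b\<in>Basis. \<Sum>a=1..n. (E a x \<bullet> b) * e a x (curvature g x b v w))"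
    unfolding ricci_def
  proof (rule sum.cong)
    fix b :: 'e
    have "curvature g x b v w \<bullet> b = (\<Sum>a=1..n. e a x (curvature g x b v w) *\<^sub>R E a x) \<bullet> b"
      using expand[OF x, of "curvature g x b v w"] by simp
    then show "curvature g x b v w \<bullet> b = (\<Sum>a=1..n. (E a x \<bullet> b) * e a x (curvature g x b v w))"
      by (simp add: inner_sum_left mult.commute)
  qed simp
  also have "\<dots> = (\<Sum>a=1..n. \<Sum>b\<in>Basis. (E a x \<bullet> b) * e a x (curvature g x b v w))"
    by (rule sum.swap)
  also have "\<dots> = (\<Sum>a=1..n. \<Sum>c=1..n. \<Omega> a c x (E a x) v * e c x w)"
  proof (rule sum.cong)
    fix a assume a: "a \<in> {1..n}"
    have "(\<Sum>b\<in>Basis. (E a x \<bullet> b) * e a x (curvature g x b v w)) =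
        (\<Sum>b\<in>Basis. \<Sum>c=1..n. ((E a x \<bullet> b) * \<Omega> a c x b v) * e c x w)"
      by (simp add: cartan[OF a x] sum_distrib_left mult.assoc)
    also have "\<dots> = (\<Sum>c=1..n. (\<Sum>b\<in>Basis. (E a x \<bullet> b) * \<Omega> a c x b v) * e c x w)"
      by (subst sum.swap) (simp add: sum_distrib_right)
    also have "\<dots> = (\<Sum>c=1..n. \<Omega> a c x (E a x) v * e c x w)"
      using linear_basis_sum[OF linear_\<Omega>[OF a _ x], of _ "E a x"] by simp
    finally show "(\<Sum>b\<in>Basis. (E a x \<bullet> b) * e a x (curvature g x b v w)) = (\<Sum>c=1..n. \<Omega> a c x (E a x) v * e c x w)" .
  qed simp
  also have "\<dots> = (\<Sum>c=1..n. (\<Sum>a=1..n. \<Omega> a c x (E a x) v) * e c x w)"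
    by (subst sum.swap) (simp add: sum_distrib_right)
  finally show ?thesis .
qed

end

section \<open>Sasaki-Einstein structures are Einstein\<close>

definition kd :: "nat \<Rightarrow> nat \<Rightarrow> real" where
  "kd a b = (if a = b then 1 else 0)"

text \<open>The value of e^a \<and> e^b on the frame vectors with numbers i and j.\<close>

definition kd2 :: "nat \<Rightarrow> nat \<Rightarrow> nat \<Rightarrow> nat \<Rightarrow> real" where
  "kd2 a b i j = kd a i * kd b j - kd a j * kd b i"

text \<open>Value on \<open>(E\<^sub>i, E\<^sub>j, E\<^sub>l)\<close> of \<open>d(e\<^sup>a \<and> e\<^sup>b) = de\<^sup>a \<and> e\<^sup>b - e\<^sup>a \<and> de\<^sup>b\<close>, where \<open>q\<^sub>a\<^sub>b\<^sub>c = \<psi>\<^sub>a\<^sub>b(E\<^sub>c)\<close>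
  and hence \<open>de\<^sup>a(E\<^sub>i, E\<^sub>j) = q\<^sub>a\<^sub>i\<^sub>j - q\<^sub>a\<^sub>j\<^sub>i\<close>.\<close>

definition dcoeff :: "(nat \<Rightarrow> nat \<Rightarrow> nat \<Rightarrow> real) \<Rightarrow> nat \<Rightarrow> nat \<Rightarrow> nat \<Rightarrow> nat \<Rightarrow> nat \<Rightarrow> real" where
  "dcoeff q a b i j l =
     (q a i j - q a j i) * kd b l - (q a i l - q a l i) * kd b j + (q a j l - q a l j) * kd b i
     - (kd a i * (q b j l - q b l j) - kd a j * (q b i l - q b l i) + kd a l * (q b i j - q b j i))"

text \<open>A linear system for the 50 components of a skew connection matrix. It forces the 35
  combinations listed here. The other 15 are the anti-self-dual part: it belongs to the Lie algebra
  that fixes all three 2-forms and \<eta>, so it cannot show in their derivatives.\<close>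

lemma sasaki_connection_coefficients:
  fixes q :: "nat \<Rightarrow> nat \<Rightarrow> nat \<Rightarrow> real"
  assumes skew: "\<And>a b c. a \<in> {1..5} \<Longrightarrow> b \<in> {1..5} \<Longrightarrow> q a b c = - q b a c"
    and deta: "\<And>i j. i \<in> {1..5} \<Longrightarrow> j \<in> {1..5} \<Longrightarrow> q 5 i j - q 5 j i = - 2 * (kd2 1 4 i j + kd2 2 3 i j)"
    and dw1: "\<And>i j l. i \<in> {1..5} \<Longrightarrow> j \<in> {1..5} \<Longrightarrow> l \<in> {1..5} \<Longrightarrow> dcoeff q 1 2 i j l + dcoeff q 3 4 i j l =
        3 * (kd 5 i * (kd2 1 3 j l + kd2 4 2 j l) - kd 5 j * (kd2 1 3 i l + kd2 4 2 i l) + kd 5 l * (kd2 1 3 i j + kd2 4 2 i j))"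
    and dw2: "\<And>i j l. i \<in> {1..5} \<Longrightarrow> j \<in> {1..5} \<Longrightarrow> l \<in> {1..5} \<Longrightarrow> dcoeff q 1 3 i j l + dcoeff q 4 2 i j l =
        - 3 * (kd 5 i * (kd2 1 2 j l + kd2 3 4 j l) - kd 5 j * (kd2 1 2 i l + kd2 3 4 i l) + kd 5 l * (kd2 1 2 i j + kd2 3 4 i j))"
    and dw3: "\<And>i j l. i \<in> {1..5} \<Longrightarrow> j \<in> {1..5} \<Longrightarrow> l \<in> {1..5} \<Longrightarrow> dcoeff q 1 4 i j l + dcoeff q 2 3 i j l = 0"
  shows "q 5 1 1 = 0 \<and> q 5 1 2 = 0 \<and> q 5 1 3 = 0 \<and> q 5 1 4 = - 1 \<and> q 5 1 5 = 0"
    and "q 5 2 1 = 0 \<and> q 5 2 2 = 0 \<and> q 5 2 3 = - 1 \<and> q 5 2 4 = 0 \<and> q 5 2 5 = 0"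
    and "q 5 3 1 = 0 \<and> q 5 3 2 = 1 \<and> q 5 3 3 = 0 \<and> q 5 3 4 = 0 \<and> q 5 3 5 = 0"
    and "q 5 4 1 = 1 \<and> q 5 4 2 = 0 \<and> q 5 4 3 = 0 \<and> q 5 4 4 = 0 \<and> q 5 4 5 = 0"
    and "q 1 2 1 + q 3 4 1 = 0 \<and> q 1 2 2 + q 3 4 2 = 0 \<and> q 1 2 3 + q 3 4 3 = 0 \<and> q 1 2 4 + q 3 4 4 = 0 \<and> q 1 2 5 + q 3 4 5 = 0"
    and "q 1 3 1 + q 4 2 1 = 0 \<and> q 1 3 2 + q 4 2 2 = 0 \<and> q 1 3 3 + q 4 2 3 = 0 \<and> q 1 3 4 + q 4 2 4 = 0 \<and> q 1 3 5 + q 4 2 5 = 0"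
    and "q 1 4 1 + q 2 3 1 = 0 \<and> q 1 4 2 + q 2 3 2 = 0 \<and> q 1 4 3 + q 2 3 3 = 0 \<and> q 1 4 4 + q 2 3 4 = 0 \<and> q 1 4 5 + q 2 3 5 = - 1"
proof -
  have d: "q a a c = 0" if "a \<in> {1..5}" for a c
    using skew[OF that that, of c] by simp
  have s: "q 2 1 c = - q 1 2 c" "q 3 1 c = - q 1 3 c" "q 4 1 c = - q 1 4 c" "q 1 5 c = - q 5 1 c"
    "q 3 2 c = - q 2 3 c" "q 2 4 c = - q 4 2 c" "q 2 5 c = - q 5 2 c"
    "q 4 3 c = - q 3 4 c" "q 3 5 c = - q 5 3 c" "q 4 5 c = - q 5 4 c" for c
    by (rule skew; simp)+
  note n = dcoeff_def kd2_def kd_def s d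
  \<comment> \<open>Each combination follows from a few scalar components of the structure
    equations; the numbers in brackets are the frame vectors inserted.\<close>
  have f00: "q 5 1 1 = 0"
    using dw1[of 3 4 5] dw2[of 1 3 5] dw3[of 1 4 5]
    by (simp add: n; linarith)
  have f01: "q 5 1 2 = 0"
    using deta[of 1 2] dw2[of 2 3 5] dw3[of 1 3 5]
    by (simp add: n; linarith)
  have f02: "q 5 1 3 = 0"
    using deta[of 1 3] dw1[of 2 3 5] dw3[of 1 2 5]
    by (simp add: n; linarith)
  have f03: "q 5 1 4 = - 1"
    using deta[of 1 4] dw1[of 2 4 5] dw2[of 1 2 5]
    by (simp add: n; linarith)
  have f04: "q 5 1 5 = 0"
    using deta[of 1 5]
    by (simp add: n; linarith)
  have f10: "q 5 2 1 = 0"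
    using deta[of 1 2] dw2[of 2 3 5] dw3[of 1 3 5]
    by (simp add: n; linarith)
  have f11: "q 5 2 2 = 0"
    using dw1[of 1 2 5] dw1[of 3 4 5] dw2[of 1 3 5] dw3[of 1 4 5]
    by (simp add: n; linarith)
  have f12: "q 5 2 3 = - 1"
    using deta[of 2 3] dw1[of 1 3 5] dw2[of 1 2 5]
    by (simp add: n; linarith)
  have f13: "q 5 2 4 = 0"
    using deta[of 2 4] dw1[of 1 4 5] dw3[of 1 2 5]
    by (simp add: n; linarith)
  have f14: "q 5 2 5 = 0"
    using deta[of 2 5]
    by (simp add: n; linarith)
  have f20: "q 5 3 1 = 0"
    using deta[of 1 3] dw1[of 2 3 5] dw3[of 1 2 5]
    by (simp add: n; linarith)
  have f21: "q 5 3 2 = 1"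
    using deta[of 2 3] dw1[of 1 3 5] dw2[of 1 2 5]
    by (simp add: n; linarith)
  have f22: "q 5 3 3 = 0"
    using dw1[of 3 4 5] dw2[of 1 3 5] dw3[of 1 4 5]
    by (simp add: n; linarith)
  have f23: "q 5 3 4 = 0"
    using deta[of 3 4] dw2[of 1 4 5] dw3[of 1 3 5]
    by (simp add: n; linarith)
  have f24: "q 5 3 5 = 0"
    using deta[of 3 5]
    by (simp add: n; linarith)
  have f30: "q 5 4 1 = 1"
    using deta[of 1 4] dw1[of 2 4 5] dw2[of 1 2 5]
    by (simp add: n; linarith)
  have f31: "q 5 4 2 = 0"
    using deta[of 2 4] dw1[of 1 4 5] dw3[of 1 2 5]
    by (simp add: n; linarith)
  have f32: "q 5 4 3 = 0"
    using deta[of 3 4] dw2[of 1 4 5] dw3[of 1 3 5]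
    by (simp add: n; linarith)
  have f33: "q 5 4 4 = 0"
    using dw1[of 3 4 5] dw2[of 1 3 5] dw3[of 1 4 5]
    by (simp add: n; linarith)
  have f34: "q 5 4 5 = 0"
    using deta[of 4 5]
    by (simp add: n; linarith)
  have f40: "q 1 2 1 + q 3 4 1 = 0"
    using dw1[of 2 3 4] dw2[of 1 2 3] dw3[of 1 2 4]
    by (simp add: n; linarith)
  have f41: "q 1 2 2 + q 3 4 2 = 0"
    using dw1[of 1 3 4] dw2[of 1 2 4] dw3[of 1 2 3]
    by (simp add: n; linarith)
  have f42: "q 1 2 3 + q 3 4 3 = 0"
    using dw1[of 1 2 4] dw2[of 1 3 4] dw3[of 2 3 4]
    by (simp add: n; linarith)
  have f43: "q 1 2 4 + q 3 4 4 = 0"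
    using dw1[of 1 2 3] dw2[of 2 3 4] dw3[of 1 3 4]
    by (simp add: n; linarith)
  have f44: "q 1 2 5 + q 3 4 5 = 0"
    using deta[of 1 2] deta[of 3 4] dw2[of 1 4 5] dw2[of 2 3 5]
    by (simp add: n; linarith)
  have f50: "q 1 3 1 + q 4 2 1 = 0"
    using dw1[of 1 2 3] dw2[of 2 3 4] dw3[of 1 3 4]
    by (simp add: n; linarith)
  have f51: "q 1 3 2 + q 4 2 2 = 0"
    using dw1[of 1 2 4] dw2[of 1 3 4] dw3[of 2 3 4]
    by (simp add: n; linarith)
  have f52: "q 1 3 3 + q 4 2 3 = 0"
    using dw1[of 1 3 4] dw2[of 1 2 4] dw3[of 1 2 3]
    by (simp add: n; linarith)
  have f53: "q 1 3 4 + q 4 2 4 = 0"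
    using dw1[of 2 3 4] dw2[of 1 2 3] dw3[of 1 2 4]
    by (simp add: n; linarith)
  have f54: "q 1 3 5 + q 4 2 5 = 0"
    using deta[of 1 3] deta[of 2 4] dw1[of 1 4 5] dw1[of 2 3 5]
    by (simp add: n; linarith)
  have f60: "q 1 4 1 + q 2 3 1 = 0"
    using dw1[of 1 2 4] dw2[of 1 3 4] dw3[of 2 3 4]
    by (simp add: n; linarith)
  have f61: "q 1 4 2 + q 2 3 2 = 0"
    using dw1[of 1 2 3] dw2[of 2 3 4] dw3[of 1 3 4]
    by (simp add: n; linarith)
  have f62: "q 1 4 3 + q 2 3 3 = 0"
    using dw1[of 2 3 4] dw2[of 1 2 3] dw3[of 1 2 4]
    by (simp add: n; linarith)
  have f63: "q 1 4 4 + q 2 3 4 = 0"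
    using dw1[of 1 3 4] dw2[of 1 2 4] dw3[of 1 2 3]
    by (simp add: n; linarith)
  have f64: "q 1 4 5 + q 2 3 5 = - 1"
    using deta[of 1 4] deta[of 2 3] dw1[of 1 3 5] dw1[of 2 4 5]
    by (simp add: n; linarith)
  show "q 5 1 1 = 0 \<and> q 5 1 2 = 0 \<and> q 5 1 3 = 0 \<and> q 5 1 4 = - 1 \<and> q 5 1 5 = 0"
    using f00 f01 f02 f03 f04 by blast
  show "q 5 2 1 = 0 \<and> q 5 2 2 = 0 \<and> q 5 2 3 = - 1 \<and> q 5 2 4 = 0 \<and> q 5 2 5 = 0"
    using f10 f11 f12 f13 f14 by blast
  show "q 5 3 1 = 0 \<and> q 5 3 2 = 1 \<and> q 5 3 3 = 0 \<and> q 5 3 4 = 0 \<and> q 5 3 5 = 0"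
    using f20 f21 f22 f23 f24 by blast
  show "q 5 4 1 = 1 \<and> q 5 4 2 = 0 \<and> q 5 4 3 = 0 \<and> q 5 4 4 = 0 \<and> q 5 4 5 = 0"
    using f30 f31 f32 f33 f34 by blast
  show "q 1 2 1 + q 3 4 1 = 0 \<and> q 1 2 2 + q 3 4 2 = 0 \<and> q 1 2 3 + q 3 4 3 = 0 \<and> q 1 2 4 + q 3 4 4 = 0 \<and> q 1 2 5 + q 3 4 5 = 0"
    using f40 f41 f42 f43 f44 by blast
  show "q 1 3 1 + q 4 2 1 = 0 \<and> q 1 3 2 + q 4 2 2 = 0 \<and> q 1 3 3 + q 4 2 3 = 0 \<and> q 1 3 4 + q 4 2 4 = 0 \<and> q 1 3 5 + q 4 2 5 = 0"
    using f50 f51 f52 f53 f54 by blast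
  show "q 1 4 1 + q 2 3 1 = 0 \<and> q 1 4 2 + q 2 3 2 = 0 \<and> q 1 4 3 + q 2 3 3 = 0 \<and> q 1 4 4 + q 2 3 4 = 0 \<and> q 1 4 5 + q 2 3 5 = - 1"
    using f60 f61 f62 f63 f64 by blast
qed

text \<open>The curvature of a Sasaki-Einstein metric minus that of the round sphere takes values in the
  anti-self-dual part of \<open>so(4)\<close>.\<close>

lemma anti_self_dual_ricci_flat:
  fixes S :: "nat \<Rightarrow> nat \<Rightarrow> nat \<Rightarrow> nat \<Rightarrow> real"
  assumes skew1: "\<And>a c b d. S a c b d = - S c a b d" and skew2: "\<And>a c b d. S a c b d = - S a c d b"
    and bianchi: "\<And>a c b d. S a c b d + S a d c b + S a b d c = 0"
    and s5: "\<And>c b d. S 5 c b d = 0"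
    and s2: "\<And>b d. S 1 2 b d + S 3 4 b d = 0"
    and s3: "\<And>b d. S 1 3 b d + S 4 2 b d = 0"
    and s4: "\<And>b d. S 1 4 b d + S 2 3 b d = 0"
    and cd: "c \<in> {1..5}" "d \<in> {1..5}"
  shows "(\<Sum>a=1..5. S a c a d) = 0"
proof -
  \<comment> \<open>The usual symmetry of curvature tensors under exchange of the two pairs: four
    Bianchi identities are combined, and all other terms cancel by the two skew symmetries.\<close>
  have pair: "S a c b d = S b d a c" for a c b d
    using bianchi[of a c b d] bianchi[of c a b d] bianchi[of b a c d] bianchi[of d a c b]
      skew1[of a c b d] skew1[of a d c b] skew1[of a b d c] skew1[of c b a d] skew1[of c d b a] skew1[of b d a c]
      skew2[of a c b d] skew2[of a d c b] skew2[of a b d c] skew2[of c b a d] skew2[of c d b a] skew2[of b d a c]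
      skew2[of d b a c] skew2[of b a c d] skew2[of d a c b] skew2[of b c d a] skew2[of d c b a] skew2[of c a b d]
      skew1[of b c a d] skew1[of d c b a] skew1[of d a b c] skew1[of b a d c]
    by linarith
  have s5': "S c 5 b d = 0" "S b d c 5 = 0" "S b d 5 c = 0" for b c d
    using s5[of c b d] skew1[of c 5 b d] pair[of b d 5 c] pair[of b d c 5] by simp_all
  have z: "S a a b d = 0" "S a c b b = 0" for a c b d
    using skew1[of a a b d] skew2[of a c b b] by simp_all
  have o: "S 2 1 b d = - S 1 2 b d" "S 3 1 b d = - S 1 3 b d" "S 4 1 b d = - S 1 4 b d" "S 3 2 b d = - S 2 3 b d"
    "S 4 2 b d = - S 2 4 b d" "S 4 3 b d = - S 3 4 b d" for b d
    by (rule skew1)+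
  have o': "S b d 2 1 = - S b d 1 2" "S b d 3 1 = - S b d 1 3" "S b d 4 1 = - S b d 1 4" "S b d 3 2 = - S b d 2 3"
    "S b d 4 2 = - S b d 2 4" "S b d 4 3 = - S b d 3 4" for b d
    by (rule skew2)+
  note n = z o o' s5 s5' sum_1_5
  \<comment> \<open>For a diagonal entry the relations \<open>s2\<close>, \<open>s3\<close>,
    \<open>s4\<close> turn the trace into a Bianchi sum over the indices 1, 2, 3, 4. In an
    off-diagonal entry the terms cancel by these relations and the exchange of pairs.\<close>
  have r11: "(\<Sum>a=1..5. S a 1 a 1) = 0"
    using s2[of 1 2] bianchi[of 3 4 1 2] pair[of 1 3 2 4] s4[of 1 4] s3[of 1 3] by (simp add: n; linarith)
  have r12: "(\<Sum>a=1..5. S a 1 a 2) = 0"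
    using s3[of 2 3] s4[of 2 4] pair[of 2 3 2 4] by (simp add: n; linarith)
  have r13: "(\<Sum>a=1..5. S a 1 a 3) = 0"
    using s2[of 2 3] pair[of 2 3 3 4] s4[of 3 4] by (simp add: n; linarith)
  have r14: "(\<Sum>a=1..5. S a 1 a 4) = 0"
    using pair[of 2 4 3 4] s3[of 3 4] s2[of 2 4] by (simp add: n; linarith)
  have r22: "(\<Sum>a=1..5. S a 2 a 2) = 0"
    using s2[of 1 2] s4[of 2 3] pair[of 1 3 2 4] bianchi[of 4 3 1 2] s3[of 2 4] by (simp add: n; linarith)
  have r23: "(\<Sum>a=1..5. S a 2 a 3) = 0"
    using s3[of 3 4] pair[of 1 3 3 4] s2[of 1 3] by (simp add: n; linarith)
  have r24: "(\<Sum>a=1..5. S a 2 a 4) = 0"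
    using s2[of 1 4] s4[of 3 4] pair[of 1 4 3 4] by (simp add: n; linarith)
  have r33: "(\<Sum>a=1..5. S a 3 a 3) = 0"
    using s4[of 2 3] pair[of 1 2 3 4] bianchi[of 4 3 1 2] s3[of 1 3] s2[of 3 4] by (simp add: n; linarith)
  have r34: "(\<Sum>a=1..5. S a 3 a 4) = 0"
    using pair[of 1 4 2 4] s3[of 1 4] s4[of 2 4] by (simp add: n; linarith)
  have r44: "(\<Sum>a=1..5. S a 4 a 4) = 0"
    using bianchi[of 3 4 1 2] pair[of 1 2 3 4] s4[of 1 4] s3[of 2 4] s2[of 3 4] by (simp add: n; linarith)
  have sym: "(\<Sum>a=1..5. S a c a d) = (\<Sum>a=1..5. S a d a c)" for c d
    by (rule sum.cong[OF refl]) (rule pair)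
  have r5: "(\<Sum>a=1..5. S a 5 a d) = 0" for d
    by (simp add: s5')
  have "c = 1 \<or> c = 2 \<or> c = 3 \<or> c = 4 \<or> c = 5" "d = 1 \<or> d = 2 \<or> d = 3 \<or> d = 4 \<or> d = 5"
    using cd by auto
  moreover note r11 r12 r13 r14 r22 r23 r24 r33 r34 r44 r5
    sym[of 2 1, unfolded r12] sym[of 3 1, unfolded r13] sym[of 4 1, unfolded r14] sym[of 3 2, unfolded r23]
    sym[of 4 2, unfolded r24] sym[of 4 3, unfolded r34] sym[of _ 5, unfolded r5]
  ultimately show ?thesis by (elim disjE) (simp_all only:)
qed

section \<open>Connection and curvature of a Sasaki-Einstein coframe\<close>

definition ewedge :: "(nat \<Rightarrow> 'e \<Rightarrow> 'e \<Rightarrow> real) \<Rightarrow> nat \<Rightarrow> nat \<Rightarrow> 'e \<Rightarrow> 'e \<Rightarrow> 'e \<Rightarrow> real" where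
  "ewedge e a b y u v = e a y u * e b y v - e a y v * e b y u"

definition d2 :: "('e::real_normed_vector \<Rightarrow> 'e \<Rightarrow> 'e \<Rightarrow> real) \<Rightarrow> 'e \<Rightarrow> 'e \<Rightarrow> 'e \<Rightarrow> 'e \<Rightarrow> real" where
  "d2 w x p q r = frechet_derivative (\<lambda>y. w y q r) (at x) p - frechet_derivative (\<lambda>y. w y p r) (at x) q
     + frechet_derivative (\<lambda>y. w y p q) (at x) r"

locale sasaki_einstein_coframe = orthonormal_coframe 5 V e E g
  for V :: "'e::euclidean_space set" and e E g +
  assumes deta: "x \<in> V \<Longrightarrow> frechet_derivative (\<lambda>y. e 5 y q) (at x) p - frechet_derivative (\<lambda>y. e 5 y p) (at x) q
      = - 2 * (ewedge e 1 4 x p q + ewedge e 2 3 x p q)"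
    and dw1: "x \<in> V \<Longrightarrow> d2 (\<lambda>y p q. ewedge e 1 2 y p q + ewedge e 3 4 y p q) x p q r =
      3 * (e 5 x p * (ewedge e 1 3 x q r + ewedge e 4 2 x q r) - e 5 x q * (ewedge e 1 3 x p r + ewedge e 4 2 x p r)
        + e 5 x r * (ewedge e 1 3 x p q + ewedge e 4 2 x p q))"
    and dw2: "x \<in> V \<Longrightarrow> d2 (\<lambda>y p q. ewedge e 1 3 y p q + ewedge e 4 2 y p q) x p q r =
      - 3 * (e 5 x p * (ewedge e 1 2 x q r + ewedge e 3 4 x q r) - e 5 x q * (ewedge e 1 2 x p r + ewedge e 3 4 x p r)
        + e 5 x r * (ewedge e 1 2 x p q + ewedge e 3 4 x p q))"
    and dw3: "x \<in> V \<Longrightarrow> d2 (\<lambda>y p q. ewedge e 1 4 y p q + ewedge e 2 3 y p q) x p q r = 0"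
begin

definition de where
  "de a x p q = frechet_derivative (\<lambda>y. e a y q) (at x) p - frechet_derivative (\<lambda>y. e a y p) (at x) q"

text \<open>First structure equation de = - \<psi> \<and> e: the Christoffel terms are symmetric and
  cancel.\<close>

lemma de_eq:
  assumes a: "a \<in> {1..5}" and x: "x \<in> V"
  shows "de a x p q = - (\<Sum>b=1..5. \<psi> a b x p * e b x q - \<psi> a b x q * e b x p)"
  unfolding de_def D_e[OF a x] christoffel_commute[OF x, of q p] by (simp add: sum_subtractf)

lemma diff_ewedge: "a \<in> {1..5} \<Longrightarrow> b \<in> {1..5} \<Longrightarrow> x \<in> V \<Longrightarrow> (\<lambda>y. ewedge e a b y q r) differentiable (at x)"
  unfolding ewedge_def by (intro differentiable_diff differentiable_mult diff_e)

lemma d2_ewedge: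
  assumes a: "a \<in> {1..5}" and b: "b \<in> {1..5}" and x: "x \<in> V"
  shows "d2 (ewedge e a b) x p q r = de a x p q * e b x r - de a x p r * e b x q + de a x q r * e b x p
    - (e a x p * de b x q r - e a x q * de b x p r + e a x r * de b x p q)"
proof -
  have D: "frechet_derivative (\<lambda>y. ewedge e a b y q r) (at x) p =
     (e a x q * frechet_derivative (\<lambda>y. e b y r) (at x) p + frechet_derivative (\<lambda>y. e a y q) (at x) p * e b x r)
     - (e a x r * frechet_derivative (\<lambda>y. e b y q) (at x) p + frechet_derivative (\<lambda>y. e a y r) (at x) p * e b x q)" for p q r
    unfolding ewedge_def
    by (subst frechet_derivative_diff) (auto intro!: differentiable_mult diff_e a b x simp: frechet_derivative_mult diff_e[OF a x] diff_e[OF b x])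
  show ?thesis unfolding d2_def D de_def by (simp add: algebra_simps)
qed

lemma d2_add:
  assumes "a \<in> {1..5}" "b \<in> {1..5}" "c \<in> {1..5}" "d \<in> {1..5}" and x: "x \<in> V"
  shows "d2 (\<lambda>y p q. ewedge e a b y p q + ewedge e c d y p q) x p q r = d2 (ewedge e a b) x p q r + d2 (ewedge e c d) x p q r"
  unfolding d2_def frechet_derivative_add[OF diff_ewedge[OF assms(1,2) x] diff_ewedge[OF assms(3,4) x]] by simp

text \<open>Evaluated on the frame, the structure equations become the linear system for the
  components of \<psi>; the forms are then reassembled from their components.\<close>

lemma connection:
  assumes x: "x \<in> V"
  shows "\<psi> 5 1 x u = - e 4 x u" "\<psi> 5 2 x u = - e 3 x u" "\<psi> 5 3 x u = e 2 x u" "\<psi> 5 4 x u = e 1 x u"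
    "\<psi> 1 2 x u + \<psi> 3 4 x u = 0" "\<psi> 1 3 x u + \<psi> 4 2 x u = 0" "\<psi> 1 4 x u + \<psi> 2 3 x u = - e 5 x u"
proof -
  define q where "q a b c = \<psi> a b x (E c x)" for a b c
  have eE: "e a x (E i x) = kd a i" if "a \<in> {1..5}" "i \<in> {1..5}" for a i
    using dual[OF that x] by (simp add: kd_def)
  have deE: "de a x (E i x) (E j x) = q a i j - q a j i" if a: "a \<in> {1..5}" and i: "i \<in> {1..5}" and j: "j \<in> {1..5}" for a i j
  proof -
    have "de a x (E i x) (E j x) = - (\<Sum>b=1..5. q a b i * (if b = j then 1 else 0) - q a b j * (if b = i then 1 else 0))"
      unfolding de_eq[OF a x] q_def by (intro arg_cong[of _ _ uminus] sum.cong) (simp_all add: dual[OF _ i x] dual[OF _ j x])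
    also have "\<dots> = q a i j - q a j i"
      using i j by (simp add: sum_subtractf if_distrib[of "(*) _"] cong: if_cong)
    finally show ?thesis .
  qed
  have wE: "ewedge e a b x (E i x) (E j x) = kd2 a b i j" if "a \<in> {1..5}" "b \<in> {1..5}" "i \<in> {1..5}" "j \<in> {1..5}" for a b i j
    using that by (simp add: ewedge_def kd2_def eE)
  have dE: "d2 (ewedge e a b) x (E i x) (E j x) (E l x) = dcoeff q a b i j l"
    if "a \<in> {1..5}" "b \<in> {1..5}" "i \<in> {1..5}" "j \<in> {1..5}" "l \<in> {1..5}" for a b i j l
    unfolding d2_ewedge[OF that(1,2) x] dcoeff_def by (simp only: deE eE that)
  have skew: "q a b c = - q b a c" if "a \<in> {1..5}" "b \<in> {1..5}" for a b c
    unfolding q_def by (rule \<psi>_skew[OF that x])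
  have e0: "q 5 i j - q 5 j i = - 2 * (kd2 1 4 i j + kd2 2 3 i j)" if "i \<in> {1..5}" "j \<in> {1..5}" for i j
    using deta[OF x, of "E j x" "E i x"] deE[of 5 i j] wE that unfolding de_def by simp
  have e1: "dcoeff q 1 2 i j l + dcoeff q 3 4 i j l =
        3 * (kd 5 i * (kd2 1 3 j l + kd2 4 2 j l) - kd 5 j * (kd2 1 3 i l + kd2 4 2 i l) + kd 5 l * (kd2 1 3 i j + kd2 4 2 i j))"
    if "i \<in> {1..5}" "j \<in> {1..5}" "l \<in> {1..5}" for i j l
    using dw1[OF x, of "E i x" "E j x" "E l x"] that by (simp add: d2_add x dE wE eE)
  have e2: "dcoeff q 1 3 i j l + dcoeff q 4 2 i j l =
        - 3 * (kd 5 i * (kd2 1 2 j l + kd2 3 4 j l) - kd 5 j * (kd2 1 2 i l + kd2 3 4 i l) + kd 5 l * (kd2 1 2 i j + kd2 3 4 i j))"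
    if "i \<in> {1..5}" "j \<in> {1..5}" "l \<in> {1..5}" for i j l
    using dw2[OF x, of "E i x" "E j x" "E l x"] that by (simp add: d2_add x dE wE eE)
  have e3: "dcoeff q 1 4 i j l + dcoeff q 2 3 i j l = 0"
    if "i \<in> {1..5}" "j \<in> {1..5}" "l \<in> {1..5}" for i j l
    using dw3[OF x, of "E i x" "E j x" "E l x"] that by (simp add: d2_add x dE)
  note Q = sasaki_connection_coefficients[of q, OF skew e0 e1 e2 e3]
  have ex: "\<psi> a b x u = q a b 1 * e 1 x u + q a b 2 * e 2 x u + q a b 3 * e 3 x u + q a b 4 * e 4 x u + q a b 5 * e 5 x u"
    if a: "a \<in> {1..5}" for a b
  proof -
    have "\<psi> a b x u = \<psi> a b x (\<Sum>c=1..5. e c x u *\<^sub>R E c x)" using expand[OF x, of u] by simp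
    also have "\<dots> = (\<Sum>c=1..5. e c x u * q a b c)"
      unfolding linear_sum[OF linear_\<psi>[OF a x]] linear_scale[OF linear_\<psi>[OF a x]] q_def by simp
    finally show ?thesis by (simp add: sum_1_5 algebra_simps)
  qed
  show "\<psi> 5 1 x u = - e 4 x u" using Q(1) by (simp add: ex)
  show "\<psi> 5 2 x u = - e 3 x u" using Q(2) by (simp add: ex)
  show "\<psi> 5 3 x u = e 2 x u" using Q(3) by (simp add: ex)
  show "\<psi> 5 4 x u = e 1 x u" using Q(4) by (simp add: ex)
  have comb: "\<psi> a b x u + \<psi> c d x u = (q a b 1 + q c d 1) * e 1 x u + (q a b 2 + q c d 2) * e 2 x u
      + (q a b 3 + q c d 3) * e 3 x u + (q a b 4 + q c d 4) * e 4 x u + (q a b 5 + q c d 5) * e 5 x u"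
    if "a \<in> {1..5}" "c \<in> {1..5}" for a b c d
    unfolding ex[OF that(1)] ex[OF that(2)] by (simp add: algebra_simps)
  show "\<psi> 1 2 x u + \<psi> 3 4 x u = 0" using Q(5) comb[of 1 3 2 4] by simp
  show "\<psi> 1 3 x u + \<psi> 4 2 x u = 0" using Q(6) comb[of 1 4 3 2] by simp
  show "\<psi> 1 4 x u + \<psi> 2 3 x u = - e 5 x u" using Q(7) comb[of 1 2 4 3] by simp
qed

text \<open>The right-hand sides are those of the unit sphere. In the three sums the undetermined
  connection forms cancel because the self-dual and anti-self-dual parts of so(4) commute; in the
  rows with index 5 they cancel against those in the exterior derivatives of the e^a.\<close>

lemma curvature_forms:
  assumes x: "x \<in> V"
  shows "\<Omega> 5 1 x u v = ewedge e 5 1 x u v" "\<Omega> 5 2 x u v = ewedge e 5 2 x u v"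
    "\<Omega> 5 3 x u v = ewedge e 5 3 x u v" "\<Omega> 5 4 x u v = ewedge e 5 4 x u v"
    "\<Omega> 1 2 x u v + \<Omega> 3 4 x u v = ewedge e 1 2 x u v + ewedge e 3 4 x u v"
    "\<Omega> 1 3 x u v + \<Omega> 4 2 x u v = ewedge e 1 3 x u v + ewedge e 4 2 x u v"
    "\<Omega> 1 4 x u v + \<Omega> 2 3 x u v = ewedge e 1 4 x u v + ewedge e 2 3 x u v"
proof -
  have neg: "frechet_derivative (\<lambda>y. f y) (at x) u = - frechet_derivative (\<lambda>y. h y) (at x) u"
    if "\<And>y. y \<in> V \<Longrightarrow> f y = - h y" "h differentiable (at x)" for f h :: "'e \<Rightarrow> real" and u
  proof -
    have "frechet_derivative f (at x) u = frechet_derivative (\<lambda>y. (-1) * h y) (at x) u"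
      by (rule fun_cong[OF frechet_derivative_cong_open[OF V x]]) (simp add: that(1))
    also have "\<dots> = (-1) * frechet_derivative h (at x) u" by (rule frechet_derivative_cmult[OF that(2)])
    finally show ?thesis by simp
  qed
  have d5: "d\<psi> 5 1 x u v = - de 4 x u v" "d\<psi> 5 2 x u v = - de 3 x u v"
    unfolding d\<psi>_def de_def using neg[OF connection(1) diff_e] neg[OF connection(2) diff_e] x by simp_all
  have d5': "d\<psi> 5 3 x u v = de 2 x u v" "d\<psi> 5 4 x u v = de 1 x u v"
    unfolding d\<psi>_def de_def
    using frechet_derivative_cong_open[OF V x connection(3)] frechet_derivative_cong_open[OF V x connection(4)] by simp_all
  have d0: "d\<psi> 1 2 x u v + d\<psi> 3 4 x u v = 0" "d\<psi> 1 3 x u v + d\<psi> 4 2 x u v = 0"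
    unfolding d\<psi>_def
    using neg[of "\<lambda>y. \<psi> 1 2 y _" "\<lambda>y. \<psi> 3 4 y _", OF _ diff_\<psi>] neg[of "\<lambda>y. \<psi> 1 3 y _" "\<lambda>y. \<psi> 4 2 y _", OF _ diff_\<psi>]
      connection(5,6) x by (simp_all add: add_eq_0_iff2)
  have d1: "d\<psi> 1 4 x u v + d\<psi> 2 3 x u v = - de 5 x u v"
  proof -
    have *: "frechet_derivative (\<lambda>y. \<psi> 1 4 y v) (at x) u + frechet_derivative (\<lambda>y. \<psi> 2 3 y v) (at x) u
        = - frechet_derivative (\<lambda>y. e 5 y v) (at x) u" for u v
    proof -
      have "frechet_derivative (\<lambda>y. \<psi> 1 4 y v + \<psi> 2 3 y v) (at x) u = - frechet_derivative (\<lambda>y. e 5 y v) (at x) u"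
        by (rule neg[OF connection(7)]) (simp_all add: diff_e x)
      then show ?thesis by (subst (asm) frechet_derivative_add) (simp_all add: diff_\<psi> x)
    qed
    show ?thesis unfolding d\<psi>_def de_def using *[of v u] *[of u v] by simp
  qed
  have z: "\<psi> a a x u = 0" if "a \<in> {1..5}" for a u
    using \<psi>_skew[OF that that x, of u] by simp
  \<comment> \<open>All entries are expressed by the coframe and the three free forms
    \<open>\<psi> 1 2\<close>, \<open>\<psi> 1 3\<close>, \<open>\<psi> 1 4\<close>.\<close>
  have s: "\<psi> 2 1 x u = - \<psi> 1 2 x u" "\<psi> 3 1 x u = - \<psi> 1 3 x u" "\<psi> 4 1 x u = - \<psi> 1 4 x u" "\<psi> 1 5 x u = e 4 x u"
    "\<psi> 3 2 x u = e 5 x u + \<psi> 1 4 x u" "\<psi> 2 3 x u = - e 5 x u - \<psi> 1 4 x u" "\<psi> 2 4 x u = \<psi> 1 3 x u" "\<psi> 4 2 x u = - \<psi> 1 3 x u"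
    "\<psi> 2 5 x u = e 3 x u" "\<psi> 4 3 x u = \<psi> 1 2 x u" "\<psi> 3 4 x u = - \<psi> 1 2 x u" "\<psi> 3 5 x u = - e 2 x u" "\<psi> 4 5 x u = - e 1 x u" for u
    using \<psi>_skew[of 2 1 x u] \<psi>_skew[of 3 1 x u] \<psi>_skew[of 4 1 x u] \<psi>_skew[of 1 5 x u] \<psi>_skew[of 3 2 x u]
      \<psi>_skew[of 2 4 x u] \<psi>_skew[of 2 5 x u] \<psi>_skew[of 4 3 x u] \<psi>_skew[of 3 5 x u] \<psi>_skew[of 4 5 x u]
      connection[OF x, of u] x by simp_all
  note n = \<Omega>_def sum_1_5 s connection(1-4)[OF x] ewedge_def
  have de: "de a x u v = - (\<psi> a 1 x u * e 1 x v - \<psi> a 1 x v * e 1 x u + (\<psi> a 2 x u * e 2 x v - \<psi> a 2 x v * e 2 x u)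
      + (\<psi> a 3 x u * e 3 x v - \<psi> a 3 x v * e 3 x u) + (\<psi> a 4 x u * e 4 x v - \<psi> a 4 x v * e 4 x u)
      + (\<psi> a 5 x u * e 5 x v - \<psi> a 5 x v * e 5 x u))" if "a \<in> {1..5}" for a
    unfolding de_eq[OF that x] sum_1_5 by simp
  show "\<Omega> 5 1 x u v = ewedge e 5 1 x u v" "\<Omega> 5 2 x u v = ewedge e 5 2 x u v"
    "\<Omega> 5 3 x u v = ewedge e 5 3 x u v" "\<Omega> 5 4 x u v = ewedge e 5 4 x u v"
    by (simp_all add: n d5 d5' de z algebra_simps)
  have "\<Omega> 1 2 x u v + \<Omega> 3 4 x u v - (d\<psi> 1 2 x u v + d\<psi> 3 4 x u v) = ewedge e 1 2 x u v + ewedge e 3 4 x u v"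
    by (simp add: n z algebra_simps)
  then show "\<Omega> 1 2 x u v + \<Omega> 3 4 x u v = ewedge e 1 2 x u v + ewedge e 3 4 x u v" by (simp add: d0)
  have "\<Omega> 1 3 x u v + \<Omega> 4 2 x u v - (d\<psi> 1 3 x u v + d\<psi> 4 2 x u v) = ewedge e 1 3 x u v + ewedge e 4 2 x u v"
    by (simp add: n z algebra_simps)
  then show "\<Omega> 1 3 x u v + \<Omega> 4 2 x u v = ewedge e 1 3 x u v + ewedge e 4 2 x u v" by (simp add: d0)
  have "\<Omega> 1 4 x u v + \<Omega> 2 3 x u v - (d\<psi> 1 4 x u v + d\<psi> 2 3 x u v) = ewedge e 1 4 x u v + ewedge e 2 3 x u v + de 5 x u v"
    by (simp add: n z de algebra_simps)
  then show "\<Omega> 1 4 x u v + \<Omega> 2 3 x u v = ewedge e 1 4 x u v + ewedge e 2 3 x u v" by (simp add: d1)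
qed

lemma ricci_eq:
  assumes x: "x \<in> V"
  shows "ricci g x v w = 4 * g x v w"
proof -
  \<comment> \<open>The curvature tensor of the unit sphere, whose trace is 5 - 1 = 4 times the
    metric.\<close>
  define K where "K a c b d = kd a b * kd c d - kd a d * kd c b" for a c b d
  \<comment> \<open>The value 0 outside the range makes the symmetries hold for all indices, as
    \<open>anti_self_dual_ricci_flat\<close> requires.\<close>
  define S where "S a c b d = (if a \<in> {1..5} \<and> c \<in> {1..5} \<and> b \<in> {1..5} \<and> d \<in> {1..5}
      then \<Omega> a c x (E b x) (E d x) - K a c b d else 0)" for a c b d
  have eE: "e a x (E i x) = kd a i" if "a \<in> {1..5}" "i \<in> {1..5}" for a i
    using dual[OF that x] by (simp add: kd_def)
  have wE: "ewedge e a c x (E b x) (E d x) = K a c b d" if "a \<in> {1..5}" "c \<in> {1..5}" "b \<in> {1..5}" "d \<in> {1..5}" for a b c d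
    using that by (simp add: ewedge_def K_def eE)
  have skew1: "S a c b d = - S c a b d" for a c b d
    using \<Omega>_skew[of a c x "E b x" "E d x"] x by (auto simp: S_def K_def)
  have skew2: "S a c b d = - S a c d b" for a c b d
    using \<Omega>_swap[of a c x "E b x" "E d x"] by (auto simp: S_def K_def)
  have \<Omega>E: "\<Omega> a c x (E b x) (E d x) = e a x (curvature g x (E b x) (E d x) (E c x))"
    if "a \<in> {1..5}" "c \<in> {1..5}" for a b c d
    using that by (simp add: cartan[OF that(1) x] dual[OF _ that(2) x] if_distrib[of "(*) _"] cong: if_cong)
  have bianchi': "S a c b d + S a d c b + S a b d c = 0" for a c b d
  proof (cases "a \<in> {1..5} \<and> c \<in> {1..5} \<and> b \<in> {1..5} \<and> d \<in> {1..5}")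
    case True
    have "e a x (curvature g x (E b x) (E d x) (E c x)) + e a x (curvature g x (E d x) (E c x) (E b x))
       + e a x (curvature g x (E c x) (E b x) (E d x)) = 0"
      using bianchi[OF x, of "E b x" "E d x" "E c x"] True linear_0[OF lin_e[of a x]] x
      by (simp add: linear_add[OF lin_e[of a x], symmetric])
    then show ?thesis using True by (simp add: S_def \<Omega>E K_def algebra_simps kd_def)
  next
    case False
    then show ?thesis by (auto simp: S_def)
  qed
  have s5: "S 5 c b d = 0" for c b d
  proof (cases "c \<in> {1..5} \<and> b \<in> {1..5} \<and> d \<in> {1..5}")
    case True
    then have "c = 1 \<or> c = 2 \<or> c = 3 \<or> c = 4 \<or> c = 5" by auto
    moreover have "S 5 5 b d = 0" using skew1[of 5 5 b d] by simp
    ultimately show ?thesis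
      using True by (elim disjE) (simp_all add: S_def curvature_forms(1-4)[OF x] wE)
  qed (auto simp: S_def)
  have s2: "S 1 2 b d + S 3 4 b d = 0" and s3: "S 1 3 b d + S 4 2 b d = 0" and s4: "S 1 4 b d + S 2 3 b d = 0" for b d
    using curvature_forms(5-7)[OF x, of "E b x" "E d x"] by (auto simp: S_def wE)
  have R: "(\<Sum>a=1..5. \<Omega> a c x (E a x) (E d x)) = 4 * kd c d" if cd: "c \<in> {1..5}" "d \<in> {1..5}" for c d
  proof -
    have "(\<Sum>a=1..5. \<Omega> a c x (E a x) (E d x)) = (\<Sum>a=1..5. S a c a d) + (\<Sum>a=1..5. K a c a d)"
      unfolding sum.distrib[symmetric] by (rule sum.cong) (use cd in \<open>auto simp: S_def\<close>)
    moreover have "(\<Sum>a=1..5. K a c a d) = 4 * kd c d"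
    proof -
      have "c = 1 \<or> c = 2 \<or> c = 3 \<or> c = 4 \<or> c = 5" using cd by auto
      then show ?thesis by (elim disjE) (simp_all add: sum_1_5 K_def kd_def)
    qed
    ultimately show ?thesis
      using anti_self_dual_ricci_flat[of S, OF skew1 skew2 bianchi' s5 s2 s3 s4 cd] by simp
  qed
  have "(\<Sum>a=1..5. \<Omega> a c x (E a x) v) = 4 * e c x v" if c: "c \<in> {1..5}" for c
  proof -
    have l: "linear (\<lambda>v. \<Omega> a c x (E a x) v)" if "a \<in> {1..5}" for a
    proof -
      have "(\<lambda>v. \<Omega> a c x (E a x) v) = (\<lambda>v. - \<Omega> a c x v (E a x))" using \<Omega>_swap by blast
      then show ?thesis using linear_compose_neg[OF linear_\<Omega>[OF that c x]] by simp
    qed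
    have "\<Omega> a c x (E a x) v = (\<Sum>d=1..5. e d x v * \<Omega> a c x (E a x) (E d x))" if "a \<in> {1..5}" for a
    proof -
      have "\<Omega> a c x (E a x) v = \<Omega> a c x (E a x) (\<Sum>d=1..5. e d x v *\<^sub>R E d x)" using expand[OF x, of v] by simp
      then show ?thesis unfolding linear_sum[OF l[OF that]] linear_scale[OF l[OF that]] by simp
    qed
    then have "(\<Sum>a=1..5. \<Omega> a c x (E a x) v) = (\<Sum>a=1..5. \<Sum>d=1..5. e d x v * \<Omega> a c x (E a x) (E d x))"
      by simp
    also have "\<dots> = (\<Sum>d=1..5. e d x v * (\<Sum>a=1..5. \<Omega> a c x (E a x) (E d x)))"
      by (subst sum.swap) (simp add: sum_distrib_left)
    also have "\<dots> = (\<Sum>d=1..5. e d x v * (4 * kd c d))" by (rule sum.cong[OF refl]) (simp only: R[OF c])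
    also have "\<dots> = 4 * e c x v" using c by (simp add: kd_def if_distrib[of "(*) _"] cong: if_cong)
    finally show ?thesis .
  qed
  then have "ricci g x v w = (\<Sum>c=1..5. 4 * e c x v * e c x w)"
    unfolding ricci_\<Omega>[OF x] by simp
  then show ?thesis by (simp add: metric[OF x] sum_distrib_left mult.assoc)
qed

end

section \<open>Curvature of the sine cone metric\<close>

context orthonormal_coframe
begin

definition W :: "('e \<times> real) set" where "W = V \<times> {0<..<pi}"

definition G :: "('e \<times> real) metric_tensor" where
  "G z u v = snd u * snd v + (sin (snd z))\<^sup>2 * g (fst z) (fst u) (fst v)"

definition f :: "nat \<Rightarrow> 'e \<times> real \<Rightarrow> 'e \<times> real \<Rightarrow> real" where
  "f a z u = (if a = Suc n then snd u else sin (snd z) * e a (fst z) (fst u))"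

definition f' :: "nat \<Rightarrow> 'e \<times> real \<Rightarrow> 'e \<times> real" where
  "f' a z = (if a = Suc n then (0, 1) else inverse (sin (snd z)) *\<^sub>R (E a (fst z), 0))"

lemma open_W: "open W"
  unfolding W_def by (intro open_Times V open_greaterThanLessThan)

lemma W_D: "z \<in> W \<Longrightarrow> fst z \<in> V" "z \<in> W \<Longrightarrow> sin (snd z) > 0"
  unfolding W_def by (auto intro: sin_gt_zero)

lemma smooth_on_fst: "smooth_on V \<phi> \<Longrightarrow> smooth_on W (\<lambda>z. \<phi> (fst z))"
  by (rule smooth_on_compose_linear[OF bounded_linear_fst open_W]) (auto dest: W_D)

lemma smooth_on_sin_snd: "smooth_on W (\<lambda>z. sin (snd z))"
  by (rule smooth_on_sin[OF open_W smooth_on_bounded_linear[OF bounded_linear_snd]])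

lemma sum_Suc_n: "(\<Sum>a=1..Suc n. h a) = (\<Sum>a=1..n. h a) + h (Suc n)"
  by simp

text \<open>Makes the results on the Levi-Civita connection available for the cone metric. The index
  \<open>Suc n\<close> stands for dt, and the rescaled dual frame exists because sin does not vanish
  on (0, pi).\<close>

lemma cone_coframe: "orthonormal_coframe (Suc n) W f f' G"
proof (rule orthonormal_coframe.intro)
  show "open W" by (rule open_W)
  show "linear (f a z)" if "a \<in> {1..Suc n}" "z \<in> W" for a z
  proof (cases "a = Suc n")
    case True
    then have "f a z = snd" by (auto simp: f_def)
    then show ?thesis by (simp add: linear_snd)
  next
    case False
    then have a: "a \<in> {1..n}" using that by auto
    have "f a z = (\<lambda>u. sin (snd z) * e a (fst z) (fst u))" using False by (auto simp: f_def)
    then show ?thesis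
      using linear_mult_right'[OF linear_compose[OF linear_fst lin_e[OF a W_D(1)[OF that(2)]], unfolded o_def]] by simp
  qed
  show "smooth_on W (\<lambda>z. f a z u)" if "a \<in> {1..Suc n}" for a u
  proof (cases "a = Suc n")
    case False
    then have "a \<in> {1..n}" using that by auto
    then show ?thesis
      using False smooth_on_mult[OF open_W smooth_on_sin_snd smooth_on_fst[OF smooth_e]] by (simp add: f_def)
  qed (simp add: f_def smooth_on_const)
  show "smooth_on W (f' a)" if "a \<in> {1..Suc n}" for a
  proof (cases "a = Suc n")
    case True
    then have "f' a = (\<lambda>z. (0, 1))" by (auto simp: f'_def)
    then show ?thesis by (simp add: smooth_on_const)
  next
    case False
    then have a: "a \<in> {1..n}" using that by auto
    have "smooth_on W (\<lambda>z. inverse (sin (snd z)) *\<^sub>R (E a (fst z), 0::real))"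
      by (intro smooth_on_scaleR open_W smooth_on_inverse smooth_on_sin_snd
          smooth_on_linear_comp[OF bounded_linear_Pair[OF bounded_linear_ident bounded_linear_zero]]
          smooth_on_fst[OF smooth_E[OF a]])
        (auto dest: W_D)
    moreover have "f' a = (\<lambda>z. inverse (sin (snd z)) *\<^sub>R (E a (fst z), 0))" using False by (auto simp: f'_def)
    ultimately show ?thesis by simp
  qed
  show "f a z (f' b z) = (if a = b then 1 else 0)" if "a \<in> {1..Suc n}" "b \<in> {1..Suc n}" "z \<in> W" for a b z
  proof -
    have "e a (fst z) (inverse (sin (snd z)) *\<^sub>R E b (fst z)) = inverse (sin (snd z)) * (if a = b then 1 else 0)"
      "e a (fst z) 0 = 0" if "a \<in> {1..n}" "b \<in> {1..n}" for b
      using linear_scale[OF lin_e[OF that(1) W_D(1)[OF \<open>z \<in> W\<close>]]] linear_0[OF lin_e[OF that(1) W_D(1)[OF \<open>z \<in> W\<close>]]]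
        dual[OF that W_D(1)[OF \<open>z \<in> W\<close>]] by simp_all
    moreover have "a \<in> {1..n} \<Longrightarrow> e a (fst z) 0 = 0"
      using linear_0[OF lin_e[OF _ W_D(1)[OF \<open>z \<in> W\<close>]]] .
    moreover have "sin (snd z) \<noteq> 0" using W_D(2)[OF \<open>z \<in> W\<close>] by simp
    moreover have "a = Suc n \<or> a \<in> {1..n}" "b = Suc n \<or> b \<in> {1..n}" using that by auto
    ultimately show ?thesis by (elim disjE) (simp_all add: f_def f'_def)
  qed
  show "u = (\<Sum>a=1..Suc n. f a z u *\<^sub>R f' a z)" if z: "z \<in> W" for z u
  proof -
    have s: "sin (snd z) \<noteq> 0" using W_D(2)[OF z] by simp
    have "(\<Sum>a=1..n. f a z u *\<^sub>R f' a z) = (\<Sum>a=1..n. (e a (fst z) (fst u) *\<^sub>R E a (fst z), 0))"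
      by (rule sum.cong) (use s in \<open>simp_all add: f_def f'_def\<close>)
    also have "\<dots> = (fst u, 0)"
      using expand[OF W_D(1)[OF z], of "fst u"] by (simp add: prod_eq_iff fst_sum snd_sum)
    finally show ?thesis unfolding sum_Suc_n by (simp add: f_def f'_def)
  qed
  show "G z u v = (\<Sum>a=1..Suc n. f a z u * f a z v)" if z: "z \<in> W" for z u v
  proof -
    have "(\<Sum>a=1..n. f a z u * f a z v) = (\<Sum>a=1..n. (sin (snd z))\<^sup>2 * (e a (fst z) (fst u) * e a (fst z) (fst v)))"
      by (rule sum.cong) (simp_all add: f_def power2_eq_square algebra_simps)
    then show ?thesis
      unfolding sum_Suc_n by (simp add: f_def G_def metric[OF W_D(1)[OF z]] sum_distrib_left)
  qed
qed

interpretation cone: orthonormal_coframe "Suc n" W f f' G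
  by (rule cone_coframe)

lemma frechet_derivative_G:
  assumes z: "z \<in> W"
  shows "frechet_derivative (\<lambda>y. G y v w) (at z) u = 2 * sin (snd z) * cos (snd z) * snd u * g (fst z) (fst v) (fst w)
    + (sin (snd z))\<^sup>2 * frechet_derivative (\<lambda>x. g x (fst v) (fst w)) (at (fst z)) (fst u)"
proof -
  have s: "((\<lambda>t. (sin t)\<^sup>2) has_real_derivative 2 * sin t * cos t) (at t)" for t
    by (auto intro!: derivative_eq_intros)
  show ?thesis
    unfolding G_def
    by (subst frechet_derivative_eqI[OF has_derivative_add[OF has_derivative_const
      has_derivative_separated[OF s has_frechet_derivative[OF diff_g[OF W_D(1)[OF z]]]]]]) simp
qed

text \<open>The warped product formulas for the function f = sin: cot is f'/f and sin cos is f f'.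
  They are verified by pairing with an arbitrary w in the Koszul formula.\<close>

lemma christoffel_G:
  assumes z: "z \<in> W"
  shows "christoffel G z u v =
    (christoffel g (fst z) (fst u) (fst v) + cot (snd z) *\<^sub>R (snd u *\<^sub>R fst v + snd v *\<^sub>R fst u),
     - (sin (snd z) * cos (snd z)) * g (fst z) (fst u) (fst v))"
proof (rule cone.christoffel_eqI[OF z])
  fix w
  note x = W_D(1)[OF z]
  have s: "sin (snd z) \<noteq> 0" using W_D(2)[OF z] by simp
  have k: "(sin (snd z))\<^sup>2 * (cot (snd z) * r) = sin (snd z) * cos (snd z) * r" for r
    using s by (simp add: cot_def power2_eq_square)
  have "G z (christoffel g (fst z) (fst u) (fst v) + cot (snd z) *\<^sub>R (snd u *\<^sub>R fst v + snd v *\<^sub>R fst u),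
     - (sin (snd z) * cos (snd z)) * g (fst z) (fst u) (fst v)) w =
     - (sin (snd z) * cos (snd z)) * g (fst z) (fst u) (fst v) * snd w
     + (sin (snd z))\<^sup>2 * koszul (fst z) (fst u) (fst v) (fst w)
     + (sin (snd z))\<^sup>2 * (cot (snd z) * (snd u * g (fst z) (fst v) (fst w) + snd v * g (fst z) (fst u) (fst w)))"
    unfolding G_def
    by (simp add: linear_add[OF linear_g'[OF x]] linear_scale[OF linear_g'[OF x]] g_christoffel[OF x] algebra_simps)
  then show "G z (christoffel g (fst z) (fst u) (fst v) + cot (snd z) *\<^sub>R (snd u *\<^sub>R fst v + snd v *\<^sub>R fst u),
     - (sin (snd z) * cos (snd z)) * g (fst z) (fst u) (fst v)) w = cone.koszul z u v w"
    unfolding k cone.koszul_def koszul_def frechet_derivative_G[OF z] by (simp add: field_simps)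
qed

lemma frechet_derivative_christoffel_G:
  assumes z: "z \<in> W"
  shows "frechet_derivative (\<lambda>y. christoffel G y v w) (at z) u =
    (frechet_derivative (\<lambda>x. christoffel g x (fst v) (fst w)) (at (fst z)) (fst u)
      + (- inverse ((sin (snd z))\<^sup>2) * snd u) *\<^sub>R (snd v *\<^sub>R fst w + snd w *\<^sub>R fst v),
     - (((cos (snd z))\<^sup>2 - (sin (snd z))\<^sup>2) * snd u * g (fst z) (fst v) (fst w)
       + sin (snd z) * cos (snd z) * frechet_derivative (\<lambda>x. g x (fst v) (fst w)) (at (fst z)) (fst u)))"
proof -
  note x = W_D(1)[OF z]
  have s: "sin (snd z) \<noteq> 0" using W_D(2)[OF z] by simp
  have hs: "(snd has_derivative snd) (at z)" and hf: "(fst has_derivative fst) (at z)"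
    by (rule bounded_linear_imp_has_derivative, rule bounded_linear_snd bounded_linear_fst)+
  have 1: "((\<lambda>y. christoffel g (fst y) (fst v) (fst w)) has_derivative
      (\<lambda>u. frechet_derivative (\<lambda>x. christoffel g x (fst v) (fst w)) (at (fst z)) (fst u))) (at z)"
    by (rule has_derivative_compose[OF hf has_frechet_derivative[OF diff_christoffel[OF x]]])
  have "(cot has_derivative (\<lambda>r. - inverse ((sin (snd z))\<^sup>2) * r)) (at (snd z))"
    using DERIV_cot[OF s] unfolding has_field_derivative_def .
  then have 2: "((\<lambda>y. cot (snd y)) has_derivative (\<lambda>u. - inverse ((sin (snd z))\<^sup>2) * snd u)) (at z)"
    by (rule has_derivative_compose[OF hs])
  have sc: "((\<lambda>t. sin t * cos t) has_real_derivative (cos t)\<^sup>2 - (sin t)\<^sup>2) (at t)" for t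
    by (auto intro!: derivative_eq_intros simp: power2_eq_square)
  have 3: "((\<lambda>y. - ((sin (snd y) * cos (snd y)) * g (fst y) (fst v) (fst w))) has_derivative
     (\<lambda>u. - (((cos (snd z))\<^sup>2 - (sin (snd z))\<^sup>2) * snd u * g (fst z) (fst v) (fst w)
       + sin (snd z) * cos (snd z) * frechet_derivative (\<lambda>x. g x (fst v) (fst w)) (at (fst z)) (fst u)))) (at z)"
    by (rule has_derivative_minus[OF has_derivative_separated[OF sc has_frechet_derivative[OF diff_g[OF x]]]])
  have "frechet_derivative (\<lambda>y. christoffel G y v w) (at z) =
     frechet_derivative (\<lambda>y. (christoffel g (fst y) (fst v) (fst w) + cot (snd y) *\<^sub>R (snd v *\<^sub>R fst w + snd w *\<^sub>R fst v),
       - ((sin (snd y) * cos (snd y)) * g (fst y) (fst v) (fst w)))) (at z)"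
    by (rule frechet_derivative_cong_open[OF open_W z]) (simp add: christoffel_G)
  then show ?thesis
    using frechet_derivative_eqI[OF has_derivative_Pair[OF has_derivative_add[OF 1 has_derivative_scaleR_left[OF 2]] 3]] by simp
qed

text \<open>The curvature of a warped product with f = sin. The terms involving dt come from f'' = -
  f, and the square of f' corrects the curvature of the base by that of a space of constant
  curvature.\<close>

lemma curvature_G:
  assumes z: "z \<in> W"
  shows "curvature G z u v w =
    (curvature g (fst z) (fst u) (fst v) (fst w) - snd w *\<^sub>R (snd u *\<^sub>R fst v - snd v *\<^sub>R fst u)
       - (cos (snd z))\<^sup>2 *\<^sub>R (g (fst z) (fst v) (fst w) *\<^sub>R fst u - g (fst z) (fst u) (fst w) *\<^sub>R fst v),
     (sin (snd z))\<^sup>2 * (snd u * g (fst z) (fst v) (fst w) - snd v * g (fst z) (fst u) (fst w)))"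
proof -
  note x = W_D(1)[OF z]
  define S C k where "S = sin (snd z)" and "C = cos (snd z)" and "k = cot (snd z)"
  have S: "S \<noteq> 0" using W_D(2)[OF z] by (simp add: S_def)
  have kS: "k * S = C" using S by (simp add: k_def S_def C_def cot_def)
  have SC: "S\<^sup>2 + C\<^sup>2 = 1" by (simp add: S_def C_def)
  \<comment> \<open>The derivative of cot is rewritten as a polynomial in k, so that the rest of the
    computation has no denominators.\<close>
  have k': "- inverse (S\<^sup>2) = - 1 - k\<^sup>2"
  proof -
    have "S\<^sup>2 * (1 + k\<^sup>2) = S\<^sup>2 + (k * S)\<^sup>2" by (simp add: algebra_simps)
    then have "S\<^sup>2 * (1 + k\<^sup>2) = 1" using kS SC by simp
    then have "inverse (S\<^sup>2) = 1 + k\<^sup>2" by (rule inverse_unique)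
    then show ?thesis by simp
  qed
  have C2: "C\<^sup>2 = k * (S * C)" using kS by (simp add: power2_eq_square mult.assoc[symmetric])
  have S2: "S\<^sup>2 = 1 - k * (S * C)" using SC C2 by simp
  obtain p a where u: "u = (p, a)" by (cases u)
  obtain q b where v: "v = (q, b)" by (cases v)
  obtain r c where w: "w = (r, c)" by (cases w)
  define \<Gamma> where "\<Gamma> = christoffel g (fst z)"
  define h where "h = g (fst z)"
  define D1 D2 where "D1 = frechet_derivative (\<lambda>x. christoffel g x q r) (at (fst z)) p"
    and "D2 = frechet_derivative (\<lambda>x. christoffel g x p r) (at (fst z)) q"
  define H1 H2 where "H1 = frechet_derivative (\<lambda>x. g x q r) (at (fst z)) p"
    and "H2 = frechet_derivative (\<lambda>x. g x p r) (at (fst z)) q"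
  have lin: "\<Gamma> p (l + m) = \<Gamma> p l + \<Gamma> p m" "\<Gamma> p (t *\<^sub>R l) = t *\<^sub>R \<Gamma> p l" "h p (l + m) = h p l + h p m" "h p (t *\<^sub>R l) = t * h p l" for p l m t
    unfolding \<Gamma>_def h_def
    by (simp_all add: linear_add[OF linear_christoffel[OF x]] linear_scale[OF linear_christoffel[OF x]]
      linear_add[OF linear_g[OF x]] linear_scale[OF linear_g[OF x]])
  have co: "\<Gamma> q p = \<Gamma> p q" "h q p = h p q"
    unfolding \<Gamma>_def h_def by (rule christoffel_commute[OF x], rule g_commute[OF x])
  \<comment> \<open>Metric compatibility; the terms with the Christoffel symbol of p and q cancel in
    the difference.\<close>
  have m: "H1 - H2 = h q (\<Gamma> p r) - h p (\<Gamma> q r)"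
    unfolding H1_def H2_def metric_compatible[OF x] \<Gamma>_def h_def christoffel_commute[OF x, of q p] by simp
  have "curvature G z u v w =
     (D1 + ((- 1 - k\<^sup>2) * a) *\<^sub>R (b *\<^sub>R r + c *\<^sub>R q) - (D2 + ((- 1 - k\<^sup>2) * b) *\<^sub>R (a *\<^sub>R r + c *\<^sub>R p))
      + (\<Gamma> p (\<Gamma> q r + k *\<^sub>R (b *\<^sub>R r + c *\<^sub>R q)) + k *\<^sub>R (a *\<^sub>R (\<Gamma> q r + k *\<^sub>R (b *\<^sub>R r + c *\<^sub>R q)) + (- (S * C) * h q r) *\<^sub>R p))
      - (\<Gamma> q (\<Gamma> p r + k *\<^sub>R (a *\<^sub>R r + c *\<^sub>R p)) + k *\<^sub>R (b *\<^sub>R (\<Gamma> p r + k *\<^sub>R (a *\<^sub>R r + c *\<^sub>R p)) + (- (S * C) * h p r) *\<^sub>R q)),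
      - ((C\<^sup>2 - S\<^sup>2) * a * h q r + S * C * H1) - (- ((C\<^sup>2 - S\<^sup>2) * b * h p r + S * C * H2))
      + - (S * C) * h p (\<Gamma> q r + k *\<^sub>R (b *\<^sub>R r + c *\<^sub>R q)) - (- (S * C) * h q (\<Gamma> p r + k *\<^sub>R (a *\<^sub>R r + c *\<^sub>R p))))"
    unfolding curvature_def christoffel_G[OF z] frechet_derivative_christoffel_G[OF z] u v w fst_conv snd_conv
      S_def[symmetric] C_def[symmetric] k_def[symmetric] k' \<Gamma>_def h_def D1_def D2_def H1_def H2_def
    by simp
  also have "\<dots> = (D1 - D2 + \<Gamma> p (\<Gamma> q r) - \<Gamma> q (\<Gamma> p r) - c *\<^sub>R (a *\<^sub>R q - b *\<^sub>R p)
      - (k * (S * C)) *\<^sub>R (h q r *\<^sub>R p - h p r *\<^sub>R q),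
     - (C\<^sup>2 - S\<^sup>2) * (a * h q r - b * h p r) - S * C * (H1 - H2 - (h q (\<Gamma> p r) - h p (\<Gamma> q r)))
       + k * (S * C) * (a * h q r - b * h p r))"
    unfolding lin co by (simp add: algebra_simps power2_eq_square)
  also have "\<dots> = (D1 - D2 + \<Gamma> p (\<Gamma> q r) - \<Gamma> q (\<Gamma> p r) - c *\<^sub>R (a *\<^sub>R q - b *\<^sub>R p)
      - C\<^sup>2 *\<^sub>R (h q r *\<^sub>R p - h p r *\<^sub>R q), S\<^sup>2 * (a * h q r - b * h p r))"
    unfolding m C2[symmetric] by (simp add: algebra_simps)
  finally show ?thesis
    unfolding u v w curvature_def \<Gamma>_def h_def D1_def D2_def S_def C_def by simp
qed

lemma ricci_G:
  assumes z: "z \<in> W"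
  shows "ricci G z v w = ricci g (fst z) (fst v) (fst w) + real DIM('e) * (snd v * snd w)
    - (cos (snd z))\<^sup>2 * ((real DIM('e) - 1) * g (fst z) (fst v) (fst w)) + (sin (snd z))\<^sup>2 * g (fst z) (fst v) (fst w)"
proof -
  note x = W_D(1)[OF z]
  have b: "(\<Sum>b\<in>Basis. (l \<bullet> b) * g (fst z) b m) = g (fst z) l m" for l m
    using linear_basis_sum[OF linear_g'[OF x], of l m] by simp
  have "ricci G z v w = (\<Sum>b\<in>Basis. curvature G z (b, 0) v w \<bullet> (b, 0)) + (\<Sum>b\<in>Basis. curvature G z (0, b) v w \<bullet> (0, b :: real))"
  proof -
    have "(\<Sum>b\<in>(Basis :: ('e \<times> real) set). curvature G z b v w \<bullet> b) = (\<Sum>b\<in>(\<lambda>i. (i, 0)) ` Basis. curvature G z b v w \<bullet> b)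
        + (\<Sum>b\<in>(\<lambda>i. (0, i)) ` Basis. curvature G z b v w \<bullet> b)"
      unfolding Basis_prod_def by (rule sum.union_disjoint) auto
    then show ?thesis
      unfolding ricci_def by (simp add: sum.reindex inj_on_def)
  qed
  also have "(\<Sum>b\<in>Basis. curvature G z (b, 0) v w \<bullet> (b, 0)) =
      (\<Sum>b\<in>Basis. curvature g (fst z) b (fst v) (fst w) \<bullet> b + snd w * snd v * (b \<bullet> b)
        - (cos (snd z))\<^sup>2 * (g (fst z) (fst v) (fst w) * (b \<bullet> b) - (fst v \<bullet> b) * g (fst z) b (fst w)))"
    unfolding curvature_G[OF z] by (rule sum.cong) (simp_all add: inner_simps algebra_simps)
  also have "\<dots> = ricci g (fst z) (fst v) (fst w) + real DIM('e) * (snd v * snd w)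
      - (cos (snd z))\<^sup>2 * (real DIM('e) * g (fst z) (fst v) (fst w) - g (fst z) (fst v) (fst w))"
    by (simp add: ricci_def sum.distrib sum_subtractf sum_distrib_left[symmetric] b)
  also have "(\<Sum>b\<in>Basis. curvature G z (0, b) v w \<bullet> (0, b :: real)) = (sin (snd z))\<^sup>2 * g (fst z) (fst v) (fst w)"
    unfolding curvature_G[OF z] using linear_0[OF linear_g'[OF x]] by simp
  finally show ?thesis by (simp add: algebra_simps)
qed

text \<open>With n the dimension of the base, the coefficient of g is (n - 1) (1 - cos^2) + sin^2 =
  n sin^2, which matches the coefficient n of dt^2. This works exactly because the base has the
  Einstein constant n - 1 of the unit sphere.\<close>

lemma sine_cone_einstein:
  assumes z: "z \<in> W" and E: "\<And>v w. ricci g (fst z) v w = (real DIM('e) - 1) * g (fst z) v w"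
  shows "ricci G z v w = real DIM('e) * G z v w"
proof -
  have c: "(cos (snd z))\<^sup>2 = 1 - (sin (snd z))\<^sup>2" by (simp add: cos_squared_eq)
  show ?thesis unfolding ricci_G[OF z] E G_def c by (simp add: algebra_simps)
qed

end

section \<open>Charts and topology of the cylinder\<close>

lemma second_countable_euclidean: "second_countable (euclidean :: 'a::second_countable_topology topology)"
proof -
  obtain B :: "'a set set" where "countable B" "topological_basis B"
    using ex_countable_basis by blast
  moreover have "openin euclidean b" if "b \<in> B" for b
    using topological_basis_open[OF \<open>topological_basis B\<close> that] by simp
  moreover have "\<exists>b\<in>B. x \<in> b \<and> b \<subseteq> U" if "open U" "x \<in> U" for x U
    by (rule topological_basisE[OF \<open>topological_basis B\<close> that]) blast
  ultimately show ?thesis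
    unfolding second_countable_def by (intro exI[of _ B]) simp
qed

lemma second_countable_prod_topology:
  assumes "second_countable X" "second_countable Y"
  shows "second_countable (prod_topology X Y)"
proof -
  obtain A where A: "countable A" "\<And>V. V \<in> A \<Longrightarrow> openin X V" "\<And>U x. openin X U \<Longrightarrow> x \<in> U \<Longrightarrow> \<exists>V\<in>A. x \<in> V \<and> V \<subseteq> U"
    using assms(1) unfolding second_countable_def by metis
  obtain B where B: "countable B" "\<And>V. V \<in> B \<Longrightarrow> openin Y V" "\<And>U x. openin Y U \<Longrightarrow> x \<in> U \<Longrightarrow> \<exists>V\<in>B. x \<in> V \<and> V \<subseteq> U"
    using assms(2) unfolding second_countable_def by metis
  define C where "C = (\<lambda>(a, b). a \<times> b) ` (A \<times> B)"
  have "countable C" unfolding C_def by (intro countable_image countable_SIGMA A(1) B(1))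
  moreover have "openin (prod_topology X Y) V" if "V \<in> C" for V
    using that A(2) B(2) unfolding C_def by (auto simp: openin_prod_Times_iff)
  moreover have "\<exists>V\<in>C. z \<in> V \<and> V \<subseteq> U" if op: "openin (prod_topology X Y) U" and zU: "z \<in> U" for U z
  proof -
    obtain x y where z: "z = (x, y)" by (cases z)
    obtain P Q where P: "openin X P" "x \<in> P" and Q: "openin Y Q" "y \<in> Q" and PQ: "P \<times> Q \<subseteq> U"
      using op[unfolded openin_prod_topology_alt, rule_format, OF zU[unfolded z]] by (elim exE conjE)
    obtain P' where P': "P' \<in> A" "x \<in> P'" "P' \<subseteq> P" using A(3)[OF P] by blast
    obtain Q' where Q': "Q' \<in> B" "y \<in> Q'" "Q' \<subseteq> Q" using B(3)[OF Q] by blast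
    have "P' \<times> Q' \<in> C" unfolding C_def using P' Q' by blast
    moreover have "z \<in> P' \<times> Q'" "P' \<times> Q' \<subseteq> U" using P' Q' PQ z by auto
    ultimately show ?thesis by (intro bexI[of _ "P' \<times> Q'"] conjI)
  qed
  ultimately show ?thesis unfolding second_countable_def by (intro exI[of _ C]) simp
qed

lemma homeomorphic_map_prod:
  assumes "homeomorphic_map X Y f"
  shows "homeomorphic_map (prod_topology X Z) (prod_topology Y Z) (\<lambda>z. (f (fst z), snd z))"
proof -
  obtain g where g: "homeomorphic_maps X Y f g" using assms homeomorphic_map_maps by blast
  have "homeomorphic_maps (prod_topology X Z) (prod_topology Y Z) (\<lambda>z. (f (fst z), snd z)) (\<lambda>z. (g (fst z), snd z))"
    using g unfolding homeomorphic_maps_def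
    by (auto simp: continuous_map_pairwise o_def intro: continuous_map_compose[of _ _ fst, unfolded o_def]
        continuous_map_fst continuous_map_snd)
  then show ?thesis using homeomorphic_map_maps by blast
qed

section \<open>Product charts on the cylinder\<close>

lemma chart_image_cyl: "chart_image (cyl_chart c) = chart_image c \<times> {0<..<pi}"
  unfolding chart_image_def cyl_chart_def by (force simp: image_iff)

lemma smooth_manifold_chart:
  assumes "smooth_manifold X I ch" "i \<in> I"
  shows "inj_on (snd (ch i)) (fst (ch i))" and "open (chart_image (ch i))" and "fst (ch i) \<subseteq> topspace X"
proof -
  have o: "openin X (fst (ch i))" "open (chart_image (ch i))"
    "homeomorphic_map (subtopology X (fst (ch i))) (top_of_set (chart_image (ch i))) (snd (ch i))"
    using assms unfolding smooth_manifold_def by blast+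
  show "fst (ch i) \<subseteq> topspace X" using openin_subset[OF o(1)] .
  then show "inj_on (snd (ch i)) (fst (ch i))"
    using o(3) unfolding homeomorphic_map_def by (simp add: Int_absorb1)
  show "open (chart_image (ch i))" by (rule o(2))
qed

lemma open_overlap:
  assumes m: "smooth_manifold X I ch" and i: "i \<in> I" and j: "j \<in> I"
  shows "open (snd (ch i) ` (fst (ch i) \<inter> fst (ch j)))"
proof -
  have o: "openin X (fst (ch i))" "openin X (fst (ch j))" "open (chart_image (ch i))"
    "homeomorphic_map (subtopology X (fst (ch i))) (top_of_set (chart_image (ch i))) (snd (ch i))"
    using m i j unfolding smooth_manifold_def by blast+
  have "openin (subtopology X (fst (ch i))) (fst (ch i) \<inter> fst (ch j))"
    using o(2) by (metis Int_commute openin_subtopology_Int)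
  then have "openin (top_of_set (chart_image (ch i))) (snd (ch i) ` (fst (ch i) \<inter> fst (ch j)))"
    using o(4) homeomorphic_imp_open_map open_map_def by blast
  then show ?thesis using o(3) openin_open_trans by blast
qed

lemma transition_apply:
  assumes "inj_on (snd c) (fst c)" "m \<in> fst c"
  shows "transition c d (snd c m) = snd d m"
  using assms by (simp add: transition_def inv_into_f_f)

lemma overlap_cyl:
  "snd (cyl_chart c) ` (fst (cyl_chart c) \<inter> fst (cyl_chart d)) = snd c ` (fst c \<inter> fst d) \<times> {0<..<pi}"
  unfolding cyl_chart_def by (force simp: image_iff)

lemma transition_cyl:
  assumes c: "inj_on (snd c) (fst c)" and z: "z \<in> snd c ` (fst c \<inter> fst d) \<times> {0<..<pi}"
  shows "transition (cyl_chart c) (cyl_chart d) z = (transition c d (fst z), snd z)"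
proof -
  obtain m where m: "m \<in> fst c" "fst z = snd c m" and t: "snd z \<in> {0<..<pi}" using z by auto
  have inj: "inj_on (snd (cyl_chart c)) (fst (cyl_chart c))"
    using c unfolding cyl_chart_def inj_on_def by auto
  have "transition (cyl_chart c) (cyl_chart d) (snd (cyl_chart c) (m, snd z)) = snd (cyl_chart d) (m, snd z)"
    by (rule transition_apply[OF inj]) (use m t in \<open>simp add: cyl_chart_def\<close>)
  moreover have "snd (cyl_chart c) (m, snd z) = z"
    using m(2) by (simp add: cyl_chart_def prod_eq_iff)
  moreover have "snd (cyl_chart d) (m, snd z) = (snd d m, snd z)"
    by (simp add: cyl_chart_def)
  moreover have "transition c d (fst z) = snd d m"
    unfolding m(2) by (rule transition_apply[OF c m(1)])
  ultimately show ?thesis by (simp only:)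
qed

lemma smooth_manifold_cyl:
  assumes m: "smooth_manifold X I ch"
  shows "smooth_manifold (cyl_top X) I (cyl_chart \<circ> ch)"
  unfolding smooth_manifold_def
proof (intro conjI ballI)
  have X: "Hausdorff_space X" "second_countable X" "(\<Union>i\<in>I. fst (ch i)) = topspace X"
    using m unfolding smooth_manifold_def by blast+
  show "Hausdorff_space (cyl_top X)"
    unfolding cyl_top_def Hausdorff_space_prod_topology by (simp add: X Hausdorff_space_subtopology)
  show "second_countable (cyl_top X)"
    unfolding cyl_top_def
    by (intro second_countable_prod_topology X second_countable_subtopology second_countable_euclidean)
  show "(\<Union>i\<in>I. fst ((cyl_chart \<circ> ch) i)) = topspace (cyl_top X)"
    unfolding cyl_top_def using X(3) by (auto simp: cyl_chart_def)
  fix i assume i: "i \<in> I"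
  have o: "openin X (fst (ch i))" "open (chart_image (ch i))"
    "homeomorphic_map (subtopology X (fst (ch i))) (top_of_set (chart_image (ch i))) (snd (ch i))"
    using m i unfolding smooth_manifold_def by blast+
  show "openin (cyl_top X) (fst ((cyl_chart \<circ> ch) i))"
    using o(1) unfolding cyl_top_def by (simp add: cyl_chart_def openin_prod_Times_iff)
  show "open (chart_image ((cyl_chart \<circ> ch) i))"
    using o(2) by (simp add: chart_image_cyl open_Times)
  have s: "subtopology (cyl_top X) (fst (ch i) \<times> {0<..<pi}) = prod_topology (subtopology X (fst (ch i))) (top_of_set {0<..<pi})"
    unfolding cyl_top_def
    by (simp add: prod_topology_subtopology subtopology_subtopology Times_Int_Times)
      (rule arg_cong[where f = "subtopology _"], blast)
  have c: "fst (cyl_chart (ch i)) = fst (ch i) \<times> {0<..<pi}" "snd (cyl_chart (ch i)) = (\<lambda>z. (snd (ch i) (fst z), snd z))"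
    by (simp_all add: cyl_chart_def)
  have "homeomorphic_map (prod_topology (subtopology X (fst (ch i))) (top_of_set {0<..<pi}))
      (prod_topology (top_of_set (chart_image (ch i))) (top_of_set {0<..<pi})) (\<lambda>z. (snd (ch i) (fst z), snd z))"
    by (rule homeomorphic_map_prod[OF o(3)])
  then show "homeomorphic_map (subtopology (cyl_top X) (fst ((cyl_chart \<circ> ch) i)))
      (top_of_set (chart_image ((cyl_chart \<circ> ch) i))) (snd ((cyl_chart \<circ> ch) i))"
    unfolding comp_apply chart_image_cyl c s prod_topology_subtopology_eu .
  fix j assume j: "j \<in> I"
  define S where "S = snd (ch i) ` (fst (ch i) \<inter> fst (ch j))"
  have S: "open S" unfolding S_def by (rule open_overlap[OF m i j])
  have SW: "open (S \<times> {0<..<pi})" by (intro open_Times S open_greaterThanLessThan)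
  have sm: "smooth_on S (transition (ch i) (ch j))"
    using m i j unfolding smooth_manifold_def S_def by blast
  \<comment> \<open>The pair is written as a sum, since smoothness of each summand follows from the
    linear embedding of one factor.\<close>
  have "smooth_on (S \<times> {0<..<pi}) (\<lambda>z. (transition (ch i) (ch j) (fst z), 0::real) + (0, snd z))"
    by (intro smooth_on_add SW smooth_on_bounded_linear bounded_linear_Pair bounded_linear_zero bounded_linear_snd
        smooth_on_linear_comp[OF bounded_linear_Pair[OF bounded_linear_ident bounded_linear_zero]]
        smooth_on_compose_linear[OF bounded_linear_fst SW sm]) auto
  then have "smooth_on (S \<times> {0<..<pi}) (transition (cyl_chart (ch i)) (cyl_chart (ch j)))"
    by (rule smooth_on_cong[OF SW])
      (simp add: transition_cyl[OF smooth_manifold_chart(1)[OF m i], of _ "ch j", folded S_def])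
  then show "smooth_on (snd ((cyl_chart \<circ> ch) i) ` (fst ((cyl_chart \<circ> ch) i) \<inter> fst ((cyl_chart \<circ> ch) j)))
      (transition ((cyl_chart \<circ> ch) i) ((cyl_chart \<circ> ch) j))"
    by (simp add: overlap_cyl S_def)
qed

lemma frechet_derivative_transition_cyl:
  assumes m: "smooth_manifold X I ch" and i: "i \<in> I" and j: "j \<in> I"
    and z: "z \<in> snd (ch i) ` (fst (ch i) \<inter> fst (ch j)) \<times> {0<..<pi}"
  shows "frechet_derivative (transition (cyl_chart (ch i)) (cyl_chart (ch j))) (at z) u =
    (frechet_derivative (transition (ch i) (ch j)) (at (fst z)) (fst u), snd u)"
proof -
  define S where "S = snd (ch i) ` (fst (ch i) \<inter> fst (ch j))"
  have S: "open S" unfolding S_def by (rule open_overlap[OF m i j])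
  have SW: "open (S \<times> {0<..<pi})" by (intro open_Times S open_greaterThanLessThan)
  have sm: "smooth_on S (transition (ch i) (ch j))"
    using m i j unfolding smooth_manifold_def S_def by blast
  have zS: "z \<in> S \<times> {0<..<pi}" using z by (simp add: S_def)
  have hs: "(snd has_derivative snd) (at z)" and hf: "(fst has_derivative fst) (at z)"
    by (rule bounded_linear_imp_has_derivative, rule bounded_linear_snd bounded_linear_fst)+
  have "((\<lambda>z. transition (ch i) (ch j) (fst z)) has_derivative
      (\<lambda>u. frechet_derivative (transition (ch i) (ch j)) (at (fst z)) (fst u))) (at z)"
    by (rule has_derivative_compose[OF hf smooth_on_has_derivative[OF sm]]) (use zS in auto)
  from has_derivative_Pair[OF this hs]
  have "frechet_derivative (\<lambda>z. (transition (ch i) (ch j) (fst z), snd z)) (at z) u =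
    (frechet_derivative (transition (ch i) (ch j)) (at (fst z)) (fst u), snd u)"
    by (simp add: frechet_derivative_eqI)
  moreover have "frechet_derivative (transition (cyl_chart (ch i)) (cyl_chart (ch j))) (at z) =
      frechet_derivative (\<lambda>z. (transition (ch i) (ch j) (fst z), snd z)) (at z)"
    by (rule frechet_derivative_cong_open[OF SW zS])
      (rule transition_cyl[OF smooth_manifold_chart(1)[OF m i], of _ "ch j", folded S_def])
  ultimately show ?thesis by simp
qed

lemma transition_in_overlap:
  assumes m: "smooth_manifold X I ch" and i: "i \<in> I" and x: "x \<in> snd (ch i) ` (fst (ch i) \<inter> fst (ch j))"
  shows "transition (ch i) (ch j) x \<in> snd (ch j) ` (fst (ch j) \<inter> fst (ch i))"
proof -
  obtain p where "p \<in> fst (ch i) \<inter> fst (ch j)" "x = snd (ch i) p" using x by blast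
  then show ?thesis using transition_apply[OF smooth_manifold_chart(1)[OF m i], of p "ch j"] by auto
qed

text \<open>The transition back is a left inverse, so by the chain rule the derivative is injective,
  hence surjective in equal dimensions. Surjectivity is what carries the partner relation from one
  chart to another.\<close>

lemma surj_frechet_derivative_transition:
  fixes ch :: "'i \<Rightarrow> ('m, 'e::euclidean_space) chart"
  assumes m: "smooth_manifold X I ch" and i: "i \<in> I" and j: "j \<in> I"
    and x: "x \<in> snd (ch i) ` (fst (ch i) \<inter> fst (ch j))"
  shows "surj (frechet_derivative (transition (ch i) (ch j)) (at x))"
    and "linear (frechet_derivative (transition (ch i) (ch j)) (at x))"
proof -
  define S where "S k l = snd (ch k) ` (fst (ch k) \<inter> fst (ch l))" for k l
  have sm: "smooth_on (S k l) (transition (ch k) (ch l))" if "k \<in> I" "l \<in> I" for k l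
    using m that unfolding smooth_manifold_def S_def by blast
  have hd: "(transition (ch i) (ch j) has_derivative frechet_derivative (transition (ch i) (ch j)) (at x)) (at x)"
    using smooth_on_has_derivative[OF sm[OF i j]] x by (simp add: S_def)
  have y: "transition (ch i) (ch j) x \<in> S j i" unfolding S_def by (rule transition_in_overlap[OF m i x])
  have "((\<lambda>y. transition (ch j) (ch i) (transition (ch i) (ch j) y)) has_derivative
      (\<lambda>u. frechet_derivative (transition (ch j) (ch i)) (at (transition (ch i) (ch j) x))
        (frechet_derivative (transition (ch i) (ch j)) (at x) u))) (at x)"
    by (rule has_derivative_compose[OF hd smooth_on_has_derivative[OF sm[OF j i] y]])
  then have "((\<lambda>y. y) has_derivative
      (\<lambda>u. frechet_derivative (transition (ch j) (ch i)) (at (transition (ch i) (ch j) x))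
        (frechet_derivative (transition (ch i) (ch j)) (at x) u))) (at x)"
  proof (rule has_derivative_transform_within_open[OF _ open_overlap[OF m i j] x])
    fix y assume "y \<in> snd (ch i) ` (fst (ch i) \<inter> fst (ch j))"
    then obtain p where "p \<in> fst (ch i)" "p \<in> fst (ch j)" "y = snd (ch i) p" by blast
    then show "transition (ch j) (ch i) (transition (ch i) (ch j) y) = y"
      using transition_apply[OF smooth_manifold_chart(1)[OF m i], of p "ch j"]
        transition_apply[OF smooth_manifold_chart(1)[OF m j], of p "ch i"] by simp
  qed
  then have "frechet_derivative (transition (ch j) (ch i)) (at (transition (ch i) (ch j) x))
        (frechet_derivative (transition (ch i) (ch j)) (at x) u) = u" for u
    using frechet_derivative_eqI[of "\<lambda>y. y"] frechet_derivative_ident by metis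
  then have "inj (frechet_derivative (transition (ch i) (ch j)) (at x))"
    by (rule inj_on_inverseI)
  moreover show l: "linear (frechet_derivative (transition (ch i) (ch j)) (at x))"
    using has_derivative_linear[OF hd] .
  ultimately show "surj (frechet_derivative (transition (ch i) (ch j)) (at x))"
    using linear_injective_imp_surjective[OF l] by simp
qed

section \<open>Topology of the completed cylinder\<close>

lemma compact_collapsed_cyl:
  assumes "compact_space X"
  shows "compact_space (collapsed_cyl X)"
proof -
  have "compact_space (prod_topology X (top_of_set {0..pi}))"
    using assms by (simp add: compact_space_prod_topology compact_space_subtopology compactin_euclidean_iff)
  then have "compactin (collapsed_cyl X) (collapse_ends (topspace X) ` topspace (prod_topology X (top_of_set {0..pi})))"
    unfolding compact_space_def
    by (rule image_compactin) (rule quotient_imp_continuous_map[OF quotient_map_collapsed_cyl])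
  then show ?thesis
    using quotient_imp_surjective_map[OF quotient_map_collapsed_cyl] unfolding compact_space_def by metis
qed

text \<open>A quotient map restricts to a quotient map over an open set. The complement of the two
  end points is open because its preimage U is, and over U the map is injective.\<close>

lemma homeomorphic_map_collapsed_cyl:
  "homeomorphic_map (cyl_top X)
     (subtopology (collapsed_cyl X)
        (topspace (collapsed_cyl X) - collapse_ends (topspace X) ` (topspace X \<times> {0, pi})))
     (collapse_ends (topspace X))"
proof -
  define N where "N = topspace X"
  define q where "q = collapse_ends N"
  define Z where "Z = prod_topology X (top_of_set {0..pi})"
  define U where "U = N \<times> {0<..<pi}"
  define V where "V = topspace (collapsed_cyl X) - q ` (N \<times> {0, pi})"
  have Q: "quotient_map Z (collapsed_cyl X) q"
    unfolding Z_def q_def N_def by (rule quotient_map_collapsed_cyl)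
  have tZ: "topspace Z = N \<times> {0..pi}" unfolding Z_def N_def by simp
  have tC: "topspace (collapsed_cyl X) = q ` (N \<times> {0..pi})"
    using quotient_imp_surjective_map[OF Q] tZ by simp
  have qU: "q z = {z}" if "z \<in> U" for z
    using that unfolding q_def U_def collapse_ends_def by auto
  have qE: "q z = N \<times> {snd z}" if "z \<in> N \<times> {0, pi}" for z
    using that unfolding q_def collapse_ends_def by auto
  \<comment> \<open>The class of z' contains z', so equality with the singleton of z would place z'
    in the open cylinder. This also covers a link consisting of one point.\<close>
  have ne: "q z \<noteq> q z'" if z: "z \<in> U" and z': "z' \<in> N \<times> {0, pi}" for z z'
  proof
    assume "q z = q z'"
    then have "z' \<in> {z}" using qU[OF z] qE[OF z'] z' by (metis mem_Times_iff singletonI)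
    then show False using z z' by (auto simp: U_def)
  qed
  have pre: "{z \<in> topspace Z. q z \<in> V} = U"
  proof -
    have "z \<in> U" if "z \<in> N \<times> {0..pi}" "z \<notin> N \<times> {0, pi}" for z
      using that by (force simp: U_def)
    moreover have "U \<subseteq> N \<times> {0..pi}" by (auto simp: U_def)
    ultimately show ?thesis unfolding tZ V_def tC using ne by blast
  qed
  have "openin Z U"
    unfolding Z_def U_def N_def openin_prod_Times_iff
    by (auto simp: openin_open intro!: exI[of _ "{0<..<pi}"])
  then have "openin (collapsed_cyl X) V"
  proof -
    have "V \<subseteq> topspace (collapsed_cyl X)" by (auto simp: V_def)
    then have "openin Z {z \<in> topspace Z. q z \<in> V} \<longleftrightarrow> openin (collapsed_cyl X) V"
      using Q unfolding quotient_map_def by blast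
    then show ?thesis using \<open>openin Z U\<close> pre by simp
  qed
  then have "quotient_map (subtopology Z U) (subtopology (collapsed_cyl X) V) q"
    using quotient_map_restriction[OF Q pre] by blast
  moreover have "subtopology Z U = cyl_top X"
  proof -
    have "{0..pi} \<inter> {0<..<pi} = {0<..<pi}" by auto
    then show ?thesis
      using prod_topology_subtopology(2)[of X "top_of_set {0..pi}" "{0<..<pi}"]
      unfolding Z_def U_def N_def cyl_top_def by (simp add: subtopology_subtopology)
  qed
  moreover have "inj_on q (topspace (cyl_top X))"
    unfolding cyl_top_def using qU by (auto simp: inj_on_def U_def N_def)
  ultimately show ?thesis
    unfolding homeomorphic_map_def V_def q_def N_def by simp
qed

section \<open>The sine cone over a Sasaki-Einstein manifold\<close>

text \<open>Dual bases exist point by point. The dual vectors solve linear systems whose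
  coefficients are the components of the coframe, so they are smooth by Cramer's rule.\<close>

lemma coframe_smooth_dual:
  fixes e :: "nat \<Rightarrow> real ^ 5 \<Rightarrow> (real ^ 5, real) covector"
  assumes V: "open V" and cof: "\<And>y. y \<in> V \<Longrightarrow> coframe 5 (\<lambda>a. e a y)"
    and sm: "\<And>a u. a \<in> {1..5} \<Longrightarrow> smooth_on V (\<lambda>y. form1 (e a y) u)"
  obtains E where "\<And>b. b \<in> {1..5} \<Longrightarrow> smooth_on V (E b)"
    and "\<And>a b y. a \<in> {1..5} \<Longrightarrow> b \<in> {1..5} \<Longrightarrow> y \<in> V \<Longrightarrow> form1 (e a y) (E b y) = (if a = b then 1 else 0)"
    and "\<And>y u. y \<in> V \<Longrightarrow> u = (\<Sum>a=1..5. form1 (e a y) u *\<^sub>R E a y)"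
proof -
  have "\<exists>E. (\<forall>a\<in>{1..5}. \<forall>b\<in>{1..5}. form1 (e a y) (E b) = (if a = b then 1 else 0)) \<and>
      (\<forall>u. u = (\<Sum>a=1..5. form1 (e a y) u *\<^sub>R E a))" if y: "y \<in> V" for y
  proof (rule coframe_dual_basis[OF cof[OF y]])
    fix E assume E: "\<And>a b. a \<in> {1..5} \<Longrightarrow> b \<in> {1..5} \<Longrightarrow> form1 (e a y) (E b) = (if a = b then 1 else 0)"
      "\<And>u. u = (\<Sum>a=1..5. form1 (e a y) u *\<^sub>R E a)"
    show ?thesis by (intro exI[of _ E] conjI ballI allI E)
  qed
  then have "\<forall>y\<in>V. \<exists>E. (\<forall>a\<in>{1..5}. \<forall>b\<in>{1..5}. form1 (e a y) (E b) = (if a = b then 1 else 0)) \<and>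
      (\<forall>u. u = (\<Sum>a=1..5. form1 (e a y) u *\<^sub>R E a))" by blast
  from bchoice[OF this] obtain E where E: "\<And>y. y \<in> V \<Longrightarrow> (\<forall>a\<in>{1..5}. \<forall>b\<in>{1..5}. form1 (e a y) (E y b) = (if a = b then 1 else 0)) \<and>
      (\<forall>u. u = (\<Sum>a=1..5. form1 (e a y) u *\<^sub>R E y a))"
    by blast
  \<comment> \<open>Matches the index type of matrices with the numbering 1, ..., 5 of the
    coframe.\<close>
  obtain \<beta> :: "5 \<Rightarrow> nat" where \<beta>: "bij_betw \<beta> UNIV {1..5}"
    using finite_same_card_bij[of "UNIV :: 5 set" "{1..5 :: nat}"] by auto
  have \<beta>r: "\<beta> k \<in> {1..5}" for k using \<beta> by (auto simp: bij_betw_def)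
  define A :: "real ^ 5 \<Rightarrow> real ^ 5 ^ 5" where "A y = (\<chi> k l. form1 (e (\<beta> k) y) (axis l 1))" for y
  have A: "(A y *v u) $ k = form1 (e (\<beta> k) y) u" if "y \<in> V" for y u k
  proof -
    have l: "linear (form1 (e (\<beta> k) y))" by (rule coframe_linear[OF cof[OF that] \<beta>r])
    have "form1 (e (\<beta> k) y) u = form1 (e (\<beta> k) y) (\<Sum>l\<in>UNIV. u $ l *\<^sub>R axis l 1)"
      using basis_expansion[of u] by (simp add: scalar_mult_eq_scaleR)
    also have "\<dots> = (\<Sum>l\<in>UNIV. u $ l *\<^sub>R form1 (e (\<beta> k) y) (axis l 1))"
      unfolding linear_sum[OF l] linear_scale[OF l] ..
    finally show ?thesis by (simp add: A_def matrix_vector_mult_def mult.commute)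
  qed
  have det: "det (A y) \<noteq> 0" if y: "y \<in> V" for y
  proof -
    have "u = 0" if "A y *v u = 0" for u
    proof (rule coframe_total[OF cof[OF y]])
      fix a :: nat assume "a \<in> {1..5}"
      then obtain k where "a = \<beta> k" using \<beta> unfolding bij_betw_def by blast
      then show "form1 (e a y) u = 0" using A[OF y, of u k] that by simp
    qed
    then show ?thesis
      using matrix_left_invertible_ker[of "A y"] invertible_left_inverse[of "A y"] invertible_det_nz[of "A y"] by blast
  qed
  have smE: "smooth_on V (\<lambda>y. E y b)" if b: "b \<in> {1..5}" for b
  proof (rule smooth_on_linear_solve[where b = "\<lambda>_. \<chi> k. if \<beta> k = b then 1 else (0::real)", OF V _ _ det])
    show "smooth_on V (\<lambda>y. A y $ k $ l)" for k l unfolding A_def by (simp add: sm \<beta>r del: atLeastAtMost_iff)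
    show "smooth_on V (\<lambda>y. (\<chi> k. if \<beta> k = b then 1 else (0::real)) $ k)" for k by (rule smooth_on_const)
    show "A y *v E y b = (\<chi> k. if \<beta> k = b then 1 else (0::real))" if "y \<in> V" for y
      using E[OF that, THEN conjunct1] \<beta>r b by (simp add: vec_eq_iff A[OF that] del: atLeastAtMost_iff)
  qed
  show thesis
  proof (rule that[of "\<lambda>b y. E y b"])
    show "smooth_on V (\<lambda>y. E y b)" if "b \<in> {1..5}" for b by (rule smE[OF that])
    show "form1 (e a y) (E y b) = (if a = b then 1 else 0)" if "a \<in> {1..5}" "b \<in> {1..5}" "y \<in> V" for a b y
      using E[OF that(3), THEN conjunct1] that(1,2) by blast
    show "u = (\<Sum>a=1..5. form1 (e a y) u *\<^sub>R E y a)" if "y \<in> V" for y u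
      by (rule E[OF that, THEN conjunct2, rule_format])
  qed
qed

text \<open>The limit 1 of sin r / r, in the form of a relative error as needed for a cone
  metric.\<close>

lemma sin_squared_near_0:
  fixes \<epsilon> :: real
  assumes "\<epsilon> > 0"
  shows "\<exists>\<delta>>0. \<forall>r. 0 < r \<and> r < \<delta> \<longrightarrow> \<bar>(sin r)\<^sup>2 - r\<^sup>2\<bar> \<le> \<epsilon> * r\<^sup>2"
proof -
  have "((\<lambda>h. (sin (0 + h) - sin 0) / h) \<longlongrightarrow> cos 0) (at (0::real))"
    using DERIV_sin[of 0] unfolding DERIV_def .
  then have "((\<lambda>h. (sin h / h)\<^sup>2) \<longlongrightarrow> 1\<^sup>2) (at (0::real))"
    by (intro tendsto_power) simp
  then have "\<forall>\<^sub>F h in at (0::real). dist ((sin h / h)\<^sup>2) (1\<^sup>2) < \<epsilon>"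
    using assms by (rule tendstoD)
  then obtain d where d: "d > 0" "\<And>h::real. h \<noteq> 0 \<Longrightarrow> dist h 0 < d \<Longrightarrow> dist ((sin h / h)\<^sup>2) (1\<^sup>2) < \<epsilon>"
    unfolding eventually_at by auto
  have "\<bar>(sin r)\<^sup>2 - r\<^sup>2\<bar> \<le> \<epsilon> * r\<^sup>2" if "0 < r" "r < d" for r
  proof -
    have "\<bar>(sin r / r)\<^sup>2 - 1\<bar> < \<epsilon>" using d(2)[of r] that by (simp add: dist_real_def)
    then have "\<bar>(sin r / r)\<^sup>2 - 1\<bar> * r\<^sup>2 \<le> \<epsilon> * r\<^sup>2" by (intro mult_right_mono) auto
    moreover have "\<bar>(sin r / r)\<^sup>2 - 1\<bar> * r\<^sup>2 = \<bar>((sin r / r)\<^sup>2 - 1) * r\<^sup>2\<bar>" by (simp add: abs_mult)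
    moreover have "((sin r / r)\<^sup>2 - 1) * r\<^sup>2 = (sin r)\<^sup>2 - r\<^sup>2" using that by (simp add: field_simps)
    ultimately show ?thesis by simp
  qed
  then show ?thesis using d(1) by blast
qed

section \<open>The sine cone of a fixed Sasaki-Einstein manifold: structure equations and
  coframes\<close>

locale sasaki_einstein_manifold =
  fixes X :: "'m topology" and I :: "'i set" and ch :: "'i \<Rightarrow> ('m, real ^ 5) chart"
    and \<eta> :: "'i \<Rightarrow> real ^ 5 \<Rightarrow> (real ^ 5, real) covector"
    and \<omega> :: "nat \<Rightarrow> 'i \<Rightarrow> real ^ 5 \<Rightarrow> (real ^ 5, real) covector"
  assumes se: "sasaki_einstein X I ch \<eta> \<omega>"
begin

abbreviation g where "g \<equiv> su2_metric \<eta> \<omega>"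
abbreviation G where "G \<equiv> warped_metric (\<lambda>t. t) sin g"
abbreviation F where "F \<equiv> sine_cone_F \<eta> \<omega>"
abbreviation \<Psi>p where "\<Psi>p \<equiv> sine_cone_Psi_plus \<eta> \<omega>"
abbreviation \<Psi>m where "\<Psi>m \<equiv> sine_cone_Psi_minus \<eta> \<omega>"

lemma su2: "su2_structure X I ch \<eta> \<omega>"
  using se unfolding sasaki_einstein_def by blast

lemma mfd: "smooth_manifold X I ch"
  using su2 unfolding su2_structure_def by blast

lemma open_chart: "i \<in> I \<Longrightarrow> open (chart_image (ch i))"
  by (rule smooth_manifold_chart(2)[OF mfd])

lemma df: "diff_form I ch 1 \<eta>" "a \<in> {1, 2, 3} \<Longrightarrow> diff_form I ch 2 (\<omega> a)"
  using su2 unfolding su2_structure_def by blast+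

lemma alt: "i \<in> I \<Longrightarrow> x \<in> chart_image (ch i) \<Longrightarrow> su2_alternating \<eta> \<omega> i x"
  unfolding su2_alternating_def using diff_form_alternating[OF df(1)] diff_form_alternating[OF df(2)] by blast

lemma overlap_chart:
  assumes "x \<in> snd (ch i) ` (fst (ch i) \<inter> fst (ch j))"
  shows "x \<in> chart_image (ch i)"
  using assms unfolding chart_image_def by blast

lemma form1_transition:
  assumes "i \<in> I" "j \<in> I" "x \<in> snd (ch i) ` (fst (ch i) \<inter> fst (ch j))"
  shows "form1 (\<eta> i x) p = form1 (\<eta> j (transition (ch i) (ch j) x)) (frechet_derivative (transition (ch i) (ch j)) (at x) p)"
proof -
  have "\<eta> i x = pullback (transition (ch i) (ch j)) (\<eta> j) x"
    using df(1) assms unfolding diff_form_def by blast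
  then show ?thesis by (simp add: form1_def pullback_def)
qed

lemma form2_transition:
  assumes "a \<in> {1, 2, 3}" "i \<in> I" "j \<in> I" "x \<in> snd (ch i) ` (fst (ch i) \<inter> fst (ch j))"
  defines "D \<equiv> frechet_derivative (transition (ch i) (ch j)) (at x)"
  shows "form2 (\<omega> a i x) p q = form2 (\<omega> a j (transition (ch i) (ch j) x)) (D p) (D q)"
proof -
  have "\<omega> a i x = pullback (transition (ch i) (ch j)) (\<omega> a j) x"
    using df(2)[OF assms(1)] assms(2-4) unfolding diff_form_def by blast
  moreover have "(\<lambda>k. D (case_nat p (\<lambda>_. q) k)) = case_nat (D p) (\<lambda>_. D q)"
    by (rule ext) (simp split: nat.split)
  ultimately show ?thesis by (simp add: form2_def pullback_def D_def)
qed

lemma sasaki_point: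
  assumes i: "i \<in> I"
  shows "sasaki_point (chart_image (ch i)) (\<lambda>y. form1 (\<eta> i y)) (\<lambda>a y. form2 (\<omega> a i y))"
proof (rule sasaki_point.intro)
  note U = open_chart[OF i]
  show "open (chart_image (ch i))" by (rule U)
  show "smooth_on (chart_image (ch i)) (\<lambda>y. form1 (\<eta> i y) p)" for p
    by (rule smooth_on_form1[OF df(1) i])
  show "smooth_on (chart_image (ch i)) (\<lambda>y. form2 (\<omega> a i y) p q)" if "a \<in> {1, 2, 3}" for a p q
    by (rule smooth_on_form2[OF df(2)[OF that] i])
  fix x assume x: "x \<in> chart_image (ch i)"
  have a1: "alternating 1 (\<eta> i y)" and a2: "alternating 2 (\<omega> 1 i y)" "alternating 2 (\<omega> 2 i y)" "alternating 2 (\<omega> 3 i y)"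
    if "y \<in> chart_image (ch i)" for y
    using su2_structure_alternating[OF su2 i that] by blast+
  have e: "ext_deriv 1 (\<eta> i) x v = - 2 * \<omega> 3 i x v"
    "ext_deriv 2 (\<omega> 1 i) x v = 3 * wedge 1 2 (\<eta> i x) (\<omega> 2 i x) v"
    "ext_deriv 2 (\<omega> 2 i) x v = - 3 * wedge 1 2 (\<eta> i x) (\<omega> 1 i x) v" for v
    using se i x unfolding sasaki_einstein_def by simp_all
  show "frechet_derivative (\<lambda>y. form1 (\<eta> i y) q) (at x) p - frechet_derivative (\<lambda>y. form1 (\<eta> i y) p) (at x) q
      = - 2 * form2 (\<omega> 3 i x) p q" for p q
    using e(1)[where v = "case_nat p (\<lambda>_. q)"] ext_deriv_1[where \<alpha> = "\<eta> i", OF U x a1, where v = "case_nat p (\<lambda>_. q)"]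
    by (simp add: form2_def)
  show "frechet_derivative (\<lambda>y. form2 (\<omega> 1 i y) q r) (at x) p - frechet_derivative (\<lambda>y. form2 (\<omega> 1 i y) p r) (at x) q
        + frechet_derivative (\<lambda>y. form2 (\<omega> 1 i y) p q) (at x) r
        = 3 * (form1 (\<eta> i x) p * form2 (\<omega> 2 i x) q r - form1 (\<eta> i x) q * form2 (\<omega> 2 i x) p r + form1 (\<eta> i x) r * form2 (\<omega> 2 i x) p q)" for p q r
    using e(2)[where v = "case_nat p (case_nat q (\<lambda>_. r))"] ext_deriv_2[where \<alpha> = "\<omega> 1 i", OF U x a2(1), where v = "case_nat p (case_nat q (\<lambda>_. r))"]
      wedge_1_2[OF a1[OF x] a2(2)[OF x], where v = "case_nat p (case_nat q (\<lambda>_. r))"]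
    by (simp add: numeral_2_eq_2)
  show "frechet_derivative (\<lambda>y. form2 (\<omega> 2 i y) q r) (at x) p - frechet_derivative (\<lambda>y. form2 (\<omega> 2 i y) p r) (at x) q
        + frechet_derivative (\<lambda>y. form2 (\<omega> 2 i y) p q) (at x) r
        = - 3 * (form1 (\<eta> i x) p * form2 (\<omega> 1 i x) q r - form1 (\<eta> i x) q * form2 (\<omega> 1 i x) p r + form1 (\<eta> i x) r * form2 (\<omega> 1 i x) p q)" for p q r
    using e(3)[where v = "case_nat p (case_nat q (\<lambda>_. r))"] ext_deriv_2[where \<alpha> = "\<omega> 2 i", OF U x a2(2), where v = "case_nat p (case_nat q (\<lambda>_. r))"]
      wedge_1_2[OF a1[OF x] a2(1)[OF x], where v = "case_nat p (case_nat q (\<lambda>_. r))"]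
    by (simp add: numeral_2_eq_2)
qed

lemma nearly_kaehler_equations:
  assumes i: "i \<in> I" and z: "z \<in> chart_image (cyl_chart (ch i))"
  shows "ext_deriv 2 (F i) z = (\<lambda>v. 3 * \<Psi>p i z v)"
    and "ext_deriv 3 (\<Psi>m i) z = (\<lambda>v. -2 * wedge 2 2 (F i z) (F i z) v)"
proof -
  interpret P: sasaki_point "chart_image (ch i)" "\<lambda>y. form1 (\<eta> i y)" "\<lambda>a y. form2 (\<omega> a i y)"
    by (rule sasaki_point[OF i])
  define S where "S = chart_image (cyl_chart (ch i))"
  have S: "open S" unfolding S_def chart_image_cyl by (intro open_Times open_chart i open_greaterThanLessThan)
  have zS: "z \<in> S" using z by (simp add: S_def)
  have fS: "fst y \<in> chart_image (ch i)" if "y \<in> S" for y using that by (auto simp: S_def chart_image_cyl)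
  have x: "fst z \<in> chart_image (ch i)" by (rule fS[OF zS])
  note alt' = alt[OF i fS]
  have F: "F i y = P.F y" if "y \<in> S" for y
    by (rule ext) (simp only: sine_cone_F_apply[OF alt'[OF that]] P.F_def)
  have \<Psi>: "\<Psi>m i y = P.\<Psi>m y" if "y \<in> S" for y
    by (rule ext) (simp only: sine_cone_Psi_minus_apply[OF alt'[OF that]] P.\<Psi>m_def)
  note forms = su2_structure_forms[OF su2 i x]
  have q11: "quad (form2 (\<omega> 1 i (fst z))) (form2 (\<omega> 1 i (fst z))) p q r s = quad (form2 (\<omega> 3 i (fst z))) (form2 (\<omega> 3 i (fst z))) p q r s"
    and q13: "quad (form2 (\<omega> 1 i (fst z))) (form2 (\<omega> 3 i (fst z))) p q r s = 0" for p q r s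
    using su2_forms.q33[OF forms] su2_forms.q13[OF forms] by simp_all
  show "ext_deriv 2 (F i) z = (\<lambda>v. 3 * \<Psi>p i z v)"
    by (rule ext) (simp only: ext_deriv_cong_open[OF S zS F] P.d_F[OF x] sine_cone_Psi_plus_apply[OF alt'[OF zS]])
  have f2: "form2 (F i z) = P.F2 z"
    by (intro ext) (simp add: form2_def P.F2_def F[OF zS])
  note altF = alternating_sine_cone_F[OF alt'[OF zS]]
  show "ext_deriv 3 (\<Psi>m i) z = (\<lambda>v. -2 * wedge 2 2 (F i z) (F i z) v)"
    by (rule ext) (simp only: ext_deriv_cong_open[OF S zS \<Psi>] P.d_Psi_minus[OF x q11 q13] wedge_2_2_quad[OF altF altF] f2)
qed

text \<open>The forms and their expressions in the coframe agree on the open set V, so they have the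
  same derivatives there and the structure equations carry over. The equation for the third 2-form
  is its closedness \<open>d_w3\<close>.\<close>

lemma local_coframe:
  assumes i: "i \<in> I" and x: "x \<in> chart_image (ch i)"
  obtains V e E where "open V" "x \<in> V" "V \<subseteq> chart_image (ch i)"
    "\<And>a v. a \<in> {1..5} \<Longrightarrow> smooth_on V (\<lambda>y. e a y v)"
    "\<And>y. y \<in> V \<Longrightarrow> su2_adapted (\<lambda>a. e a y) (\<eta> i y) (\<lambda>a. \<omega> a i y)"
    "sasaki_einstein_coframe V (\<lambda>a y. form1 (e a y)) E (g i)"
proof -
  obtain V e where V: "open V" "x \<in> V" "V \<subseteq> chart_image (ch i)"
    and sm: "\<And>a v. a \<in> {1..5} \<Longrightarrow> smooth_on V (\<lambda>y. e a y v)"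
    and ad: "\<And>y. y \<in> V \<Longrightarrow> su2_adapted (\<lambda>a. e a y) (\<eta> i y) (\<lambda>a. \<omega> a i y)"
    using su2_structure_local_coframe[OF su2 i x] by metis
  have cof: "coframe 5 (\<lambda>a. e a y)" and e5: "\<eta> i y = e 5 y" if "y \<in> V" for y
    using ad[OF that] unfolding su2_adapted_def by blast+
  have smf: "smooth_on V (\<lambda>y. form1 (e a y) u)" if "a \<in> {1..5}" for a u
    unfolding form1_def by (rule sm[OF that])
  obtain E where E: "\<And>b. b \<in> {1..5} \<Longrightarrow> smooth_on V (E b)"
    "\<And>a b y. a \<in> {1..5} \<Longrightarrow> b \<in> {1..5} \<Longrightarrow> y \<in> V \<Longrightarrow> form1 (e a y) (E b y) = (if a = b then 1 else 0)"
    "\<And>y u. y \<in> V \<Longrightarrow> u = (\<Sum>a=1..5. form1 (e a y) u *\<^sub>R E a y)"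
  proof (rule coframe_smooth_dual[where e = e, OF V(1) cof smf])
    fix E assume E: "\<And>b. b \<in> {1..5} \<Longrightarrow> smooth_on V (E b)"
      "\<And>a b y. a \<in> {1..5} \<Longrightarrow> b \<in> {1..5} \<Longrightarrow> y \<in> V \<Longrightarrow> form1 (e a y) (E b y) = (if a = b then 1 else 0)"
      "\<And>y u. y \<in> V \<Longrightarrow> u = (\<Sum>a=1..5. form1 (e a y) u *\<^sub>R E a y)"
    show thesis by (rule that[OF E])
  qed
  interpret P: sasaki_point "chart_image (ch i)" "\<lambda>y. form1 (\<eta> i y)" "\<lambda>a y. form2 (\<omega> a i y)"
    by (rule sasaki_point[OF i])
  have w: "ewedge (\<lambda>a y. form1 (e a y)) 1 2 y p q + ewedge (\<lambda>a y. form1 (e a y)) 3 4 y p q = form2 (\<omega> 1 i y) p q"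
    "ewedge (\<lambda>a y. form1 (e a y)) 1 3 y p q + ewedge (\<lambda>a y. form1 (e a y)) 4 2 y p q = form2 (\<omega> 2 i y) p q"
    "ewedge (\<lambda>a y. form1 (e a y)) 1 4 y p q + ewedge (\<lambda>a y. form1 (e a y)) 2 3 y p q = form2 (\<omega> 3 i y) p q"
    if "y \<in> V" for y p q
    unfolding ewedge_def su2_adapted_form2[OF ad[OF that]] by simp_all
  have cong: "d2 f y = d2 h y" if "y \<in> V" "\<And>y p q. y \<in> V \<Longrightarrow> f y p q = h y p q" for f h :: "real ^ 5 \<Rightarrow> real ^ 5 \<Rightarrow> real ^ 5 \<Rightarrow> real" and y
  proof -
    have "frechet_derivative (\<lambda>y. f y p q) (at y) = frechet_derivative (\<lambda>y. h y p q) (at y)" for p q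
      by (rule frechet_derivative_cong_open[OF V(1) that(1)]) (rule that(2))
    then show ?thesis unfolding d2_def by simp
  qed
  have dd: "d2 (\<lambda>y p q. ewedge (\<lambda>a y. form1 (e a y)) 1 2 y p q + ewedge (\<lambda>a y. form1 (e a y)) 3 4 y p q) y = d2 (\<lambda>y. form2 (\<omega> 1 i y)) y"
    "d2 (\<lambda>y p q. ewedge (\<lambda>a y. form1 (e a y)) 1 3 y p q + ewedge (\<lambda>a y. form1 (e a y)) 4 2 y p q) y = d2 (\<lambda>y. form2 (\<omega> 2 i y)) y"
    "d2 (\<lambda>y p q. ewedge (\<lambda>a y. form1 (e a y)) 1 4 y p q + ewedge (\<lambda>a y. form1 (e a y)) 2 3 y p q) y = d2 (\<lambda>y. form2 (\<omega> 3 i y)) y"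
    if "y \<in> V" for y
    by (rule cong[OF that], erule w)+
  have yU: "y \<in> chart_image (ch i)" if "y \<in> V" for y using that V(3) by blast
  have "sasaki_einstein_coframe V (\<lambda>a y. form1 (e a y)) E (g i)"
  proof (intro sasaki_einstein_coframe.intro orthonormal_coframe.intro sasaki_einstein_coframe_axioms.intro)
    show "linear (form1 (e a y))" if "a \<in> {1..5}" "y \<in> V" for a y
      by (rule coframe_linear[OF cof[OF that(2)] that(1)])
    show "g i y u v = (\<Sum>a=1..5. form1 (e a y) u * form1 (e a y) v)" if "y \<in> V" for y u v
      unfolding su2_metric_eq[where \<eta> = \<eta> and \<omega> = \<omega>, OF ad[OF that]] coframe_metric_form1 ..
    fix y assume y: "y \<in> V"
    show "frechet_derivative (\<lambda>y. form1 (e 5 y) q) (at y) p - frechet_derivative (\<lambda>y. form1 (e 5 y) p) (at y) q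
      = - 2 * (ewedge (\<lambda>a y. form1 (e a y)) 1 4 y p q + ewedge (\<lambda>a y. form1 (e a y)) 2 3 y p q)" for p q
    proof -
      have "frechet_derivative (\<lambda>y. form1 (e 5 y) q) (at y) = frechet_derivative (\<lambda>y. form1 (\<eta> i y) q) (at y)" for q
        by (rule frechet_derivative_cong_open[OF V(1) y]) (simp add: e5)
      then show ?thesis unfolding w[OF y] using P.d_eta[OF yU[OF y], of q p] by simp
    qed
    show "d2 (\<lambda>y p q. ewedge (\<lambda>a y. form1 (e a y)) 1 2 y p q + ewedge (\<lambda>a y. form1 (e a y)) 3 4 y p q) y p q r =
      3 * (form1 (e 5 y) p * (ewedge (\<lambda>a y. form1 (e a y)) 1 3 y q r + ewedge (\<lambda>a y. form1 (e a y)) 4 2 y q r)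
        - form1 (e 5 y) q * (ewedge (\<lambda>a y. form1 (e a y)) 1 3 y p r + ewedge (\<lambda>a y. form1 (e a y)) 4 2 y p r)
        + form1 (e 5 y) r * (ewedge (\<lambda>a y. form1 (e a y)) 1 3 y p q + ewedge (\<lambda>a y. form1 (e a y)) 4 2 y p q))" for p q r
      unfolding dd[OF y] w[OF y] e5[OF y, symmetric] unfolding d2_def by (rule P.d_w1[OF yU[OF y]])
    show "d2 (\<lambda>y p q. ewedge (\<lambda>a y. form1 (e a y)) 1 3 y p q + ewedge (\<lambda>a y. form1 (e a y)) 4 2 y p q) y p q r =
      - 3 * (form1 (e 5 y) p * (ewedge (\<lambda>a y. form1 (e a y)) 1 2 y q r + ewedge (\<lambda>a y. form1 (e a y)) 3 4 y q r)
        - form1 (e 5 y) q * (ewedge (\<lambda>a y. form1 (e a y)) 1 2 y p r + ewedge (\<lambda>a y. form1 (e a y)) 3 4 y p r)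
        + form1 (e 5 y) r * (ewedge (\<lambda>a y. form1 (e a y)) 1 2 y p q + ewedge (\<lambda>a y. form1 (e a y)) 3 4 y p q))" for p q r
      unfolding dd[OF y] w[OF y] e5[OF y, symmetric] unfolding d2_def by (rule P.d_w2[OF yU[OF y]])
    show "d2 (\<lambda>y p q. ewedge (\<lambda>a y. form1 (e a y)) 1 4 y p q + ewedge (\<lambda>a y. form1 (e a y)) 2 3 y p q) y p q r = 0" for p q r
      unfolding dd[OF y] unfolding d2_def by (rule P.d_w3[OF yU[OF y]])
  qed (use V smf E in auto)
  then show thesis using that[OF V sm ad] by blast
qed

end

section \<open>The SU(3)-structure, the metrics and the conical ends\<close>

context sasaki_einstein_manifold
begin

lemma local_sasaki_einstein_coframe:
  assumes "i \<in> I" "x \<in> chart_image (ch i)"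
  obtains V e E where "open V" "x \<in> V" "V \<subseteq> chart_image (ch i)" "sasaki_einstein_coframe V e E (g i)"
proof (rule local_coframe[OF assms])
  fix V e E assume "open V" "x \<in> V" "V \<subseteq> chart_image (ch i)"
    "sasaki_einstein_coframe V (\<lambda>a y. form1 (e a y)) E (g i)"
  then show thesis by (rule that)
qed

lemma ex_adapted: "i \<in> I \<Longrightarrow> x \<in> chart_image (ch i) \<Longrightarrow> \<exists>e. su2_adapted e (\<eta> i x) (\<lambda>a. \<omega> a i x)"
  by (rule local_coframe) blast+

lemma cyl_chart_D:
  assumes "z \<in> chart_image (cyl_chart (ch i))"
  shows "fst z \<in> chart_image (ch i)" "snd z \<in> {0<..<pi}" "sin (snd z) > 0"
  using assms by (auto simp: chart_image_cyl intro: sin_gt_zero)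

lemma su3_adapted_sine_cone:
  assumes i: "i \<in> I" and z: "z \<in> chart_image (cyl_chart (ch i))"
    and ad: "su2_adapted e (\<eta> i (fst z)) (\<lambda>a. \<omega> a i (fst z))"
  shows "su3_adapted (sine_cone_frame e (snd z)) (F i z) (\<Psi>p i z) (\<Psi>m i z)"
  by (rule sine_cone_adapted[where \<omega> = \<omega> and \<eta> = \<eta>, OF ad _ alt[OF i cyl_chart_D(1)[OF z]]])
    (use cyl_chart_D(3)[OF z] in simp)

lemma G_apply: "G i z u v = snd u * snd v + (sin (snd z))\<^sup>2 * g i (fst z) (fst u) (fst v)"
  by (simp add: warped_metric_def)

lemma su3_metric_sine_cone:
  assumes i: "i \<in> I" and z: "z \<in> chart_image (cyl_chart (ch i))"
  shows "su3_metric F \<Psi>p \<Psi>m i z = G i z"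
proof -
  obtain e where ad: "su2_adapted e (\<eta> i (fst z)) (\<lambda>a. \<omega> a i (fst z))"
    using ex_adapted[OF i cyl_chart_D(1)[OF z]] by blast
  have "su3_metric F \<Psi>p \<Psi>m i z = coframe_metric 6 (sine_cone_frame e (snd z))"
    by (rule su3_metric_eq[where F = F and \<Psi>p = \<Psi>p and \<Psi>m = \<Psi>m, OF su3_adapted_sine_cone[OF i z ad]])
  then show ?thesis
    by (intro ext) (simp only: coframe_metric_sine_cone_frame G_apply su2_metric_eq[where \<eta> = \<eta> and \<omega> = \<omega>, OF ad])
qed

lemma open_cyl: "i \<in> I \<Longrightarrow> open (chart_image (cyl_chart (ch i)))"
  unfolding chart_image_cyl by (intro open_Times open_chart open_greaterThanLessThan)

lemma smooth_on_cyl_fst: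
  assumes i: "i \<in> I" and "smooth_on (chart_image (ch i)) \<phi>"
  shows "smooth_on (chart_image (cyl_chart (ch i))) (\<lambda>z. \<phi> (fst z))"
  by (rule smooth_on_compose_linear[OF bounded_linear_fst open_cyl[OF i] assms(2)]) (rule cyl_chart_D(1))

lemma smooth_on_snd: "smooth_on S snd"
  by (rule smooth_on_bounded_linear[OF bounded_linear_snd])

lemma smooth_forms:
  assumes i: "i \<in> I"
  shows "smooth_on (chart_image (cyl_chart (ch i))) (\<lambda>z. F i z v)"
    and "smooth_on (chart_image (cyl_chart (ch i))) (\<lambda>z. \<Psi>p i z v)"
    and "smooth_on (chart_image (cyl_chart (ch i))) (\<lambda>z. \<Psi>m i z v)"
proof -
  define S where "S = chart_image (cyl_chart (ch i))"
  have S: "open S" unfolding S_def by (rule open_cyl[OF i])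
  have e: "smooth_on S (\<lambda>z. form1 (\<eta> i (fst z)) p)" for p
    unfolding S_def by (rule smooth_on_cyl_fst[OF i smooth_on_form1[OF df(1) i]])
  have w: "smooth_on S (\<lambda>z. form2 (\<omega> a i (fst z)) p q)" if "a \<in> {1, 2, 3}" for a p q
    unfolding S_def by (rule smooth_on_cyl_fst[OF i smooth_on_form2[OF df(2)[OF that] i]])
  have a: "su2_alternating \<eta> \<omega> i (fst z)" if "z \<in> S" for z
    using alt[OF i cyl_chart_D(1)] that unfolding S_def by blast
  have t: "smooth_on S (\<lambda>z. sin (snd z))" "smooth_on S (\<lambda>z. cos (snd z))"
    by (rule smooth_on_sin smooth_on_cos, rule S, rule smooth_on_snd)+
  note sm = smooth_on_add smooth_on_diff smooth_on_mult smooth_on_power smooth_on_const S t e w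
  show "smooth_on (chart_image (cyl_chart (ch i))) (\<lambda>z. F i z v)"
    unfolding S_def[symmetric]
    by (rule smooth_on_cong[OF S _ sine_cone_F_apply[OF a, symmetric]], (intro sm; simp), assumption)
  show "smooth_on (chart_image (cyl_chart (ch i))) (\<lambda>z. \<Psi>p i z v)"
    unfolding S_def[symmetric]
    by (rule smooth_on_cong[OF S _ sine_cone_Psi_plus_apply[OF a, symmetric]], (intro sm; simp), assumption)
  show "smooth_on (chart_image (cyl_chart (ch i))) (\<lambda>z. \<Psi>m i z v)"
    unfolding S_def[symmetric]
    by (rule smooth_on_cong[OF S _ sine_cone_Psi_minus_apply[OF a, symmetric]], (intro sm; simp), assumption)
qed

lemma forms_transition:
  assumes i: "i \<in> I" and j: "j \<in> I" and z: "z \<in> snd (ch i) ` (fst (ch i) \<inter> fst (ch j)) \<times> {0<..<pi}"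
  defines "\<tau> \<equiv> transition (cyl_chart (ch i)) (cyl_chart (ch j))"
  shows "F i z = pullback \<tau> (F j) z" "\<Psi>p i z = pullback \<tau> (\<Psi>p j) z" "\<Psi>m i z = pullback \<tau> (\<Psi>m j) z"
proof -
  have x: "fst z \<in> snd (ch i) ` (fst (ch i) \<inter> fst (ch j))" using z by auto
  have \<tau>: "\<tau> z = (transition (ch i) (ch j) (fst z), snd z)"
    unfolding \<tau>_def by (rule transition_cyl[OF smooth_manifold_chart(1)[OF mfd i] z])
  have D: "frechet_derivative \<tau> (at z) u = (frechet_derivative (transition (ch i) (ch j)) (at (fst z)) (fst u), snd u)" for u
    unfolding \<tau>_def by (rule frechet_derivative_transition_cyl[OF mfd i j z])
  have a: "su2_alternating \<eta> \<omega> i (fst z)" by (rule alt[OF i overlap_chart[OF x]])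
  have b: "su2_alternating \<eta> \<omega> j (fst (\<tau> z))"
    unfolding \<tau> fst_conv by (rule alt[OF j overlap_chart[OF transition_in_overlap[OF mfd i x]]])
  note b = b[unfolded \<tau>]
  note tr = form1_transition[OF i j x] form2_transition[OF _ i j x, of 1, simplified]
    form2_transition[OF _ i j x, of 2, simplified] form2_transition[OF _ i j x, of 3, simplified]
  show "F i z = pullback \<tau> (F j) z"
    by (rule ext) (simp only: pullback_def sine_cone_F_apply[OF a] sine_cone_F_apply[OF b] D \<tau> fst_conv snd_conv tr)
  show "\<Psi>p i z = pullback \<tau> (\<Psi>p j) z"
    by (rule ext) (simp only: pullback_def sine_cone_Psi_plus_apply[OF a] sine_cone_Psi_plus_apply[OF b] D \<tau> fst_conv snd_conv tr)
  show "\<Psi>m i z = pullback \<tau> (\<Psi>m j) z"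
    by (rule ext) (simp only: pullback_def sine_cone_Psi_minus_apply[OF a] sine_cone_Psi_minus_apply[OF b] D \<tau> fst_conv snd_conv tr)
qed

lemma diff_forms: "diff_form I (cyl_chart \<circ> ch) 2 F" "diff_form I (cyl_chart \<circ> ch) 3 \<Psi>p" "diff_form I (cyl_chart \<circ> ch) 3 \<Psi>m"
proof -
  have a: "su2_alternating \<eta> \<omega> i (fst z)" if "i \<in> I" "z \<in> chart_image (cyl_chart (ch i))" for i z
    by (rule alt[OF that(1) cyl_chart_D(1)[OF that(2)]])
  show "diff_form I (cyl_chart \<circ> ch) 2 F" "diff_form I (cyl_chart \<circ> ch) 3 \<Psi>p" "diff_form I (cyl_chart \<circ> ch) 3 \<Psi>m"
    unfolding diff_form_def comp_apply overlap_cyl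
    by (intro conjI ballI allI; rule alternating_sine_cone_F[OF a] alternating_sine_cone_Psi_plus[OF a]
        alternating_sine_cone_Psi_minus[OF a] smooth_forms forms_transition; assumption)+
qed

lemma su3_structure_sine_cone: "su3_structure (cyl_top X) I (cyl_chart \<circ> ch) F \<Psi>p \<Psi>m"
  unfolding su3_structure_def comp_def
proof (intro conjI ballI)
  show "smooth_manifold (cyl_top X) I (\<lambda>x. cyl_chart (ch x))" by (rule smooth_manifold_cyl[OF mfd, unfolded comp_def])
  fix i z assume i: "i \<in> I" and z: "z \<in> chart_image (cyl_chart (ch i))"
  obtain V e E where V: "open V" "fst z \<in> V" "V \<subseteq> chart_image (ch i)"
    and sm: "\<And>a v. a \<in> {1..5} \<Longrightarrow> smooth_on V (\<lambda>y. e a y v)"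
    and ad: "\<And>y. y \<in> V \<Longrightarrow> su2_adapted (\<lambda>a. e a y) (\<eta> i y) (\<lambda>a. \<omega> a i y)"
  proof (rule local_coframe[OF i cyl_chart_D(1)[OF z]])
    fix V e E
    assume V: "open V" "fst z \<in> V" "V \<subseteq> chart_image (ch i)"
      and sm: "\<And>a v. a \<in> {1..5} \<Longrightarrow> smooth_on V (\<lambda>y. e a y v)"
      and ad: "\<And>y. y \<in> V \<Longrightarrow> su2_adapted (\<lambda>a. e a y) (\<eta> i y) (\<lambda>a. \<omega> a i y)"
    show thesis by (rule that[OF V sm ad])
  qed
  define W where "W = V \<times> {0<..<pi}"
  have W: "open W" unfolding W_def by (intro open_Times V open_greaterThanLessThan)
  define f where "f a y = sine_cone_frame (\<lambda>a. e a (fst y)) (snd y) a" for a y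
  show "\<exists>V e. open V \<and> z \<in> V \<and> V \<subseteq> chart_image (cyl_chart (ch i)) \<and>
      (\<forall>a\<in>{1..6}. \<forall>v. smooth_on V (\<lambda>y. e a y v)) \<and>
      (\<forall>y\<in>V. su3_adapted (\<lambda>a. e a y) (F i y) (\<Psi>p i y) (\<Psi>m i y))"
  proof (intro exI[of _ W] exI[of _ f] conjI ballI allI)
    show "z \<in> W" using V(2) cyl_chart_D(2)[OF z] by (simp add: W_def mem_Times_iff)
    show WU: "W \<subseteq> chart_image (cyl_chart (ch i))" using V(3) unfolding W_def chart_image_cyl by blast
    fix y assume y: "y \<in> W"
    then have "fst y \<in> V" by (auto simp: W_def)
    then show "su3_adapted (\<lambda>a. f a y) (F i y) (\<Psi>p i y) (\<Psi>m i y)"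
      unfolding f_def using su3_adapted_sine_cone[OF i _ ad] y WU by blast
  next
    fix a :: nat and v assume a: "a \<in> {1..6}"
    have t: "smooth_on W (\<lambda>z. sin (snd z))" "smooth_on W (\<lambda>z. cos (snd z))"
      by (rule smooth_on_sin smooth_on_cos, rule W, rule smooth_on_snd)+
    have s: "smooth_on W (\<lambda>y. form1 (e b (fst y)) u)" if "b \<in> {1..5}" for b u
      unfolding form1_def
      by (rule smooth_on_compose_linear[OF bounded_linear_fst W sm[OF that]]) (auto simp: W_def)
    have "a = 6 \<or> a \<in> {1..5}" using a by auto
    then show "smooth_on W (\<lambda>y. f a y v)"
      unfolding f_def sine_cone_frame_def
      by (intro smooth_on_if smooth_on_const smooth_on_add smooth_on_diff smooth_on_mult t s W) auto
  qed (rule W)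
next
  show "DIM((real ^ 5) \<times> real) = 6"
    by (simp only: DIM_prod DIM_cart DIM_real card_num1 card_bit0 card_bit1 mult_1_right arith_simps)
qed (rule diff_forms[unfolded comp_def])+

lemma nearly_kaehler_sine_cone: "nearly_kaehler (cyl_top X) I (cyl_chart \<circ> ch) F \<Psi>p \<Psi>m"
  unfolding nearly_kaehler_def
  unfolding comp_def
  by (intro conjI ballI su3_structure_sine_cone[unfolded comp_def] nearly_kaehler_equations)

lemma g_props:
  assumes i: "i \<in> I" and x: "x \<in> chart_image (ch i)"
  shows "bilinear (g i x)" "g i x u v = g i x v u" "u \<noteq> 0 \<Longrightarrow> g i x u u > 0"
proof -
  obtain e where ad: "su2_adapted e (\<eta> i x) (\<lambda>a. \<omega> a i x)" using ex_adapted[OF i x] by blast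
  have cof: "coframe 5 e" using ad unfolding su2_adapted_def by blast
  note m = su2_metric_eq[where \<eta> = \<eta> and \<omega> = \<omega>, OF ad]
  show "bilinear (g i x)" unfolding m by (rule bilinear_coframe_metric[OF cof])
  show "g i x u v = g i x v u" unfolding m by (rule coframe_metric_commute)
  show "u \<noteq> 0 \<Longrightarrow> g i x u u > 0" unfolding m by (rule coframe_metric_pos[OF cof])
qed

text \<open>The metric is described point by point, but near each point it is the sum of squares of
  a smooth coframe.\<close>

lemma smooth_g:
  assumes i: "i \<in> I" shows "smooth_on (chart_image (ch i)) (\<lambda>x. g i x u v)"
proof (rule smooth_on_local)
  fix x assume x: "x \<in> chart_image (ch i)"
  obtain V e E where V: "open V" "x \<in> V" "V \<subseteq> chart_image (ch i)"
    and C: "sasaki_einstein_coframe V e E (g i)"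
    by (rule local_sasaki_einstein_coframe[OF i x])
  interpret C: sasaki_einstein_coframe V e E "g i" by (rule C)
  show "\<exists>V. open V \<and> x \<in> V \<and> smooth_on V (\<lambda>x. g i x u v)" using V C.smooth_g by blast
qed

text \<open>The derivative D of the transition takes partners to partners: the relation is tested on
  vectors \<open>D w'\<close>, and these are all vectors. The formula
  \<open>su2_adapted_metric\<close> then transports the metric along with the forms.\<close>

lemma g_transition:
  assumes i: "i \<in> I" and j: "j \<in> I" and x: "x \<in> snd (ch i) ` (fst (ch i) \<inter> fst (ch j))"
  defines "\<tau> \<equiv> transition (ch i) (ch j)"
  shows "g i x u v = g j (\<tau> x) (frechet_derivative \<tau> (at x) u) (frechet_derivative \<tau> (at x) v)"
proof -
  define D where "D = frechet_derivative \<tau> (at x)"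
  have surj: "surj D" unfolding D_def \<tau>_def by (rule surj_frechet_derivative_transition(1)[OF mfd i j x])
  have y: "\<tau> x \<in> chart_image (ch j)"
    unfolding \<tau>_def by (rule overlap_chart[OF transition_in_overlap[OF mfd i x]])
  note tr = form1_transition[OF i j x, folded \<tau>_def, folded D_def]
    form2_transition[OF _ i j x, folded \<tau>_def, folded D_def]
  obtain e where ad: "su2_adapted e (\<eta> i x) (\<lambda>a. \<omega> a i x)" using ex_adapted[OF i overlap_chart[OF x]] by blast
  obtain e' where ad': "su2_adapted e' (\<eta> j (\<tau> x)) (\<lambda>a. \<omega> a j (\<tau> x))" using ex_adapted[OF j y] by blast
  obtain Y where Y: "\<And>w. form2 (\<omega> 2 i x) Y w = form2 (\<omega> 1 i x) u w"
    using su2_adapted_ex_partner[OF ad, of u] by blast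
  have Y': "form2 (\<omega> 2 j (\<tau> x)) (D Y) w = form2 (\<omega> 1 j (\<tau> x)) (D u) w" for w
  proof -
    obtain w' where w: "w = D w'" using surj by (metis surjD)
    show ?thesis using Y[of w'] tr(2)[of 1 u w'] tr(2)[of 2 Y w'] by (simp add: w)
  qed
  show ?thesis
    unfolding D_def[symmetric] su2_metric_eq[where \<eta> = \<eta> and \<omega> = \<omega>, OF ad] su2_metric_eq[where \<eta> = \<eta> and \<omega> = \<omega>, OF ad']
      su2_adapted_metric[OF ad Y] su2_adapted_metric[OF ad' Y']
    using tr(1)[of u] tr(1)[of v] tr(2)[of 3 v Y] by simp
qed

lemma riemannian_g: "riemannian_metric I ch g"
  unfolding riemannian_metric_def Let_def using g_props smooth_g g_transition by blast

lemma riemannian_G: "riemannian_metric I (cyl_chart \<circ> ch) G"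
  unfolding riemannian_metric_def Let_def comp_apply overlap_cyl
proof (intro conjI ballI allI impI)
  fix i z assume i: "i \<in> I" and z: "z \<in> chart_image (cyl_chart (ch i))"
  note x = cyl_chart_D(1)[OF z]
  have l: "linear (g i (fst z) u)" "linear (\<lambda>u. g i (fst z) u v)" for u v
    using g_props(1)[OF i x] unfolding bilinear_def by blast+
  show "bilinear (G i z)"
    unfolding bilinear_def
  proof (intro conjI allI)
    show "linear (G i z u)" for u
      by (rule linearI) (simp_all add: G_apply linear_add[OF l(1)] linear_scale[OF l(1)] algebra_simps)
    show "linear (\<lambda>u. G i z u v)" for v
      by (rule linearI) (simp_all add: G_apply linear_add[OF l(2)] linear_scale[OF l(2)] algebra_simps)
  qed
  show "G i z u v = G i z v u" for u v
    unfolding G_apply using g_props(2)[OF i x, of "fst u" "fst v"] by simp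
  show "G i z u u > 0" if "u \<noteq> 0" for u
  proof (cases "fst u = 0")
    case True
    then have "snd u \<noteq> 0" using that by (simp add: prod_eq_iff)
    then have "0 < snd u * snd u" by (metis not_real_square_gt_zero)
    moreover have "g i (fst z) (fst u) (fst u) = 0" using linear_0[OF l(1)] True by simp
    ultimately show ?thesis by (simp add: G_apply)
  next
    case False
    then have "0 < (sin (snd z))\<^sup>2 * g i (fst z) (fst u) (fst u)"
      using g_props(3)[OF i x] cyl_chart_D(3)[OF z] by (intro mult_pos_pos) simp_all
    then show ?thesis unfolding G_apply by (intro add_nonneg_pos) simp_all
  qed
next
  fix i u v assume i: "i \<in> I"
  show "smooth_on (chart_image (cyl_chart (ch i))) (\<lambda>x. G i x u v)"
    unfolding G_apply
    by (intro smooth_on_add smooth_on_mult smooth_on_power smooth_on_const open_cyl[OF i] smooth_on_sin smooth_on_snd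
        smooth_on_cyl_fst[OF i smooth_g[OF i]])
next
  fix i j z u v assume i: "i \<in> I" and j: "j \<in> I" and z: "z \<in> snd (ch i) ` (fst (ch i) \<inter> fst (ch j)) \<times> {0<..<pi}"
  have x: "fst z \<in> snd (ch i) ` (fst (ch i) \<inter> fst (ch j))" using z by auto
  show "G i z u v = G j (transition (cyl_chart (ch i)) (cyl_chart (ch j)) z)
      (frechet_derivative (transition (cyl_chart (ch i)) (cyl_chart (ch j))) (at z) u)
      (frechet_derivative (transition (cyl_chart (ch i)) (cyl_chart (ch j))) (at z) v)"
    unfolding frechet_derivative_transition_cyl[OF mfd i j z] transition_cyl[OF smooth_manifold_chart(1)[OF mfd i] z]
      G_apply fst_conv snd_conv g_transition[OF i j x] ..
qed

lemma ricci_sine_cone: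
  assumes i: "i \<in> I" and z: "z \<in> chart_image (cyl_chart (ch i))"
  shows "ricci (G i) z u v = 5 * G i z u v"
proof -
  obtain V e E where V: "open V" "fst z \<in> V" "V \<subseteq> chart_image (ch i)"
    and C: "sasaki_einstein_coframe V e E (g i)"
    by (rule local_sasaki_einstein_coframe[OF i cyl_chart_D(1)[OF z]])
  interpret C: sasaki_einstein_coframe V e E "g i" by (rule C)
  have G: "G i = C.G" by (intro ext) (simp only: G_apply C.G_def)
  have zW: "z \<in> C.W" using V(2) cyl_chart_D(2)[OF z] by (simp add: C.W_def mem_Times_iff)
  show ?thesis
    unfolding G using C.sine_cone_einstein[OF zW] C.ricci_eq[OF V(2)] by simp
qed

lemma einstein_sine_cone: "einstein_metric I (cyl_chart \<circ> ch) G"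
  unfolding einstein_metric_def comp_def
  by (intro conjI exI[of _ 5] ballI allI riemannian_G[unfolded comp_def] ricci_sine_cone)

text \<open>Both t and pi - t satisfy the hypothesis, so one argument serves both ends. The dt^2
  parts of the two metrics agree, and the difference is sin^2 s - s^2 times the metric of the link;
  its relative size depends on s only, hence the uniformity.\<close>

lemma conical_end_sine_cone:
  assumes s: "\<And>t. 0 < t \<Longrightarrow> t < pi \<Longrightarrow> s t > 0 \<and> sin (s t) = sin t \<and> (deriv s t)\<^sup>2 = 1"
  shows "conical_end I ch g s (su3_metric F \<Psi>p \<Psi>m)"
  unfolding conical_end_def
proof (intro allI impI)
  fix \<epsilon> :: real assume \<epsilon>: "\<epsilon> > 0"
  obtain \<delta> where \<delta>: "\<delta> > 0" "\<And>r. 0 < r \<Longrightarrow> r < \<delta> \<Longrightarrow> \<bar>(sin r)\<^sup>2 - r\<^sup>2\<bar> \<le> \<epsilon> * r\<^sup>2"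
    using sin_squared_near_0[OF \<epsilon>] by blast
  show "\<exists>\<delta>>0. \<forall>i\<in>I. \<forall>z\<in>chart_image (cyl_chart (ch i)). s (snd z) < \<delta> \<longrightarrow>
        (\<forall>u. \<bar>su3_metric F \<Psi>p \<Psi>m i z u u - warped_metric s s g i z u u\<bar> \<le> \<epsilon> * warped_metric s s g i z u u)"
  proof (intro exI[of _ \<delta>] conjI ballI impI allI \<delta>(1))
    fix i z and u :: "(real ^ 5) \<times> real"
    assume i: "i \<in> I" and z: "z \<in> chart_image (cyl_chart (ch i))" and sd: "s (snd z) < \<delta>"
    define r where "r = s (snd z)"
    define h where "h = g i (fst z) (fst u) (fst u)"
    have r: "0 < r" "sin r = sin (snd z)" "(deriv s (snd z))\<^sup>2 = 1"
      using s[of "snd z"] cyl_chart_D(2)[OF z] by (auto simp: r_def)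
    have h: "h \<ge> 0"
      using g_props(3)[OF i cyl_chart_D(1)[OF z], of "fst u"] linear_0[of "g i (fst z) 0"] g_props(1)[OF i cyl_chart_D(1)[OF z]]
      unfolding h_def bilinear_def by (cases "fst u = 0") (auto simp: less_imp_le)
    have w: "warped_metric s s g i z u u = (snd u)\<^sup>2 + r\<^sup>2 * h"
    proof -
      have "deriv s (snd z) * snd u * (deriv s (snd z) * snd u) = (deriv s (snd z))\<^sup>2 * (snd u)\<^sup>2"
        by (simp add: power2_eq_square)
      then show ?thesis by (simp add: warped_metric_def r_def h_def r(3))
    qed
    have m: "su3_metric F \<Psi>p \<Psi>m i z u u = (snd u)\<^sup>2 + (sin r)\<^sup>2 * h"
      unfolding su3_metric_sine_cone[OF i z] G_apply h_def r(2) by (simp add: power2_eq_square)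
    have "\<bar>su3_metric F \<Psi>p \<Psi>m i z u u - warped_metric s s g i z u u\<bar> = \<bar>(sin r)\<^sup>2 - r\<^sup>2\<bar> * h"
      unfolding m w using h by (simp add: left_diff_distrib[symmetric] abs_mult)
    also have "\<dots> \<le> \<epsilon> * r\<^sup>2 * h"
      using \<delta>(2)[OF r(1)] sd h by (intro mult_right_mono) (simp_all add: r_def)
    also have "\<dots> \<le> \<epsilon> * warped_metric s s g i z u u"
      unfolding w using \<epsilon> by (simp add: distrib_left mult.assoc)
    finally show "\<bar>su3_metric F \<Psi>p \<Psi>m i z u u - warped_metric s s g i z u u\<bar> \<le> \<epsilon> * warped_metric s s g i z u u" .
  qed
qed

lemma compact_sine_cone:
  assumes "compact_space X"
  shows "compact_nk_two_conical X I ch g F \<Psi>p \<Psi>m"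
  unfolding compact_nk_two_conical_def
proof (intro conjI)
  have "deriv (\<lambda>t. pi - t) t = - 1" for t :: real
    by (rule DERIV_imp_deriv) (auto intro!: derivative_eq_intros)
  then show "conical_end I ch g (\<lambda>t. pi - t) (su3_metric F \<Psi>p \<Psi>m)"
    by (intro conical_end_sine_cone) simp
  show "conical_end I ch g (\<lambda>t. t) (su3_metric F \<Psi>p \<Psi>m)"
    by (intro conical_end_sine_cone) simp
qed (use assms in \<open>simp_all add: compact_collapsed_cyl homeomorphic_map_collapsed_cyl nearly_kaehler_sine_cone riemannian_g\<close>)

end

theorem theorem3p7:
  fixes X :: "'m topology" and I :: "'i set" and ch :: "'i \<Rightarrow> ('m, real ^ 5) chart"
    and \<eta> :: "'i \<Rightarrow> real ^ 5 \<Rightarrow> (real ^ 5, real) covector"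
    and \<omega> :: "nat \<Rightarrow> 'i \<Rightarrow> real ^ 5 \<Rightarrow> (real ^ 5, real) covector"
    and g5 :: "'i \<Rightarrow> (real ^ 5) metric_tensor"
    and F \<Psi>p \<Psi>m :: "'i \<Rightarrow> (real ^ 5) \<times> real \<Rightarrow> ((real ^ 5) \<times> real, real) covector"
    and g6 :: "'i \<Rightarrow> ((real ^ 5) \<times> real) metric_tensor"
  assumes "sasaki_einstein X I ch \<eta> \<omega>"
    and "g5 = su2_metric \<eta> \<omega>"
    and "F = sine_cone_F \<eta> \<omega>"
    and "\<Psi>p = sine_cone_Psi_plus \<eta> \<omega>"
    and "\<Psi>m = sine_cone_Psi_minus \<eta> \<omega>"
    and "g6 = warped_metric (\<lambda>t. t) sin g5"
  shows "nearly_kaehler (cyl_top X) I (cyl_chart \<circ> ch) F \<Psi>p \<Psi>m \<and>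
    (\<forall>i\<in>I. \<forall>z\<in>chart_image (cyl_chart (ch i)). su3_metric F \<Psi>p \<Psi>m i z = g6 i z) \<and>
    einstein_metric I (cyl_chart \<circ> ch) g6 \<and>
    (compact_space X \<longrightarrow> compact_nk_two_conical X I ch g5 F \<Psi>p \<Psi>m)"
proof -
  interpret sasaki_einstein_manifold X I ch \<eta> \<omega>
    by (rule sasaki_einstein_manifold.intro) (rule assms(1))
  show ?thesis
    unfolding assms(2-6)
    using nearly_kaehler_sine_cone su3_metric_sine_cone einstein_sine_cone compact_sine_cone by blast
qed

end
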